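(* Let $k^+$ and $k^-$ be positive integers and let $Z_\Lambda=(Z_\Lambda^+,Z_\Lambda^-)$ be an $n$-parameter family of piecewise analytic Filippov vector fields, equal to $Z_\Lambda^+$ for $y>0$ and to $Z_\Lambda^-$ for $y<0$, having a $(2k^+,2k^-)$-monodromic tangential singularity at the origin for every $\Lambda$ in an open set $U\subset\mathbb{R}^n$. Let $V_{2i}(\Lambda)$ be the $2i$-th Lyapunov coefficient, for $i=1,2,\dots,n+1$, and denote $\mathcal V_n=(V_2,V_4,\ldots,V_{2n}):U\rightarrow\mathbb{R}^n$. Assume that, for some $\Lambda_0\in U$, $\mathcal V_n(\Lambda_0)=0$, $\det(D\mathcal V_n(\Lambda_0))\neq0$, and $V_{2n+2}(\Lambda_0)\neq0$. Then there exists an open set $W\subset U$ such that $Z_\Lambda$ has $n$ hyperbolic limit cycles for every $\Lambda\in W$. In addition, all the limit cycles converge to the origin as $\Lambda$ goes to $\Lambda_0$.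
   Context: For a piecewise vector field $Z=(Z^+,Z^-)$, with $Z^\pm=(X^\pm,Y^\pm)$ analytic and discontinuity line $\Sigma=\{y=0\}$, the origin is a $(2k^+,2k^-)$-monodromic tangential singularity when it is an invisible contact of multiplicity $2k^{+}$ of $Z^+$ with $\Sigma$, an invisible contact of multiplicity $2k^-$ of $Z^-$ with $\Sigma$, and a first-return map on $\Sigma$ is defined around it; concretely: C1. $X^{\pm}(0,0)\neq0$, $Y^{\pm}(0,0)=0$, $\frac{\partial^i Y^{\pm}}{\partial x^i}(0,0)=0$ for $i=1,\ldots,2k^{\pm}-2$, and $\frac{\partial^{2k^{\pm}-1} Y^{\pm}}{\partial x^{2k^{\pm}-1}}(0,0)\neq0$; C2. $X^+(0,0)\frac{\partial^{2k^{+}-1} Y^{+}}{\partial x^{2k^{+}-1}}(0,0)<0$ and $X^-(0,0)\frac{\partial^{2k^{-}-1} Y^{-}}{\partial x^{2k^{-}-1}}(0,0)>0$; C3. $X^+(0,0)X^-(0,0)<0$. Put $\delta=\mathrm{sign}(X^+(0,0))=-\mathrm{sign}(X^-(0,0))$. Half-return maps: for $x\neq 0$ close to $0$, the orbit of $Z^{+}$ through $(x,0)$ restricted to $\{y\ge 0\}$ (resp. of $Z^-$ restricted to $\{y\le0\}$), followed forward or backward in time (whichever direction enters $\{y>0\}$, resp. $\{y<0\}$), meets $\Sigma$ again for the first time at $(\varphi^{+}(x),0)$ (resp. $(\varphi^{-}(x),0)$); $\varphi^{\pm}(0)=0$. The maps $\varphi^{\pm}$ are analytic involutions near $0$, with $\varphi^{\pm}(x)=-x+\sum_{m\ge2}\alpha_m^{\pm}x^m$.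 The displacement function is $\Delta(x)=\delta(\varphi^+(x)-\varphi^-(x))=\sum_{m\ge2}V_mx^m$, and the $m$th Lyapunov coefficient is $V_m=\delta(\alpha_m^+-\alpha_m^-)$; for the family $Z_\Lambda$ it is denoted $V_m(\Lambda)$. Trajectories follow Filippov's convention; near the origin, orbits of $Z$ cross $\Sigma\setminus\{(0,0)\}$ by concatenating orbits of $Z^+$ in $y\ge0$ and of $Z^-$ in $y\le0$. A limit cycle is an isolated closed orbit; it is hyperbolic if the derivative of the first-return map on $\Sigma$ at the corresponding fixed point differs from $1$ in absolute value. *)

theory Defs
  imports "HOL-Analysis.Analysis"
begin

text \<open>
  Real analyticity on a Euclidean space: local expansion in a multiple power series.  The
  multi-indices are the functions \<open>Basis \<rightarrow> nat\<close>, extended by \<open>undefined\<close> outside \<open>Basis\<close>.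
\<close>

definition real_analytic_at :: "('a::euclidean_space \<Rightarrow> 'b::real_normed_vector) \<Rightarrow> 'a \<Rightarrow> bool" where
  "real_analytic_at f p \<longleftrightarrow>
     (\<exists>r>0. \<exists>c :: ('a \<Rightarrow> nat) \<Rightarrow> 'b. \<forall>z. norm z < r \<longrightarrow>
        ((\<lambda>\<alpha>. (\<Prod>b\<in>Basis. (z \<bullet> b) ^ \<alpha> b) *\<^sub>R c \<alpha>) has_sum f (p + z)) (Basis \<rightarrow>\<^sub>E UNIV))"

definition real_analytic_on :: "('a::euclidean_space \<Rightarrow> 'b::real_normed_vector) \<Rightarrow> 'a set \<Rightarrow> bool" where
  "real_analytic_on f S \<longleftrightarrow> (\<forall>p\<in>S. real_analytic_at f p)"

text \<open>
  Planar vector fields are functions on \<open>real \<times> real\<close>.  A piecewise vector field is a pair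
  \<open>Zp\<close> (acting for \<open>y > 0\<close>), \<open>Zm\<close> (acting for \<open>y < 0\<close>).
\<close>

type_synonym vfield = "real \<times> real \<Rightarrow> real \<times> real"

definition dx_at_0 :: "nat \<Rightarrow> (real \<times> real \<Rightarrow> real) \<Rightarrow> real" where
  "dx_at_0 i f = (deriv ^^ i) (\<lambda>x. f (x, 0)) 0"

definition monodromic_tangential :: "vfield \<Rightarrow> vfield \<Rightarrow> nat \<Rightarrow> nat \<Rightarrow> bool" where
  "monodromic_tangential Zp Zm kp km \<longleftrightarrow>
     (let Xp = (\<lambda>p. fst (Zp p)); Yp = (\<lambda>p. snd (Zp p));
          Xm = (\<lambda>p. fst (Zm p)); Ym = (\<lambda>p. snd (Zm p)) in
      \<comment> \<open>contacts of order \<open>2kp\<close> and \<open>2km\<close> with the discontinuity line\<close>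
      Xp (0, 0) \<noteq> 0 \<and> Yp (0, 0) = 0 \<and> (\<forall>i\<in>{1..2 * kp - 2}. dx_at_0 i Yp = 0) \<and>
        dx_at_0 (2 * kp - 1) Yp \<noteq> 0 \<and>
      Xm (0, 0) \<noteq> 0 \<and> Ym (0, 0) = 0 \<and> (\<forall>i\<in>{1..2 * km - 2}. dx_at_0 i Ym = 0) \<and>
        dx_at_0 (2 * km - 1) Ym \<noteq> 0 \<and>
      \<comment> \<open>both contacts are invisible\<close>
      Xp (0, 0) * dx_at_0 (2 * kp - 1) Yp < 0 \<and> Xm (0, 0) * dx_at_0 (2 * km - 1) Ym > 0 \<and>
      \<comment> \<open>the two half-turns have the same orientation\<close>
      Xp (0, 0) * Xm (0, 0) < 0)"

text \<open>
  \<open>half_return_to \<sigma> Z x x'\<close>: the orbit of \<open>Z\<close> through \<open>(x, 0)\<close> enters the side \<open>\<sigma> y > 0\<close>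
  (\<open>\<sigma> = 1\<close> or \<open>\<sigma> = -1\<close>) and meets \<open>y = 0\<close> again for the first time at \<open>(x', 0)\<close>.
  The time \<open>T\<close> is negative when the orbit has to be followed backward.
\<close>

definition half_return_to :: "real \<Rightarrow> vfield \<Rightarrow> real \<Rightarrow> real \<Rightarrow> bool" where
  "half_return_to \<sigma> Z x x' \<longleftrightarrow>
     (\<exists>\<gamma> T. T \<noteq> 0 \<and>
        (\<forall>t\<in>closed_segment 0 T.
           (\<gamma> has_vector_derivative Z (\<gamma> t)) (at t within closed_segment 0 T)) \<and>
        \<gamma> 0 = (x, 0) \<and> \<gamma> T = (x', 0) \<and>
        (\<forall>t\<in>open_segment 0 T. \<sigma> * snd (\<gamma> t) > 0))"

definition half_return :: "real \<Rightarrow> vfield \<Rightarrow> real \<Rightarrow> real" where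
  "half_return \<sigma> Z x = (if x = 0 then 0 else (THE x'. half_return_to \<sigma> Z x x'))"

definition taylor_coeff :: "(real \<Rightarrow> real) \<Rightarrow> nat \<Rightarrow> real" where
  "taylor_coeff f m = (deriv ^^ m) f 0 / fact m"

definition lyapunov_coeff :: "vfield \<Rightarrow> vfield \<Rightarrow> nat \<Rightarrow> real" where
  "lyapunov_coeff Zp Zm m =
     sgn (fst (Zp (0, 0))) *
       (taylor_coeff (half_return 1 Zp) m - taylor_coeff (half_return (-1) Zm) m)"

definition filippov_set :: "vfield \<Rightarrow> vfield \<Rightarrow> real \<times> real \<Rightarrow> (real \<times> real) set" where
  "filippov_set Zp Zm p =
     (if snd p > 0 then {Zp p} else if snd p < 0 then {Zm p} else convex hull {Zp p, Zm p})"

text \<open>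
  Filippov solutions are the (locally) absolutely continuous curves \<open>\<gamma>\<close> with \<open>\<gamma>' \<in> F(\<gamma>)\<close> almost
  everywhere; absolute continuity is expressed by \<open>\<gamma>\<close> being an indefinite Lebesgue integral of \<open>v\<close>,
  so that \<open>v = \<gamma>'\<close> almost everywhere.  The time set \<open>I\<close> is meant to be an interval.
\<close>

definition filippov_solution_on ::
  "vfield \<Rightarrow> vfield \<Rightarrow> real set \<Rightarrow> (real \<Rightarrow> real \<times> real) \<Rightarrow> bool" where
  "filippov_solution_on Zp Zm I \<gamma> \<longleftrightarrow>
     (\<exists>v. (\<forall>a\<in>I. \<forall>b\<in>I. a \<le> b \<longrightarrow>
              v absolutely_integrable_on {a..b} \<and> (v has_integral (\<gamma> b - \<gamma> a)) {a..b}) \<and>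
          negligible {t\<in>I. v t \<notin> filippov_set Zp Zm (\<gamma> t)})"

definition closed_orbit :: "vfield \<Rightarrow> vfield \<Rightarrow> (real \<times> real) set \<Rightarrow> bool" where
  "closed_orbit Zp Zm \<Gamma> \<longleftrightarrow>
     (\<exists>\<gamma> T. filippov_solution_on Zp Zm UNIV \<gamma> \<and> T > 0 \<and> (\<forall>t. \<gamma> (t + T) = \<gamma> t) \<and>
        inj_on \<gamma> {0..<T} \<and> \<Gamma> = range \<gamma>)"

definition limit_cycle :: "vfield \<Rightarrow> vfield \<Rightarrow> (real \<times> real) set \<Rightarrow> bool" where
  "limit_cycle Zp Zm \<Gamma> \<longleftrightarrow>
     closed_orbit Zp Zm \<Gamma> \<and>
     (\<exists>N. open N \<and> \<Gamma> \<subseteq> N \<and> (\<forall>\<Gamma>'. closed_orbit Zp Zm \<Gamma>' \<and> \<Gamma>' \<subseteq> N \<longrightarrow> \<Gamma>' = \<Gamma>))"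

text \<open>
  \<open>P\<close> is, near its fixed point \<open>x0\<close>, the map of first return (in forward time) to the section
  \<open>{(s, 0). \<bar>s - x0\<bar> < \<epsilon>}\<close> of the discontinuity line.  The section is local, so that the other
  crossing points of the cycle do not count as returns.
\<close>

definition first_return_map_at :: "vfield \<Rightarrow> vfield \<Rightarrow> real \<Rightarrow> (real \<Rightarrow> real) \<Rightarrow> bool" where
  "first_return_map_at Zp Zm x0 P \<longleftrightarrow>
     P x0 = x0 \<and>
     (\<exists>\<epsilon>>0. \<forall>\<^sub>F x in nhds x0.
        \<exists>\<gamma> T. T > 0 \<and> filippov_solution_on Zp Zm {0..T} \<gamma> \<and>
          \<gamma> 0 = (x, 0) \<and> \<gamma> T = (P x, 0) \<and> \<bar>P x - x0\<bar> < \<epsilon> \<and>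
          (\<forall>t. 0 < t \<and> t < T \<longrightarrow> \<gamma> t \<notin> {(s, 0) | s. \<bar>s - x0\<bar> < \<epsilon>}))"

definition hyperbolic_limit_cycle :: "vfield \<Rightarrow> vfield \<Rightarrow> (real \<times> real) set \<Rightarrow> bool" where
  "hyperbolic_limit_cycle Zp Zm \<Gamma> \<longleftrightarrow>
     limit_cycle Zp Zm \<Gamma> \<and>
     (\<exists>x0 P d. (x0, 0) \<in> \<Gamma> \<and> first_return_map_at Zp Zm x0 P \<and>
        (P has_real_derivative d) (at x0) \<and> \<bar>d\<bar> \<noteq> 1)"

end

theory Submission
  imports Defs "HOL-Complex_Analysis.Complex_Analysis"
begin

text \<open>
  Near an invisible contact an orbit is a graph \<open>y = \<eta>(x, s)\<close> over the \<open>x\<close>-axis, where \<open>\<eta>(x, _)\<close> solves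
  \<open>dy/ds = Y/X\<close> with \<open>\<eta>(x, x) = 0\<close>.  After complexification, \<open>\<eta>(x, x\<sigma>) / x^(2k)\<close> extends
  holomorphically over \<open>x = 0\<close> with value \<open>\<alpha> (\<sigma>^(2k) - 1) / 2k\<close> there, and its zero near \<open>\<sigma> = -1\<close> is
  \<open>\<phi>(x) / x\<close> for the half-return map \<open>\<phi>\<close>; this gives analyticity of \<open>\<phi>\<close> in \<open>x\<close> and in the parameters.

  Since both half-return maps are involutions, \<open>\<Delta>(\<phi>\<^sup>+(x)) + B(x) \<Delta>(x) = 0\<close> with \<open>B(0) = -1\<close>, so every odd
  Lyapunov coefficient is bounded by a fixed multiple of the sum of the preceding ones.  By the
  open mapping theorem, parameters close to \<open>\<Lambda>\<^sub>0\<close> can be chosen with \<open>V\<^sub>2\<^sub>j\<close> close to \<open>\<mu>^(2n+2-2j) c\<^sub>j\<close>, where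
  \<open>c\<^sub>j\<close> are the coefficients of \<open>V\<^sub>2\<^sub>n\<^sub>+\<^sub>2(\<Lambda>\<^sub>0) s\<^sup>2 (s\<^sup>2 - 1) \<dots> (s\<^sup>2 - n\<^sup>2)\<close>.  Then \<open>\<Delta>(\<mu>s) / \<mu>^(2n+2)\<close> is uniformly close to
  this polynomial, and its simple zeros \<open>1, \<dots>, n\<close> persist as \<open>n\<close> hyperbolic limit cycles.
\<close>

section \<open>Half-turns of a planar field\<close>

text \<open>Three obstacles shape the proof. The contact conditions are available at real
  parameters, whereas holomorphic dependence is wanted at complex ones; so a quotient by a power of
  the phase variable is replaced by a Cauchy integral over a fixed circle, which makes sense at all
  complex parameters and equals the quotient at the real ones. The half-return map is a definite
  description over all orbits, and closed orbits are arbitrary periodic Filippov solutions; so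
  arbitrary solutions have to be trapped on known graphs, and closed orbits with several turns have
  to be excluded near a cycle. The open mapping theorem asks for continuity near \<Lambda>0 and
  differentiability at \<Lambda>0, which boundedness and holomorphy along complex lines provide. The
  exponents 2n+2-2j come from the substitution x = \<mu> s, which gives all even terms up to order
  2n+2 the common size \<mu>^(2n+2); the odd terms turn out smaller by a further factor \<mu>. For
  the parameters chosen, V_2 is comparable to \<mu>^(2n). As V_2 vanishes at \<Lambda>0, convergence
  of the parameters forces \<mu> to 0, and with it the cycles to the origin.\<close>

lemma positive_before_transversal_zeros:
  fixes u u' :: "real \<Rightarrow> real"
  assumes ab: "a < b" and ua: "u a > 0" and ub: "u b = 0"
    and der: "\<And>t. t \<in> {a..b} \<Longrightarrow> (u has_real_derivative u' t) (at t)"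
    and neg: "\<And>t. t \<in> {a..b} \<Longrightarrow> u t = 0 \<Longrightarrow> u' t < 0"
    and t: "t \<in> {a..<b}"
  shows "u t > 0"
proof (rule ccontr)
  assume "\<not> u t > 0"
  have cont: "continuous_on {a..b} u"
    using der DERIV_isCont continuous_at_imp_continuous_on by blast
  obtain z where z: "a \<le> z" "z \<le> t" "u z = 0"
    using IVT2'[of u t 0 a] \<open>\<not> u t > 0\<close> ua t continuous_on_subset[OF cont] by force
  \<comment> \<open>The end zero is transversal too, so \<open>u\<close> is positive just before
    \<open>b\<close>; \<open>b'\<close> below is such a point, to the right of
    \<open>t\<close>.\<close>
  obtain d where d: "d > 0" "\<And>h. 0 < h \<Longrightarrow> h < d \<Longrightarrow> u b < u (b - h)"
    using DERIV_neg_dec_left[of u "u' b" b] der[of b] neg[of b] ab ub by auto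
  define b' where "b' = max ((t + b) / 2) (b - d / 2)"
  have b': "t < b'" "b' < b" using t d(1) by (simp_all add: b'_def less_max_iff_disj)
  have "b - d / 2 \<le> b'" by (simp add: b'_def)
  then have "b - b' < d" using d(1) by simp
  then have ub': "u b' > 0" using d(2)[of "b - b'"] b' ub by simp
  \<comment> \<open>Just after the last zero in [z, b'] the function is negative, while
    \<open>u b' > 0\<close>; so one more zero has to follow, a contradiction.\<close>
  define S where "S = {s \<in> {z..b'}. u s = 0}"
  have "continuous_on {z..b'} u" by (rule continuous_on_subset[OF cont]) (use z b' t in auto)
  then have "closed S" unfolding S_def by (intro continuous_closed_preimage_constant) auto
  moreover have "bounded S" by (rule bounded_subset[of "{z..b'}"]) (auto simp: S_def)
  ultimately have "compact S" by (simp add: compact_eq_bounded_closed)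
  moreover have "z \<in> S" using z b' t by (auto simp: S_def)
  ultimately obtain c where c: "c \<in> S" "\<And>s. s \<in> S \<Longrightarrow> s \<le> c"
    using compact_attains_sup[of S] by blast
  have cb: "c \<in> {a..b}" "c < b'" "u c = 0" using c(1) z b' ub' by (auto simp: S_def order_le_less)
  obtain e where e: "e > 0" "\<And>h. 0 < h \<Longrightarrow> h < e \<Longrightarrow> u (c + h) < u c"
    using DERIV_neg_dec_right[of u "u' c" c] der[OF cb(1)] neg[OF cb(1,3)] by auto
  define h where "h = min (e / 2) ((b' - c) / 2)"
  have h: "0 < h" "h < e" "c + h < b'" using e(1) cb by (auto simp: h_def min_def field_simps)
  obtain y where y: "c + h \<le> y" "y \<le> b'" "u y = 0"
    using IVT'[of u "c + h" 0 b'] e(2)[OF h(1,2)] cb h b' ub' continuous_on_subset[OF cont, of "{c + h..b'}"] by force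
  then have "y \<in> S" using c(1) h by (auto simp: S_def)
  then show False using c(2)[of y] y h by simp
qed

text \<open>The square of \<open>d\<close> is used because its modulus need not be differentiable.
  Its derivative is at most 2 K d^2, so the weighted square below cannot grow from its initial value
  0.\<close>

lemma Gronwall_zero:
  fixes d d' :: "real \<Rightarrow> real"
  assumes ab: "a \<le> b" and cont: "continuous_on {a..b} d" and d0: "d a = 0"
    and der: "\<And>t. a < t \<Longrightarrow> t < b \<Longrightarrow> (d has_real_derivative d' t) (at t)"
    and bound: "\<And>t. a < t \<Longrightarrow> t < b \<Longrightarrow> \<bar>d' t\<bar> \<le> K * \<bar>d t\<bar>"
  shows "d b = 0"
proof -
  let ?g = "\<lambda>t. (d t)^2 * exp (- (2 * K * t))"
  have "?g b \<le> ?g a"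
  proof (rule DERIV_nonpos_imp_decreasing_open[OF ab])
    fix t assume t: "a < t" "t < b"
    have "(?g has_real_derivative (2 * (d t * d' t) - 2 * K * (d t)^2) * exp (- (2 * K * t))) (at t)"
      by (auto intro!: derivative_eq_intros der[OF t] simp: algebra_simps power2_eq_square)
    moreover have "d t * d' t \<le> K * (d t)^2"
    proof -
      have "d t * d' t \<le> \<bar>d t\<bar> * \<bar>d' t\<bar>" by (metis abs_ge_self abs_mult)
      also have "\<dots> \<le> \<bar>d t\<bar> * (K * \<bar>d t\<bar>)" using bound[OF t] by (intro mult_left_mono) auto
      also have "\<dots> = K * (d t)^2" by (simp add: power2_eq_square)
      finally show ?thesis .
    qed
    then have "(2 * (d t * d' t) - 2 * K * (d t)^2) * exp (- (2 * K * t)) \<le> 0"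
      by (intro mult_nonpos_nonneg) auto
    ultimately show "\<exists>y. (?g has_real_derivative y) (at t) \<and> y \<le> 0" by blast
  qed (intro continuous_intros cont)
  then have "(d b)^2 * exp (- (2 * K * b)) \<le> 0" using d0 by simp
  moreover have "exp (- (2 * K * b)) > 0" by simp
  ultimately have "(d b)^2 \<le> 0" by (simp add: mult_le_0_iff)
  then show ?thesis by simp
qed

section \<open>Orbits on one side as graphs over the axis\<close>

definition slope :: "vfield \<Rightarrow> real \<Rightarrow> real \<Rightarrow> real" where
  "slope Z x y = snd (Z (x, y)) / fst (Z (x, y))"

text \<open>
  \<open>\<sigma>\<close> is the side of the discontinuity line, \<open>\<kappa>\<close> the sign of the horizontal component, \<open>\<eta> x\<close> the graph of the
  orbit through \<open>(x, 0)\<close> and \<open>\<phi>\<close> its other zero.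
\<close>

locale half_turn =
  fixes \<sigma> \<kappa> \<rho> R m B L N r0 :: real and Z :: vfield and \<eta> :: "real \<Rightarrow> real \<Rightarrow> real" and \<phi> :: "real \<Rightarrow> real"
  assumes \<sigma>: "\<sigma> = 1 \<or> \<sigma> = -1" and \<kappa>: "\<kappa> = 1 \<or> \<kappa> = -1"
    and pos: "0 < r0" "2 * r0 \<le> \<rho>" "0 < R" "0 < m" "0 \<le> L" "0 \<le> N"
    and Zcont: "continuous_on ({-\<rho><..<\<rho>} \<times> {-R<..<R}) Z"
    and Xlow: "\<And>x y. \<bar>x\<bar> < \<rho> \<Longrightarrow> \<bar>y\<bar> < R \<Longrightarrow> m \<le> \<kappa> * fst (Z (x, y))"
    and Zbound: "\<And>x y. \<bar>x\<bar> < \<rho> \<Longrightarrow> \<bar>y\<bar> < R \<Longrightarrow> norm (Z (x, y)) \<le> B"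
    and lip: "\<And>x y y'. \<bar>x\<bar> < \<rho> \<Longrightarrow> \<bar>y\<bar> < R \<Longrightarrow> \<bar>y'\<bar> < R \<Longrightarrow> \<bar>slope Z x y - slope Z x y'\<bar> \<le> L * \<bar>y - y'\<bar>"
    and eta_diag: "\<And>x. \<bar>x\<bar> < \<rho> \<Longrightarrow> \<eta> x x = 0"
    and eta_box: "\<And>x s. \<bar>x\<bar> < \<rho> \<Longrightarrow> \<bar>s\<bar> < \<rho> \<Longrightarrow> \<bar>\<eta> x s\<bar> < R"
    and eta_ode: "\<And>x s. \<bar>x\<bar> < \<rho> \<Longrightarrow> \<bar>s\<bar> < \<rho> \<Longrightarrow> (\<eta> x has_real_derivative slope Z s (\<eta> x s)) (at s)"
    and eta_lin: "\<And>x s. \<bar>x\<bar> < \<rho> \<Longrightarrow> \<bar>s\<bar> < \<rho> \<Longrightarrow> \<bar>\<eta> x s\<bar> \<le> N * \<bar>s - x\<bar>"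
    and slope_sign: "\<And>s. s \<noteq> 0 \<Longrightarrow> \<bar>s\<bar> < 2 * r0 \<Longrightarrow> \<sigma> * (s * slope Z s 0) < 0"
    and eta_mid: "\<And>x. x \<noteq> 0 \<Longrightarrow> \<bar>x\<bar> < r0 \<Longrightarrow> \<sigma> * \<eta> x 0 > 0"
    and phi: "\<And>x. x \<noteq> 0 \<Longrightarrow> \<bar>x\<bar> < r0 \<Longrightarrow> x * \<phi> x < 0 \<and> \<bar>\<phi> x\<bar> \<le> 3 / 2 * \<bar>x\<bar> \<and> \<eta> x (\<phi> x) = 0"
    and phi_0: "\<phi> 0 = 0"
begin

lemma kappa_simps [simp]: "\<kappa> * \<kappa> = 1" "\<bar>\<kappa>\<bar> = 1" "\<kappa> * (\<kappa> * x) = x" "\<bar>\<kappa> * x\<bar> = \<bar>x\<bar>" for x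
  using \<kappa> by auto

lemma sigma_simps [simp]: "\<sigma> * \<sigma> = 1" "\<sigma> * (\<sigma> * x) = x" for x
  using \<sigma> by auto

text \<open>At 0 the graph is on the side \<sigma> by \<open>eta_mid\<close>, and by
  \<open>slope_sign\<close> each of its zeros on the segment from 0 to \<open>c\<close> is crossed
  towards the other side. So no zero can precede the zero \<open>c\<close>.\<close>

lemma eta_positive_towards_0:
  assumes x: "x \<noteq> 0" "\<bar>x\<bar> < r0" and c: "\<bar>c\<bar> < 2 * r0" "\<eta> x c = 0" "c \<noteq> 0"
    and s: "s = l * c" "0 \<le> l" "l < 1"
  shows "\<sigma> * \<eta> x s > 0"
proof -
  have xr: "\<bar>x\<bar> < \<rho>" using x pos by simp
  define u where "u l = \<sigma> * \<eta> x (l * c)" for l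
  have lc: "\<bar>l * c\<bar> < 2 * r0" if "l \<in> {0..1}" for l
  proof -
    have "l * \<bar>c\<bar> \<le> 1 * \<bar>c\<bar>" using that by (intro mult_right_mono) auto
    with c(1) have "l * \<bar>c\<bar> < 2 * r0" by simp
    then show ?thesis using that by (simp add: abs_mult)
  qed
  have "u l > 0"
  proof (rule positive_before_transversal_zeros[where a=0 and b=1 and u=u and u'="\<lambda>l. \<sigma> * (slope Z (l * c) (\<eta> x (l * c)) * c)"])
    show "u 0 > 0" using eta_mid[OF x] by (simp add: u_def)
    show "u 1 = 0" using c by (simp add: u_def)
    fix l :: real assume l: "l \<in> {0..1}"
    have "((\<lambda>l. l * c) has_real_derivative c) (at l)" by (auto intro!: derivative_eq_intros)
    from DERIV_chain2[OF eta_ode[OF xr] this] lc[OF l] pos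
    show "(u has_real_derivative \<sigma> * (slope Z (l * c) (\<eta> x (l * c)) * c)) (at l)"
      unfolding u_def by (intro DERIV_cmult) auto
    assume ul: "u l = 0"
    then have "l \<noteq> 0" using eta_mid[OF x] by (auto simp: u_def)
    then have l0: "l > 0" using l by simp
    have e0: "\<eta> x (l * c) = 0" using ul \<sigma> by (auto simp: u_def)
    have "\<sigma> * ((l * c) * slope Z (l * c) 0) < 0" using slope_sign[of "l * c"] lc[OF l] l0 c by simp
    then have "l * (\<sigma> * (slope Z (l * c) 0 * c)) < 0" by (simp add: mult_ac)
    then show "\<sigma> * (slope Z (l * c) (\<eta> x (l * c)) * c) < 0"
      using l0 unfolding e0 by (simp add: mult_less_0_iff)
  qed (use s in auto)
  then show ?thesis by (simp add: u_def s)
qed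

text \<open>The segment passes through 0 and both its ends are zeros of \<open>\<eta> x\<close>.
  Each half is covered by \<open>eta_positive_towards_0\<close>, with \<open>c = x\<close> or
  \<open>c = \<phi> x\<close>.\<close>

lemma eta_positive_between:
  assumes x: "x \<noteq> 0" "\<bar>x\<bar> < r0" and s: "s \<in> open_segment x (\<phi> x)"
  shows "\<sigma> * \<eta> x s > 0"
proof -
  have p: "x * \<phi> x < 0" "\<bar>\<phi> x\<bar> \<le> 3 / 2 * \<bar>x\<bar>" "\<eta> x (\<phi> x) = 0" using phi[OF x] by auto
  have xr: "\<bar>x\<bar> < \<rho>" using x pos by simp
  obtain t where t: "0 < t" "t < 1" "s = (1 - t) * x + t * \<phi> x"
    using s by (auto simp: in_segment)
  show ?thesis
  proof (cases "s * x \<ge> 0")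
    case True
    have "s / x < 1"
    proof -
      have "\<phi> x / x < 0" using p(1) by (auto simp: divide_less_0_iff mult_less_0_iff)
      then have "t * (\<phi> x / x) < 0" using t(1) by (rule mult_pos_neg[rotated])
      moreover have "s / x = (1 - t) + t * (\<phi> x / x)" using x t(3) by (simp add: field_simps)
      ultimately show ?thesis using t by linarith
    qed
    moreover have "s / x \<ge> 0" using True x by (simp add: zero_le_divide_iff zero_le_mult_iff)
    ultimately show ?thesis
      by (intro eta_positive_towards_0[OF x, of x s "s / x"]) (use x xr pos eta_diag in auto)
  next
    case False
    have p0: "\<phi> x \<noteq> 0" using p by auto
    have "s / \<phi> x < 1"
    proof -
      have "x / \<phi> x < 0" using p(1) by (auto simp: divide_less_0_iff mult_less_0_iff)
      then have "(1 - t) * (x / \<phi> x) < 0" using t(2) by (intro mult_pos_neg) auto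
      moreover have "s / \<phi> x = (1 - t) * (x / \<phi> x) + t" using p0 t(3) by (simp add: field_simps)
      ultimately show ?thesis using t by linarith
    qed
    moreover have "s / \<phi> x \<ge> 0" using False p x
      by (auto simp: zero_le_divide_iff mult_less_0_iff zero_le_mult_iff not_le)
    ultimately show ?thesis
      by (intro eta_positive_towards_0[OF x, of "\<phi> x" s "s / \<phi> x"]) (use x p p0 in auto)
  qed
qed

definition region :: "(real \<times> real) set" where
  "region = {-\<rho><..<\<rho>} \<times> {-R<..<R}"

definition arc :: "real \<Rightarrow> (real \<times> real) set" where
  "arc x = (\<lambda>s. (s, \<eta> x s)) ` closed_segment x (\<phi> x)"

lemma open_region: "open region" unfolding region_def by (intro open_Times) auto

lemma region_iff: "p \<in> region \<longleftrightarrow> \<bar>fst p\<bar> < \<rho> \<and> \<bar>snd p\<bar> < R"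
  by (cases p) (auto simp: region_def abs_less_iff)

lemma segment_bound: 
  assumes x: "x \<noteq> 0" "\<bar>x\<bar> < r0" and s: "s \<in> closed_segment x (\<phi> x)"
  shows "\<bar>s\<bar> \<le> 3 / 2 * \<bar>x\<bar>" "\<bar>s\<bar> < \<rho>"
proof -
  obtain t where t: "0 \<le> t" "t \<le> 1" "s = (1 - t) * x + t * \<phi> x"
    using s by (auto simp: in_segment)
  have "\<bar>s\<bar> \<le> (1 - t) * \<bar>x\<bar> + t * \<bar>\<phi> x\<bar>"
    unfolding t(3) using t abs_triangle_ineq[of "(1 - t) * x" "t * \<phi> x"] by (simp add: abs_mult)
  also have "\<dots> \<le> (1 - t) * (3 / 2 * \<bar>x\<bar>) + t * (3 / 2 * \<bar>x\<bar>)"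
    using t phi[OF x] by (intro add_mono mult_left_mono) auto
  also have "\<dots> = 3 / 2 * \<bar>x\<bar>" unfolding distrib_right[symmetric] by simp
  finally show "\<bar>s\<bar> \<le> 3 / 2 * \<bar>x\<bar>" .
  then show "\<bar>s\<bar> < \<rho>" using x pos by simp
qed

lemma arc_in_region: "x \<noteq> 0 \<Longrightarrow> \<bar>x\<bar> < r0 \<Longrightarrow> arc x \<subseteq> region"
  using segment_bound(2) eta_box pos by (auto simp: arc_def region_iff)

text \<open>The bound is linear in \<open>x\<close>, so cycles through small crossing points are
  small as a whole. The factor 5/2 bounds the distance of \<open>s\<close> from \<open>x\<close>,
  the modulus of \<open>s\<close> being at most 3/2 of that of \<open>x\<close>.\<close>

lemma arc_small:
  assumes x: "x \<noteq> 0" "\<bar>x\<bar> < r0" and p: "p \<in> arc x"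
  shows "norm p \<le> (3 / 2 + 5 / 2 * N) * \<bar>x\<bar>"
proof -
  obtain s where s: "s \<in> closed_segment x (\<phi> x)" "p = (s, \<eta> x s)" using p by (auto simp: arc_def)
  have "\<bar>\<eta> x s\<bar> \<le> N * \<bar>s - x\<bar>" using eta_lin[of x s] segment_bound[OF x s(1)] x pos by simp
  also have "\<dots> \<le> N * (5 / 2 * \<bar>x\<bar>)"
    using segment_bound(1)[OF x s(1)] abs_triangle_ineq4[of s x] pos by (intro mult_left_mono) auto
  finally show ?thesis using segment_bound(1)[OF x s(1)] norm_Pair_le[of s "\<eta> x s"] s(2)
    by (simp add: algebra_simps)
qed

lemma eta_continuous:
  assumes "\<bar>x\<bar> < \<rho>"
  shows "continuous_on {-\<rho><..<\<rho>} (\<eta> x)"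
proof (intro continuous_at_imp_continuous_on ballI)
  fix s assume "s \<in> {-\<rho><..<\<rho>}"
  then show "isCont (\<eta> x) s" by (intro DERIV_isCont[OF eta_ode[OF assms]]) auto
qed

lemma compact_arc: 
  assumes x: "x \<noteq> 0" "\<bar>x\<bar> < r0"
  shows "compact (arc x)"
proof -
  have "continuous_on (closed_segment x (\<phi> x)) (\<eta> x)"
  proof (rule continuous_on_subset[OF eta_continuous])
    show "\<bar>x\<bar> < \<rho>" using x pos by simp
    show "closed_segment x (\<phi> x) \<subseteq> {-\<rho><..<\<rho>}"
      using segment_bound(2)[OF x] by (meson abs_less_iff greaterThanLessThan_iff minus_less_iff subsetI)
  qed
  then show ?thesis unfolding arc_def by (intro compact_continuous_image continuous_intros) auto
qed

text \<open>The vertical distance \<open>d\<close> to the graph changes along the solution at the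
  rate X (slope(y) - slope(\<eta>)), hence by at most B L times its modulus, and it is 0 at the
  start.\<close>

lemma follows_solution:
  assumes ab: "a \<le> b" and cont: "continuous_on {a..b} \<gamma>"
    and ode: "\<And>t. a < t \<Longrightarrow> t < b \<Longrightarrow> (\<gamma> has_vector_derivative Z (\<gamma> t)) (at t)"
    and bx: "\<And>t. t \<in> {a..b} \<Longrightarrow> \<gamma> t \<in> region" and ini: "\<gamma> a = (x, 0)" and x: "\<bar>x\<bar> < \<rho>" and t: "t \<in> {a..b}"
  shows "snd (\<gamma> t) = \<eta> x (fst (\<gamma> t))"
proof -
  define d where "d t = snd (\<gamma> t) - \<eta> x (fst (\<gamma> t))" for t
  have cf: "continuous_on {a..t} (\<lambda>t. fst (\<gamma> t))" "continuous_on {a..t} (\<lambda>t. snd (\<gamma> t))"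
    using cont t by (auto intro!: continuous_on_fst continuous_on_snd intro: continuous_on_subset)
  have "d t = 0"
  proof (rule Gronwall_zero[where K="B * L" and a=a and b=t and d=d and d'="\<lambda>t. fst (Z (\<gamma> t)) * (slope Z (fst (\<gamma> t)) (snd (\<gamma> t)) - slope Z (fst (\<gamma> t)) (\<eta> x (fst (\<gamma> t))))"])
    show "a \<le> t" using t by simp
    show "d a = 0" using ini eta_diag x by (simp add: d_def)
    have "(\<lambda>t. fst (\<gamma> t)) ` {a..t} \<subseteq> {-\<rho><..<\<rho>}" using bx t by (force simp: region_iff abs_less_iff)
    then show "continuous_on {a..t} d"
      unfolding d_def by (intro continuous_on_diff cf continuous_on_compose2[OF eta_continuous[OF x] cf(1)])
    fix u assume u: "a < u" "u < t"
    then have ub: "\<gamma> u \<in> region" "a < u" "u < b" using bx t u by auto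
    then have ux: "\<bar>fst (\<gamma> u)\<bar> < \<rho>" "\<bar>snd (\<gamma> u)\<bar> < R" by (auto simp: region_iff)
    have Xn: "fst (Z (\<gamma> u)) \<noteq> 0" using Xlow[OF ux] pos by auto
    have v: "(\<gamma> has_vector_derivative Z (\<gamma> u)) (at u)" using ode ub by simp
    have f: "((\<lambda>t. fst (\<gamma> t)) has_real_derivative fst (Z (\<gamma> u))) (at u)"
      using bounded_linear.has_vector_derivative[OF bounded_linear_fst v]
      by (simp add: has_real_derivative_iff_has_vector_derivative)
    have s: "((\<lambda>t. snd (\<gamma> t)) has_real_derivative snd (Z (\<gamma> u))) (at u)"
      using bounded_linear.has_vector_derivative[OF bounded_linear_snd v]
      by (simp add: has_real_derivative_iff_has_vector_derivative)
    have "(d has_real_derivative snd (Z (\<gamma> u)) - slope Z (fst (\<gamma> u)) (\<eta> x (fst (\<gamma> u))) * fst (Z (\<gamma> u))) (at u)"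
      unfolding d_def by (intro DERIV_diff s DERIV_chain2[OF eta_ode[OF x ux(1)] f])
    moreover have "snd (Z (\<gamma> u)) = fst (Z (\<gamma> u)) * slope Z (fst (\<gamma> u)) (snd (\<gamma> u))"
      using Xn by (simp add: slope_def)
    ultimately show "(d has_real_derivative fst (Z (\<gamma> u)) * (slope Z (fst (\<gamma> u)) (snd (\<gamma> u)) - slope Z (fst (\<gamma> u)) (\<eta> x (fst (\<gamma> u))))) (at u)"
      by (simp add: algebra_simps)
    have "\<bar>fst (Z (\<gamma> u))\<bar> \<le> B"
      using Zbound[OF ux] norm_fst_le[of "fst (Z (\<gamma> u))" "snd (Z (\<gamma> u))"]
      unfolding prod.collapse real_norm_def by linarith
    then have "\<bar>fst (Z (\<gamma> u))\<bar> * \<bar>slope Z (fst (\<gamma> u)) (snd (\<gamma> u)) - slope Z (fst (\<gamma> u)) (\<eta> x (fst (\<gamma> u)))\<bar>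
        \<le> B * (L * \<bar>d u\<bar>)"
      unfolding d_def using ux eta_box[OF x ux(1)] by (intro mult_mono lip) auto
    then show "\<bar>fst (Z (\<gamma> u)) * (slope Z (fst (\<gamma> u)) (snd (\<gamma> u)) - slope Z (fst (\<gamma> u)) (\<eta> x (fst (\<gamma> u))))\<bar> \<le> B * L * \<bar>d u\<bar>"
      by (simp add: abs_mult)
  qed
  then show ?thesis by (simp add: d_def)
qed

text \<open>The horizontal speed in the direction \<open>\<kappa>\<close> is at least
  \<open>m\<close>. This later excludes a return to the starting point and bounds the time that can
  be spent in \<open>region\<close>.\<close>

lemma moves_monotonically:
  assumes cont: "continuous_on {a..b} \<gamma>"
    and ode: "\<And>t. a < t \<Longrightarrow> t < b \<Longrightarrow> (\<gamma> has_vector_derivative Z (\<gamma> t)) (at t)"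
    and bx: "\<And>t. t \<in> {a..b} \<Longrightarrow> \<gamma> t \<in> region" and t: "a \<le> t1" "t1 \<le> t2" "t2 \<le> b"
  shows "m * (t2 - t1) \<le> \<kappa> * fst (\<gamma> t2) - \<kappa> * fst (\<gamma> t1)"
proof -
  let ?g = "\<lambda>t. \<kappa> * fst (\<gamma> t) - m * t"
  have "?g t1 \<le> ?g t2"
  proof (rule DERIV_nonneg_imp_increasing_open[OF t(2)])
    fix u assume u: "t1 < u" "u < t2"
    have ub: "\<gamma> u \<in> region" using bx u t by simp
    then have l: "m \<le> \<kappa> * fst (Z (\<gamma> u))" using Xlow[of "fst (\<gamma> u)" "snd (\<gamma> u)"] by (simp add: region_iff)
    have v: "(\<gamma> has_vector_derivative Z (\<gamma> u)) (at u)" using ode u t by simp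
    have f: "((\<lambda>t. fst (\<gamma> t)) has_real_derivative fst (Z (\<gamma> u))) (at u)"
      using bounded_linear.has_vector_derivative[OF bounded_linear_fst v]
      by (simp add: has_real_derivative_iff_has_vector_derivative)
    have "(?g has_real_derivative \<kappa> * fst (Z (\<gamma> u)) - m) (at u)"
      by (auto intro!: derivative_eq_intros f)
    with l show "\<exists>y. (?g has_real_derivative y) (at u) \<and> 0 \<le> y" by (intro exI conjI) auto
  next
    have "continuous_on {t1..t2} \<gamma>" by (rule continuous_on_subset[OF cont]) (use t in auto)
    then show "continuous_on {t1..t2} ?g" by (intro continuous_intros)
  qed
  then show ?thesis by (simp add: algebra_simps)
qed


lemma slope_uminus: "slope (\<lambda>p. - Z p) = slope Z"
  by (simp add: slope_def fun_eq_iff)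

text \<open>Reversing time changes the sign of \<open>\<kappa>\<close> but neither the slopes nor
  the graphs. Statements about backward time are obtained by interpreting the locale once more with
  these parameters.\<close>

lemma reversed: "half_turn \<sigma> (- \<kappa>) \<rho> R m B L N r0 (\<lambda>p. - Z p) \<eta> \<phi>"
proof
  show "- \<kappa> = 1 \<or> - \<kappa> = - 1" using \<kappa> by auto
  show "continuous_on ({-\<rho><..<\<rho>} \<times> {-R<..<R}) (\<lambda>p. - Z p)" by (intro continuous_intros Zcont)
  show "m \<le> - \<kappa> * fst (- Z (x, y))" if "\<bar>x\<bar> < \<rho>" "\<bar>y\<bar> < R" for x y using Xlow[OF that] by simp
  show "norm (- Z (x, y)) \<le> B" if "\<bar>x\<bar> < \<rho>" "\<bar>y\<bar> < R" for x y using Zbound[OF that] by simp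
  show "\<bar>slope (\<lambda>p. - Z p) x y - slope (\<lambda>p. - Z p) x y'\<bar> \<le> L * \<bar>y - y'\<bar>"
    if "\<bar>x\<bar> < \<rho>" "\<bar>y\<bar> < R" "\<bar>y'\<bar> < R" for x y y' unfolding slope_uminus by (rule lip[OF that])
  show "(\<eta> x has_real_derivative slope (\<lambda>p. - Z p) s (\<eta> x s)) (at s)" if "\<bar>x\<bar> < \<rho>" "\<bar>s\<bar> < \<rho>" for x s
    unfolding slope_uminus by (rule eta_ode[OF that])
  show "\<sigma> * (s * slope (\<lambda>p. - Z p) s 0) < 0" if "s \<noteq> 0" "\<bar>s\<bar> < 2 * r0" for s
    unfolding slope_uminus by (rule slope_sign[OF that])
qed (rule \<sigma> pos eta_diag eta_box eta_lin eta_mid phi phi_0; assumption)+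

lemma in_segment_iff:
  assumes x: "\<kappa> * x < 0" "\<bar>x\<bar> < r0"
  shows "s \<in> closed_segment x (\<phi> x) \<longleftrightarrow> \<kappa> * x \<le> \<kappa> * s \<and> \<kappa> * s \<le> \<kappa> * \<phi> x"
    and "s \<in> open_segment x (\<phi> x) \<longleftrightarrow> \<kappa> * x < \<kappa> * s \<and> \<kappa> * s < \<kappa> * \<phi> x"
    and "\<kappa> * \<phi> x > 0"
proof -
  have "x \<noteq> 0" using x by auto
  then have "x * \<phi> x < 0" using phi[of x] x by auto
  with x \<kappa> show "s \<in> closed_segment x (\<phi> x) \<longleftrightarrow> \<kappa> * x \<le> \<kappa> * s \<and> \<kappa> * s \<le> \<kappa> * \<phi> x"
    and "s \<in> open_segment x (\<phi> x) \<longleftrightarrow> \<kappa> * x < \<kappa> * s \<and> \<kappa> * s < \<kappa> * \<phi> x"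
    and "\<kappa> * \<phi> x > 0"
    by (auto simp: closed_segment_eq_real_ivl open_segment_eq_real_ivl mult_less_0_iff)
qed

text \<open>The solution lies on the graph of \<open>\<eta> x\<close> and moves in the direction
  \<open>\<kappa>\<close>. If it started away from 0 it would enter the wrong side at once; starting
  towards 0 it cannot pass \<open>\<phi> x\<close>, where the graph meets the axis.\<close>

lemma capture_local:
  assumes ab: "a < b" and cont: "continuous_on {a..b} \<gamma>"
    and ode: "\<And>t. a < t \<Longrightarrow> t < b \<Longrightarrow> (\<gamma> has_vector_derivative Z (\<gamma> t)) (at t)"
    and bx: "\<And>t. t \<in> {a..b} \<Longrightarrow> \<gamma> t \<in> region" and ini: "\<gamma> a = (x, 0)" and x: "x \<noteq> 0" "\<bar>x\<bar> < r0"
    and side: "\<And>t. a < t \<Longrightarrow> t < b \<Longrightarrow> \<sigma> * snd (\<gamma> t) > 0"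
  shows "\<kappa> * x < 0" and "t \<in> {a..b} \<Longrightarrow> \<gamma> t \<in> arc x"
proof -
  have xr: "\<bar>x\<bar> < \<rho>" using x pos by simp
  define u where "u t = \<kappa> * fst (\<gamma> t)" for t
  have ua: "u a = \<kappa> * x" by (simp add: u_def ini)
  have eta: "snd (\<gamma> t) = \<eta> x (fst (\<gamma> t))" if "t \<in> {a..b}" for t
    by (rule follows_solution[OF less_imp_le[OF ab] cont ode bx ini xr that])
  have mono: "m * (t2 - t1) \<le> u t2 - u t1" if "a \<le> t1" "t1 \<le> t2" "t2 \<le> b" for t1 t2
    unfolding u_def by (rule moves_monotonically[OF cont ode bx that])
  have contu: "continuous_on {a..b} u" unfolding u_def by (intro continuous_intros cont)
  show kx: "\<kappa> * x < 0"
  proof (rule ccontr)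
    assume "\<not> \<kappa> * x < 0"
    then have kx: "\<kappa> * x > 0" using x \<kappa> by auto
    \<comment> \<open>Signed height of the graph at distance \<open>h\<close> in the direction of
      motion. By \<open>slope_sign\<close> it decreases from 0, which contradicts
      \<open>side\<close>.\<close>
    define w where "w h = \<sigma> * \<eta> x (x + \<kappa> * h)" for h
    have 1: "((\<lambda>h. x + \<kappa> * h) has_real_derivative \<kappa>) (at 0)" by (auto intro!: derivative_eq_intros)
    have 2: "(\<eta> x has_real_derivative slope Z x 0) (at (x + \<kappa> * 0))"
      using eta_ode[OF xr xr] eta_diag[OF xr] by simp
    have "(w has_real_derivative \<sigma> * (slope Z x 0 * \<kappa>)) (at 0)"
      unfolding w_def by (rule DERIV_cmult[OF DERIV_chain2[OF 2 1]])
    moreover have "\<sigma> * (slope Z x 0 * \<kappa>) < 0"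
    proof -
      have "\<sigma> * (x * slope Z x 0) < 0" using slope_sign[of x] x by simp
      then have "(\<kappa> * x) * (\<sigma> * (x * slope Z x 0)) < 0" using kx by (rule mult_pos_neg[rotated])
      then have "(x * x) * (\<sigma> * (slope Z x 0 * \<kappa>)) < 0" by (simp add: mult_ac)
      moreover have "x * x > 0" using x by (metis not_real_square_gt_zero)
      ultimately show ?thesis by (simp add: mult_less_0_iff)
    qed
    ultimately obtain d where d: "d > 0" "\<And>h. 0 < h \<Longrightarrow> h < d \<Longrightarrow> w (0 + h) < w 0"
      using DERIV_neg_dec_right by blast
    have w0: "w 0 = 0" using eta_diag[OF xr] by (simp add: w_def)
    obtain e where e: "e > 0" "\<And>t. t \<in> {a..b} \<Longrightarrow> dist t a < e \<Longrightarrow> dist (u t) (u a) < d"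
      using contu d(1) ab unfolding continuous_on_iff by (metis atLeastAtMost_iff less_imp_le order_refl)
    define t where "t = a + min (e / 2) ((b - a) / 2)"
    have "0 < min (e / 2) ((b - a) / 2)" "min (e / 2) ((b - a) / 2) < e" "min (e / 2) ((b - a) / 2) < b - a"
    proof -
      have "min (e / 2) ((b - a) / 2) \<le> (b - a) / 2" by (rule min.cobounded2)
      also have "\<dots> < b - a" using ab by simp
      finally show "min (e / 2) ((b - a) / 2) < b - a" .
    qed (use e(1) ab in auto)
    then have t: "a < t" "t < b" "dist t a < e" by (auto simp: t_def dist_real_def)
    have "u t - u a < d" using e(2)[of t] t by (simp add: dist_real_def)
    moreover have "u t - u a > 0"
    proof -
      have "0 < m * (t - a)" using pos t by simp
      also have "\<dots> \<le> u t - u a" using mono[of a t] t by simp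
      finally show ?thesis .
    qed
    ultimately have "w (u t - u a) < 0" using d(2)[of "u t - u a"] w0 by simp
    moreover have "x + \<kappa> * (u t - u a) = fst (\<gamma> t)" by (simp add: ua right_diff_distrib) (simp add: u_def)
    ultimately have "\<sigma> * snd (\<gamma> t) < 0" using eta[of t] t by (simp add: w_def)
    with side[of t] t show False by simp
  qed
  show "\<gamma> t \<in> arc x" if t: "t \<in> {a..b}"
  proof -
    have "\<kappa> * x \<le> u t"
    proof -
      have "0 \<le> m * (t - a)" using pos t by simp
      then show ?thesis using mono[of a t] t ua by simp
    qed
    moreover have "u t \<le> \<kappa> * \<phi> x"
    proof (rule ccontr)
      assume c: "\<not> u t \<le> \<kappa> * \<phi> x"
      have "u a \<le> \<kappa> * \<phi> x" using in_segment_iff(3)[OF kx x(2)] kx ua by simp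
      then obtain t' where t': "a \<le> t'" "t' \<le> t" "u t' = \<kappa> * \<phi> x"
        using IVT'[of u a "\<kappa> * \<phi> x" t] c t continuous_on_subset[OF contu, of "{a..t}"] by auto
      have "t' \<noteq> a" "t' \<noteq> t" using t' c ua kx in_segment_iff(3)[OF kx x(2)] by auto
      then have tt: "a < t'" "t' < b" using t' t by auto
      have "fst (\<gamma> t') = \<phi> x" using t'(3) \<kappa> by (auto simp: u_def)
      then have "snd (\<gamma> t') = 0" using eta[of t'] tt phi[OF x] by simp
      then show False using side[OF tt] by simp
    qed
    ultimately have "fst (\<gamma> t) \<in> closed_segment x (\<phi> x)"
      using in_segment_iff(1)[OF kx x(2)] by (simp add: u_def)
    then show ?thesis using eta[OF t] by (auto simp: arc_def intro!: image_eqI[of _ _ "fst (\<gamma> t)"] prod_eqI)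
  qed
qed

text \<open>\<open>capture_local\<close> presupposes that the orbit stays in \<open>region\<close>;
  a continuation argument supplies this. The arc is compact inside the open region, so at the
  infimum of the times off the arc the orbit is still on it and stays in the region a little longer,
  where \<open>capture_local\<close> keeps it on the arc.\<close>

lemma capture:
  assumes ab: "a < b" and cont: "continuous_on {a..b} \<gamma>"
    and ode: "\<And>t. a < t \<Longrightarrow> t < b \<Longrightarrow> (\<gamma> has_vector_derivative Z (\<gamma> t)) (at t)"
    and ini: "\<gamma> a = (x, 0)" and x: "x \<noteq> 0" "\<bar>x\<bar> < r0"
    and side: "\<And>t. a < t \<Longrightarrow> t < b \<Longrightarrow> \<sigma> * snd (\<gamma> t) > 0"
  shows "\<kappa> * x < 0" and "\<And>t. t \<in> {a..b} \<Longrightarrow> \<gamma> t \<in> arc x" and "snd (\<gamma> b) = 0 \<Longrightarrow> \<gamma> b = (\<phi> x, 0)"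
proof -
  have xr: "\<bar>x\<bar> < \<rho>" using x pos by simp
  have ina: "\<gamma> a \<in> arc x" using eta_diag[OF xr] by (auto simp: ini arc_def)
  have near: "\<exists>e>0. \<forall>s\<in>{a..b}. \<bar>s - t\<bar> < e \<longrightarrow> \<gamma> s \<in> region" if tt: "t \<in> {a..b}" "\<gamma> t \<in> arc x" for t
  proof -
    have "\<gamma> t \<in> region" using tt arc_in_region[OF x] by blast
    then obtain e1 where e1: "e1 > 0" "\<And>p. dist p (\<gamma> t) < e1 \<Longrightarrow> p \<in> region"
      using open_region unfolding open_dist by blast
    obtain e where e: "e > 0" "\<forall>s\<in>{a..b}. dist s t < e \<longrightarrow> dist (\<gamma> s) (\<gamma> t) < e1"
      using cont[unfolded continuous_on_iff, rule_format, OF tt(1) e1(1)] by blast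
    show ?thesis
      by (intro exI[of _ e] conjI ballI impI e(1) e1(2)) (use e(2) in \<open>auto simp: dist_real_def\<close>)
  qed
  have loc: "\<kappa> * x < 0 \<and> (\<forall>t\<in>{a..t1}. \<gamma> t \<in> arc x)"
    if t1: "a < t1" "t1 \<le> b" and bx: "\<And>t. t \<in> {a..t1} \<Longrightarrow> \<gamma> t \<in> region" for t1
  proof -
    have c1: "continuous_on {a..t1} \<gamma>" by (rule continuous_on_subset[OF cont]) (use t1 in auto)
    have o1: "(\<gamma> has_vector_derivative Z (\<gamma> t)) (at t)" "\<sigma> * snd (\<gamma> t) > 0" if "a < t" "t < t1" for t
      using ode[of t] side[of t] that t1 by auto
    show ?thesis using capture_local[OF t1(1) c1 o1(1) bx ini x o1(2)] by blast
  qed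
  have all: "\<gamma> t \<in> arc x" if t: "t \<in> {a..b}" for t
  proof (rule ccontr)
    assume nt: "\<gamma> t \<notin> arc x"
    define S where "S = {s \<in> {a..b}. \<gamma> s \<notin> arc x}"
    have Sne: "S \<noteq> {}" and bdd: "bdd_below S" using t nt by (auto simp: S_def intro: bdd_belowI[of _ a])
    define c where "c = Inf S"
    have c: "a \<le> c" "c \<le> b" unfolding c_def
      using Sne bdd t nt by (auto intro!: cInf_greatest cInf_lower2[of t] simp: S_def)
    have below: "\<gamma> s \<in> arc x" if "a \<le> s" "s < c" for s
      using that c cInf_lower[OF _ bdd, of s] by (force simp: S_def c_def)
    have inc: "\<gamma> c \<in> arc x"
    proof (cases "c = a")
      case False
      then have ac: "a < c" using c by simp
      have cl: "closed {s \<in> {a..b}. \<gamma> s \<in> arc x}"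
        using continuous_closed_preimage[OF cont, of "arc x"] compact_imp_closed[OF compact_arc[OF x]]
        by (simp add: vimage_def Int_def conj_commute)
      have "closure {a..<c} \<subseteq> {s \<in> {a..b}. \<gamma> s \<in> arc x}"
        by (rule closure_minimal[OF _ cl]) (use below c in auto)
      moreover have "c \<in> closure {a..<c}" using closure_atLeastLessThan[OF ac] ac by simp
      ultimately show ?thesis by blast
    qed (use ina in simp)
    obtain e where e: "e > 0" "\<And>s. s \<in> {a..b} \<Longrightarrow> \<bar>s - c\<bar> < e \<Longrightarrow> \<gamma> s \<in> region"
      using near[OF _ inc] c by auto
    define t1 where "t1 = min b (c + e / 2)"
    have t1: "a < t1" "t1 \<le> b" using ab c e(1) by (auto simp: t1_def)
    have "\<gamma> s \<in> region" if s: "s \<in> {a..t1}" for s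
    proof (cases "s < c")
      case True
      then show ?thesis using below[of s] s arc_in_region[OF x] by auto
    next
      case False
      then show ?thesis using e(1) s t1 by (intro e(2)) (auto simp: t1_def)
    qed
    then have arc1: "\<And>s. s \<in> {a..t1} \<Longrightarrow> \<gamma> s \<in> arc x" using loc[OF t1] by blast
    have "t1 < b"
    proof (rule ccontr)
      assume "\<not> t1 < b"
      then have "t \<in> {a..t1}" using t t1 by auto
      with arc1 nt show False by blast
    qed
    then have "c < t1" using e(1) by (auto simp: t1_def min_def split: if_splits)
    then obtain s where "s \<in> S" "s < t1" using cInf_lessD[OF Sne] unfolding c_def by blast
    then show False using arc1[of s] by (auto simp: S_def)
  qed
  then show "\<And>t. t \<in> {a..b} \<Longrightarrow> \<gamma> t \<in> arc x" by blast
  have bx: "\<And>t. t \<in> {a..b} \<Longrightarrow> \<gamma> t \<in> region" using all arc_in_region[OF x] by blast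
  show kx: "\<kappa> * x < 0" using loc[OF ab order_refl bx] by blast
  show "\<gamma> b = (\<phi> x, 0)" if b0: "snd (\<gamma> b) = 0"
  proof -
    obtain s where s: "s \<in> closed_segment x (\<phi> x)" "\<gamma> b = (s, \<eta> x s)" using all[of b] ab by (auto simp: arc_def)
    \<comment> \<open>The end point is on the axis, hence one of the two ends of the arc; the strict
      horizontal motion excludes the starting point.\<close>
    have "m * (b - a) \<le> \<kappa> * fst (\<gamma> b) - \<kappa> * fst (\<gamma> a)"
      using ab by (intro moves_monotonically[OF cont ode bx]) auto
    moreover have "m * (b - a) > 0" using pos ab by simp
    ultimately have "s \<noteq> x" using s(2) ini by auto
    moreover have "s \<notin> open_segment x (\<phi> x)" using eta_positive_between[OF x, of s] b0 s(2) by auto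
    ultimately have "s = \<phi> x" using s(1) by (auto simp: open_segment_def)
    then show ?thesis using s(2) b0 by simp
  qed
qed

text \<open>The graph is already known, so only its time parametrization is missing. In the
  coordinate u = \<kappa> x time is the integral of 1 / h, where \<open>h\<close> is the horizontal
  speed along the graph, and the inverse function \<open>w\<close> is the motion.\<close>

lemma arc_curve:
  assumes x: "\<kappa> * x < 0" "\<bar>x\<bar> < r0"
  shows "\<exists>T \<gamma>. T > 0 \<and> \<gamma> 0 = (x, 0) \<and> \<gamma> T = (\<phi> x, 0) \<and>
    (\<forall>t\<in>{0..T}. (\<gamma> has_vector_derivative Z (\<gamma> t)) (at t)) \<and> (\<forall>t\<in>{0<..<T}. \<sigma> * snd (\<gamma> t) > 0) \<and>
    \<gamma> ` {0..T} = arc x \<and> inj_on \<gamma> {0..T}"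
proof -
  have x0: "x \<noteq> 0" using x by auto
  have xr: "\<bar>x\<bar> < \<rho>" using x pos by simp
  define u0 where "u0 = \<kappa> * x"
  define u1 where "u1 = \<kappa> * \<phi> x"
  have u01: "u0 < u1" using x(1) in_segment_iff(3)[OF x] by (simp add: u0_def u1_def)
  have "\<bar>u0\<bar> < \<rho>" "\<bar>u1\<bar> < \<rho>" using xr segment_bound(2)[OF x0 x(2), of "\<phi> x"] by (auto simp: u0_def u1_def)
  \<comment> \<open>A slightly larger interval makes the derivatives at both ends of the arc
    two-sided.\<close>
  then obtain c d where cd: "-\<rho> < c" "c < u0" "u1 < d" "d < \<rho>"
    by (meson abs_less_iff dense minus_less_iff)
  define h where "h u = \<kappa> * fst (Z (\<kappa> * u, \<eta> x (\<kappa> * u)))" for u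
  have ur: "\<bar>\<kappa> * u\<bar> < \<rho>" if "u \<in> {c..d}" for u using that cd by (auto simp: abs_less_iff)
  have hm: "m \<le> h u" if "u \<in> {c..d}" for u
    unfolding h_def using ur[OF that] eta_box[OF xr ur[OF that]] by (intro Xlow) auto
  have hcont: "continuous_on {c..d} h"
  proof -
    have k: "continuous_on {c..d} (\<lambda>u. \<kappa> * u)" by (intro continuous_intros)
    have "(\<lambda>u. \<kappa> * u) ` {c..d} \<subseteq> {-\<rho><..<\<rho>}"
    proof (rule image_subsetI)
      fix u assume "u \<in> {c..d}"
      from ur[OF this] have a: "\<bar>\<kappa> * u\<bar> < \<rho>" .
      show "\<kappa> * u \<in> {-\<rho><..<\<rho>}" unfolding greaterThanLessThan_iff using a by linarith
    qed
    then have "continuous_on {c..d} (\<lambda>u. \<eta> x (\<kappa> * u))" by (rule continuous_on_compose2[OF eta_continuous[OF xr] k])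
    then have "continuous_on {c..d} (\<lambda>u. (\<kappa> * u, \<eta> x (\<kappa> * u)))" by (intro continuous_on_Pair k)
    moreover have "(\<lambda>u. (\<kappa> * u, \<eta> x (\<kappa> * u))) ` {c..d} \<subseteq> {-\<rho><..<\<rho>} \<times> {-R<..<R}"
    proof (rule image_subsetI)
      fix u assume "u \<in> {c..d}"
      then have "(\<kappa> * u, \<eta> x (\<kappa> * u)) \<in> region" using ur[of u] eta_box[OF xr] by (auto simp: region_iff)
      then show "(\<kappa> * u, \<eta> x (\<kappa> * u)) \<in> {-\<rho><..<\<rho>} \<times> {-R<..<R}" by (simp only: region_def)
    qed
    ultimately have "continuous_on {c..d} (\<lambda>u. Z (\<kappa> * u, \<eta> x (\<kappa> * u)))" by (rule continuous_on_compose2[OF Zcont])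
    then show ?thesis unfolding h_def by (intro continuous_intros)
  qed
  define \<tau> where "\<tau> u = integral {c..u} (\<lambda>u. 1 / h u)" for u
  have h0: "h u > 0" if "u \<in> {c..d}" for u using hm[OF that] pos by simp
  have ci: "continuous_on {c..d} (\<lambda>u. 1 / h u)" by (intro continuous_intros hcont) (use h0 in force)
  have \<tau>d: "(\<tau> has_real_derivative 1 / h u) (at u)" if u: "u \<in> {c<..<d}" for u
  proof -
    have "(\<tau> has_real_derivative 1 / h u) (at u within {c..d})"
      unfolding \<tau>_def using u by (intro integral_has_real_derivative[OF ci]) auto
    then show ?thesis using at_within_Icc_at[of c u d] u by simp
  qed
  have mono: "\<tau> u < \<tau> v" if "c < u" "u < v" "v < d" for u v
  proof (rule DERIV_pos_imp_increasing[OF that(2)])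
    fix y assume "u \<le> y" "y \<le> v"
    with that have "y \<in> {c<..<d}" by auto
    from \<tau>d[OF this] h0[of y] \<open>y \<in> {c<..<d}\<close> show "\<exists>z. DERIV \<tau> y :> z \<and> 0 < z" by auto
  qed
  have inj: "inj_on \<tau> {c<..<d}"
    by (rule linorder_inj_onI) (use mono in force)+
  define w where "w = the_inv_into {c<..<d} \<tau>"
  have w: "w (\<tau> u) = u" if "u \<in> {c<..<d}" for u unfolding w_def by (rule the_inv_into_f_f[OF inj that])
  have \<tau>cont: "continuous_on {c<..<d} \<tau>"
    using \<tau>d DERIV_isCont continuous_at_imp_continuous_on by blast
  have wd: "(w has_real_derivative h u) (at (\<tau> u))" if u: "u \<in> {c<..<d}" for u
  proof -
    have "(w has_real_derivative inverse (1 / h u)) (at (\<tau> u))"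
      by (rule has_field_derivative_inverse_strong[OF \<tau>d[OF u] _ open_greaterThanLessThan u \<tau>cont w]) (use h0[of u] u in auto)
    then show ?thesis by simp
  qed
  define T where "T = \<tau> u1 - \<tau> u0"
  have T: "T > 0" using mono[of u0 u1] u01 cd by (simp add: T_def)
  have sub: "{u0..u1} \<subseteq> {c<..<d}" using cd by auto
  have onto: "\<exists>u\<in>{u0..u1}. \<tau> u = \<tau> u0 + t" if t: "t \<in> {0..T}" for t
    using IVT'[of \<tau> u0 "\<tau> u0 + t" u1] t u01 continuous_on_subset[OF \<tau>cont sub] by (auto simp: T_def)
  define W where "W t = w (\<tau> u0 + t)" for t
  have W: "W t \<in> {u0..u1}" "\<tau> (W t) = \<tau> u0 + t" if t: "t \<in> {0..T}" for t
  proof -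
    obtain u where u: "u \<in> {u0..u1}" "\<tau> u = \<tau> u0 + t" using onto[OF t] by blast
    then have "W t = u" using w[of u] sub by (auto simp: W_def)
    then show "W t \<in> {u0..u1}" "\<tau> (W t) = \<tau> u0 + t" using u by auto
  qed
  have Wd: "(W has_real_derivative h (W t)) (at t)" if t: "t \<in> {0..T}" for t
  proof -
    have "(w has_real_derivative h (W t)) (at (\<tau> u0 + t))" using wd[of "W t"] W[OF t] sub by auto
    moreover have "((\<lambda>t. \<tau> u0 + t) has_real_derivative 1) (at t)" by (auto intro!: derivative_eq_intros)
    ultimately have "(W has_real_derivative h (W t) * 1) (at t)"
      unfolding W_def by (rule DERIV_chain2)
    then show ?thesis by simp
  qed
  have W_inv: "W (\<tau> u - \<tau> u0) = u" if "u \<in> {u0..u1}" for u using w[of u] that sub by (auto simp: W_def)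
  define \<gamma> where "\<gamma> t = (\<kappa> * W t, \<eta> x (\<kappa> * W t))" for t
  have W0: "W 0 = u0" "W T = u1" using W_inv[of u0] W_inv[of u1] u01 by (auto simp: T_def)
  have kW: "\<bar>\<kappa> * W t\<bar> < \<rho>" if "t \<in> {0..T}" for t using ur[of "W t"] W[OF that] cd by auto
  have "\<gamma> 0 = (x, 0)" using W0 eta_diag[OF xr] by (simp add: \<gamma>_def u0_def)
  moreover have "\<gamma> T = (\<phi> x, 0)" using W0 phi[OF x0 x(2)] by (simp add: \<gamma>_def u1_def)
  moreover have "(\<gamma> has_vector_derivative Z (\<gamma> t)) (at t)" if t: "t \<in> {0..T}" for t
  proof -
    have 1: "((\<lambda>t. \<kappa> * W t) has_real_derivative fst (Z (\<gamma> t))) (at t)"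
      using DERIV_cmult[OF Wd[OF t], of \<kappa>] by (simp add: h_def \<gamma>_def)
    have "((\<lambda>t. \<eta> x (\<kappa> * W t)) has_real_derivative slope Z (\<kappa> * W t) (\<eta> x (\<kappa> * W t)) * fst (Z (\<gamma> t))) (at t)"
      by (rule DERIV_chain2[OF eta_ode[OF xr kW[OF t]] 1])
    moreover have "slope Z (\<kappa> * W t) (\<eta> x (\<kappa> * W t)) * fst (Z (\<gamma> t)) = snd (Z (\<gamma> t))"
      using Xlow[OF kW[OF t] eta_box[OF xr kW[OF t]]] pos by (auto simp: slope_def \<gamma>_def)
    ultimately have 2: "((\<lambda>t. \<eta> x (\<kappa> * W t)) has_real_derivative snd (Z (\<gamma> t))) (at t)" by simp
    have "((\<lambda>t. (\<kappa> * W t, \<eta> x (\<kappa> * W t))) has_vector_derivative (fst (Z (\<gamma> t)), snd (Z (\<gamma> t)))) (at t)"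
      using 1 2 by (intro has_vector_derivative_Pair) (auto simp: has_real_derivative_iff_has_vector_derivative)
    then show ?thesis by (simp add: \<gamma>_def[abs_def])
  qed
  moreover have "\<sigma> * snd (\<gamma> t) > 0" if t: "t \<in> {0<..<T}" for t
  proof -
    have t': "t \<in> {0..T}" using t by auto
    have "W t \<noteq> u0" "W t \<noteq> u1" using W(2)[OF t'] t by (auto simp: T_def)
    then have "\<kappa> * W t \<in> open_segment x (\<phi> x)"
      using W(1)[OF t'] in_segment_iff(2)[OF x] by (simp add: u0_def u1_def)
    from eta_positive_between[OF x0 x(2) this] show ?thesis by (simp add: \<gamma>_def)
  qed
  moreover have "\<gamma> ` {0..T} = arc x"
  proof
    show "\<gamma> ` {0..T} \<subseteq> arc x"
      using W(1) in_segment_iff(1)[OF x] by (auto simp: arc_def \<gamma>_def u0_def u1_def)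
    show "arc x \<subseteq> \<gamma> ` {0..T}"
    proof
      fix p assume "p \<in> arc x"
      then obtain s where s: "s \<in> closed_segment x (\<phi> x)" "p = (s, \<eta> x s)" by (auto simp: arc_def)
      then have u: "\<kappa> * s \<in> {u0..u1}" using in_segment_iff(1)[OF x] by (simp add: u0_def u1_def)
      have "\<tau> u0 \<le> \<tau> (\<kappa> * s)" "\<tau> (\<kappa> * s) \<le> \<tau> u1"
        using u mono[of u0 "\<kappa> * s"] mono[of "\<kappa> * s" u1] cd by (auto simp: order_le_less)
      then have "\<tau> (\<kappa> * s) - \<tau> u0 \<in> {0..T}" by (simp add: T_def)
      moreover have "p = \<gamma> (\<tau> (\<kappa> * s) - \<tau> u0)" using W_inv[OF u] s(2) by (simp add: \<gamma>_def)
      ultimately show "p \<in> \<gamma> ` {0..T}" by blast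
    qed
  qed
  moreover have "inj_on \<gamma> {0..T}"
  proof (rule inj_onI)
    fix s t assume st: "s \<in> {0..T}" "t \<in> {0..T}" "\<gamma> s = \<gamma> t"
    then have "W s = W t" using \<kappa> by (auto simp: \<gamma>_def)
    then have "\<tau> (W s) = \<tau> (W t)" by (rule arg_cong)
    then show "s = t" unfolding W(2)[OF st(1)] W(2)[OF st(2)] by (rule add_left_imp_eq)
  qed
  ultimately show ?thesis using T by blast
qed

end

section \<open>Reversal of orbits and the half-return relation\<close>

lemma half_return_to_uminus:
  assumes "half_return_to \<sigma> (\<lambda>p. - Z p) x x'"
  shows "half_return_to \<sigma> Z x x'"
proof -
  obtain \<gamma> T where T: "T \<noteq> 0" and d: "\<And>t. t \<in> closed_segment 0 T \<Longrightarrow> (\<gamma> has_vector_derivative - Z (\<gamma> t)) (at t within closed_segment 0 T)"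
    and e: "\<gamma> 0 = (x, 0)" "\<gamma> T = (x', 0)" and p: "\<And>t. t \<in> open_segment 0 T \<Longrightarrow> \<sigma> * snd (\<gamma> t) > 0"
    using assms unfolding half_return_to_def by blast
  have im: "uminus ` closed_segment 0 (- T) = closed_segment 0 T"
    using closed_segment_linear_image[of uminus 0 "-T"] by (simp add: module_hom_uminus linear_uminus image_comp)
  have seg: "- t \<in> closed_segment 0 T" if "t \<in> closed_segment 0 (- T)" for t
    using im that by blast
  have oseg: "- t \<in> open_segment 0 T" if "t \<in> open_segment 0 (- T)" for t
    using that seg[of t] by (auto simp: open_segment_def)
  let ?g = "\<lambda>t. \<gamma> (- t)"
  have "(?g has_vector_derivative Z (?g t)) (at t within closed_segment 0 (- T))" if t: "t \<in> closed_segment 0 (- T)" for t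
  proof -
    have 1: "(uminus has_vector_derivative (-1::real)) (at t within closed_segment 0 (- T))"
      by (auto intro!: derivative_eq_intros)
    have 2: "(\<gamma> has_vector_derivative - Z (\<gamma> (- t))) (at (- t) within uminus ` closed_segment 0 (- T))"
      unfolding im by (rule d[OF seg[OF t]])
    from vector_diff_chain_within[OF 1 2] show ?thesis by (simp add: o_def)
  qed
  then show ?thesis
    unfolding half_return_to_def using T e p oseg
    by (intro exI[of _ ?g] exI[of _ "- T"]) auto
qed

text \<open>The definition admits times of either sign, so the same orbit, read from its end with
  time \<open>- T\<close>, is again a half-return. Together with uniqueness this makes the
  half-return map an involution.\<close>

lemma half_return_to_sym:
  assumes "half_return_to \<sigma> Z x x'"
  shows "half_return_to \<sigma> Z x' x"
proof -
  obtain \<gamma> T where T: "T \<noteq> 0" and d: "\<And>t. t \<in> closed_segment 0 T \<Longrightarrow> (\<gamma> has_vector_derivative Z (\<gamma> t)) (at t within closed_segment 0 T)"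
    and e: "\<gamma> 0 = (x, 0)" "\<gamma> T = (x', 0)" and p: "\<And>t. t \<in> open_segment 0 T \<Longrightarrow> \<sigma> * snd (\<gamma> t) > 0"
    using assms unfolding half_return_to_def by blast
  have im: "(+) T ` closed_segment 0 (- T) = closed_segment 0 T"
    using closed_segment_translation[of T 0 "-T"] closed_segment_commute[of T 0] by simp
  have seg: "T + t \<in> closed_segment 0 T" if "t \<in> closed_segment 0 (- T)" for t
    using im that by blast
  have oseg: "T + t \<in> open_segment 0 T" if "t \<in> open_segment 0 (- T)" for t
    using that seg[of t] by (auto simp: open_segment_def)
  let ?g = "\<lambda>t. \<gamma> (T + t)"
  have "(?g has_vector_derivative Z (?g t)) (at t within closed_segment 0 (- T))" if t: "t \<in> closed_segment 0 (- T)" for t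
  proof -
    have 1: "((+) T has_vector_derivative (1::real)) (at t within closed_segment 0 (- T))"
      by (auto intro!: derivative_eq_intros)
    have 2: "(\<gamma> has_vector_derivative Z (\<gamma> (T + t))) (at (T + t) within (+) T ` closed_segment 0 (- T))"
      unfolding im by (rule d[OF seg[OF t]])
    from vector_diff_chain_within[OF 1 2] show ?thesis by (simp add: o_def)
  qed
  then show ?thesis
    unfolding half_return_to_def using T e p oseg
    by (intro exI[of _ ?g] exI[of _ "- T"]) auto
qed

context half_turn
begin

lemma half_return_to_phi_forward:
  assumes x: "\<kappa> * x < 0" "\<bar>x\<bar> < r0"
  shows "half_return_to \<sigma> Z x (\<phi> x)"
proof -
  obtain T \<gamma> where T: "T > 0" "\<gamma> 0 = (x, 0)" "\<gamma> T = (\<phi> x, 0)"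
    "\<forall>t\<in>{0..T}. (\<gamma> has_vector_derivative Z (\<gamma> t)) (at t)" "\<forall>t\<in>{0<..<T}. \<sigma> * snd (\<gamma> t) > 0"
    using arc_curve[OF x] by blast
  then show ?thesis
    unfolding half_return_to_def
    by (intro exI[of _ \<gamma>] exI[of _ T])
      (auto simp: closed_segment_eq_real_ivl open_segment_eq_real_ivl intro: has_vector_derivative_at_within)
qed

lemma half_return_to_forward_unique:
  assumes x: "x \<noteq> 0" "\<bar>x\<bar> < r0" and T: "T > 0"
    and d: "\<And>t. t \<in> {0..T} \<Longrightarrow> (\<gamma> has_vector_derivative Z (\<gamma> t)) (at t within {0..T})"
    and e: "\<gamma> 0 = (x, 0)" "\<gamma> T = (x', 0)" and p: "\<And>t. t \<in> {0<..<T} \<Longrightarrow> \<sigma> * snd (\<gamma> t) > 0"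
  shows "x' = \<phi> x"
proof -
  have "continuous_on {0..T} \<gamma>"
    using d has_vector_derivative_continuous continuous_on_eq_continuous_within by blast
  moreover have "(\<gamma> has_vector_derivative Z (\<gamma> t)) (at t)" if "0 < t" "t < T" for t
    using d[of t] that at_within_Icc_at[of 0 t T] by simp
  ultimately have "\<gamma> T = (\<phi> x, 0)" using capture(3)[of 0 T \<gamma> x] T e p x by auto
  then show ?thesis using e by simp
qed

text \<open>Existence and uniqueness together identify the definite description in
  \<open>half_return\<close> with \<open>\<phi>\<close>. A negative return time is turned into a
  positive one for the field \<open>- Z\<close>.\<close>

lemma half_return_to_iff:
  assumes x: "x \<noteq> 0" "\<bar>x\<bar> < r0"
  shows "half_return_to \<sigma> Z x x' \<longleftrightarrow> x' = \<phi> x"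
proof
  interpret rev: half_turn \<sigma> "- \<kappa>" \<rho> R m B L N r0 "\<lambda>p. - Z p" \<eta> \<phi> by (rule reversed)
  assume h: "half_return_to \<sigma> Z x x'"
  then obtain \<gamma> T where T: "T \<noteq> 0" and d: "\<And>t. t \<in> closed_segment 0 T \<Longrightarrow> (\<gamma> has_vector_derivative Z (\<gamma> t)) (at t within closed_segment 0 T)"
    and e: "\<gamma> 0 = (x, 0)" "\<gamma> T = (x', 0)" and p: "\<And>t. t \<in> open_segment 0 T \<Longrightarrow> \<sigma> * snd (\<gamma> t) > 0"
    unfolding half_return_to_def by blast
  show "x' = \<phi> x"
  proof (cases "T > 0")
    case True
    then show ?thesis
      using half_return_to_forward_unique[OF x True, of \<gamma> x'] d e p
      by (simp add: closed_segment_eq_real_ivl open_segment_eq_real_ivl)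
  next
    case False
    then have T0: "T < 0" using T by simp
    let ?g = "\<lambda>t. \<gamma> (- t)"
    have im: "uminus ` {0..- T} = {T..0}" by simp
    have "(?g has_vector_derivative - Z (?g t)) (at t within {0..- T})" if t: "t \<in> {0..- T}" for t
    proof -
      have 1: "(uminus has_vector_derivative (-1::real)) (at t within {0..- T})"
        by (auto intro!: derivative_eq_intros)
      have 2: "(\<gamma> has_vector_derivative Z (\<gamma> (- t))) (at (- t) within uminus ` {0..- T})"
        unfolding im using d[of "- t"] t T0 by (simp add: closed_segment_eq_real_ivl)
      from vector_diff_chain_within[OF 1 2] show ?thesis by (simp add: o_def)
    qed
    moreover have "\<sigma> * snd (?g t) > 0" if "t \<in> {0<..<- T}" for t
      using p[of "- t"] that T0 by (simp add: open_segment_eq_real_ivl)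
    ultimately show ?thesis
      using rev.half_return_to_forward_unique[OF x, of "- T" ?g x'] T0 e by simp
  qed
next
  interpret rev: half_turn \<sigma> "- \<kappa>" \<rho> R m B L N r0 "\<lambda>p. - Z p" \<eta> \<phi> by (rule reversed)
  assume "x' = \<phi> x"
  moreover have "half_return_to \<sigma> Z x (\<phi> x)"
  proof (cases "\<kappa> * x < 0")
    case False
    then have "- \<kappa> * x < 0" using x \<kappa> by auto
    from half_return_to_uminus[OF rev.half_return_to_phi_forward[OF this x(2)]] show ?thesis .
  qed (use half_return_to_phi_forward x in blast)
  ultimately show "half_return_to \<sigma> Z x x'" by simp
qed

lemma half_return_eq_phi: "\<bar>x\<bar> < r0 \<Longrightarrow> half_return \<sigma> Z x = \<phi> x"
  using half_return_to_iff phi_0 by (auto simp: half_return_def)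

lemma phi_involution:
  assumes x: "\<bar>x\<bar> < r0" "\<bar>\<phi> x\<bar> < r0"
  shows "\<phi> (\<phi> x) = x"
proof (cases "x = 0")
  case False
  have ne: "\<phi> x \<noteq> 0" using phi[OF False x(1)] by auto
  have "half_return_to \<sigma> Z x (\<phi> x)" using half_return_to_iff[OF False x(1)] by simp
  from half_return_to_sym[OF this] show ?thesis using half_return_to_iff[OF ne x(2)] by simp
qed (simp add: phi_0)

end

section \<open>Filippov solutions and hyperbolic cycles\<close>

text \<open>Intended for curves that are smooth apart from corners on the axis. The corners are
  locally finite, so the fundamental theorem of calculus applies on each interval, and boundedness
  makes the velocity absolutely integrable.\<close>

lemma filippov_solutionI:
  fixes \<gamma> v :: "real \<Rightarrow> real \<times> real"
  assumes I: "\<And>a b. a \<in> I \<Longrightarrow> b \<in> I \<Longrightarrow> {a..b} \<subseteq> I" and cont: "continuous_on I \<gamma>"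
    and S: "negligible S" "\<And>a b. finite (S \<inter> {a..b})"
    and der: "\<And>t. t \<in> I \<Longrightarrow> t \<notin> S \<Longrightarrow> (\<gamma> has_vector_derivative v t) (at t)"
    and F: "\<And>t. t \<in> I \<Longrightarrow> t \<notin> S \<Longrightarrow> v t \<in> filippov_set Zp Zm (\<gamma> t)"
    and B: "\<And>t. norm (v t) \<le> B"
  shows "filippov_solution_on Zp Zm I \<gamma>"
  unfolding filippov_solution_on_def
proof (intro exI conjI ballI impI)
  fix a b assume ab: "a \<in> I" "b \<in> I" "a \<le> b"
  have sub: "{a..b} \<subseteq> I" by (rule I[OF ab(1,2)])
  have hi: "(v has_integral (\<gamma> b - \<gamma> a)) {a..b}"
  proof (rule fundamental_theorem_of_calculus_interior_strong[OF S(2)[of a b] ab(3)])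
    fix t assume "t \<in> {a<..<b} - S \<inter> {a..b}"
    then show "(\<gamma> has_vector_derivative v t) (at t)" using sub by (intro der) auto
  qed (rule continuous_on_subset[OF cont sub])
  then show "(v has_integral (\<gamma> b - \<gamma> a)) {a..b}" .
  show "v absolutely_integrable_on {a..b}"
    by (rule absolutely_integrable_integrable_bound[where g="\<lambda>_. B"]) (use B hi in \<open>auto intro: has_integral_integrable\<close>)
next
  show "negligible {t \<in> I. v t \<notin> filippov_set Zp Zm (\<gamma> t)}"
    by (rule negligible_subset[OF S(1)]) (use F in blast)
qed

lemma filippov_continuous:
  assumes "filippov_solution_on Zp Zm UNIV \<gamma>"
  shows "continuous_on UNIV \<gamma>"
proof -
  obtain v where v: "\<And>a b. a \<le> b \<Longrightarrow> (v has_integral (\<gamma> b - \<gamma> a)) {a..b}"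
    using assms unfolding filippov_solution_on_def by auto
  have "isCont \<gamma> t" for t
  proof -
    have "continuous_on {t-1..t+1} (\<lambda>u. integral {t-1..u} v)"
      using v[of "t-1" "t+1"] by (intro indefinite_integral_continuous_1) (auto intro: has_integral_integrable)
    then have "continuous_on {t-1..t+1} (\<lambda>u. \<gamma> (t-1) + integral {t-1..u} v)" by (intro continuous_intros)
    then have "continuous_on {t-1..t+1} \<gamma>"
    proof (rule continuous_on_eq)
      show "\<gamma> (t-1) + integral {t-1..u} v = \<gamma> u" if "u \<in> {t-1..t+1}" for u
        using integral_unique[OF v[of "t-1" u]] that by simp
    qed
    then show ?thesis by (rule continuous_on_interior) simp
  qed
  then show ?thesis by (simp add: continuous_at_imp_continuous_on)
qed

text \<open>Where the Filippov set reduces to \<open>Z (\<gamma> t)\<close>, the velocity equals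
  this value almost everywhere. Then \<open>\<gamma>\<close> is the integral of a continuous
  function, hence a classical solution.\<close>

lemma filippov_smooth_piece:
  assumes fs: "filippov_solution_on Zp Zm UNIV \<gamma>"
    and F: "\<And>t. a < t \<Longrightarrow> t < b \<Longrightarrow> filippov_set Zp Zm (\<gamma> t) = {Z (\<gamma> t)}"
    and G: "continuous_on G Z" "\<And>t. t \<in> {a..b} \<Longrightarrow> \<gamma> t \<in> G" and t: "a < t" "t < b"
  shows "(\<gamma> has_vector_derivative Z (\<gamma> t)) (at t)"
proof -
  obtain v where v: "\<And>a b. a \<le> b \<Longrightarrow> (v has_integral (\<gamma> b - \<gamma> a)) {a..b}"
    and n: "negligible {t. v t \<notin> filippov_set Zp Zm (\<gamma> t)}"
    using fs unfolding filippov_solution_on_def by auto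
  have ng: "negligible ({t. v t \<notin> filippov_set Zp Zm (\<gamma> t)} \<union> {a, b})"
    by (intro negligible_Un n negligible_finite) auto
  have hi: "((\<lambda>t. Z (\<gamma> t)) has_integral (\<gamma> u - \<gamma> a)) {a..u}" if u: "u \<in> {a..b}" for u
  proof (rule has_integral_spike[OF ng])
    show "(v has_integral (\<gamma> u - \<gamma> a)) {a..u}" using v[of a u] u by simp
    fix x assume x: "x \<in> {a..u} - ({t. v t \<notin> filippov_set Zp Zm (\<gamma> t)} \<union> {a, b})"
    then have "a < x" "x < b" using u by auto
    then show "Z (\<gamma> x) = v x" using x F[of x] by auto
  qed
  have c\<gamma>: "continuous_on {a..b} \<gamma>" using filippov_continuous[OF fs] continuous_on_subset by blast
  have "continuous_on {a..b} (\<lambda>t. Z (\<gamma> t))" by (rule continuous_on_compose2[OF G(1) c\<gamma>]) (use G(2) in auto)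
  then have "((\<lambda>u. integral {a..u} (\<lambda>t. Z (\<gamma> t))) has_vector_derivative Z (\<gamma> t)) (at t within {a..b})"
    using t by (intro integral_has_vector_derivative) auto
  then have "((\<lambda>u. integral {a..u} (\<lambda>t. Z (\<gamma> t))) has_vector_derivative Z (\<gamma> t)) (at t)"
    using at_within_Icc_at[of a t b] t by simp
  then have "((\<lambda>u. \<gamma> a + integral {a..u} (\<lambda>t. Z (\<gamma> t))) has_vector_derivative 0 + Z (\<gamma> t)) (at t)"
    by (intro has_vector_derivative_add has_vector_derivative_const)
  then have "((\<lambda>u. \<gamma> a + integral {a..u} (\<lambda>t. Z (\<gamma> t))) has_vector_derivative Z (\<gamma> t)) (at t)" by simp
  then show ?thesis
  proof (rule has_vector_derivative_transform_within_open[of _ _ _ "{a<..<b}"])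
    show "\<gamma> a + integral {a..u} (\<lambda>t. Z (\<gamma> t)) = \<gamma> u" if "u \<in> {a<..<b}" for u
      using integral_unique[OF hi[of u]] that by simp
  qed (use t in auto)
qed

text \<open>If both vertical components have the sign \<open>w\<close>, then so has every convex
  combination, with a common lower bound \<open>c\<close> nearby. Hence a Filippov solution can
  neither slide nor turn back there.\<close>

lemma filippov_crossing:
  assumes fs: "filippov_solution_on Zp Zm UNIV \<gamma>" and t0: "\<gamma> t0 = p" 
    and Zp: "isCont Zp p" "w * snd (Zp p) > 0" and Zm: "isCont Zm p" "w * snd (Zm p) > 0" and p: "snd p = 0"
  shows "\<exists>e>0. \<forall>t. (t0 < t \<longrightarrow> t < t0 + e \<longrightarrow> w * snd (\<gamma> t) > 0) \<and>
    (t0 - e < t \<longrightarrow> t < t0 \<longrightarrow> w * snd (\<gamma> t) < 0)"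
proof -
  define c where "c = min (w * snd (Zp p)) (w * snd (Zm p)) / 2"
  have c: "c > 0" "c < w * snd (Zp p)" "c < w * snd (Zm p)" using Zp Zm by (auto simp: c_def min_def)
  have "\<forall>\<^sub>F q in nhds p. c < w * snd (Zp q)" "\<forall>\<^sub>F q in nhds p. c < w * snd (Zm q)"
  proof -
    have "isCont (\<lambda>q. w * snd (Zp q)) p" "isCont (\<lambda>q. w * snd (Zm q)) p" using Zp(1) Zm(1) by (auto intro!: continuous_intros)
    then have "((\<lambda>q. w * snd (Zp q)) \<longlongrightarrow> w * snd (Zp p)) (nhds p)" "((\<lambda>q. w * snd (Zm q)) \<longlongrightarrow> w * snd (Zm p)) (nhds p)"
      using tendsto_at_iff_tendsto_nhds[of "\<lambda>q. w * snd (Zp q)" p] tendsto_at_iff_tendsto_nhds[of "\<lambda>q. w * snd (Zm q)" p]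
      unfolding isCont_def by blast+
    then show "\<forall>\<^sub>F q in nhds p. c < w * snd (Zp q)" "\<forall>\<^sub>F q in nhds p. c < w * snd (Zm q)"
      using order_tendstoD(1) c(2,3) by blast+
  qed
  then have "\<forall>\<^sub>F q in nhds p. c < w * snd (Zp q) \<and> c < w * snd (Zm q)" by (rule eventually_conj)
  moreover have "isCont \<gamma> t0" using filippov_continuous[OF fs] by (simp add: continuous_on_eq_continuous_at)
  then have "(\<gamma> \<longlongrightarrow> p) (nhds t0)"
    using tendsto_at_iff_tendsto_nhds[of \<gamma> t0] unfolding isCont_def t0 by blast
  ultimately have "\<forall>\<^sub>F t in nhds t0. c < w * snd (Zp (\<gamma> t)) \<and> c < w * snd (Zm (\<gamma> t))"
    unfolding filterlim_iff by blast
  then obtain e where e: "e > 0" "\<And>t. dist t t0 < e \<Longrightarrow> c < w * snd (Zp (\<gamma> t)) \<and> c < w * snd (Zm (\<gamma> t))"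
    by (auto simp: eventually_nhds_metric)
  obtain v where v: "\<And>a b. a \<le> b \<Longrightarrow> (v has_integral (\<gamma> b - \<gamma> a)) {a..b}"
    and n: "negligible {t. v t \<notin> filippov_set Zp Zm (\<gamma> t)}"
    using fs unfolding filippov_solution_on_def by auto
  have Fc: "c \<le> w * snd y" if t: "dist t t0 < e" and y: "y \<in> filippov_set Zp Zm (\<gamma> t)" for t y
  proof -
    have "convex {y :: real \<times> real. c \<le> w * snd y}"
    proof -
      have "{y::real\<times>real. c \<le> w * snd y} = {y. inner (0, w) y \<ge> c}" by (auto simp: inner_prod_def)
      then show ?thesis by (simp add: convex_halfspace_ge)
    qed
    then have "convex hull {Zp (\<gamma> t), Zm (\<gamma> t)} \<subseteq> {y. c \<le> w * snd y}"
      using e(2)[OF t] by (intro hull_minimal) auto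
    then show ?thesis using y e(2)[OF t] by (auto simp: filippov_set_def split: if_splits)
  qed
  have grow: "c * (b - a) \<le> w * snd (\<gamma> b - \<gamma> a)" if ab: "a \<le> b" "t0 - e < a" "b < t0 + e" for a b
  proof -
    have w0: "w \<noteq> 0" using Zp(2) by auto
    \<comment> \<open>On the null set where \<open>v\<close> is not admissible, the value
      \<open>(0, c / w)\<close> makes the lower bound \<open>c\<close> hold at every time without
      changing the integral.\<close>
    define u where "u s = (if v s \<in> filippov_set Zp Zm (\<gamma> s) then v s else (0, c / w))" for s
    have "(u has_integral (\<gamma> b - \<gamma> a)) {a..b}"
      by (rule has_integral_spike[OF n _ v]) (use ab in \<open>auto simp: u_def\<close>)
    from has_integral_linear[OF this bounded_linear_snd] have "((\<lambda>s. snd (u s)) has_integral snd (\<gamma> b - \<gamma> a)) {a..b}"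
      by (simp add: o_def)
    from has_integral_mult_right[OF this, of w] have 1: "((\<lambda>s. w * snd (u s)) has_integral w * snd (\<gamma> b - \<gamma> a)) {a..b}" .
    have 2: "((\<lambda>s. c) has_integral c * (b - a)) {a..b}"
      using has_integral_const_real[of c a b] ab by (simp add: mult.commute)
    show ?thesis
    proof (rule has_integral_le[OF 2 1])
      fix x assume "x \<in> {a..b}"
      then have "dist x t0 < e" using ab by (auto simp: dist_real_def abs_less_iff)
      from Fc[OF this, of "v x"] show "c \<le> w * snd (u x)" using w0 by (auto simp: u_def)
    qed
  qed
  have "w * snd (\<gamma> t) > 0" if t: "t0 < t" "t < t0 + e" for t
  proof -
    have "c * (t - t0) > 0" using c t by simp
    with grow[of t0 t] t e(1) t0 p show ?thesis by simp
  qed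
  moreover have "w * snd (\<gamma> t) < 0" if t: "t0 - e < t" "t < t0" for t
  proof -
    have "c * (t0 - t) > 0" using c t by simp
    with grow[of t t0] t e(1) t0 p show ?thesis by simp
  qed
  ultimately show ?thesis using e(1) by blast
qed

context half_turn
begin

lemma bounded_time_on_side:
  assumes ab: "a \<le> b" and cont: "continuous_on {a..b} \<gamma>"
    and ode: "\<And>t. a < t \<Longrightarrow> t < b \<Longrightarrow> (\<gamma> has_vector_derivative Z (\<gamma> t)) (at t)"
    and bx: "\<And>t. t \<in> {a..b} \<Longrightarrow> \<gamma> t \<in> region"
  shows "b - a \<le> 2 * \<rho> / m"
proof -
  have "m * (b - a) \<le> \<kappa> * fst (\<gamma> b) - \<kappa> * fst (\<gamma> a)"
    by (rule moves_monotonically[OF cont ode bx]) (use ab in auto)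
  also have "\<dots> \<le> \<bar>\<kappa> * fst (\<gamma> b)\<bar> + \<bar>\<kappa> * fst (\<gamma> a)\<bar>" by linarith
  also have "\<dots> \<le> 2 * \<rho>" using bx[of a] bx[of b] ab by (simp add: region_iff)
  finally show ?thesis using pos by (simp add: field_simps)
qed

text \<open>Apart from continuity and confinement to \<open>region\<close>, the curve is constrained
  on the open side \<sigma> y > 0 only. So a Filippov solution in the box is a side orbit of the
  upper and of the lower field at the same time.\<close>

definition side_orbit :: "(real \<Rightarrow> real \<times> real) \<Rightarrow> bool" where
  "side_orbit \<gamma> \<longleftrightarrow> continuous_on UNIV \<gamma> \<and> range \<gamma> \<subseteq> region \<and>
     (\<forall>a b. (\<forall>s. a < s \<longrightarrow> s < b \<longrightarrow> \<sigma> * snd (\<gamma> s) > 0) \<longrightarrow>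
       (\<forall>t. a < t \<longrightarrow> t < b \<longrightarrow> (\<gamma> has_vector_derivative Z (\<gamma> t)) (at t)))"

lemma side_orbitD:
  assumes "side_orbit \<gamma>"
  shows "continuous_on UNIV \<gamma>" "\<gamma> t \<in> region"
    "(\<And>s. a < s \<Longrightarrow> s < b \<Longrightarrow> \<sigma> * snd (\<gamma> s) > 0) \<Longrightarrow> a < t \<Longrightarrow> t < b \<Longrightarrow> (\<gamma> has_vector_derivative Z (\<gamma> t)) (at t)"
  using assms unfolding side_orbit_def by blast+

text \<open>On the open side the orbit advances horizontally, so it leaves that side within a
  bounded time, and \<open>capture\<close> tells where it lands. By the intermediate value theorem
  the whole arc is covered.\<close>

lemma next_crossing:
  assumes so: "side_orbit \<gamma>" and s: "\<gamma> t0 = (s, 0)" "s \<noteq> 0" "\<bar>s\<bar> < r0" and e: "e > 0" "\<And>t. t0 < t \<Longrightarrow> t < t0 + e \<Longrightarrow> \<sigma> * snd (\<gamma> t) > 0"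
  shows "\<exists>t1>t0. \<gamma> t1 = (\<phi> s, 0) \<and> arc s \<subseteq> range \<gamma>"
proof -
  note cont = side_orbitD(1)[OF so] and bx = side_orbitD(2)[OF so]
  have tpos: "0 \<le> 2 * \<rho> / m" using pos by simp
  \<comment> \<open>Starting at \<open>t0 + e / 2\<close> keeps the zero at \<open>t0\<close> out of
    this closed set, so that its minimum is the next crossing.\<close>
  define S where "S = {t. t0 + e / 2 \<le> t \<and> \<sigma> * snd (\<gamma> t) \<le> 0}"
  have cy: "continuous_on UNIV (\<lambda>t. \<sigma> * snd (\<gamma> t))" by (intro continuous_intros cont)
  have clS: "closed S"
  proof -
    have "S = {t0 + e / 2..} \<inter> {t. \<sigma> * snd (\<gamma> t) \<le> 0}" by (auto simp: S_def)
    then show ?thesis using closed_Collect_le[OF cy continuous_on_const] by (auto intro!: closed_Int)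
  qed
  have "S \<noteq> {}"
  proof
    assume S0: "S = {}"
    have side: "\<sigma> * snd (\<gamma> t) > 0" if "t0 < t" for t
    proof (cases "t < t0 + e")
      case False
      moreover have "t \<notin> S" using S0 by blast
      ultimately show ?thesis using e(1) by (simp add: S_def not_le)
    qed (use e(2) that in blast)
    let ?b = "t0 + 2 * \<rho> / m + 1"
    have "?b - t0 \<le> 2 * \<rho> / m"
      by (rule bounded_time_on_side[of t0 ?b \<gamma>]) (use side bx tpos cont in \<open>auto intro: side_orbitD(3)[OF so, of t0 ?b] continuous_on_subset\<close>)
    then show False by simp
  qed
  have bddS: "bdd_below S" by (auto simp: S_def intro: bdd_belowI[of _ "t0 + e / 2"])
  define t1 where "t1 = Inf S"
  have t1S: "t1 \<in> S" unfolding t1_def by (rule closed_contains_Inf[OF \<open>S \<noteq> {}\<close> bddS clS])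
  then have t01: "t0 < t1" using e(1) by (auto simp: S_def)
  have side: "\<sigma> * snd (\<gamma> t) > 0" if "t0 < t" "t < t1" for t
  proof (cases "t < t0 + e / 2")
    case True
    then show ?thesis using e that by (intro e(2)) auto
  next
    case False
    have "t \<notin> S" using cInf_lower[OF _ bddS, of t] that unfolding t1_def by force
    with False show ?thesis by (simp add: S_def not_le)
  qed
  have c01: "continuous_on {t0..t1} \<gamma>" by (rule continuous_on_subset[OF cont]) auto
  have od: "(\<gamma> has_vector_derivative Z (\<gamma> t)) (at t)" if "t0 < t" "t < t1" for t
    using side_orbitD(3)[OF so, of t0 t1 t] side that by blast
  have cap2: "\<gamma> t \<in> arc s" if "t \<in> {t0..t1}" for t
    by (rule capture(2)[OF t01 c01 _ s _ that]) (use od side in auto)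
  have cap3: "\<gamma> t1 = (\<phi> s, 0)" if "snd (\<gamma> t1) = 0"
    by (rule capture(3)[OF t01 c01 _ s _ that]) (use od side in auto)
  have "\<sigma> * snd (\<gamma> t1) \<ge> 0"
  proof (rule tendsto_lowerbound)
    show "((\<lambda>t. \<sigma> * snd (\<gamma> t)) \<longlongrightarrow> \<sigma> * snd (\<gamma> t1)) (at_left t1)"
      using cy by (simp add: continuous_on_eq_continuous_at isCont_def filterlim_at_split)
    show "\<forall>\<^sub>F t in at_left t1. 0 \<le> \<sigma> * snd (\<gamma> t)"
      using eventually_at_left_real[OF t01] by eventually_elim (use side in \<open>auto intro: less_imp_le\<close>)
  qed simp
  then have "snd (\<gamma> t1) = 0" using t1S \<sigma> by (auto simp: S_def)
  then have fin: "\<gamma> t1 = (\<phi> s, 0)" by (rule cap3)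
  have "arc s \<subseteq> range \<gamma>"
  proof
    fix q assume "q \<in> arc s"
    then obtain \<xi> where \<xi>: "\<xi> \<in> closed_segment s (\<phi> s)" "q = (\<xi>, \<eta> s \<xi>)" by (auto simp: arc_def)
    have "connected ((\<lambda>t. fst (\<gamma> t)) ` {t0..t1})"
      by (intro connected_continuous_image continuous_intros c01) simp
    moreover have "s \<in> (\<lambda>t. fst (\<gamma> t)) ` {t0..t1}" "\<phi> s \<in> (\<lambda>t. fst (\<gamma> t)) ` {t0..t1}"
      using s(1) fin t01 imageI[of t0 "{t0..t1}" "\<lambda>t. fst (\<gamma> t)"] imageI[of t1 "{t0..t1}" "\<lambda>t. fst (\<gamma> t)"] by auto
    ultimately have "closed_segment s (\<phi> s) \<subseteq> (\<lambda>t. fst (\<gamma> t)) ` {t0..t1}"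
      by (meson connected_contains_Icc closed_segment_subset convex_connected is_interval_connected_1 is_interval_convex_1)
    then obtain t where t: "t \<in> {t0..t1}" "fst (\<gamma> t) = \<xi>" using \<xi>(1) by auto
    then have "\<gamma> t = q" using cap2[OF t(1)] \<xi>(2) by (auto simp: arc_def)
    then show "q \<in> range \<gamma>" by blast
  qed
  with fin t01 show ?thesis by blast
qed

text \<open>Depending on the orientation, the arc on this side is run through after or before the
  crossing. The second case is the first one for the reversed orbit and field.\<close>

lemma crossing_arc:
  assumes so: "side_orbit \<gamma>" and s: "\<gamma> t0 = (s, 0)" "s \<noteq> 0" "\<bar>s\<bar> < r0" and e: "e > 0"
    and side: "(\<forall>t. t0 < t \<longrightarrow> t < t0 + e \<longrightarrow> \<sigma> * snd (\<gamma> t) > 0) \<or> (\<forall>t. t0 - e < t \<longrightarrow> t < t0 \<longrightarrow> \<sigma> * snd (\<gamma> t) > 0)"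
  shows "(\<phi> s, 0) \<in> range \<gamma> \<and> arc s \<subseteq> range \<gamma>"
  using side
proof
  assume "\<forall>t. t0 < t \<longrightarrow> t < t0 + e \<longrightarrow> \<sigma> * snd (\<gamma> t) > 0"
  then obtain t1 where "\<gamma> t1 = (\<phi> s, 0)" "arc s \<subseteq> range \<gamma>"
    using next_crossing[OF so s e] by blast
  then show ?thesis by (metis rangeI)
next
  interpret rev: half_turn \<sigma> "- \<kappa>" \<rho> R m B L N r0 "\<lambda>p. - Z p" \<eta> \<phi> by (rule reversed)
  assume side: "\<forall>t. t0 - e < t \<longrightarrow> t < t0 \<longrightarrow> \<sigma> * snd (\<gamma> t) > 0"
  let ?g = "\<lambda>t. \<gamma> (- t)"
  have "continuous_on UNIV ?g" by (rule continuous_on_compose2[OF side_orbitD(1)[OF so]]) (auto intro: continuous_intros)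
  moreover have "(?g has_vector_derivative - Z (?g t)) (at t)"
    if "\<And>s. a < s \<Longrightarrow> s < b \<Longrightarrow> \<sigma> * snd (?g s) > 0" "a < t" "t < b" for a b t
  proof -
    have 1: "(uminus has_vector_derivative (-1::real)) (at t)" by (auto intro!: derivative_eq_intros)
    have "\<sigma> * snd (\<gamma> s) > 0" if "- b < s" "s < - a" for s using \<open>\<And>s. a < s \<Longrightarrow> s < b \<Longrightarrow> \<sigma> * snd (?g s) > 0\<close>[of "- s"] that by simp
    then have 2: "(\<gamma> has_vector_derivative Z (\<gamma> (- t))) (at (- t))"
      using side_orbitD(3)[OF so, of "- b" "- a" "- t"] that(2,3) by simp
    from vector_diff_chain_at[OF 1 2] show ?thesis by (simp add: o_def)
  qed
  moreover have "?g (- t0) = (s, 0)" using s by simp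
  moreover have "\<sigma> * snd (?g t) > 0" if "- t0 < t" "t < - t0 + e" for t using side that by simp
  ultimately have "rev.side_orbit ?g \<and> ?g (- t0) = (s, 0) \<and> (\<forall>t. - t0 < t \<longrightarrow> t < - t0 + e \<longrightarrow> \<sigma> * snd (?g t) > 0)"
    using side_orbitD(2)[OF so] unfolding rev.side_orbit_def by blast
  then obtain t1 where t1: "?g t1 = (\<phi> s, 0)" "arc s \<subseteq> range ?g"
    using rev.next_crossing[of ?g "- t0" s e] s e by blast
  have "range ?g \<subseteq> range \<gamma>" by auto
  moreover have "(\<phi> s, 0) \<in> range ?g" using t1(1) by (metis rangeI)
  ultimately show ?thesis using t1(2) by blast
qed

text \<open>Used to show that every point of a closed orbit lies on the arc of one of its crossings.
  The bounded time on a side guarantees that there is an earlier time on the axis.\<close>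

lemma previous_crossing:
  assumes so: "side_orbit \<gamma>" and zero: "\<And>t. snd (\<gamma> t) = 0 \<Longrightarrow> fst (\<gamma> t) \<noteq> 0 \<and> \<bar>fst (\<gamma> t)\<bar> < r0"
    and t: "\<sigma> * snd (\<gamma> t) > 0"
  shows "\<exists>t0 s. \<gamma> t0 = (s, 0) \<and> \<gamma> t \<in> arc s"
proof -
  note cont = side_orbitD(1)[OF so] and bx = side_orbitD(2)[OF so]
  have tpos: "0 \<le> 2 * \<rho> / m" using pos by simp
  define S where "S = {s. s \<le> t \<and> \<sigma> * snd (\<gamma> s) \<le> 0}"
  have cy: "continuous_on UNIV (\<lambda>t. \<sigma> * snd (\<gamma> t))" by (intro continuous_intros cont)
  have clS: "closed S"
  proof -
    have "S = {..t} \<inter> {t. \<sigma> * snd (\<gamma> t) \<le> 0}" by (auto simp: S_def)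
    then show ?thesis using closed_Collect_le[OF cy continuous_on_const] by (auto intro!: closed_Int)
  qed
  have "S \<noteq> {}"
  proof
    assume S0: "S = {}"
    have side: "\<sigma> * snd (\<gamma> s) > 0" if "s < t" for s
    proof -
      have "s \<notin> S" using S0 by blast
      with that show ?thesis by (simp add: S_def not_le)
    qed
    let ?a = "t - (2 * \<rho> / m + 1)"
    have "t - ?a \<le> 2 * \<rho> / m"
      by (rule bounded_time_on_side[of ?a t \<gamma>]) (use side bx tpos cont in \<open>auto intro: side_orbitD(3)[OF so, of ?a t] continuous_on_subset\<close>)
    then show False by simp
  qed
  have bddS: "bdd_above S" by (auto simp: S_def intro: bdd_aboveI[of _ t])
  define t0 where "t0 = Sup S"
  have t0S: "t0 \<in> S" unfolding t0_def by (rule closed_contains_Sup[OF \<open>S \<noteq> {}\<close> bddS clS])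
  have t01: "t0 < t" using t0S t by (cases "t0 = t") (auto simp: S_def)
  have side: "\<sigma> * snd (\<gamma> s) > 0" if "t0 < s" "s < t" for s
  proof -
    have "s \<notin> S" using cSup_upper[OF _ bddS, of s] that unfolding t0_def by force
    with that show ?thesis by (simp add: S_def not_le)
  qed
  have "\<sigma> * snd (\<gamma> t0) \<ge> 0"
  proof (rule tendsto_lowerbound)
    show "((\<lambda>t. \<sigma> * snd (\<gamma> t)) \<longlongrightarrow> \<sigma> * snd (\<gamma> t0)) (at_right t0)"
      using cy by (simp add: continuous_on_eq_continuous_at isCont_def filterlim_at_split)
    show "\<forall>\<^sub>F t in at_right t0. 0 \<le> \<sigma> * snd (\<gamma> t)"
      using eventually_at_right_real[OF t01] by eventually_elim (use side in \<open>auto intro: less_imp_le\<close>)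
  qed simp
  then have z: "snd (\<gamma> t0) = 0" using t0S \<sigma> by (auto simp: S_def)
  define s where "s = fst (\<gamma> t0)"
  have s: "\<gamma> t0 = (s, 0)" "s \<noteq> 0" "\<bar>s\<bar> < r0" using zero[OF z] z by (auto simp: s_def prod_eq_iff)
  have c01: "continuous_on {t0..t} \<gamma>" by (rule continuous_on_subset[OF cont]) auto
  have od: "(\<gamma> has_vector_derivative Z (\<gamma> u)) (at u)" if "t0 < u" "u < t" for u
    using side_orbitD(3)[OF so, of t0 t u] side that by blast
  have "\<gamma> t \<in> arc s" using capture(2)[OF t01 c01 od s side, of t] t01 by simp
  with s(1) show ?thesis by blast
qed

text \<open>Run backwards, the arc of \<open>x\<close> starts at \<open>(\<phi> x, 0)\<close>, so
  \<open>capture\<close> for the reversed field puts it on the arc of \<open>\<phi> x\<close>. The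
  same inclusion at \<open>\<phi> x\<close> and the involution property give equality.\<close>

lemma arc_phi:
  assumes x: "x \<noteq> 0" "\<bar>x\<bar> < r0" "\<bar>\<phi> x\<bar> < r0"
  shows "arc (\<phi> x) = arc x"
proof -
  \<comment> \<open>Stated for an arbitrary instance of the locale, since the other sign of \<kappa>
    x is treated by the reversed instance.\<close>
  have fwd: "half_turn.arc \<eta>' \<phi>' x \<subseteq> half_turn.arc \<eta>' \<phi>' (\<phi>' x)"
    if h: "half_turn \<sigma> \<kappa>' \<rho> R m B L N r0 Z' \<eta>' \<phi>'" and x: "\<kappa>' * x < 0" "\<bar>x\<bar> < r0" "\<bar>\<phi>' x\<bar> < r0" for \<kappa>' Z' \<eta>' \<phi>' x
  proof -
    interpret h: half_turn \<sigma> \<kappa>' \<rho> R m B L N r0 Z' \<eta>' \<phi>' by (rule h)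
    interpret r: half_turn \<sigma> "- \<kappa>'" \<rho> R m B L N r0 "\<lambda>p. - Z' p" \<eta>' \<phi>' by (rule h.reversed)
    obtain T \<gamma> where T: "T > 0" "\<gamma> 0 = (x, 0)" "\<gamma> T = (\<phi>' x, 0)"
      "\<And>t. t \<in> {0..T} \<Longrightarrow> (\<gamma> has_vector_derivative Z' (\<gamma> t)) (at t)" "\<And>t. t \<in> {0<..<T} \<Longrightarrow> \<sigma> * snd (\<gamma> t) > 0"
      "\<gamma> ` {0..T} = h.arc x"
      using h.arc_curve[OF x(1,2)] by blast
    let ?g = "\<lambda>t. \<gamma> (T - t)"
    have "x \<noteq> 0" using x(1) by auto
    then have "\<phi>' x \<noteq> 0" using h.phi[of x] x by auto
    have "(?g has_vector_derivative - Z' (?g t)) (at t)" if t: "t \<in> {0..T}" for t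
    proof -
      have 1: "((\<lambda>t. T - t) has_vector_derivative (-1::real)) (at t)" by (auto intro!: derivative_eq_intros)
      have 2: "(\<gamma> has_vector_derivative Z' (\<gamma> (T - t))) (at (T - t))" using t by (intro T(4)) auto
      from vector_diff_chain_at[OF 1 2] show ?thesis by (simp add: o_def)
    qed
    note g = this
    have gc: "continuous_on {0..T} ?g"
      by (rule continuous_at_imp_continuous_on) (use g has_vector_derivative_continuous in blast)
    have in_arc: "?g t \<in> h.arc (\<phi>' x)" if "t \<in> {0..T}" for t
      by (rule r.capture(2)[of 0 T ?g "\<phi>' x", OF T(1) gc _ _ \<open>\<phi>' x \<noteq> 0\<close> x(3) _ that])
        (use g T in auto)
    show ?thesis
    proof
      fix p assume "p \<in> h.arc x"
      then obtain t where "t \<in> {0..T}" "p = \<gamma> t" using T(6) by blast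
      then show "p \<in> h.arc (\<phi>' x)" using in_arc[of "T - t"] by simp
    qed
  qed
  have sub: "arc x \<subseteq> arc (\<phi> x)" if x: "x \<noteq> 0" "\<bar>x\<bar> < r0" "\<bar>\<phi> x\<bar> < r0" for x
  proof (cases "\<kappa> * x < 0")
    case True
    then show ?thesis using fwd[OF half_turn_axioms] x by blast
  next
    case False
    then have "- \<kappa> * x < 0" using x \<kappa> by auto
    then show ?thesis using fwd[OF reversed] x by blast
  qed
  have "\<phi> x \<noteq> 0" using phi[OF x(1,2)] by auto
  then show ?thesis using sub[OF x] sub[of "\<phi> x"] phi_involution[OF x(2,3)] x by auto
qed

end

section \<open>Closed orbits assembled from two half-turns\<close>

lemma periodic_extension:
  fixes c :: "real \<Rightarrow> 'a::real_normed_vector"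
  assumes T: "T > 0" and c: "continuous_on {0..T} c" "c 0 = c T"
  defines "\<gamma> \<equiv> \<lambda>t. c (t - T * of_int \<lfloor>t / T\<rfloor>)"
  shows "continuous_on UNIV \<gamma>" "\<gamma> (t + T) = \<gamma> t" "t \<in> {0..T} \<Longrightarrow> \<gamma> t = c t" "range \<gamma> = c ` {0..T}"
    "t - T * of_int \<lfloor>t / T\<rfloor> \<in> {0<..<T} \<Longrightarrow> (c has_vector_derivative v) (at (t - T * of_int \<lfloor>t / T\<rfloor>)) \<Longrightarrow>
      (\<gamma> has_vector_derivative v) (at t)"
    "0 \<le> t - T * of_int \<lfloor>t / T\<rfloor>" "t - T * of_int \<lfloor>t / T\<rfloor> < T"
proof -
  have fr: "0 \<le> t - T * of_int \<lfloor>t / T\<rfloor> \<and> t - T * of_int \<lfloor>t / T\<rfloor> < T" for t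
  proof -
    have "of_int \<lfloor>t / T\<rfloor> \<le> t / T" "t / T < of_int \<lfloor>t / T\<rfloor> + 1" by linarith+
    then have "of_int \<lfloor>t / T\<rfloor> * T \<le> t" "t < (of_int \<lfloor>t / T\<rfloor> + 1) * T"
      using pos_le_divide_eq[OF T] pos_divide_less_eq[OF T] by blast+
    then show ?thesis by (simp add: algebra_simps)
  qed
  then show "0 \<le> t - T * of_int \<lfloor>t / T\<rfloor>" "t - T * of_int \<lfloor>t / T\<rfloor> < T" by blast+
  \<comment> \<open>Both end points of the period interval are allowed, because
    \<open>c 0 = c T\<close>; this is what lets the closed pieces be glued continuously.\<close>
  have piece: "\<gamma> t = c (t - T * of_int k)" if "T * of_int k \<le> t" "t \<le> T * (of_int k + 1)" for t k
  proof (cases "t = T * (of_int k + 1)")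
    case True
    then have "t / T = of_int (k + 1)" using T by simp
    then have "\<lfloor>t / T\<rfloor> = k + 1" by (simp only: floor_of_int)
    then have "\<gamma> t = c 0" using True by (simp add: \<gamma>_def)
    moreover have "t - T * of_int k = T" using True by (simp add: algebra_simps)
    ultimately show ?thesis using c(2) by simp
  next
    case False
    then have "of_int k \<le> t / T" "t / T < of_int k + 1" using that T by (auto simp: field_simps)
    then have "\<lfloor>t / T\<rfloor> = k" by linarith
    then show ?thesis by (simp add: \<gamma>_def)
  qed
  have cont_piece: "continuous_on {T * of_int k..T * (of_int k + 1)} \<gamma>" for k
  proof -
    have "continuous_on {T * of_int k..T * (of_int k + 1)} (\<lambda>t. c (t - T * of_int k))"
      by (rule continuous_on_compose2[OF c(1)]) (auto intro!: continuous_intros simp: algebra_simps)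
    then show ?thesis by (rule continuous_on_eq) (use piece in auto)
  qed
  show "continuous_on UNIV \<gamma>"
  proof (intro continuous_at_imp_continuous_on ballI)
    fix t :: real
    define k where "k = \<lfloor>t / T\<rfloor>"
    have k: "T * of_int k \<le> t" "t < T * (of_int k + 1)" using fr[of t] by (auto simp: k_def algebra_simps)
    have "continuous_on ({T * of_int (k - 1)..T * (of_int (k - 1) + 1)} \<union> {T * of_int k..T * (of_int k + 1)}) \<gamma>"
      by (intro continuous_on_closed_Un cont_piece) auto
    moreover have "{T * of_int (k - 1)..T * (of_int (k - 1) + 1)} \<union> {T * of_int k..T * (of_int k + 1)}
        = {T * of_int (k - 1)..T * (of_int k + 1)}"
      using T by (intro ivl_disj_un_two_touch(4)[of _ "T * of_int k", THEN trans[rotated]]) (auto simp: algebra_simps)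
    ultimately have "continuous_on {T * of_int (k - 1)..T * (of_int k + 1)} \<gamma>" by simp
    then show "isCont \<gamma> t"
      by (rule continuous_on_interior) (use k T in \<open>auto simp: algebra_simps\<close>)
  qed
  show "\<gamma> (t + T) = \<gamma> t"
  proof -
    have "(t + T) / T = t / T + 1" using T by (simp add: field_simps)
    then show ?thesis by (simp add: \<gamma>_def algebra_simps)
  qed
  show g: "\<gamma> t = c t" if "t \<in> {0..T}" for t using piece[of 0 t] that by simp
  show "range \<gamma> = c ` {0..T}"
  proof
    show "range \<gamma> \<subseteq> c ` {0..T}" using fr by (auto simp: \<gamma>_def less_imp_le)
    show "c ` {0..T} \<subseteq> range \<gamma>" using g by (metis image_subsetI rangeI)
  qed
  show "(\<gamma> has_vector_derivative v) (at t)"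
    if u: "t - T * of_int \<lfloor>t / T\<rfloor> \<in> {0<..<T}" and d: "(c has_vector_derivative v) (at (t - T * of_int \<lfloor>t / T\<rfloor>))"
  proof -
    define k where "k = \<lfloor>t / T\<rfloor>"
    have 1: "((\<lambda>t. t - T * of_int k) has_vector_derivative 1) (at t)" by (auto intro!: derivative_eq_intros)
    have "((\<lambda>t. c (t - T * of_int k)) has_vector_derivative v) (at t)"
      using vector_diff_chain_at[OF 1, of c v] d by (simp add: k_def o_def)
    then show ?thesis
    proof (rule has_vector_derivative_transform_within_open[of _ _ _ "{T * of_int k<..<T * (of_int k + 1)}"])
      show "c (y - T * of_int k) = \<gamma> y" if "y \<in> {T * of_int k<..<T * (of_int k + 1)}" for y
        using piece[of k y] that by simp
    qed (use u in \<open>auto simp: k_def algebra_simps\<close>)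
  qed
qed

text \<open>The lower field moves in the direction \<open>- \<kappa>\<close>, so forward orbits pass
  from an upper arc to a lower one. The negative derivatives make both half-return maps order
  reversing.\<close>

locale two_half_turns =
  up: half_turn 1 \<kappa> \<rho> R m B L N r0 Zp \<eta> \<phi> + lo: half_turn "-1" "- \<kappa>" \<rho> R m' B' L' N' r0 Zm \<eta>' \<phi>'
  for \<kappa> \<rho> R m B L N r0 m' B' L' N' :: real and Zp Zm :: vfield
    and \<eta> \<eta>' :: "real \<Rightarrow> real \<Rightarrow> real" and \<phi> \<phi>' :: "real \<Rightarrow> real" +
  fixes D\<phi> D\<phi>' :: "real \<Rightarrow> real"
  assumes D\<phi>: "\<And>x. \<bar>x\<bar> < r0 \<Longrightarrow> (\<phi> has_real_derivative D\<phi> x) (at x) \<and> D\<phi> x < 0"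
    and D\<phi>': "\<And>x. \<bar>x\<bar> < r0 \<Longrightarrow> (\<phi>' has_real_derivative D\<phi>' x) (at x) \<and> D\<phi>' x < 0"
begin

lemma cont_fields: "p \<in> up.region \<Longrightarrow> isCont Zp p" "p \<in> lo.region \<Longrightarrow> isCont Zm p"
  using up.Zcont lo.Zcont up.open_region lo.open_region
  by (auto simp: up.region_def lo.region_def continuous_on_eq_continuous_at)

lemma small_abs: "\<bar>x\<bar> < r0 / 2 \<Longrightarrow> x \<noteq> 0 \<Longrightarrow> \<bar>\<phi> x\<bar> < r0 \<and> \<bar>\<phi>' x\<bar> < r0"
  using up.phi[of x] lo.phi[of x] up.pos by auto

lemma forward_turn:
  assumes x: "\<kappa> * x < 0" "\<bar>x\<bar> < r0 / 2"
  shows "\<exists>T1 T2 c. T1 > 0 \<and> T2 > 0 \<and> c 0 = (x, 0) \<and> c T1 = (\<phi> x, 0) \<and> c (T1 + T2) = (\<phi>' (\<phi> x), 0) \<and>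
    continuous_on {0..T1 + T2} c \<and>
    (\<forall>t. 0 < t \<longrightarrow> t < T1 \<longrightarrow> (c has_vector_derivative Zp (c t)) (at t) \<and> snd (c t) > 0) \<and>
    (\<forall>t. T1 < t \<longrightarrow> t < T1 + T2 \<longrightarrow> (c has_vector_derivative Zm (c t)) (at t) \<and> snd (c t) < 0) \<and>
    c ` {0..T1} = up.arc x \<and> c ` {T1..T1 + T2} = lo.arc (\<phi> x) \<and> inj_on c {0..T1} \<and> inj_on c {T1..T1 + T2}"
proof -
  have x0: "x \<noteq> 0" and xr: "\<bar>x\<bar> < r0" using x up.pos by auto
  have px: "\<bar>\<phi> x\<bar> < r0" "- \<kappa> * \<phi> x < 0" using small_abs[OF x(2) x0] up.in_segment_iff(3)[OF x(1) xr] by auto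
  obtain T1 g where g: "T1 > 0" "g 0 = (x, 0)" "g T1 = (\<phi> x, 0)"
    "\<And>t. t \<in> {0..T1} \<Longrightarrow> (g has_vector_derivative Zp (g t)) (at t)" "\<And>t. t \<in> {0<..<T1} \<Longrightarrow> snd (g t) > 0"
    "g ` {0..T1} = up.arc x" "inj_on g {0..T1}"
    using up.arc_curve[OF x(1) xr] by auto
  obtain T2 h where h: "T2 > 0" "h 0 = (\<phi> x, 0)" "h T2 = (\<phi>' (\<phi> x), 0)"
    "\<And>t. t \<in> {0..T2} \<Longrightarrow> (h has_vector_derivative Zm (h t)) (at t)" "\<And>t. t \<in> {0<..<T2} \<Longrightarrow> snd (h t) < 0"
    "h ` {0..T2} = lo.arc (\<phi> x)" "inj_on h {0..T2}"
    using lo.arc_curve[OF px(2,1)] by auto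
  define c where "c t = (if t \<le> T1 then g t else h (t - T1))" for t
  have cg: "c t = g t" if "t \<le> T1" for t using that by (simp add: c_def)
  have ch: "c t = h (t - T1)" if "T1 \<le> t" for t using that g(3) h(2) by (cases "t = T1") (auto simp: c_def)
  have gc: "continuous_on {0..T1} g"
    by (rule continuous_at_imp_continuous_on) (use g(4) has_vector_derivative_continuous in blast)
  have hc: "continuous_on {0..T2} h"
    by (rule continuous_at_imp_continuous_on) (use h(4) has_vector_derivative_continuous in blast)
  have "continuous_on {T1..T1 + T2} (\<lambda>t. h (t - T1))"
    by (rule continuous_on_compose2[OF hc]) (auto intro!: continuous_intros)
  then have c2: "continuous_on {T1..T1 + T2} c" by (rule continuous_on_eq) (use ch in auto)
  have c1: "continuous_on {0..T1} c" using gc by (rule continuous_on_eq) (use cg in auto)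
  have "continuous_on ({0..T1} \<union> {T1..T1 + T2}) c" by (intro continuous_on_closed_Un c1 c2) auto
  moreover have "{0..T1} \<union> {T1..T1 + T2} = {0..T1 + T2}" using g(1) h(1) by auto
  ultimately have "continuous_on {0..T1 + T2} c" by simp
  moreover have "(c has_vector_derivative Zp (c t)) (at t) \<and> snd (c t) > 0" if t: "0 < t" "t < T1" for t
  proof
    have "(g has_vector_derivative Zp (g t)) (at t)" using g(4) t by simp
    then have "(c has_vector_derivative Zp (g t)) (at t)"
      by (rule has_vector_derivative_transform_within_open[of _ _ _ "{..<T1}"]) (use t cg in auto)
    then show "(c has_vector_derivative Zp (c t)) (at t)" using cg t by simp
    show "snd (c t) > 0" using g(5)[of t] cg[of t] t by simp
  qed
  moreover have "(c has_vector_derivative Zm (c t)) (at t) \<and> snd (c t) < 0" if t: "T1 < t" "t < T1 + T2" for t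
  proof
    have 1: "((\<lambda>t. t - T1) has_vector_derivative 1) (at t)" by (auto intro!: derivative_eq_intros)
    have 2: "(h has_vector_derivative Zm (h (t - T1))) (at (t - T1))" using h(4) t by simp
    have "((\<lambda>t. h (t - T1)) has_vector_derivative Zm (h (t - T1))) (at t)"
      using vector_diff_chain_at[OF 1 2] by (simp add: o_def)
    then have "(c has_vector_derivative Zm (h (t - T1))) (at t)"
      by (rule has_vector_derivative_transform_within_open[of _ _ _ "{T1<..}"]) (use t ch in auto)
    then show "(c has_vector_derivative Zm (c t)) (at t)" using ch t by simp
    show "snd (c t) < 0" using h(5)[of "t - T1"] ch[of t] t by simp
  qed
  moreover have "c ` {0..T1} = up.arc x" using g(6) cg by auto
  moreover have "c ` {T1..T1 + T2} = lo.arc (\<phi> x)"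
  proof -
    have "c ` {T1..T1 + T2} = (\<lambda>t. h (t - T1)) ` {T1..T1 + T2}" using ch by (intro image_cong) auto
    also have "\<dots> = h ` ((\<lambda>t. t - T1) ` {T1..T1 + T2})" by (simp only: image_image)
    also have "(\<lambda>t. t - T1) ` {T1..T1 + T2} = {0..T2}" by simp
    finally show ?thesis using h(6) by simp
  qed
  moreover have "inj_on c {0..T1}" using inj_on_cong[of "{0..T1}" c g] g(7) cg by simp
  moreover have "inj_on c {T1..T1 + T2}"
  proof (rule inj_onI)
    fix s t assume "s \<in> {T1..T1 + T2}" "t \<in> {T1..T1 + T2}" "c s = c t"
    then show "s = t" using inj_onD[OF h(7), of "s - T1" "t - T1"] ch by auto
  qed
  moreover have "c 0 = (x, 0)" "c T1 = (\<phi> x, 0)" "c (T1 + T2) = (\<phi>' (\<phi> x), 0)"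
    using cg[of 0] cg[of T1] ch[of "T1 + T2"] g h by auto
  ultimately show ?thesis using g(1) h(1) by blast
qed

lemma norm_fields: "p \<in> up.region \<Longrightarrow> norm (Zp p) \<le> \<bar>B\<bar> + \<bar>B'\<bar>" "p \<in> lo.region \<Longrightarrow> norm (Zm p) \<le> \<bar>B\<bar> + \<bar>B'\<bar>"
  using up.Zbound[of "fst p" "snd p"] lo.Zbound[of "fst p" "snd p"] by (auto simp: up.region_iff lo.region_iff)

lemma return_map:
  assumes x: "\<kappa> * x0 < 0" "\<bar>x0\<bar> < r0 / 2" and fp: "\<phi>' (\<phi> x0) = x0"
  shows "first_return_map_at Zp Zm x0 (\<lambda>x. \<phi>' (\<phi> x))"
    and "((\<lambda>x. \<phi>' (\<phi> x)) has_real_derivative D\<phi>' (\<phi> x0) * D\<phi> x0) (at x0)"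
proof -
  have x00: "x0 \<noteq> 0" using x by auto
  have x0r: "\<bar>x0\<bar> < r0" using x up.pos by simp
  have d1: "(\<phi> has_real_derivative D\<phi> x0) (at x0)" using D\<phi> x0r by blast
  have d2: "(\<phi>' has_real_derivative D\<phi>' (\<phi> x0)) (at (\<phi> x0))" using D\<phi>' small_abs[OF x(2) x00] by blast
  show d: "((\<lambda>x. \<phi>' (\<phi> x)) has_real_derivative D\<phi>' (\<phi> x0) * D\<phi> x0) (at x0)"
    by (rule DERIV_chain2[OF d2 d1])
  \<comment> \<open>This radius keeps the other crossing point \<open>\<phi> x\<close> out of the
    section, as it lies on the other side of 0.\<close>
  let ?e = "\<bar>x0\<bar>"
  have "isCont (\<lambda>x. \<phi>' (\<phi> x)) x0" using d by (rule DERIV_isCont)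
  then have "((\<lambda>x. \<phi>' (\<phi> x)) \<longlongrightarrow> \<phi>' (\<phi> x0)) (nhds x0)"
    using tendsto_at_iff_tendsto_nhds[of "\<lambda>x. \<phi>' (\<phi> x)" x0] unfolding isCont_def by blast
  then have "\<forall>\<^sub>F x in nhds x0. dist (\<phi>' (\<phi> x)) (\<phi>' (\<phi> x0)) < ?e" using x00 by (intro tendstoD) auto
  then have e1: "\<forall>\<^sub>F x in nhds x0. \<bar>\<phi>' (\<phi> x) - x0\<bar> < ?e" by (simp add: fp dist_real_def)
  have e2: "\<forall>\<^sub>F x in nhds x0. \<kappa> * x < 0 \<and> \<bar>x\<bar> < r0 / 2"
  proof -
    have "open {x. \<kappa> * x < 0 \<and> \<bar>x\<bar> < r0 / 2}"
      by (intro open_Collect_conj open_Collect_less continuous_intros)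
    from eventually_nhds_in_open[OF this, of x0] x show ?thesis by simp
  qed
  from e1 e2 have "\<forall>\<^sub>F x in nhds x0. \<exists>\<gamma> T. T > 0 \<and> filippov_solution_on Zp Zm {0..T} \<gamma> \<and>
          \<gamma> 0 = (x, 0) \<and> \<gamma> T = (\<phi>' (\<phi> x), 0) \<and> \<bar>\<phi>' (\<phi> x) - x0\<bar> < ?e \<and>
          (\<forall>t. 0 < t \<and> t < T \<longrightarrow> \<gamma> t \<notin> {(s, 0) | s. \<bar>s - x0\<bar> < ?e})"
  proof eventually_elim
    fix x assume px: "\<bar>\<phi>' (\<phi> x) - x0\<bar> < ?e" and x: "\<kappa> * x < 0 \<and> \<bar>x\<bar> < r0 / 2"
    have x0: "x \<noteq> 0" and xr: "\<bar>x\<bar> < r0" using x up.pos by auto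
    obtain T1 T2 c where T: "T1 > 0" "T2 > 0" and ce: "c 0 = (x, 0)" "c T1 = (\<phi> x, 0)" "c (T1 + T2) = (\<phi>' (\<phi> x), 0)"
      and cc: "continuous_on {0..T1 + T2} c"
      and c1: "\<And>t. 0 < t \<Longrightarrow> t < T1 \<Longrightarrow> (c has_vector_derivative Zp (c t)) (at t) \<and> snd (c t) > 0"
      and c2: "\<And>t. T1 < t \<Longrightarrow> t < T1 + T2 \<Longrightarrow> (c has_vector_derivative Zm (c t)) (at t) \<and> snd (c t) < 0"
      and ca: "c ` {0..T1} = up.arc x" "c ` {T1..T1 + T2} = lo.arc (\<phi> x)"
      using forward_turn[of x] x by metis
    have pn: "\<phi> x \<noteq> 0" "\<bar>\<phi> x\<bar> < r0" using up.phi[OF x0 xr] small_abs[of x] x x0 by auto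
    have r1: "c t \<in> up.region" if "t \<in> {0..T1}" for t using ca(1) that up.arc_in_region[OF x0 xr] by blast
    have r2: "c t \<in> lo.region" if "t \<in> {T1..T1 + T2}" for t using ca(2) that lo.arc_in_region[OF pn] by blast
    define v where "v t = (if 0 < t \<and> t < T1 then Zp (c t) else if T1 < t \<and> t < T1 + T2 then Zm (c t) else 0)" for t
    have "filippov_solution_on Zp Zm {0..T1 + T2} c"
    proof (rule filippov_solutionI[where S="{0, T1, T1 + T2}" and v=v and B="\<bar>B\<bar> + \<bar>B'\<bar>"])
      fix t assume t: "t \<in> {0..T1 + T2}" "t \<notin> {0, T1, T1 + T2}"
      show "(c has_vector_derivative v t) (at t)" "v t \<in> filippov_set Zp Zm (c t)"
        using c1[of t] c2[of t] t by (cases "t < T1"; force simp: v_def filippov_set_def)+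
    next
      show "norm (v t) \<le> \<bar>B\<bar> + \<bar>B'\<bar>" for t
        using norm_fields(1)[OF r1, of t] norm_fields(2)[OF r2, of t] by (auto simp: v_def)
    qed (use cc in auto)
    moreover have "c t \<notin> {(s, 0) | s. \<bar>s - x0\<bar> < ?e}" if t: "0 < t" "t < T1 + T2" for t
    proof -
      consider "t < T1" | "t = T1" | "T1 < t" by linarith
      then show ?thesis
      proof cases
        case 2
        have "\<kappa> * \<phi> x > 0" using up.in_segment_iff(3)[of x] x xr by blast
        then have "\<phi> x * x0 < 0" using \<open>\<kappa> * x0 < 0\<close> up.\<kappa> by (auto simp: mult_less_0_iff)
        then have "\<not> \<bar>\<phi> x - x0\<bar> < ?e" by (auto simp: mult_less_0_iff)
        then show ?thesis using 2 ce by simp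
      qed (use c1[of t] c2[of t] t in auto)
    qed
    ultimately show "\<exists>\<gamma> T. T > 0 \<and> filippov_solution_on Zp Zm {0..T} \<gamma> \<and>
          \<gamma> 0 = (x, 0) \<and> \<gamma> T = (\<phi>' (\<phi> x), 0) \<and> \<bar>\<phi>' (\<phi> x) - x0\<bar> < ?e \<and>
          (\<forall>t. 0 < t \<and> t < T \<longrightarrow> \<gamma> t \<notin> {(s, 0) | s. \<bar>s - x0\<bar> < ?e})"
      using T ce px by (intro exI[of _ c] exI[of _ "T1 + T2"]) auto
  qed
  then show "first_return_map_at Zp Zm x0 (\<lambda>x. \<phi>' (\<phi> x))"
    unfolding first_return_map_at_def using fp x00 by (intro conjI exI[of _ ?e]) auto
qed

lemma closed_orbit_turn:
  assumes x: "\<kappa> * x < 0" "\<bar>x\<bar> < r0 / 2" and fp: "\<phi>' (\<phi> x) = x"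
  shows "closed_orbit Zp Zm (up.arc x \<union> lo.arc (\<phi> x))"
proof -
  have x0: "x \<noteq> 0" and xr: "\<bar>x\<bar> < r0" using x up.pos by auto
  obtain T1 T2 c where T: "T1 > 0" "T2 > 0" and ce: "c 0 = (x, 0)" "c T1 = (\<phi> x, 0)" "c (T1 + T2) = (\<phi>' (\<phi> x), 0)"
    and cc: "continuous_on {0..T1 + T2} c"
    and c1: "\<And>t. 0 < t \<Longrightarrow> t < T1 \<Longrightarrow> (c has_vector_derivative Zp (c t)) (at t) \<and> snd (c t) > 0"
    and c2: "\<And>t. T1 < t \<Longrightarrow> t < T1 + T2 \<Longrightarrow> (c has_vector_derivative Zm (c t)) (at t) \<and> snd (c t) < 0"
    and ca: "c ` {0..T1} = up.arc x" "c ` {T1..T1 + T2} = lo.arc (\<phi> x)"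
    and ci: "inj_on c {0..T1}" "inj_on c {T1..T1 + T2}"
    using forward_turn[of x] x by metis
  have pn: "\<phi> x \<noteq> 0" "\<bar>\<phi> x\<bar> < r0" using up.phi[OF x0 xr] small_abs[of x] x x0 by auto
  have r1: "c t \<in> up.region" if "t \<in> {0..T1}" for t using ca(1) that up.arc_in_region[OF x0 xr] by blast
  have r2: "c t \<in> lo.region" if "t \<in> {T1..T1 + T2}" for t using ca(2) that lo.arc_in_region[OF pn] by blast
  define T where "T = T1 + T2"
  have Tp: "T > 0" using T by (simp add: T_def)
  have c0T: "c 0 = c T" using ce fp by (simp add: T_def)
  have cc': "continuous_on {0..T} c" using cc by (simp add: T_def)
  define u where "u t = t - T * of_int \<lfloor>t / T\<rfloor>" for t
  define \<gamma> where "\<gamma> t = c (u t)" for t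
  note pe = periodic_extension[OF Tp cc' c0T, folded u_def, folded \<gamma>_def]
  \<comment> \<open>At the corners, and outside of one period, the velocity gets the arbitrary value
    0; \<open>S\<close> collects the corner times of the periodic curve.\<close>
  define v where "v t = (if 0 < t \<and> t < T1 then Zp (c t) else if T1 < t \<and> t < T then Zm (c t) else 0)" for t
  define S where "S = {t. u t \<notin> {0<..<T1} \<union> {T1<..<T}}"
  have Sfin: "finite (S \<inter> {a..b})" for a b
  proof -
    have "S \<subseteq> (\<lambda>k. T * of_int k) ` UNIV \<union> (\<lambda>k. T * of_int k + T1) ` UNIV"
    proof
      fix t assume "t \<in> S"
      then have "u t = 0 \<or> u t = T1" using pe(6)[of t] pe(7)[of t] by (auto simp: S_def)
      then have "t = T * of_int \<lfloor>t / T\<rfloor> \<or> t = T * of_int \<lfloor>t / T\<rfloor> + T1" by (auto simp: u_def)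
      then show "t \<in> (\<lambda>k. T * of_int k) ` UNIV \<union> (\<lambda>k. T * of_int k + T1) ` UNIV" by blast
    qed
    then have "S \<inter> {a..b} \<subseteq> (\<lambda>k. T * of_int k) ` {\<lfloor>a / T\<rfloor> - 1..\<lfloor>b / T\<rfloor> + 1} \<union> (\<lambda>k. T * of_int k + T1) ` {\<lfloor>a / T\<rfloor> - 1..\<lfloor>b / T\<rfloor> + 1}"
    proof (intro subsetI)
      fix t assume t: "t \<in> S \<inter> {a..b}"
      define k where "k = \<lfloor>t / T\<rfloor>"
      have "a / T \<le> t / T" "t / T \<le> b / T" using t Tp by (auto intro: divide_right_mono)
      then have "k \<in> {\<lfloor>a / T\<rfloor> - 1..\<lfloor>b / T\<rfloor> + 1}"
        unfolding k_def using floor_mono[of "a / T" "t / T"] floor_mono[of "t / T" "b / T"] by simp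
      moreover have "u t = 0 \<or> u t = T1" using t pe(6)[of t] pe(7)[of t] by (auto simp: S_def)
      then have "t = T * of_int k \<or> t = T * of_int k + T1" by (auto simp: u_def k_def)
      ultimately show "t \<in> (\<lambda>k. T * of_int k) ` {\<lfloor>a / T\<rfloor> - 1..\<lfloor>b / T\<rfloor> + 1} \<union> (\<lambda>k. T * of_int k + T1) ` {\<lfloor>a / T\<rfloor> - 1..\<lfloor>b / T\<rfloor> + 1}"
        by blast
    qed
    then show ?thesis by (rule finite_subset) auto
  qed
  have Sneg: "negligible S"
  proof -
    have "S = (\<Union>n::nat. S \<inter> {- real n..real n})"
    proof (intro equalityI subsetI)
      fix t assume "t \<in> S"
      moreover obtain n :: nat where "\<bar>t\<bar> \<le> real n" using real_arch_simple by blast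
      ultimately have "t \<in> S \<inter> {- real n..real n}" by (auto simp: abs_le_iff)
      then show "t \<in> (\<Union>n::nat. S \<inter> {- real n..real n})" by blast
    qed auto
    moreover have "negligible (\<Union>n::nat. S \<inter> {- real n..real n})"
      by (intro negligible_countable_Union) (auto intro: negligible_finite Sfin)
    ultimately show ?thesis by simp
  qed
  have "filippov_solution_on Zp Zm UNIV \<gamma>"
  proof (rule filippov_solutionI[where S=S and v="\<lambda>t. v (u t)" and B="\<bar>B\<bar> + \<bar>B'\<bar>"])
    fix t assume "t \<notin> S"
    then have t: "0 < u t \<and> u t < T1 \<or> T1 < u t \<and> u t < T" by (auto simp: S_def)
    have cd: "(c has_vector_derivative v (u t)) (at (u t))" and vF: "v (u t) \<in> filippov_set Zp Zm (c (u t))"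
      using c1[of "u t"] c2[of "u t"] t by (auto simp: v_def filippov_set_def T_def)
    show "(\<gamma> has_vector_derivative v (u t)) (at t)"
      by (rule pe(5)[OF _ cd]) (use t T in \<open>auto simp: T_def\<close>)
    show "v (u t) \<in> filippov_set Zp Zm (\<gamma> t)" using vF by (simp add: \<gamma>_def)
  next
    show "norm (v (u t)) \<le> \<bar>B\<bar> + \<bar>B'\<bar>" for t
      using norm_fields(1)[OF r1, of "u t"] norm_fields(2)[OF r2, of "u t"] by (auto simp: v_def T_def)
  qed (use pe(1) Sneg Sfin in auto)
  moreover have "inj_on \<gamma> {0..<T}"
  proof (rule inj_onI)
    fix s t assume st: "s \<in> {0..<T}" "t \<in> {0..<T}" "\<gamma> s = \<gamma> t"
    then have e: "c s = c t" using pe(3)[of s] pe(3)[of t] by simp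
    have sgn: "snd (c r) \<ge> 0" if "r \<in> {0..T1}" for r
      using c1[of r] ce that by (cases "r = 0 \<or> r = T1") auto
    have neg: "snd (c r) < 0" if "r \<in> {T1<..<T}" for r using c2[of r] that by (simp add: T_def)
    show "s = t"
    proof (cases "s \<le> T1"; cases "t \<le> T1")
      assume "s \<le> T1" "t \<le> T1" then show ?thesis using inj_onD[OF ci(1) e] st by simp
    next
      assume "s \<le> T1" "\<not> t \<le> T1" then show ?thesis using sgn[of s] neg[of t] e st by simp
    next
      assume "\<not> s \<le> T1" "t \<le> T1" then show ?thesis using sgn[of t] neg[of s] e st by simp
    next
      assume "\<not> s \<le> T1" "\<not> t \<le> T1" then show ?thesis using inj_onD[OF ci(2) e] st by (simp add: T_def)
    qed
  qed
  moreover have "up.arc x \<union> lo.arc (\<phi> x) = range \<gamma>"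
  proof -
    have "{0..T} = {0..T1} \<union> {T1..T1 + T2}" using T by (auto simp: T_def)
    then show ?thesis unfolding pe(4) ca[symmetric] by (simp only: image_Un)
  qed
  ultimately show ?thesis unfolding closed_orbit_def using Tp pe(2) by blast
qed

end

section \<open>Isolation and hyperbolicity of a cycle\<close>

lemma DERIV_nonzero_isolated:
  fixes f :: "real \<Rightarrow> real"
  assumes "(f has_real_derivative l) (at x)" "l \<noteq> 0"
  shows "\<exists>e>0. \<forall>y. y \<noteq> x \<longrightarrow> \<bar>y - x\<bar> < e \<longrightarrow> f y \<noteq> f x"
proof -
  have "((\<lambda>y. (f y - f x) / (y - x)) \<longlongrightarrow> l) (at x)"
    using assms(1) by (simp add: has_field_derivative_iff)
  then have "\<forall>\<^sub>F y in at x. (f y - f x) / (y - x) \<noteq> 0"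
    using assms(2) by (rule tendsto_imp_eventually_ne)
  then obtain e where e: "e > 0" "\<And>y. y \<noteq> x \<Longrightarrow> dist y x < e \<Longrightarrow> (f y - f x) / (y - x) \<noteq> 0"
    unfolding eventually_at by blast
  have "f y \<noteq> f x" if "y \<noteq> x" "\<bar>y - x\<bar> < e" for y
    using e(2)[of y] that by (auto simp: dist_real_def)
  with e(1) show ?thesis by blast
qed

context two_half_turns
begin

text \<open>By invisibility the two slopes have opposite signs, and so have the two horizontal
  components. Hence the vertical components agree in sign, and all points of the axis near 0 other
  than 0 are crossing points.\<close>

lemma field_signs:
  assumes s: "s \<noteq> 0" "\<bar>s\<bar> < r0"
  shows "- \<kappa> * s * snd (Zp (s, 0)) > 0" "- \<kappa> * s * snd (Zm (s, 0)) > 0"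
proof -
  have sr: "\<bar>s\<bar> < \<rho>" "\<bar>s\<bar> < 2 * r0" using s up.pos by auto
  have fx: "\<kappa> * fst (Zp (s, 0)) > 0" "- \<kappa> * fst (Zm (s, 0)) > 0"
    using up.Xlow[OF sr(1), of 0] lo.Xlow[OF sr(1), of 0] up.pos lo.pos by auto
  have n: "fst (Zp (s, 0)) \<noteq> 0" "fst (Zm (s, 0)) \<noteq> 0" using fx by auto
  have e: "snd (Zp (s, 0)) = slope Zp s 0 * fst (Zp (s, 0))" "snd (Zm (s, 0)) = slope Zm s 0 * fst (Zm (s, 0))"
    using n by (simp_all add: slope_def)
  have n1: "- (s * slope Zp s 0) > 0" using up.slope_sign[OF s(1) sr(2)] by simp
  have "(- (s * slope Zp s 0)) * (\<kappa> * fst (Zp (s, 0))) > 0"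
    by (rule mult_pos_pos[OF n1 fx(1)])
  then show "- \<kappa> * s * snd (Zp (s, 0)) > 0" unfolding e by (simp add: mult_ac)
  have n2: "s * slope Zm s 0 > 0" using lo.slope_sign[OF s(1) sr(2)] by simp
  have "(s * slope Zm s 0) * (- \<kappa> * fst (Zm (s, 0))) > 0"
    by (rule mult_pos_pos[OF n2 fx(2)])
  then show "- \<kappa> * s * snd (Zm (s, 0)) > 0" unfolding e by (simp add: mult_ac)
qed

lemma filippov_sides:
  assumes fs: "filippov_solution_on Zp Zm UNIV \<gamma>" and rg: "range \<gamma> \<subseteq> up.region"
  shows "up.side_orbit \<gamma>" "lo.side_orbit \<gamma>"
proof -
  have c: "continuous_on UNIV \<gamma>" by (rule filippov_continuous[OF fs])
  have gr: "\<gamma> t \<in> up.region" for t using rg by auto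
  have Zc: "continuous_on up.region Zp" "continuous_on up.region Zm"
    unfolding up.region_def by (rule up.Zcont lo.Zcont)+
  have "(\<gamma> has_vector_derivative Zp (\<gamma> t)) (at t)"
    if "\<And>s. a < s \<Longrightarrow> s < b \<Longrightarrow> 1 * snd (\<gamma> s) > 0" "a < t" "t < b" for a b t
  proof (rule filippov_smooth_piece[where Zp=Zp and Zm=Zm and Z=Zp and G=up.region and a=a and b=b])
    show "filippov_set Zp Zm (\<gamma> t) = {Zp (\<gamma> t)}" if "a < t" "t < b" for t
      using \<open>\<And>s. a < s \<Longrightarrow> s < b \<Longrightarrow> 1 * snd (\<gamma> s) > 0\<close>[OF that] by (auto simp: filippov_set_def)
  qed (use fs Zc gr that(2,3) in auto)
  with c rg show "up.side_orbit \<gamma>" unfolding up.side_orbit_def by blast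
  have "(\<gamma> has_vector_derivative Zm (\<gamma> t)) (at t)"
    if "\<And>s. a < s \<Longrightarrow> s < b \<Longrightarrow> - 1 * snd (\<gamma> s) > 0" "a < t" "t < b" for a b t
  proof (rule filippov_smooth_piece[where Zp=Zp and Zm=Zm and Z=Zm and G=up.region and a=a and b=b])
    show "filippov_set Zp Zm (\<gamma> t) = {Zm (\<gamma> t)}" if "a < t" "t < b" for t
      using \<open>\<And>s. a < s \<Longrightarrow> s < b \<Longrightarrow> - 1 * snd (\<gamma> s) > 0\<close>[OF that] by (auto simp: filippov_set_def)
  qed (use fs Zc gr that(2,3) in auto)
  with c rg show "lo.side_orbit \<gamma>" unfolding lo.side_orbit_def by blast
qed

text \<open>A crossing orbit is on one side just before and on the other side just after. So
  \<open>crossing_arc\<close> applies to both half-planes, forward in one and backward in the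
  other.\<close>

lemma arcs_through_crossing:
  assumes fs: "filippov_solution_on Zp Zm UNIV \<gamma>" and rg: "range \<gamma> \<subseteq> up.region"
    and s: "\<gamma> t0 = (s, 0)" "s \<noteq> 0" "\<bar>s\<bar> < r0"
  shows "(\<phi> s, 0) \<in> range \<gamma>" "(\<phi>' s, 0) \<in> range \<gamma>" "up.arc s \<subseteq> range \<gamma>" "lo.arc s \<subseteq> range \<gamma>"
proof -
  \<comment> \<open>The common sign of the two vertical components at \<open>(s, 0)\<close>.\<close>
  define w where "w = - \<kappa> * sgn s"
  have w: "w = 1 \<or> w = -1" using s(2) up.\<kappa> by (auto simp: w_def sgn_if)
  have sp: "(s, 0) \<in> up.region" "(s, 0) \<in> lo.region" using s up.pos by (auto simp: up.region_iff)
  have wz: "w * z > 0" if "- \<kappa> * s * z > 0" for z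
    using that s(2) mult.commute[of s z] by (cases "s > 0") (auto simp: w_def sgn_if mult.assoc mult.left_commute[of \<kappa> s] zero_less_mult_iff mult_less_0_iff)
  obtain e where e: "e > 0" "\<And>t. t0 < t \<Longrightarrow> t < t0 + e \<Longrightarrow> w * snd (\<gamma> t) > 0"
      "\<And>t. t0 - e < t \<Longrightarrow> t < t0 \<Longrightarrow> w * snd (\<gamma> t) < 0"
    using filippov_crossing[OF fs s(1) cont_fields(1)[OF sp(1)] wz[OF field_signs(1)[OF s(2,3)]]
        cont_fields(2)[OF sp(2)] wz[OF field_signs(2)[OF s(2,3)]]] by auto
  have "(\<phi> s, 0) \<in> range \<gamma> \<and> up.arc s \<subseteq> range \<gamma>"
    by (rule up.crossing_arc[OF filippov_sides(1)[OF fs rg] s e(1)]) (use w e in force)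
  then show "(\<phi> s, 0) \<in> range \<gamma>" "up.arc s \<subseteq> range \<gamma>" by auto
  have "(\<phi>' s, 0) \<in> range \<gamma> \<and> lo.arc s \<subseteq> range \<gamma>"
    by (rule lo.crossing_arc[OF filippov_sides(2)[OF fs rg] s e(1)]) (use w e in force)
  then show "(\<phi>' s, 0) \<in> range \<gamma>" "lo.arc s \<subseteq> range \<gamma>" by auto
qed

lemma phi_antimono:
  assumes "\<bar>x\<bar> < r0" "\<bar>y\<bar> < r0" "x \<le> y"
  shows "\<phi> y \<le> \<phi> x" "\<phi>' y \<le> \<phi>' x"
proof -
  have r: "\<bar>z\<bar> < r0" if "x \<le> z" "z \<le> y" for z using assms that by linarith
  show "\<phi> y \<le> \<phi> x"
    by (rule DERIV_nonpos_imp_nonincreasing[OF assms(3)]) (use D\<phi> r less_imp_le in blast)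
  show "\<phi>' y \<le> \<phi>' x"
    by (rule DERIV_nonpos_imp_nonincreasing[OF assms(3)]) (use D\<phi>' r less_imp_le in blast)
qed

lemma arc_endpoints:
  assumes s: "s \<noteq> 0" "\<bar>s\<bar> < r0"
  shows "p \<in> up.arc s \<Longrightarrow> snd p = 0 \<Longrightarrow> p = (s, 0) \<or> p = (\<phi> s, 0)"
    "p \<in> lo.arc s \<Longrightarrow> snd p = 0 \<Longrightarrow> p = (s, 0) \<or> p = (\<phi>' s, 0)"
    "(s, 0) \<in> up.arc s" "(\<phi> s, 0) \<in> up.arc s" "(s, 0) \<in> lo.arc s" "(\<phi>' s, 0) \<in> lo.arc s"
proof -
  have sr: "\<bar>s\<bar> < \<rho>" using s up.pos by simp
  show "p = (s, 0) \<or> p = (\<phi> s, 0)" if "p \<in> up.arc s" "snd p = 0"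
  proof -
    obtain v where v: "v \<in> closed_segment s (\<phi> s)" "p = (v, \<eta> s v)" using \<open>p \<in> up.arc s\<close> by (auto simp: up.arc_def)
    have "v \<notin> open_segment s (\<phi> s)" using up.eta_positive_between[OF s, of v] v(2) \<open>snd p = 0\<close> by auto
    then show ?thesis using v \<open>snd p = 0\<close> by (auto simp: open_segment_def)
  qed
  show "p = (s, 0) \<or> p = (\<phi>' s, 0)" if "p \<in> lo.arc s" "snd p = 0"
  proof -
    obtain v where v: "v \<in> closed_segment s (\<phi>' s)" "p = (v, \<eta>' s v)" using \<open>p \<in> lo.arc s\<close> by (auto simp: lo.arc_def)
    have "v \<notin> open_segment s (\<phi>' s)" using lo.eta_positive_between[OF s, of v] v(2) \<open>snd p = 0\<close> by auto
    then show ?thesis using v \<open>snd p = 0\<close> by (auto simp: open_segment_def)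
  qed
  show "(s, 0) \<in> up.arc s" "(s, 0) \<in> lo.arc s"
    using up.eta_diag[OF sr] lo.eta_diag[OF sr] by (auto simp: up.arc_def lo.arc_def intro!: image_eqI[of _ _ s])
  show "(\<phi> s, 0) \<in> up.arc s" "(\<phi>' s, 0) \<in> lo.arc s"
    using up.phi[OF s] lo.phi[OF s] unfolding up.arc_def lo.arc_def by (force intro: rev_image_eqI)+
qed

text \<open>\<open>V\<close> meets the axis only near the two crossings of the cycle: away from 0,
  and on the positive side within the range of \<open>iso\<close>. A closed orbit in
  \<open>V\<close> might still make several turns; comparing its innermost and outermost positive
  crossings shows that both are \<open>x0\<close>.\<close>

lemma isolated_cycle:
  assumes x0: "0 < x0" "x0 < r0 / 4" and eq: "\<phi> x0 = \<phi>' x0" and e: "0 < e"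
    and iso: "\<And>x. x \<noteq> x0 \<Longrightarrow> \<bar>x - x0\<bar> < e \<Longrightarrow> \<phi> x \<noteq> \<phi>' x"
  defines "V \<equiv> {p \<in> up.region. snd p \<noteq> 0 \<or> \<bar>fst p - x0\<bar> < min e (x0 / 2) \<or> \<bar>fst p - \<phi> x0\<bar> < min (x0 / 2) (- \<phi> x0 / 2)}"
  shows "open V" "up.arc x0 \<union> lo.arc x0 \<subseteq> V"
    "closed_orbit Zp Zm \<Gamma>' \<Longrightarrow> \<Gamma>' \<subseteq> V \<Longrightarrow> \<Gamma>' = up.arc x0 \<union> lo.arc x0"
proof -
  have x: "x0 \<noteq> 0" "\<bar>x0\<bar> < r0" using x0 up.pos by auto
  have y: "\<phi> x0 < 0" "- \<phi> x0 \<le> 3 / 2 * x0" "\<bar>\<phi> x0\<bar> < r0"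
    using up.phi[OF x] x0 by (auto simp: mult_less_0_iff)
  show "open V"
  proof -
    have "V = up.region \<inter> {p. snd p \<noteq> 0 \<or> \<bar>fst p - x0\<bar> < min e (x0 / 2) \<or> \<bar>fst p - \<phi> x0\<bar> < min (x0 / 2) (- \<phi> x0 / 2)}"
      by (auto simp: V_def)
    moreover have "open {p :: real \<times> real. snd p \<noteq> 0 \<or> \<bar>fst p - x0\<bar> < min e (x0 / 2) \<or> \<bar>fst p - \<phi> x0\<bar> < min (x0 / 2) (- \<phi> x0 / 2)}"
      by (intro open_Collect_disj open_Collect_neq open_Collect_less continuous_intros)
    ultimately show ?thesis using up.open_region by auto
  qed
  have pos: "min e (x0 / 2) > 0" "min (x0 / 2) (- \<phi> x0 / 2) > 0" using e x0 y by auto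
  show "up.arc x0 \<union> lo.arc x0 \<subseteq> V"
  proof
    fix p assume p: "p \<in> up.arc x0 \<union> lo.arc x0"
    then have "p \<in> up.region" using up.arc_in_region[OF x] lo.arc_in_region[OF x] by auto
    moreover have "p = (x0, 0) \<or> p = (\<phi> x0, 0)" if "snd p = 0"
      using p that arc_endpoints(1,2)[OF x, of p] eq by (cases "p \<in> up.arc x0") auto
    ultimately show "p \<in> V" using pos by (auto simp: V_def)
  qed
  show "\<Gamma>' = up.arc x0 \<union> lo.arc x0" if co: "closed_orbit Zp Zm \<Gamma>'" and GV: "\<Gamma>' \<subseteq> V"
  proof -
    obtain \<gamma> T where fs: "filippov_solution_on Zp Zm UNIV \<gamma>" and T: "T > 0" "\<And>t. \<gamma> (t + T) = \<gamma> t" and G: "\<Gamma>' = range \<gamma>"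
      using co unfolding closed_orbit_def by blast
    have rg: "range \<gamma> \<subseteq> up.region" using GV G by (auto simp: V_def)
    have cz: "\<bar>s - x0\<bar> < min e (x0 / 2) \<or> \<bar>s - \<phi> x0\<bar> < min (x0 / 2) (- \<phi> x0 / 2)" if "(s, 0) \<in> \<Gamma>'" for s
      using that GV by (auto simp: V_def)
    have small: "s \<noteq> 0 \<and> \<bar>s\<bar> < r0" if "(s, 0) \<in> \<Gamma>'" for s
    proof -
      consider "\<bar>s - x0\<bar> < x0 / 2" | "\<bar>s - \<phi> x0\<bar> < x0 / 2" "\<bar>s - \<phi> x0\<bar> < - \<phi> x0 / 2"
        using cz[OF \<open>(s, 0) \<in> \<Gamma>'\<close>] by fastforce
      then have "(s < 0 \<or> s > 0) \<and> \<bar>s\<bar> < r0"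
      proof cases
        case 1
        then have "s > 0" "s < r0" using x0 by linarith+
        then show ?thesis by simp
      next
        case 2
        then have "s < 0" "- s < r0" using x0 y by linarith+
        then show ?thesis by simp
      qed
      then show ?thesis by auto
    qed
    have posi: "\<bar>s - x0\<bar> < e" if "(s, 0) \<in> \<Gamma>'" "s > 0" for s
      using cz[OF that(1)] that(2) y by (auto simp: abs_less_iff)
    have step: "(\<phi> s, 0) \<in> \<Gamma>'" "(\<phi>' s, 0) \<in> \<Gamma>'" "up.arc s \<subseteq> \<Gamma>'" "lo.arc s \<subseteq> \<Gamma>'" if sG: "(s, 0) \<in> \<Gamma>'" for s
    proof -
      obtain t0 where t0: "\<gamma> t0 = (s, 0)" using sG G by force
      have ss: "s \<noteq> 0" "\<bar>s\<bar> < r0" using small[OF sG] by auto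
      show "(\<phi> s, 0) \<in> \<Gamma>'" "(\<phi>' s, 0) \<in> \<Gamma>'" "up.arc s \<subseteq> \<Gamma>'" "lo.arc s \<subseteq> \<Gamma>'"
        unfolding G by (rule arcs_through_crossing[OF fs rg t0 ss])+
    qed
    have sgn: "s * \<phi> s < 0" "s * \<phi>' s < 0" if "(s, 0) \<in> \<Gamma>'" for s
      using small[OF that] up.phi[of s] lo.phi[of s] by auto
    have inv: "\<phi> (\<phi> s) = s" "\<phi>' (\<phi>' s) = s" if sG: "(s, 0) \<in> \<Gamma>'" for s
      using small[OF sG] small[OF step(1)[OF sG]] small[OF step(2)[OF sG]] up.phi_involution lo.phi_involution by auto
    have on_arc: "\<exists>s. (s, 0) \<in> \<Gamma>' \<and> p \<in> up.arc s \<union> lo.arc s" if pG: "p \<in> \<Gamma>'" for p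
    proof -
      obtain t where t: "p = \<gamma> t" using pG G by blast
      have z: "fst (\<gamma> t) \<noteq> 0 \<and> \<bar>fst (\<gamma> t)\<bar> < r0" if "snd (\<gamma> t) = 0" for t
        using small[of "fst (\<gamma> t)"] that G by (metis prod.collapse rangeI)
      consider "snd p = 0" | "1 * snd (\<gamma> t) > 0" | "- 1 * snd (\<gamma> t) > 0" using t by fastforce
      then show ?thesis
      proof cases
        case 1
        then have p: "p = (fst p, 0)" by (simp add: prod_eq_iff)
        then have "(fst p, 0) \<in> \<Gamma>'" using pG by simp
        moreover from this have "p \<in> up.arc (fst p)" using arc_endpoints(3)[of "fst p"] small p by metis
        ultimately show ?thesis by blast
      next
        case 2
        from up.previous_crossing[OF filippov_sides(1)[OF fs rg] z this]
        obtain t0 s where "\<gamma> t0 = (s, 0)" "\<gamma> t \<in> up.arc s" by blast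
        then show ?thesis using t G by (metis UnI1 rangeI)
      next
        case 3
        from lo.previous_crossing[OF filippov_sides(2)[OF fs rg] z this]
        obtain t0 s where "\<gamma> t0 = (s, 0)" "\<gamma> t \<in> lo.arc s" by blast
        then show ?thesis using t G by (metis UnI2 rangeI)
      qed
    qed
    define K where "K = fst ` (\<Gamma>' \<inter> {p. snd p = 0 \<and> 0 \<le> fst p})"
    have Kiff: "s \<in> K \<longleftrightarrow> (s, 0) \<in> \<Gamma>' \<and> s > 0" for s
    proof
      assume "s \<in> K"
      then have "(s, 0) \<in> \<Gamma>'" "s \<ge> 0" by (auto simp: K_def prod_eq_iff)
      with small[of s] show "(s, 0) \<in> \<Gamma>' \<and> s > 0" by auto
    qed (force simp: K_def)
    have "compact \<Gamma>'"
    proof -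
      have "range \<gamma> = \<gamma> ` {0..T}"
      proof
        have per: "\<gamma> (t + T * of_int k) = \<gamma> t" for t k
        proof (induction k rule: int_induct[where k=0])
          case (step1 i)
          then show ?case using T(2)[of "t + T * of_int i"] by (simp add: algebra_simps)
        next
          case (step2 i)
          then show ?case using T(2)[of "t + T * of_int (i - 1)"] by (simp add: algebra_simps)
        qed simp
        show "range \<gamma> \<subseteq> \<gamma> ` {0..T}"
        proof (rule image_subsetI)
          fix t :: real
          define k where "k = \<lfloor>t / T\<rfloor>"
          have "of_int k \<le> t / T" "t / T < of_int k + 1" unfolding k_def by linarith+
          then have "t + T * of_int (- k) \<in> {0..T}" using T(1) by (simp add: field_simps)
          then show "\<gamma> t \<in> \<gamma> ` {0..T}" using per[of t "- k"] by (metis imageI)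
        qed
      qed auto
      then show ?thesis unfolding G
        using compact_continuous_image[OF continuous_on_subset[OF filippov_continuous[OF fs]], of "{0..T}"] by simp
    qed
    moreover have "closed {p :: real \<times> real. snd p = 0 \<and> 0 \<le> fst p}"
      by (intro closed_Collect_conj closed_Collect_eq closed_Collect_le continuous_intros)
    ultimately have Kc: "compact K" unfolding K_def
      by (intro compact_continuous_image continuous_intros compact_Int_closed)
    have Kne: "K \<noteq> {}"
    proof -
      obtain s where s: "(s, 0) \<in> \<Gamma>'" using on_arc[of "\<gamma> 0"] G by blast
      show ?thesis
      proof (cases "s > 0")
        case False
        then have "\<phi> s > 0" using sgn(1)[OF s] by (auto simp: mult_less_0_iff)
        then show ?thesis using step(1)[OF s] Kiff by blast
      qed (use s Kiff in blast)
    qed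
    \<comment> \<open>For the largest positive crossing \<open>s\<close>, both
      \<open>\<phi>' (\<phi> s)\<close> and \<open>\<phi> (\<phi>' s)\<close> are positive
      crossings, hence at most \<open>s\<close>. The decreasing involutions turn this into
      \<open>\<phi>' s \<le> \<phi> s\<close> and \<open>\<phi> s \<le> \<phi>' s\<close>. For the
      smallest crossing the inequalities are reversed.\<close>
    have extreme: "s = x0" if sK: "s \<in> K" and ext: "(\<forall>u\<in>K. u \<le> s) \<or> (\<forall>u\<in>K. s \<le> u)" for s
    proof -
      have sG: "(s, 0) \<in> \<Gamma>'" "s > 0" using sK Kiff by auto
      have n: "(\<phi> s, 0) \<in> \<Gamma>'" "\<phi> s < 0" "(\<phi>' s, 0) \<in> \<Gamma>'" "\<phi>' s < 0"
        using step[OF sG(1)] sgn[OF sG(1)] sG(2) by (auto simp: mult_less_0_iff)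
      have u: "\<phi>' (\<phi> s) \<in> K" "\<phi> (\<phi>' s) \<in> K"
        using step(2)[OF n(1)] step(1)[OF n(3)] sgn(2)[OF n(1)] sgn(1)[OF n(3)] n by (auto simp: Kiff mult_less_0_iff)
      have b: "\<bar>s\<bar> < r0" "\<bar>\<phi> s\<bar> < r0" "\<bar>\<phi>' s\<bar> < r0" "\<bar>\<phi>' (\<phi> s)\<bar> < r0" "\<bar>\<phi> (\<phi>' s)\<bar> < r0"
        using small[OF sG(1)] small[OF n(1)] small[OF n(3)] small[of "\<phi>' (\<phi> s)"] small[of "\<phi> (\<phi>' s)"] u
        unfolding Kiff by blast+
      have i1: "\<phi>' (\<phi>' (\<phi> s)) = \<phi> s" "\<phi> (\<phi> (\<phi>' s)) = \<phi>' s" using inv(2)[OF n(1)] inv(1)[OF n(3)] by auto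
      have "\<phi> s = \<phi>' s" using ext
      proof
        assume "\<forall>u\<in>K. u \<le> s"
        with u have le: "\<phi>' (\<phi> s) \<le> s" "\<phi> (\<phi>' s) \<le> s" by auto
        show ?thesis using phi_antimono(2)[OF b(4,1) le(1)] phi_antimono(1)[OF b(5,1) le(2)] i1 by simp
      next
        assume "\<forall>u\<in>K. s \<le> u"
        with u have le: "s \<le> \<phi>' (\<phi> s)" "s \<le> \<phi> (\<phi>' s)" by auto
        show ?thesis using phi_antimono(2)[OF b(1,4) le(1)] phi_antimono(1)[OF b(1,5) le(2)] i1 by simp
      qed
      then show "s = x0" using iso posi[OF sG] by blast
    qed
    obtain s1 where s1: "s1 \<in> K" "\<forall>u\<in>K. u \<le> s1" using compact_attains_sup[OF Kc Kne] by blast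
    obtain s2 where s2: "s2 \<in> K" "\<forall>u\<in>K. s2 \<le> u" using compact_attains_inf[OF Kc Kne] by blast
    have "s1 = x0" "s2 = x0" using extreme s1 s2 by blast+
    then have K1: "u = x0" if "u \<in> K" for u using s1(2) s2(2) that by force
    have x0G: "(x0, 0) \<in> \<Gamma>'" using s1 \<open>s1 = x0\<close> Kiff by blast
    have two: "s = x0 \<or> s = \<phi> x0" if "(s, 0) \<in> \<Gamma>'" for s
    proof (cases "s > 0")
      case False
      then have "\<phi> s > 0" using sgn(1)[OF that] by (auto simp: mult_less_0_iff)
      then have "\<phi> s = x0" using K1 Kiff step(1)[OF that] by blast
      then show ?thesis using inv(1)[OF that] by simp
    qed (use that K1 Kiff in blast)
    have arcs: "up.arc (\<phi> x0) = up.arc x0" "lo.arc (\<phi> x0) = lo.arc x0"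
      using up.arc_phi[OF x y(3)] lo.arc_phi[OF x] y(3) eq by auto
    show ?thesis
    proof
      show "\<Gamma>' \<subseteq> up.arc x0 \<union> lo.arc x0"
      proof
        fix p assume "p \<in> \<Gamma>'"
        then obtain s where "(s, 0) \<in> \<Gamma>'" "p \<in> up.arc s \<union> lo.arc s" using on_arc by blast
        then show "p \<in> up.arc x0 \<union> lo.arc x0" using two[of s] arcs by auto
      qed
      show "up.arc x0 \<union> lo.arc x0 \<subseteq> \<Gamma>'" using step(3,4)[OF x0G] by blast
    qed
  qed
qed

text \<open>The hypothesis compares the two derivatives at one point, whereas the multiplier of the
  return map is the product of one derivative at \<open>x0\<close> and the other at
  \<open>\<phi> x0\<close>. Differentiating the involution identities relates the two
  points.\<close>

theorem hyperbolic_cycle: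
  assumes x0: "0 < x0" "x0 < r0 / 4" and eq: "\<phi> x0 = \<phi>' x0" and D: "D\<phi> x0 \<noteq> D\<phi>' x0"
  shows "hyperbolic_limit_cycle Zp Zm (up.arc x0 \<union> lo.arc x0)"
proof -
  let ?\<Gamma> = "up.arc x0 \<union> lo.arc x0"
  have x: "x0 \<noteq> 0" "\<bar>x0\<bar> < r0" "\<bar>x0\<bar> < r0 / 2" using x0 up.pos by auto
  have y: "\<phi> x0 < 0" "\<bar>\<phi> x0\<bar> < r0 / 2" "\<bar>\<phi> x0\<bar> < r0"
    using up.phi[OF x(1,2)] x0 by (auto simp: mult_less_0_iff)
  have inv: "\<phi> (\<phi> x0) = x0" "\<phi>' (\<phi> x0) = x0"
    using up.phi_involution[OF x(2)] lo.phi_involution[OF x(2)] y eq by auto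
  have arcs: "up.arc (\<phi> x0) = up.arc x0" "lo.arc (\<phi> x0) = lo.arc x0"
    using up.arc_phi[OF x(1,2) y(3)] lo.arc_phi[OF x(1,2)] y(3) eq by auto
  have "((\<lambda>x. \<phi> x - \<phi>' x) has_real_derivative D\<phi> x0 - D\<phi>' x0) (at x0)"
    using D\<phi>[OF x(2)] D\<phi>'[OF x(2)] by (intro DERIV_diff) auto
  from DERIV_nonzero_isolated[OF this] D eq obtain e where e: "e > 0"
    "\<And>x. x \<noteq> x0 \<Longrightarrow> \<bar>x - x0\<bar> < e \<Longrightarrow> \<phi> x \<noteq> \<phi>' x" by auto
  have prod1: "D\<phi> (\<phi> x0) * D\<phi> x0 = 1" "D\<phi>' (\<phi> x0) * D\<phi>' x0 = 1"
  proof -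
    have op: "open {-r0/2<..<r0/2}" by simp
    have "((\<lambda>x. \<phi> (\<phi> x)) has_real_derivative D\<phi> (\<phi> x0) * D\<phi> x0) (at x0)"
      using D\<phi>[OF y(3)] D\<phi>[OF x(2)] by (intro DERIV_chain2[of \<phi>]) auto
    moreover have "((\<lambda>x. \<phi> (\<phi> x)) has_real_derivative 1) (at x0)"
    proof (rule has_field_derivative_transform_within_open[OF DERIV_ident op])
      show "x = \<phi> (\<phi> x)" if "x \<in> {-r0/2<..<r0/2}" for x
      proof (cases "x = 0")
        case False
        then show ?thesis using up.phi_involution[of x] small_abs[of x] that up.pos by auto
      qed (simp add: up.phi_0)
    qed (use x0 up.pos in auto)
    ultimately show "D\<phi> (\<phi> x0) * D\<phi> x0 = 1" by (rule DERIV_unique)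
    have "((\<lambda>x. \<phi>' (\<phi>' x)) has_real_derivative D\<phi>' (\<phi>' x0) * D\<phi>' x0) (at x0)"
      using D\<phi>'[of "\<phi>' x0"] y(3) eq D\<phi>'[OF x(2)] by (intro DERIV_chain2[of \<phi>']) auto
    moreover have "((\<lambda>x. \<phi>' (\<phi>' x)) has_real_derivative 1) (at x0)"
    proof (rule has_field_derivative_transform_within_open[OF DERIV_ident op])
      show "x = \<phi>' (\<phi>' x)" if "x \<in> {-r0/2<..<r0/2}" for x
      proof (cases "x = 0")
        case False
        then show ?thesis using lo.phi_involution[of x] small_abs[of x] that up.pos by auto
      qed (simp add: lo.phi_0)
    qed (use x0 up.pos in auto)
    ultimately have "D\<phi>' (\<phi>' x0) * D\<phi>' x0 = 1" by (rule DERIV_unique)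
    then show "D\<phi>' (\<phi> x0) * D\<phi>' x0 = 1" using eq by simp
  qed
  have neg: "D\<phi> x0 < 0" "D\<phi>' x0 < 0" "D\<phi> (\<phi> x0) < 0" "D\<phi>' (\<phi> x0) < 0"
    using D\<phi> D\<phi>' x y by blast+
  \<comment> \<open>The composition \<open>\<phi>' (\<phi> x)\<close> is the forward return only
    from points with \<open>\<kappa> * b < 0\<close>; so the sign of \<open>\<kappa>\<close> decides
    between the base points \<open>x0\<close> and \<open>\<phi> x0\<close>.\<close>
  have "\<exists>b. (b, 0) \<in> ?\<Gamma> \<and> closed_orbit Zp Zm ?\<Gamma> \<and> first_return_map_at Zp Zm b (\<lambda>x. \<phi>' (\<phi> x)) \<and>
      (\<exists>d. ((\<lambda>x. \<phi>' (\<phi> x)) has_real_derivative d) (at b) \<and> \<bar>d\<bar> \<noteq> 1)"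
  proof (cases "\<kappa> < 0")
    case True
    then have k: "\<kappa> * x0 < 0" using x0 by (simp add: mult_less_0_iff)
    have "D\<phi>' (\<phi> x0) * D\<phi> x0 \<noteq> 1"
    proof
      assume "D\<phi>' (\<phi> x0) * D\<phi> x0 = 1"
      then have "D\<phi>' (\<phi> x0) * D\<phi> x0 = D\<phi>' (\<phi> x0) * D\<phi>' x0" using prod1 by simp
      with neg D show False by simp
    qed
    moreover have "D\<phi>' (\<phi> x0) * D\<phi> x0 > 0" using neg by (intro mult_neg_neg)
    ultimately have d: "\<bar>D\<phi>' (\<phi> x0) * D\<phi> x0\<bar> \<noteq> 1" by simp
    show ?thesis
      using return_map[OF k x(3) inv(2)] closed_orbit_turn[OF k x(3) inv(2)] arcs arc_endpoints(3)[OF x(1,2)] d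
      by (intro exI[of _ x0]) auto
  next
    case False
    then have k: "\<kappa> * \<phi> x0 < 0" using y up.\<kappa> by (auto simp: mult_less_0_iff)
    have fp: "\<phi>' (\<phi> (\<phi> x0)) = \<phi> x0" using inv eq by simp
    have "D\<phi>' x0 * D\<phi> (\<phi> x0) \<noteq> 1"
    proof
      assume "D\<phi>' x0 * D\<phi> (\<phi> x0) = 1"
      then have "D\<phi> (\<phi> x0) * D\<phi>' x0 = D\<phi> (\<phi> x0) * D\<phi> x0" using prod1 by (simp add: mult.commute)
      with neg D show False by simp
    qed
    moreover have "D\<phi>' x0 * D\<phi> (\<phi> x0) > 0" using neg by (intro mult_neg_neg)
    ultimately have d: "\<bar>D\<phi>' x0 * D\<phi> (\<phi> x0)\<bar> \<noteq> 1" by simp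
    show ?thesis
      using return_map[OF k y(2) fp] closed_orbit_turn[OF k y(2) fp] arcs arc_endpoints(4)[OF x(1,2)] d inv(1)
      by (intro exI[of _ "\<phi> x0"]) auto
  qed
  then obtain b d where b: "(b, 0) \<in> ?\<Gamma>" "closed_orbit Zp Zm ?\<Gamma>" "first_return_map_at Zp Zm b (\<lambda>x. \<phi>' (\<phi> x))"
    "((\<lambda>x. \<phi>' (\<phi> x)) has_real_derivative d) (at b)" "\<bar>d\<bar> \<noteq> 1" by blast
  have "limit_cycle Zp Zm ?\<Gamma>"
    unfolding limit_cycle_def using b(2) isolated_cycle[OF x0 eq e] by blast
  with b show ?thesis unfolding hyperbolic_limit_cycle_def by blast
qed

end

section \<open>Estimates for holomorphic functions of one variable\<close>

lemma norm_deriv_le_bound: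
  fixes f :: "complex \<Rightarrow> complex"
  assumes "f holomorphic_on ball a d" "0 < d" "\<And>x. x \<in> ball a d \<Longrightarrow> norm (f x) \<le> M"
  shows "norm (deriv f a) \<le> M / d"
proof -
  \<comment> \<open>The bound is given on the open disc, so Cauchy's inequality is used on circles
    of radius \<open>z * d\<close> and \<open>z\<close> then tends to 1.\<close>
  have "z * (norm (deriv f a) * d) \<le> M" if z: "0 < z" "z < 1" for z
  proof -
    have zd: "0 < z * d" "z * d < d" using z assms(2) by auto
    have "norm ((deriv ^^ 1) f a) \<le> fact 1 * M / (z * d) ^ 1"
    proof (rule Cauchy_inequality)
      show "f holomorphic_on ball a (z * d)"
        by (rule holomorphic_on_subset[OF assms(1)]) (use zd in auto)
      show "continuous_on (cball a (z * d)) f"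
        by (rule continuous_on_subset[OF holomorphic_on_imp_continuous_on[OF assms(1)]]) (use zd in auto)
      show "norm (f x) \<le> M" if "norm (a - x) = z * d" for x
        by (rule assms(3)) (use zd that in \<open>auto simp: dist_norm\<close>)
    qed (use zd in auto)
    then show ?thesis using zd by (simp add: field_simps)
  qed
  then have "norm (deriv f a) * d \<le> M" by (rule field_le_mult_one_interval)
  then show ?thesis using assms(2) by (simp add: field_simps)
qed

text \<open>The source of most smallness estimates below: a function that is bounded on a much
  larger disc is nearly constant.\<close>

lemma holomorphic_bounded_lipschitz:
  fixes f :: "complex \<Rightarrow> complex"
  assumes f: "f holomorphic_on ball a r" and M: "\<And>x. x \<in> ball a r \<Longrightarrow> norm (f x) \<le> M"
    and d: "d < r" and x: "x \<in> cball a d" "y \<in> cball a d"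
  shows "norm (f x - f y) \<le> M / (r - d) * norm (x - y)"
proof (rule field_differentiable_bound[of "cball a d" f "deriv f"])
  fix z assume z: "z \<in> cball a d"
  then have zr: "z \<in> ball a r" using d by auto
  have sub: "ball z (r - d) \<subseteq> ball a r" using z
    by (auto intro!: le_less_trans[OF dist_triangle[of a _ z]])
  show "(f has_field_derivative deriv f z) (at z within cball a d)"
    using holomorphic_derivI[OF f open_ball zr] has_field_derivative_at_within by blast
  show "norm (deriv f z) \<le> M / (r - d)"
    by (rule norm_deriv_le_bound) (use f sub M d holomorphic_on_subset in auto)
qed (use x in auto)

text \<open>The cofactor is the power series with shifted coefficients; so it is holomorphic at 0 as
  well, and its value there is the next Taylor coefficient.\<close>

lemma holomorphic_factor_Taylor:
  fixes f :: "complex \<Rightarrow> complex"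
  assumes f: "f holomorphic_on ball 0 r"
  shows "\<exists>R. R holomorphic_on ball 0 r \<and>
    (\<forall>x\<in>ball 0 r. f x = (\<Sum>m<N. (deriv ^^ m) f 0 / fact m * x ^ m) + x ^ N * R x) \<and>
    (r > 0 \<longrightarrow> R 0 = (deriv ^^ N) f 0 / fact N)"
proof -
  define c where "c m = (deriv ^^ m) f 0 / fact m" for m
  define R where "R x = (\<Sum>n. c (n + N) * x ^ n)" for x
  have s: "(\<lambda>n. c n * x ^ n) sums f x" if "x \<in> ball 0 r" for x
    using holomorphic_power_series[OF f that] by (simp add: c_def)
  have sm: "summable (\<lambda>n. c (n + N) * x ^ n)" if x: "x \<in> ball 0 r" for x
  proof (cases "x = 0")
    case True
    then show ?thesis
      by (intro summable_finite[of "{0}"]) (auto simp: power_0_left)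
  next
    case False
    have "summable (\<lambda>n. c (n + N) * x ^ (n + N))"
      using s[OF x] summable_iff_shift[of "\<lambda>n. c n * x ^ n" N] sums_summable by blast
    then have "summable (\<lambda>n. c (n + N) * x ^ (n + N) * inverse (x ^ N))"
      by (rule summable_mult2)
    moreover have "(\<lambda>n. c (n + N) * x ^ (n + N) * inverse (x ^ N)) = (\<lambda>n. c (n + N) * x ^ n)"
      using False by (auto simp: power_add fun_eq_iff)
    ultimately show ?thesis by simp
  qed
  show ?thesis
  proof (intro exI[of _ R] conjI ballI impI)
    show "R holomorphic_on ball 0 r"
      by (rule power_series_holomorphic[of _ _ "\<lambda>n. c (n + N)"])
        (use sm in \<open>auto simp: R_def summable_sums\<close>)
    show "f x = (\<Sum>m<N. (deriv ^^ m) f 0 / fact m * x ^ m) + x ^ N * R x" if x: "x \<in> ball 0 r" for x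
    proof -
      have "f x = (\<Sum>n. c n * x ^ n)" using s[OF x] by (simp add: sums_iff)
      also have "\<dots> = (\<Sum>n. c (n + N) * x ^ (n + N)) + (\<Sum>m<N. c m * x ^ m)"
        using suminf_split_initial_segment s[OF x] sums_summable by blast
      also have "(\<Sum>n. c (n + N) * x ^ (n + N)) = x ^ N * R x"
        unfolding R_def using suminf_mult[OF sm[OF x], of "x ^ N"] by (simp add: power_add mult_ac)
      finally show ?thesis by (simp add: c_def)
    qed
    show "R 0 = (deriv ^^ N) f 0 / fact N" if "r > 0"
      using powser_zero[of "\<lambda>n. c (n + N)"] by (simp add: R_def c_def)
  qed
qed

text \<open>Maximum principle: on the circle the modulus of \<open>x ^ N\<close> is constant, so a
  bound for the product there bounds the cofactor in the whole disc, including 0.\<close>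

lemma bound_cofactor_power:
  fixes R :: "complex \<Rightarrow> complex"
  assumes R: "R holomorphic_on ball 0 r" and d: "0 < d" "d < r"
    and M: "\<And>x. norm x = d \<Longrightarrow> norm (x ^ N * R x) \<le> M" and x: "norm x \<le> d"
  shows "norm (R x) \<le> M / d ^ N"
proof (rule maximum_modulus_frontier[of R "cball 0 d"])
  show "R holomorphic_on interior (cball 0 d)"
    by (rule holomorphic_on_subset[OF R]) (use d in auto)
  show "continuous_on (closure (cball 0 d)) R"
    by (rule continuous_on_subset[OF holomorphic_on_imp_continuous_on[OF R]]) (use d in auto)
  show "norm (R z) \<le> M / d ^ N" if "z \<in> frontier (cball 0 d)" for z
  proof -
    have "norm z = d" using that d by auto
    with M[of z] d show ?thesis by (simp add: norm_mult norm_power field_simps)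
  qed
qed (use x in auto)

text \<open>Translates the real iterated derivatives of \<open>dx_at_0\<close> and
  \<open>taylor_coeff\<close> into complex ones. The induction runs over all points of the interval,
  because the next derivative needs the identity in a neighbourhood.\<close>

lemma deriv_of_real_restriction:
  fixes F :: "complex \<Rightarrow> complex" and f :: "real \<Rightarrow> real"
  assumes F: "F holomorphic_on ball 0 r" and f: "\<And>x. \<bar>x\<bar> < r \<Longrightarrow> F (of_real x) = of_real (f x)"
    and x: "\<bar>x\<bar> < r"
  shows "(deriv ^^ m) F (of_real x) = of_real ((deriv ^^ m) f x)"
  using x
proof (induction m arbitrary: x)
  case 0
  then show ?case using f by simp
next
  case (Suc m)
  let ?G = "(deriv ^^ m) F" and ?g = "(deriv ^^ m) f"
  have xr: "of_real x \<in> ball (0::complex) r" using Suc.prems by simp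
  have "?G holomorphic_on ball 0 r" using F by (simp add: holomorphic_higher_deriv)
  then have d: "(?G has_field_derivative deriv ?G (of_real x)) (at (of_real x))"
    using holomorphic_derivI xr by blast
  have "((\<lambda>t. ?G (of_real t)) has_vector_derivative 1 * deriv ?G (of_real x)) (at x)"
    using field_vector_diff_chain_at[of of_real 1 x ?G] d
      has_vector_derivative_of_real[OF DERIV_ident]
    by (auto simp: o_def)
  then have v: "((\<lambda>t. ?G (of_real t)) has_vector_derivative deriv ?G (of_real x)) (at x)" by simp
  have ev: "\<forall>\<^sub>F t in nhds x. ?G (of_real t) = of_real (?g t)"
  proof -
    have "\<forall>\<^sub>F t in nhds x. t \<in> {-r<..<r}"
      using Suc.prems by (intro eventually_nhds_in_open) auto
    then show ?thesis by eventually_elim (auto intro!: Suc.IH)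
  qed
  have "((\<lambda>t. complex_of_real (?g t)) has_vector_derivative deriv ?G (of_real x)) (at x)"
  proof -
    have "((\<lambda>t. complex_of_real (?g t)) has_vector_derivative deriv ?G (of_real x)) (at x)
        = ((\<lambda>t. ?G (of_real t)) has_vector_derivative deriv ?G (of_real x)) (at x)"
      using ev by (intro has_vector_derivative_cong_ev)
        (auto elim!: eventually_mono dest: eventually_nhds_x_imp_x)
    with v show ?thesis by simp
  qed
  then have re: "(?g has_vector_derivative Re (deriv ?G (of_real x))) (at x)"
    and im: "((\<lambda>t. 0::real) has_vector_derivative Im (deriv ?G (of_real x))) (at x)"
    using bounded_linear.has_vector_derivative[OF bounded_linear_Re] 
      bounded_linear.has_vector_derivative[OF bounded_linear_Im] by fastforce+
  have "deriv ?g x = Re (deriv ?G (of_real x))"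
    using re by (simp add: DERIV_imp_deriv has_real_derivative_iff_has_vector_derivative)
  moreover have "Im (deriv ?G (of_real x)) = 0"
    using vector_derivative_unique_at[OF im has_vector_derivative_const] by simp
  ultimately show ?case by (simp add: complex_eq_iff)
qed


text \<open>The uniform bound \<open>M\<close> on a disc gives a Lipschitz bound in
  \<open>w\<close>, which dominates the difference quotients; dominated convergence then permits
  differentiation under the integral.\<close>

lemma holomorphic_on_integral_parameter:
  fixes g :: "complex \<Rightarrow> real \<Rightarrow> complex"
  assumes T: "open T" and hol: "\<And>t. t \<in> {0..1} \<Longrightarrow> (\<lambda>w. g w t) holomorphic_on T"
    and cont: "\<And>w. w \<in> T \<Longrightarrow> continuous_on {0..1} (g w)"
    and M: "\<And>w t. w \<in> T \<Longrightarrow> t \<in> {0..1} \<Longrightarrow> norm (g w t) \<le> M"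
  shows "(\<lambda>w. integral {0..1} (g w)) holomorphic_on T"
proof -
  have "\<exists>D. ((\<lambda>w. integral {0..1} (g w)) has_field_derivative D) (at w0)" if w0: "w0 \<in> T" for w0
  proof -
    obtain d where d: "d > 0" "ball w0 d \<subseteq> T" using T w0 openE by blast
    let ?D = "\<lambda>t. deriv (\<lambda>w. g w t) w0"
    have "((\<lambda>y. (integral {0..1} (g y) - integral {0..1} (g w0)) / (y - w0))
        \<longlongrightarrow> integral {0..1} ?D) (at w0)"
      unfolding tendsto_at_iff_sequentially
    proof (intro allI impI)
      fix X :: "nat \<Rightarrow> complex"
      assume X0: "\<forall>i. X i \<in> UNIV - {w0}" and X: "X \<longlonglongrightarrow> w0"
      then have "\<forall>\<^sub>F i in sequentially. dist (X i) w0 < d / 2"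
        using d by (intro tendstoD[OF X]) auto
      then obtain N where N: "\<And>i. i \<ge> N \<Longrightarrow> dist (X i) w0 < d / 2"
        by (auto simp: eventually_sequentially)
      \<comment> \<open>Dropping finitely many terms keeps the whole sequence within
        \<open>d / 2\<close> of \<open>w0\<close>, where the dominating constant is valid for every
        index.\<close>
      define Y where "Y i = X (i + N)" for i
      have Yd: "dist (Y i) w0 < d / 2" for i using N by (simp add: Y_def)
      have Y: "Y \<longlonglongrightarrow> w0" "\<And>i. Y i \<noteq> w0" "\<And>i. Y i \<in> cball w0 (d / 2)"
        using LIMSEQ_ignore_initial_segment[OF X, of N] X0 Yd less_imp_le
        by (auto simp: Y_def[abs_def] dist_commute)
      have "Y i \<in> ball w0 d" for i using Yd[of i] d(1) by (simp add: dist_commute)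
      then have YT: "Y i \<in> T" for i using d(2) by blast
      let ?f = "\<lambda>i t. (g (Y i) t - g w0 t) / (Y i - w0)"
      have int: "g (Y i) integrable_on {0..1}" "g w0 integrable_on {0..1}" for i
        using cont[OF YT] cont[OF w0] by (auto intro: integrable_continuous_interval)
      have fi: "?f i integrable_on {0..1}" for i
        using cont[OF YT] cont[OF w0] Y(2)
        by (intro integrable_continuous_interval continuous_intros) auto
      have lim: "(\<lambda>i. integral {0..1} (?f i)) \<longlonglongrightarrow> integral {0..1} ?D"
      proof (rule dominated_convergence(2)[where h="\<lambda>_. M / (d - d / 2)"])
        show "norm (?f i t) \<le> M / (d - d / 2)" if t: "t \<in> {0..1}" for i t
        proof -
          have "norm (g (Y i) t - g w0 t) \<le> M / (d - d / 2) * norm (Y i - w0)"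
          proof (rule holomorphic_bounded_lipschitz[where f="\<lambda>w. g w t" and a=w0])
            show "(\<lambda>w. g w t) holomorphic_on ball w0 d"
              using hol[OF t] d holomorphic_on_subset by blast
            show "norm (g x t) \<le> M" if "x \<in> ball w0 d" for x using M[OF _ t] that d by blast
          qed (use d Y(3) in auto)
          then show ?thesis using Y(2)[of i] by (simp add: norm_divide field_simps)
        qed
        show "(\<lambda>i. ?f i t) \<longlonglongrightarrow> ?D t" if t: "t \<in> {0..1}" for t
        proof -
          have "((\<lambda>w. g w t) has_field_derivative ?D t) (at w0)"
            using holomorphic_derivI[OF hol[OF t] T w0] by simp
          then have "((\<lambda>y. (g y t - g w0 t) / (y - w0)) \<longlongrightarrow> ?D t) (at w0)"
            by (simp add: has_field_derivative_iff)
          then have "((\<lambda>y. (g y t - g w0 t) / (y - w0)) \<circ> Y) \<longlonglongrightarrow> ?D t"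
            using Y unfolding tendsto_at_iff_sequentially by auto
          then show ?thesis by (simp add: o_def)
        qed
      qed (use fi in auto)
      have eq: "integral {0..1} (?f i)
          = (integral {0..1} (g (Y i)) - integral {0..1} (g w0)) / (Y i - w0)" for i
        using int(1)[of i] int(2) by (simp add: integral_diff)
      have "(\<lambda>i. ((\<lambda>y. (integral {0..1} (g y) - integral {0..1} (g w0)) / (y - w0)) \<circ> X) (i + N))
          \<longlonglongrightarrow> integral {0..1} ?D"
        using lim unfolding eq by (simp add: o_def Y_def)
      then show "((\<lambda>y. (integral {0..1} (g y) - integral {0..1} (g w0)) / (y - w0)) \<circ> X)
          \<longlonglongrightarrow> integral {0..1} ?D"
        by (rule LIMSEQ_offset)
    qed
    then show ?thesis by (auto simp: has_field_derivative_iff)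
  qed
  then show ?thesis
    using holomorphic_on_open[OF T] by blast
qed

section \<open>Holomorphy along curves\<close>

text \<open>
  A function of several complex variables is called holomorphic when its composition with every
  holomorphic curve (``plot'') \<open>c\<close> defined on an open set \<open>T\<close> is holomorphic.  This notion is stable under
  composition, integrals with parameters and uniform limits, and needs only one-variable theory.
  A parameter point is a function \<open>'i \<Rightarrow> complex\<close>; the phase variables are appended as pairs.
\<close>

type_synonym 'a plots = "complex set \<Rightarrow> (complex \<Rightarrow> 'a) \<Rightarrow> bool"

text \<open>A point belongs to the domain when the constant curve at it is a plot; a family of
  curves thus carries its own domain.\<close>

definition plot_dom :: "'a plots \<Rightarrow> 'a set" where
  "plot_dom P = {z. P UNIV (\<lambda>_. z)}"

definition plot_family :: "'a plots \<Rightarrow> bool" where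
  "plot_family P \<longleftrightarrow> (\<forall>T T' c. P T c \<longrightarrow> T' \<subseteq> T \<longrightarrow> P T' c) \<and>
     (\<forall>T c w. P T c \<longrightarrow> w \<in> T \<longrightarrow> c w \<in> plot_dom P)"

definition curve_holomorphic :: "'a plots \<Rightarrow> ('a \<Rightarrow> complex) \<Rightarrow> bool" where
  "curve_holomorphic P F \<longleftrightarrow> (\<forall>T c. open T \<longrightarrow> P T c \<longrightarrow> (\<lambda>w. F (c w)) holomorphic_on T)"

lemma curve_holomorphicD:
  "curve_holomorphic P F \<Longrightarrow> open T \<Longrightarrow> P T c \<Longrightarrow> (\<lambda>w. F (c w)) holomorphic_on T"
  by (auto simp: curve_holomorphic_def)

lemma plot_familyD:
  "plot_family P \<Longrightarrow> P T c \<Longrightarrow> w \<in> T \<Longrightarrow> c w \<in> plot_dom P"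
  "plot_family P \<Longrightarrow> P T c \<Longrightarrow> T' \<subseteq> T \<Longrightarrow> P T' c"
  unfolding plot_family_def by blast+

lemma plot_constant: "plot_family P \<Longrightarrow> z \<in> plot_dom P \<Longrightarrow> P T (\<lambda>_. z)"
  unfolding plot_family_def plot_dom_def by blast

lemma curve_holomorphic_integral:
  fixes F :: "'a \<Rightarrow> real \<Rightarrow> complex"
  assumes P: "plot_family P" and F: "\<And>t. t \<in> {0..1} \<Longrightarrow> curve_holomorphic P (\<lambda>z. F z t)"
    and "\<And>z. z \<in> plot_dom P \<Longrightarrow> continuous_on {0..1} (F z)"
    and "\<And>z t. z \<in> plot_dom P \<Longrightarrow> t \<in> {0..1} \<Longrightarrow> norm (F z t) \<le> M"
  shows "curve_holomorphic P (\<lambda>z. integral {0..1} (F z))"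
  unfolding curve_holomorphic_def
proof (intro allI impI)
  fix T c assume "open T" "P T c"
  then show "(\<lambda>w. integral {0..1} (F (c w))) holomorphic_on T"
    by (intro holomorphic_on_integral_parameter[where M=M])
      (use assms plot_familyD[OF P] curve_holomorphicD[OF F] in auto)
qed

lemma curve_holomorphic_uniform_limit:
  assumes P: "plot_family P" and F: "\<forall>\<^sub>F n in fl. curve_holomorphic P (F n)"
    and lim: "uniform_limit (plot_dom P) F G fl" and fl: "fl \<noteq> bot"
  shows "curve_holomorphic P G"
  unfolding curve_holomorphic_def
proof (intro allI impI)
  fix T c assume T: "open T" and c: "P T c"
  have "\<exists>D. ((\<lambda>w. G (c w)) has_field_derivative D) (at x)" if x: "x \<in> T" for x
  proof -
    obtain d where d: "d > 0" "cball x d \<subseteq> T" using T x open_contains_cball by blast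
    have "(\<lambda>w. G (c w)) holomorphic_on ball x d"
    proof (rule holomorphic_uniform_limit[where f="\<lambda>n w. F n (c w)" and z=x and r=d and F=fl])
      show "\<forall>\<^sub>F n in fl. continuous_on (cball x d) (\<lambda>w. F n (c w)) \<and>
          (\<lambda>w. F n (c w)) holomorphic_on ball x d"
        using F
      proof (eventually_elim, intro conjI)
        fix n assume "curve_holomorphic P (F n)"
        then have h: "(\<lambda>w. F n (c w)) holomorphic_on T" using T c curve_holomorphicD by blast
        then show "(\<lambda>w. F n (c w)) holomorphic_on ball x d"
          by (rule holomorphic_on_subset) (use d ball_subset_cball in blast)
        show "continuous_on (cball x d) (\<lambda>w. F n (c w))"
          using h d holomorphic_on_imp_continuous_on continuous_on_subset by blast
      qed
      show "uniform_limit (cball x d) (\<lambda>n w. F n (c w)) (\<lambda>w. G (c w)) fl"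
        unfolding uniform_limit_iff
      proof (intro allI impI)
        fix e :: real assume "e > 0"
        with lim have "\<forall>\<^sub>F n in fl. \<forall>z\<in>plot_dom P. dist (F n z) (G z) < e"
          by (auto simp: uniform_limit_iff)
        then show "\<forall>\<^sub>F n in fl. \<forall>w\<in>cball x d. dist (F n (c w)) (G (c w)) < e"
          by (rule eventually_mono) (use plot_familyD(1)[OF P c] d in auto)
      qed
    qed (use fl in auto)
    then show ?thesis
      using holomorphic_on_open[of "ball x d"] d by auto
  qed
  then show "(\<lambda>w. G (c w)) holomorphic_on T" using holomorphic_on_open[OF T] by blast
qed

text \<open>Picard iteration, uniform over the domain so that the limit remains holomorphic along
  curves. The target set may depend on the point, which carries reality at real points over to the
  limit. The contraction is stated with a bound uniform in \<open>z\<close>, because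
  \<open>\<T> u z\<close> may use values of \<open>u\<close> at other points.\<close>

lemma curve_holomorphic_fixed_point:
  fixes \<T> :: "('a \<Rightarrow> complex) \<Rightarrow> 'a \<Rightarrow> complex"
  assumes P: "plot_family P"
    and K: "\<And>z. z \<in> plot_dom P \<Longrightarrow> closed (K z) \<and> K z \<subseteq> cball 0 B"
    and B: "B > 0"
    and u0: "curve_holomorphic P u0" "\<And>z. z \<in> plot_dom P \<Longrightarrow> u0 z \<in> K z"
    and T: "\<And>u. curve_holomorphic P u \<Longrightarrow> (\<And>z. z \<in> plot_dom P \<Longrightarrow> u z \<in> K z) \<Longrightarrow>
          curve_holomorphic P (\<T> u) \<and> (\<forall>z\<in>plot_dom P. \<T> u z \<in> K z)"
    and contr: "\<And>u v e. curve_holomorphic P u \<Longrightarrow> curve_holomorphic P v \<Longrightarrow>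
          (\<And>z. z \<in> plot_dom P \<Longrightarrow> u z \<in> K z \<and> v z \<in> K z \<and> norm (u z - v z) \<le> e) \<Longrightarrow>
          \<forall>z\<in>plot_dom P. norm (\<T> u z - \<T> v z) \<le> e / 2"
  obtains u where "curve_holomorphic P u" "\<And>z. z \<in> plot_dom P \<Longrightarrow> u z \<in> K z"
    "\<And>z. z \<in> plot_dom P \<Longrightarrow> \<T> u z = u z"
proof -
  define U where "U n = (\<T> ^^ n) u0" for n
  have U: "curve_holomorphic P (U n)" "\<forall>z\<in>plot_dom P. U n z \<in> K z" for n
    by (induction n) (use u0 T in \<open>auto simp: U_def\<close>)
  have step: "\<forall>z\<in>plot_dom P. norm (U (Suc n) z - U n z) \<le> 2 * B * (1/2) ^ n" for n
  proof (induction n)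
    case 0
    have "norm (U (Suc 0) z - U 0 z) \<le> B + B" if "z \<in> plot_dom P" for z
      using U(2)[of 0] U(2)[of "Suc 0"] K[OF that] that
      by (intro order_trans[OF norm_triangle_ineq4] add_mono) (auto simp: dist_norm)
    then show ?case by simp
  next
    case (Suc n)
    have "\<forall>z\<in>plot_dom P. norm (\<T> (U (Suc n)) z - \<T> (U n) z) \<le> 2 * B * (1/2) ^ n / 2"
      by (rule contr) (use U Suc in auto)
    then show ?case by (simp add: U_def)
  qed
  define G where "G z = u0 z + (\<Sum>i. U (Suc i) z - U i z)" for z
  have "uniform_limit (plot_dom P) (\<lambda>n z. \<Sum>i<n. U (Suc i) z - U i z)
      (\<lambda>z. \<Sum>i. U (Suc i) z - U i z) sequentially"
    by (rule Weierstrass_m_test[where M="\<lambda>n. 2 * B * (1/2) ^ n"])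
      (use step in \<open>auto intro!: summable_mult summable_geometric\<close>)
  moreover have "(\<Sum>i<n. U (Suc i) z - U i z) = U n z - u0 z" for n z
    using sum_lessThan_telescope[of "\<lambda>i. U i z" n] by (simp add: U_def)
  ultimately have lim: "uniform_limit (plot_dom P) U G sequentially"
    by (simp add: uniform_limit_iff G_def dist_norm algebra_simps)
  have G: "curve_holomorphic P G"
    by (rule curve_holomorphic_uniform_limit[OF P _ lim]) (use U in auto)
  have GK: "G z \<in> K z" if z: "z \<in> plot_dom P" for z
    by (rule closed_sequentially[of "K z" "\<lambda>n. U n z"])
      (use K U z tendsto_uniform_limitI[OF lim z] in auto)
  have "\<T> G z = G z" if z: "z \<in> plot_dom P" for z
  proof -
    have "(\<lambda>n. U (Suc n) z) \<longlonglongrightarrow> \<T> G z"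
    proof (rule LIMSEQ_I)
      fix e :: real assume e: "e > 0"
      obtain N where N: "\<And>n z. n \<ge> N \<Longrightarrow> z \<in> plot_dom P \<Longrightarrow> norm (U n z - G z) < e"
        using lim e unfolding uniform_limit_iff eventually_sequentially dist_norm by meson
      have "norm (U (Suc n) z - \<T> G z) < e" if n: "n \<ge> N" for n
      proof -
        have "\<forall>z\<in>plot_dom P. norm (\<T> (U n) z - \<T> G z) \<le> e / 2"
          by (rule contr) (use U G GK N n in \<open>auto intro: less_imp_le\<close>)
        then show ?thesis using z e by (auto simp: U_def intro: le_less_trans)
      qed
      then show "\<exists>no. \<forall>n\<ge>no. norm (U (Suc n) z - \<T> G z) < e" by blast
    qed
    moreover have "(\<lambda>n. U (Suc n) z) \<longlonglongrightarrow> G z"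
      using tendsto_uniform_limitI[OF lim z] by (rule LIMSEQ_Suc)
    ultimately show ?thesis by (rule LIMSEQ_unique)
  qed
  with G GK that show thesis by blast
qed

section \<open>Plots with values in polydiscs\<close>

definition poly_plots :: "real \<Rightarrow> ('i \<Rightarrow> complex) plots" where
  "poly_plots r T c \<longleftrightarrow> (\<forall>i. (\<lambda>w. c w i) holomorphic_on T) \<and> (\<forall>w\<in>T. \<forall>i. norm (c w i) < r)"

definition prod_plots :: "'a plots \<Rightarrow> real \<Rightarrow> ('a \<times> complex) plots" where
  "prod_plots P r T c \<longleftrightarrow> P T (\<lambda>w. fst (c w)) \<and> (\<lambda>w. snd (c w)) holomorphic_on T \<and>
     (\<forall>w\<in>T. norm (snd (c w)) < r)"

lemma plot_dom_poly [simp]: "z \<in> plot_dom (poly_plots r) \<longleftrightarrow> (\<forall>i. norm (z i) < r)"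
  by (auto simp: plot_dom_def poly_plots_def)

lemma plot_dom_prod [simp]: "z \<in> plot_dom (prod_plots P r) \<longleftrightarrow> fst z \<in> plot_dom P \<and> norm (snd z) < r"
  by (auto simp: plot_dom_def prod_plots_def)

lemma plot_family_poly [intro, simp]: "plot_family (poly_plots r)"
  unfolding plot_family_def by (auto simp: poly_plots_def intro: holomorphic_on_subset)

lemma plot_family_prod:
  assumes P: "plot_family P"
  shows "plot_family (prod_plots P r)"
  unfolding plot_family_def
proof (intro conjI allI impI)
  fix T T' c assume "prod_plots P r T c" "T' \<subseteq> T"
  then show "prod_plots P r T' c"
    using plot_familyD(2)[OF P, of T "\<lambda>w. fst (c w)" T']
    by (auto simp: prod_plots_def intro: holomorphic_on_subset)
next
  fix T c w assume "prod_plots P r T c" "w \<in> T"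
  then show "c w \<in> plot_dom (prod_plots P r)"
    using plot_familyD(1)[OF P, of T "\<lambda>w. fst (c w)" w] by (auto simp: prod_plots_def)
qed

lemma prod_plots_Pair [simp]:
  "prod_plots P r T (\<lambda>w. (f w, g w)) \<longleftrightarrow> P T f \<and> g holomorphic_on T \<and> (\<forall>w\<in>T. norm (g w) < r)"
  by (simp add: prod_plots_def)

lemma curve_holomorphic_mono:
  assumes "curve_holomorphic P F" "\<And>T c. P' T c \<Longrightarrow> P T c"
  shows "curve_holomorphic P' F"
  using assms unfolding curve_holomorphic_def by blast

lemma poly_plots_mono: "poly_plots r T c \<Longrightarrow> r \<le> r' \<Longrightarrow> poly_plots r' T c"
  unfolding poly_plots_def by (meson less_le_trans)

lemma prod_plots_mono:
  "prod_plots P r T c \<Longrightarrow> (P T (\<lambda>w. fst (c w)) \<Longrightarrow> P' T (\<lambda>w. fst (c w))) \<Longrightarrow> r \<le> r' \<Longrightarrow>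
    prod_plots P' r' T c"
  unfolding prod_plots_def by (meson less_le_trans)

lemma divide_inverse_minus_1_le:
  fixes \<theta> M :: real
  assumes "0 < \<theta>" "\<theta> \<le> 1 / 2" "0 \<le> M"
  shows "M / (1 / \<theta> - 1) \<le> 2 * M * \<theta>"
proof -
  have "M / (1 / \<theta> - 1) = M * \<theta> / (1 - \<theta>)" using assms by (simp add: field_simps)
  also have "\<dots> \<le> M * \<theta> / (1 / 2)" using assms by (intro divide_left_mono) auto
  finally show ?thesis by simp
qed

text \<open>The point and the centre are joined by the complex line w \<mapsto> (w a, w x), which
  stays in the polydisc for |w| < 1 / \<theta>. Its values at w = 1 and w = 0 are close, because
  this disc is large.\<close>

lemma curve_holomorphic_close_to_0:
  fixes F :: "('i \<Rightarrow> complex) \<times> complex \<Rightarrow> complex"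
  assumes F: "curve_holomorphic (prod_plots (poly_plots r) r) F"
    and M: "\<And>z. z \<in> plot_dom (prod_plots (poly_plots r) r) \<Longrightarrow> norm (F z) \<le> M"
    and \<theta>: "0 < \<theta>" "\<theta> \<le> 1 / 2" and r: "r > 0"
    and a: "\<And>i. norm (a i) \<le> \<theta> * r" and x: "norm x \<le> \<theta> * r"
  shows "norm (F (a, x) - F (\<lambda>_. 0, 0)) \<le> 2 * M * \<theta>"
proof -
  let ?c = "\<lambda>w. (\<lambda>i. w * a i, w * x)"
  have bd: "norm (w * y) < r" if "norm w < 1 / \<theta>" "norm y \<le> \<theta> * r" for w y :: complex
  proof -
    have "norm w * norm y \<le> norm w * (\<theta> * r)" using that by (intro mult_left_mono) auto
    also have "\<dots> < 1 / \<theta> * (\<theta> * r)" using that \<theta> r by (intro mult_strict_right_mono) auto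
    also have "\<dots> = r" using \<theta> by simp
    finally show ?thesis by (simp add: norm_mult)
  qed
  have P: "prod_plots (poly_plots r) r (ball 0 (1/\<theta>)) ?c"
    using bd a x by (auto simp: poly_plots_def intro!: holomorphic_intros)
  have "norm (F (?c 1) - F (?c 0)) \<le> M / (1 / \<theta> - 1) * norm (1 - 0 :: complex)"
  proof (rule holomorphic_bounded_lipschitz[where a=0])
    show "(\<lambda>w. F (?c w)) holomorphic_on ball 0 (1/\<theta>)"
      by (rule curve_holomorphicD[OF F, OF open_ball P])
    show "norm (F (?c w)) \<le> M" if "w \<in> ball 0 (1/\<theta>)" for w
      using plot_familyD(1)[OF plot_family_prod, OF plot_family_poly, OF P, OF that]
      by (intro M) auto
  qed (use \<theta> in \<open>auto simp: field_simps\<close>)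
  moreover have "M / (1 / \<theta> - 1) \<le> 2 * M * \<theta>"
  proof -
    have "norm (F (\<lambda>_. 0, 0)) \<le> M" using r by (intro M) auto
    then have "0 \<le> M" using norm_ge_zero order_trans by blast
    then show ?thesis using \<theta> by (rule divide_inverse_minus_1_le[rotated 2])
  qed
  ultimately show ?thesis by simp
qed

lemma second_order_Taylor_bound:
  fixes g :: "complex \<Rightarrow> complex"
  assumes g: "g holomorphic_on ball 0 R" and M: "\<And>w. w \<in> ball 0 R \<Longrightarrow> norm (g w) \<le> M" and R: "R \<ge> 2"
  shows "norm (g 1 - g 0 - deriv g 0) \<le> 12 * M / R^2"
proof -
  obtain Q where Q: "Q holomorphic_on ball 0 R"
    "\<And>x. x \<in> ball 0 R \<Longrightarrow> g x = (\<Sum>m<2. (deriv ^^ m) g 0 / fact m * x ^ m) + x ^ 2 * Q x"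
    using holomorphic_factor_Taylor[OF g, of 2] by blast
  have Qe: "x ^ 2 * Q x = g x - g 0 - deriv g 0 * x" if "x \<in> ball 0 R" for x
    using Q(2)[OF that] by (simp add: numeral_2_eq_2)
  \<comment> \<open>On the circle of radius R / 2 each of the three terms \<open>g x\<close>,
    \<open>g 0\<close> and \<open>deriv g 0 * x\<close> is at most \<open>M\<close>; hence the
    constant 12.\<close>
  have "norm (Q 1) \<le> 3 * M / (R / 2) ^ 2"
  proof (rule bound_cofactor_power[OF Q(1)])
    show "norm (x ^ 2 * Q x) \<le> 3 * M" if x: "norm x = R / 2" for x
    proof -
      have xb: "x \<in> ball 0 R" using x R by auto
      have "norm (deriv g 0) \<le> M / R" using norm_deriv_le_bound[OF g _ M] R by auto
      then have "norm (deriv g 0 * x) \<le> M / R * R"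
        using x R unfolding norm_mult by (intro mult_mono) (auto intro: order_trans[OF norm_ge_zero])
      then have d: "norm (deriv g 0 * x) \<le> M" using R by simp
      have "norm (x ^ 2 * Q x) \<le> norm (g x) + norm (g 0) + norm (deriv g 0 * x)"
        unfolding Qe[OF xb] by norm
      also have "\<dots> \<le> M + M + M" using M[OF xb] M[of 0] R d by (intro add_mono) auto
      finally show ?thesis by simp
    qed
  qed (use R in auto)
  then show ?thesis using Qe[of 1] R by (simp add: power_divide)
qed

text \<open>Holomorphy along curves yields derivatives along complex lines. Boundedness upgrades
  this: mixed second differences are quadratically small, so the directional derivative is additive,
  and the Taylor remainder is uniform in the direction. Both conclusions serve the open mapping
  theorem for the Lyapunov coefficients.\<close>

lemma curve_holomorphic_differentiable_at_0:
  fixes G :: "('i::finite \<Rightarrow> complex) \<Rightarrow> complex"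
  assumes G: "curve_holomorphic (poly_plots r) G" and r: "r > 0"
    and M: "\<And>a. (\<And>i. norm (a i) < r) \<Longrightarrow> norm (G a) \<le> M"
  defines "E \<equiv> \<lambda>h :: real ^ 'i. G (\<lambda>i. of_real (h $ i))"
  shows "continuous_on (ball 0 r) E" "E differentiable (at 0)"
proof -
  have lineP: "poly_plots r (ball 0 R) (\<lambda>w i. a i + w * b i)"
    if "\<forall>i w. norm w < R \<longrightarrow> norm (a i + w * b i) < r" for a b R
    using that by (auto simp: poly_plots_def intro!: holomorphic_intros)
  have line1: "(\<lambda>w. G (\<lambda>i. a i + w * b i)) holomorphic_on ball 0 R"
    if "\<forall>i w. norm w < R \<longrightarrow> norm (a i + w * b i) < r" for a b R
    by (rule curve_holomorphicD[OF G, OF open_ball, OF lineP[OF that]])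
  have line2: "norm (G (\<lambda>i. a i + w * b i)) \<le> M"
    if "\<forall>i w. norm w < R \<longrightarrow> norm (a i + w * b i) < r" "w \<in> ball 0 R" for a b R w
    using that by (intro M) auto
  have comp: "norm (complex_of_real (h $ i)) \<le> norm h" for h :: "real ^ 'i" and i
    using component_le_norm_cart[of h i] by simp
  have "norm (G (\<lambda>_. 0)) \<le> M" using r by (intro M) auto
  then have M0: "M \<ge> 0" using norm_ge_zero order_trans by blast
  have lip: "norm (G (\<lambda>i. a i + b i) - G a) \<le> 2 * M * \<delta> / d"
    if a: "\<And>i. norm (a i) \<le> r - d" and b: "\<And>i. norm (b i) \<le> \<delta>" and d: "0 < \<delta>" "\<delta> \<le> d / 2" for a b d \<delta>
  proof -
    have wr: "\<forall>i w. norm w < d / \<delta> \<longrightarrow> norm (a i + w * b i) < r"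
    proof (intro allI impI)
      fix i and w :: complex assume w: "norm w < d / \<delta>"
      have "norm (w * b i) \<le> norm w * \<delta>" unfolding norm_mult using b by (intro mult_left_mono) auto
      also have "\<dots> < d" using w d by (simp add: field_simps)
      finally show "norm (a i + w * b i) < r" using a[of i] norm_triangle_ineq[of "a i" "w * b i"] by linarith
    qed
    have "norm (G (\<lambda>i. a i + 1 * b i) - G (\<lambda>i. a i + 0 * b i))
        \<le> M / (d / \<delta> - 1) * norm (1 - 0 :: complex)"
      by (rule holomorphic_bounded_lipschitz[where a=0, OF line1[OF wr] line2[OF wr]]) (use d in \<open>auto simp: field_simps\<close>)
    also have "\<dots> \<le> 2 * M * \<delta> / d"
    proof -
      have "M / (1 / (\<delta> / d) - 1) \<le> 2 * M * (\<delta> / d)"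
        using d M0 by (intro divide_inverse_minus_1_le) (auto simp: field_simps)
      then show ?thesis by simp
    qed
    finally show ?thesis by simp
  qed
  show "continuous_on (ball 0 r) E"
  proof (rule continuous_at_imp_continuous_on, intro ballI)
    fix u :: "real ^ 'i" assume u: "u \<in> ball 0 r"
    define d where "d = r - norm u"
    have d: "d > 0" using u by (simp add: d_def)
    have ev: "\<forall>\<^sub>F x in at u. norm (x - u) < d / 2 \<and> x \<noteq> u"
      using d by (auto simp: eventually_at dist_norm intro!: exI[of _ "d/2"])
    have "\<forall>\<^sub>F x in at u. norm (E x - E u) \<le> 2 * M * norm (x - u) / d"
      using ev
    proof eventually_elim
      fix x assume x: "norm (x - u) < d / 2 \<and> x \<noteq> u"
      have "norm (G (\<lambda>i. of_real (u $ i) + of_real ((x - u) $ i)) - G (\<lambda>i. of_real (u $ i)))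
          \<le> 2 * M * norm (x - u) / d"
        using x comp[of u] comp[of "x - u"] by (intro lip) (auto simp: d_def)
      then show "norm (E x - E u) \<le> 2 * M * norm (x - u) / d" by (simp add: E_def)
    qed
    moreover have "((\<lambda>x. 2 * M * norm (x - u) / d) \<longlongrightarrow> 2 * M * norm (u - u) / d) (at u)"
      by (intro tendsto_intros) (use d in auto)
    ultimately have "((\<lambda>x. E x - E u) \<longlongrightarrow> 0) (at u)"
      using Lim_null_comparison by force
    then show "isCont E u" unfolding isCont_def using Lim_null by blast
  qed
  \<comment> \<open>The Lipschitz estimate is used twice: the difference over \<open>a\<close> is of
    order \<delta> by \<open>lip\<close>, and this bound makes its variation in the direction
    \<open>b\<close> of order \<delta>^2.\<close>
  have mixed: "norm (G (\<lambda>i. a i + b i) - G a - G b + G (\<lambda>_. 0)) \<le> 16 * M * \<delta>^2 / r^2"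
    if a: "\<And>i. norm (a i) \<le> \<delta>" and b: "\<And>i. norm (b i) \<le> \<delta>" and d: "0 < \<delta>" "\<delta> \<le> r / 4" for a b \<delta>
  proof -
    let ?R = "r / (2 * \<delta>)"
    let ?h = "\<lambda>w. G (\<lambda>i. a i + w * b i) - G (\<lambda>i. 0 + w * b i)"
    have wb: "norm (w * b i) < r / 2" if "norm w < ?R" for w i
    proof -
      have "norm (w * b i) \<le> norm w * \<delta>" unfolding norm_mult using b by (intro mult_left_mono) auto
      also have "\<dots> < r / 2" using that d by (simp add: field_simps)
      finally show ?thesis .
    qed
    have 1: "\<forall>i w. norm w < ?R \<longrightarrow> norm (a i + w * b i) < r"
    proof (intro allI impI)
      fix i and w :: complex assume "norm w < ?R"
      then show "norm (a i + w * b i) < r"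
        using wb[of w i] a[of i] d norm_triangle_ineq[of "a i" "w * b i"] r by linarith
    qed
    have 2: "\<forall>i w. norm w < ?R \<longrightarrow> norm (0 + w * b i) < r"
    proof (intro allI impI)
      fix i and w :: complex assume "norm w < ?R"
      then show "norm (0 + w * b i) < r" using wb[of w i] r by simp
    qed
    have hol: "?h holomorphic_on ball 0 ?R"
      by (rule holomorphic_on_diff[OF line1[OF 1] line1[OF 2]])
    have hb: "norm (?h w) \<le> 4 * M * \<delta> / r" if w: "w \<in> ball 0 ?R" for w
    proof -
      have "norm (G (\<lambda>i. w * b i + a i) - G (\<lambda>i. w * b i)) \<le> 2 * M * \<delta> / (r / 2)"
        using wb[of w] w a d by (intro lip) (auto intro: less_imp_le)
      then show ?thesis by (simp add: add.commute)
    qed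
    have "norm (?h 1 - ?h 0) \<le> 4 * M * \<delta> / r / (?R - 1) * norm (1 - 0 :: complex)"
      by (rule holomorphic_bounded_lipschitz[OF hol hb]) (use d in \<open>auto simp: field_simps\<close>)
    also have "\<dots> \<le> 4 * M * \<delta> / r * (4 * \<delta> / r)"
    proof -
      have "4 * M * \<delta> / r / (1 / (2 * \<delta> / r) - 1) \<le> 2 * (4 * M * \<delta> / r) * (2 * \<delta> / r)"
        using d r M0 by (intro divide_inverse_minus_1_le) (auto simp: field_simps)
      then show ?thesis by (simp add: mult.commute)
    qed
    also have "\<dots> \<le> 16 * M * \<delta>^2 / r^2" using M0 by (simp add: power2_eq_square field_simps)
    finally show ?thesis by (simp add: algebra_simps)
  qed
  define D where "D b = deriv (\<lambda>w. G (\<lambda>i. w * b i)) 0" for b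
  have line0: "norm (w * b i) < r" if "norm w < r / \<delta>" "\<And>i. norm (b i) \<le> \<delta>" "0 < \<delta>" for w \<delta> i and b :: "'i \<Rightarrow> complex"
  proof -
    have "norm (w * b i) \<le> norm w * \<delta>" unfolding norm_mult using that by (intro mult_left_mono) auto
    also have "\<dots> < r" using that by (simp add: field_simps)
    finally show ?thesis .
  qed
  have Dlim: "((\<lambda>w. (G (\<lambda>i. w * b i) - G (\<lambda>_. 0)) / w) \<longlongrightarrow> D b) (at 0)"
    and Dhas: "((\<lambda>w. G (\<lambda>i. w * b i)) has_field_derivative D b) (at 0)" for b
  proof -
    obtain \<delta> where \<delta>: "\<delta> > 0" "\<And>i. norm (b i) \<le> \<delta>"
    proof
      show "norm (b i) \<le> (\<Sum>i\<in>UNIV. norm (b i)) + 1" for i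
        using member_le_sum[of i UNIV "\<lambda>i. norm (b i)"] by simp
    qed (simp add: add_nonneg_pos sum_nonneg)
    have "(\<lambda>w. G (\<lambda>i. 0 + w * b i)) holomorphic_on ball 0 (r / \<delta>)"
      using line0[of _ \<delta> b] \<delta> by (intro line1) auto
    then show "((\<lambda>w. G (\<lambda>i. w * b i)) has_field_derivative D b) (at 0)"
      unfolding D_def using \<delta> r by (intro holomorphic_derivI[of _ "ball 0 (r/\<delta>)"]) auto
    then show "((\<lambda>w. (G (\<lambda>i. w * b i) - G (\<lambda>_. 0)) / w) \<longlongrightarrow> D b) (at 0)"
      by (simp add: has_field_derivative_iff)
  qed
  \<comment> \<open>Dividing \<open>mixed\<close> for w a and w b by |w| leaves an error of order
    |w|, which disappears in the limit.\<close>
  have Dadd: "D (\<lambda>i. a i + b i) = D a + D b" for a b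
  proof -
    obtain \<delta> where \<delta>: "\<delta> > 0" "\<And>i. norm (a i) \<le> \<delta>" "\<And>i. norm (b i) \<le> \<delta>"
    proof
      show "norm (b i) \<le> (\<Sum>i\<in>UNIV. norm (a i)) + (\<Sum>i\<in>UNIV. norm (b i)) + 1"
        "norm (a i) \<le> (\<Sum>i\<in>UNIV. norm (a i)) + (\<Sum>i\<in>UNIV. norm (b i)) + 1" for i
        using member_le_sum[of i UNIV "\<lambda>i. norm (b i)"] member_le_sum[of i UNIV "\<lambda>i. norm (a i)"]
          sum_nonneg[of UNIV "\<lambda>i. norm (a i)"] sum_nonneg[of UNIV "\<lambda>i. norm (b i)"]
        by simp_all
    qed (simp add: add_nonneg_pos sum_nonneg)
    let ?q = "\<lambda>b w. (G (\<lambda>i. w * b i) - G (\<lambda>_. 0)) / w"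
    have "\<forall>\<^sub>F w in at 0. norm (?q (\<lambda>i. a i + b i) w - ?q a w - ?q b w) \<le> 16 * M * \<delta>^2 / r^2 * norm w"
    proof -
      have "\<forall>\<^sub>F w in at (0::complex). norm w < r / 4 / \<delta> \<and> w \<noteq> 0"
        using r \<delta> by (auto simp: eventually_at dist_norm intro!: exI[of _ "r/4/\<delta>"])
      then show ?thesis
      proof eventually_elim
        fix w :: complex assume w: "norm w < r / 4 / \<delta> \<and> w \<noteq> 0"
        have "norm (G (\<lambda>i. w * a i + w * b i) - G (\<lambda>i. w * a i) - G (\<lambda>i. w * b i) + G (\<lambda>_. 0))
          \<le> 16 * M * (norm w * \<delta>)^2 / r^2"
          using w \<delta> by (intro mixed) (auto simp: norm_mult mult_left_mono field_simps)
        then have "norm (G (\<lambda>i. w * a i + w * b i) - G (\<lambda>i. w * a i) - G (\<lambda>i. w * b i) + G (\<lambda>_. 0)) / norm w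
          \<le> 16 * M * (norm w * \<delta>)^2 / r^2 / norm w" by (intro divide_right_mono) auto
        also have "\<dots> = 16 * M * \<delta>^2 / r^2 * norm w" using w by (simp add: power2_eq_square field_simps)
        finally show "norm (?q (\<lambda>i. a i + b i) w - ?q a w - ?q b w) \<le> 16 * M * \<delta>^2 / r^2 * norm w"
          using w by (simp add: norm_divide[symmetric] diff_divide_distrib add_divide_distrib algebra_simps)
      qed
    qed
    moreover have "((\<lambda>w::complex. 16 * M * \<delta>^2 / r^2 * norm w) \<longlongrightarrow> 16 * M * \<delta>^2 / r^2 * norm (0::complex)) (at 0)"
      by (intro tendsto_intros)
    ultimately have l1: "((\<lambda>w. ?q (\<lambda>i. a i + b i) w - ?q a w - ?q b w) \<longlongrightarrow> 0) (at 0)"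
      using Lim_null_comparison by force
    have l2: "((\<lambda>w. ?q (\<lambda>i. a i + b i) w - ?q a w - ?q b w)
        \<longlongrightarrow> D (\<lambda>i. a i + b i) - D a - D b) (at 0)"
      by (intro tendsto_diff Dlim)
    have "D (\<lambda>i. a i + b i) - D a - D b = 0"
      by (rule tendsto_unique[OF _ l2 l1]) simp
    then show ?thesis by (simp add: algebra_simps)
  qed
  have Dscale: "D (\<lambda>i. s * b i) = s * D b" for s b
  proof -
    have g: "((\<lambda>w. s * w) has_field_derivative s) (at 0)"
      by (auto intro!: derivative_eq_intros)
    have "((\<lambda>w. G (\<lambda>i. w * b i)) has_field_derivative D b) (at (s * 0))" using Dhas by simp
    from DERIV_chain2[OF this g]
    have "((\<lambda>w. G (\<lambda>i. (s * w) * b i)) has_field_derivative s * D b) (at 0)"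
      by (simp only: mult.commute[of "D b" s])
    then show ?thesis using Dhas[of "\<lambda>i. s * b i"] by (simp add: mult_ac DERIV_unique)
  qed
  have quad: "norm (G b - G (\<lambda>_. 0) - D b) \<le> 12 * M / r^2 * \<delta>^2"
    if b: "\<And>i. norm (b i) \<le> \<delta>" and d: "0 < \<delta>" "\<delta> \<le> r / 2" for b \<delta>
  proof -
    have 0: "\<forall>i w. norm w < r / \<delta> \<longrightarrow> norm (0 + w * b i) < r"
    proof (intro allI impI)
      fix i and w :: complex assume "norm w < r / \<delta>"
      from line0[OF this b d(1)] show "norm (0 + w * b i) < r" by simp
    qed
    have "norm (G (\<lambda>i. 0 + 1 * b i) - G (\<lambda>i. 0 + 0 * b i) - deriv (\<lambda>w. G (\<lambda>i. 0 + w * b i)) 0) \<le> 12 * M / (r / \<delta>)^2"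
      using d by (intro second_order_Taylor_bound[OF line1[OF 0] line2[OF 0]]) (auto simp: field_simps)
    then show ?thesis by (simp add: D_def power_divide)
  qed
  define L where "L h = D (\<lambda>i. of_real (h $ i))" for h :: "real ^ 'i"
  have "linear L"
  proof (rule linearI)
    show "L (g + h) = L g + L h" for g h by (simp add: L_def Dadd)
    show "L (s *\<^sub>R h) = s *\<^sub>R L h" for s h
    proof -
      have "L (s *\<^sub>R h) = D (\<lambda>i. of_real s * of_real (vec_nth h i))" by (simp add: L_def)
      also have "\<dots> = of_real s * L h" by (simp only: Dscale L_def)
      finally show ?thesis by (simp only: scaleR_conv_of_real)
    qed
  qed
  then have bl: "bounded_linear L" by (simp add: linear_conv_bounded_linear)
  have "((\<lambda>h. norm (E (0 + h) - E 0 - L h) / norm h) \<longlongrightarrow> 0) (at 0)"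
  proof -
    have "\<forall>\<^sub>F h in at (0::real^'i). norm h < r / 2 \<and> h \<noteq> 0"
      using r by (auto simp: eventually_at dist_norm intro!: exI[of _ "r/2"])
    then have "\<forall>\<^sub>F h in at 0. norm (norm (E (0 + h) - E 0 - L h) / norm h) \<le> 12 * M / r^2 * norm h"
    proof eventually_elim
      fix h :: "real^'i" assume h: "norm h < r / 2 \<and> h \<noteq> 0"
      have "norm (E h - E 0 - L h) \<le> 12 * M / r^2 * (norm h)^2"
        using quad[of "\<lambda>i. of_real (h $ i)" "norm h"] h comp by (simp add: E_def L_def)
      then have "norm (E h - E 0 - L h) / norm h \<le> 12 * M / r^2 * (norm h)^2 / norm h"
        by (intro divide_right_mono) auto
      then show "norm (norm (E (0 + h) - E 0 - L h) / norm h) \<le> 12 * M / r^2 * norm h"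
        using h by (simp add: power2_eq_square)
    qed
    moreover have "((\<lambda>h::real^'i. 12 * M / r^2 * norm h) \<longlongrightarrow> 0) (at 0)"
      by (rule tendsto_mult_right_zero, rule tendsto_norm_zero, rule tendsto_ident_at)
    ultimately show ?thesis by (rule Lim_null_comparison)
  qed
  with bl have "(E has_derivative L) (at 0)" unfolding has_derivative_at by blast
  then show "E differentiable (at 0)" unfolding differentiable_def by blast
qed

section \<open>Complexification of real power series\<close>

definition complexified_inner :: "((('n::finite \<Rightarrow> complex) \<times> complex) \<times> complex) \<Rightarrow> (real ^ 'n) \<times> real \<times> real \<Rightarrow> complex"
  where "complexified_inner z b = (\<Sum>i\<in>UNIV. fst (fst z) i * of_real (vec_nth (fst b) i))
     + snd (fst z) * of_real (fst (snd b)) + snd z * of_real (snd (snd b))"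

lemma complexified_inner_of_real:
  "complexified_inner ((\<lambda>i. of_real (vec_nth h i), of_real x), of_real y) b = of_real ((h, x, y) \<bullet> b)"
  by (simp add: complexified_inner_def inner_prod_def inner_vec_def)

lemma norm_complexified_inner_Basis:
  fixes b :: "(real ^ 'n::finite) \<times> real \<times> real"
  assumes b: "b \<in> Basis" and a: "\<And>i. norm (fst (fst z) i) \<le> r" "norm (snd (fst z)) \<le> r" "norm (snd z) \<le> r"
  shows "norm (complexified_inner z b) \<le> r"
proof -
  from b consider (1) u where "u \<in> (Basis :: (real ^ 'n) set)" "b = (u, 0)" | (2) "b = (0, 1, 0)" | (3) "b = (0, 0, 1)"
    unfolding Basis_prod_def by (auto simp: zero_prod_def)
  then show ?thesis
  proof cases
    case 1
    then obtain j where "b = (axis j 1, 0)" by (force simp: Basis_vec_def)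
    then have "complexified_inner z b
        = (\<Sum>i\<in>UNIV. fst (fst z) i * of_real (if i = j then 1 else 0))"
      by (simp add: complexified_inner_def axis_def)
    also have "\<dots> = (\<Sum>i\<in>UNIV. if i = j then fst (fst z) i else 0)"
      by (intro sum.cong) auto
    finally have "complexified_inner z b = fst (fst z) j" by simp
    then show ?thesis using a(1) by simp
  next
    case 2
    then show ?thesis using a(2) by (simp add: complexified_inner_def)
  next
    case 3
    then show ?thesis using a(3) by (simp add: complexified_inner_def)
  qed
qed

text \<open>Unconditional convergence at the one real point with all coordinates equal to
  \<open>s\<close> is absolute convergence, and its terms dominate those at every point of the
  complex polydisc of radius \<open>s\<close>. The partial sums are polynomials, so the limit is
  holomorphic along curves.\<close>

lemma power_series_complex_extension:
  fixes f :: "(real ^ 'n::finite) \<times> real \<times> real \<Rightarrow> real" and c :: "((real ^ 'n) \<times> real \<times> real \<Rightarrow> nat) \<Rightarrow> real"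
  assumes r: "r > 0"
    and hs: "\<And>z. norm z < r \<Longrightarrow>
      ((\<lambda>\<alpha>. (\<Prod>b\<in>Basis. (z \<bullet> b) ^ \<alpha> b) * c \<alpha>) has_sum f z) (Basis \<rightarrow>\<^sub>E UNIV)"
  shows "\<exists>s>0. \<exists>F M. curve_holomorphic (prod_plots (prod_plots (poly_plots s) s) s) F \<and>
    (\<forall>z\<in>plot_dom (prod_plots (prod_plots (poly_plots s) s) s). norm (F z) \<le> M) \<and>
    (\<forall>h x y. (\<forall>i. \<bar>vec_nth h i\<bar> < s) \<longrightarrow> \<bar>x\<bar> < s \<longrightarrow> \<bar>y\<bar> < s \<longrightarrow>
      F ((\<lambda>i. of_real (vec_nth h i), of_real x), of_real y) = of_real (f (h, x, y)))"
proof -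
  let ?B = "Basis :: ((real ^ 'n) \<times> real \<times> real) set"
  let ?A = "?B \<rightarrow>\<^sub>E (UNIV :: nat set)"
  define K where "K = real (card ?B)"
  have K: "K \<ge> 0" by (simp add: K_def)
  \<comment> \<open>With \<open>K\<close> coordinates of modulus at most \<open>s\<close>, a point
    has norm at most K s, which is less than \<open>r\<close>.\<close>
  define s where "s = r / (2 * (K + 1))"
  have s: "s > 0" using r K by (simp add: s_def)
  let ?P = "prod_plots (prod_plots (poly_plots s) s) s :: ((('n \<Rightarrow> complex) \<times> complex) \<times> complex) plots"
  have norm_lt: "norm z < r" if "\<And>b. b \<in> ?B \<Longrightarrow> \<bar>z \<bullet> b\<bar> \<le> s" for z
  proof -
    have "norm z \<le> (\<Sum>b\<in>?B. \<bar>z \<bullet> b\<bar>)" by (rule norm_le_l1)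
    also have "\<dots> \<le> K * s" unfolding K_def using that by (rule sum_bounded_above)
    also have "\<dots> < r"
    proof -
      have "K * r < 2 * (K + 1) * r" using r K by (intro mult_strict_right_mono) auto
      then show ?thesis using K by (simp add: s_def divide_simps mult_ac)
    qed
    finally show ?thesis .
  qed
  define M where "M \<alpha> = (\<Prod>b\<in>?B. s ^ \<alpha> b) * \<bar>c \<alpha>\<bar>" for \<alpha>
  have M: "M summable_on ?A"
  proof -
    define z where "z = (\<Sum>b\<in>?B. s *\<^sub>R b)"
    have zb: "z \<bullet> b = s" if "b \<in> ?B" for b
    proof -
      have "z \<bullet> b = (\<Sum>b'\<in>?B. if b' = b then s else 0)"
        unfolding z_def inner_sum_left using that by (intro sum.cong) (auto simp: inner_Basis)
      then show ?thesis using that by simp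
    qed
    have "norm z < r" by (rule norm_lt) (use zb s in auto)
    from hs[OF this] have "(\<lambda>\<alpha>. (\<Prod>b\<in>?B. (z \<bullet> b) ^ \<alpha> b) * c \<alpha>) summable_on ?A"
      by (rule has_sum_imp_summable)
    then have "(\<lambda>\<alpha>. norm ((\<Prod>b\<in>?B. (z \<bullet> b) ^ \<alpha> b) * c \<alpha>)) summable_on ?A"
      by (rule summable_on_iff_abs_summable_on_real[THEN iffD1])
    moreover have "norm ((\<Prod>b\<in>?B. (z \<bullet> b) ^ \<alpha> b) * c \<alpha>) = M \<alpha>" for \<alpha>
      using s zb by (simp add: M_def abs_mult abs_prod power_abs)
    ultimately show ?thesis by simp
  qed
  define t where "t \<alpha> z = (\<Prod>b\<in>?B. complexified_inner z b ^ \<alpha> b) * of_real (c \<alpha>)" for \<alpha> z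
  define F where "F z = (\<Sum>\<^sub>\<infinity>\<alpha>\<in>?A. t \<alpha> z)" for z
  have tM: "norm (t \<alpha> z) \<le> M \<alpha>" if "z \<in> plot_dom ?P" for \<alpha> z
  proof -
    have "norm (complexified_inner z b) \<le> s" if "b \<in> ?B" for b
      using \<open>z \<in> plot_dom ?P\<close> that by (intro norm_complexified_inner_Basis) (auto intro: less_imp_le)
    then have "(\<Prod>b\<in>?B. norm (complexified_inner z b) ^ \<alpha> b) \<le> (\<Prod>b\<in>?B. s ^ \<alpha> b)"
      by (intro prod_mono) (auto intro: power_mono)
    then show ?thesis by (simp add: t_def M_def norm_mult prod_norm[symmetric] norm_power mult_right_mono)
  qed
  have lim: "uniform_limit (plot_dom ?P) (\<lambda>X z. \<Sum>\<alpha>\<in>X. t \<alpha> z) F (finite_subsets_at_top ?A)"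
    unfolding F_def by (rule Weierstrass_m_test_general[OF _ M]) (rule tM)
  have hol: "curve_holomorphic ?P (\<lambda>z. \<Sum>\<alpha>\<in>X. t \<alpha> z)" for X
    unfolding curve_holomorphic_def
  proof (intro allI impI)
    fix T :: "complex set" and cv assume T: "open T" and cv: "?P T cv"
    have c: "(\<lambda>w. fst (fst (cv w)) i) holomorphic_on T" "(\<lambda>w. snd (fst (cv w))) holomorphic_on T"
      "(\<lambda>w. snd (cv w)) holomorphic_on T" for i
      using cv by (simp_all add: prod_plots_def poly_plots_def)
    show "(\<lambda>w. \<Sum>\<alpha>\<in>X. t \<alpha> (cv w)) holomorphic_on T"
      unfolding t_def complexified_inner_def
      by (intro holomorphic_on_sum holomorphic_on_prod holomorphic_on_mult holomorphic_on_power
          holomorphic_on_add holomorphic_on_const c)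
  qed
  have F1: "curve_holomorphic ?P F"
  proof (rule curve_holomorphic_uniform_limit[OF _ _ lim])
    show "plot_family ?P" by (intro plot_family_prod plot_family_poly)
    show "\<forall>\<^sub>F X in finite_subsets_at_top ?A. curve_holomorphic ?P (\<lambda>z. \<Sum>\<alpha>\<in>X. t \<alpha> z)"
      using hol by simp
  qed simp
  have F2: "norm (F z) \<le> (\<Sum>\<^sub>\<infinity>\<alpha>\<in>?A. M \<alpha>)" if z: "z \<in> plot_dom ?P" for z
  proof -
    have "(\<lambda>\<alpha>. norm (t \<alpha> z)) summable_on ?A"
      by (rule summable_on_comparison_test[OF M]) (use tM[OF z] in auto)
    then have "(\<lambda>\<alpha>. t \<alpha> z) summable_on ?A" by (rule abs_summable_summable)
    then have "((\<lambda>\<alpha>. t \<alpha> z) has_sum F z) ?A" unfolding F_def by (rule has_sum_infsum)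
    then show ?thesis using has_sum_infsum[OF M] by (rule norm_infsum_le) (rule tM[OF z])
  qed
  have F3: "F ((\<lambda>i. of_real (vec_nth h i), of_real x), of_real y) = of_real (f (h, x, y))"
    if h: "\<forall>i. \<bar>vec_nth h i\<bar> < s" and x: "\<bar>x\<bar> < s" and y: "\<bar>y\<bar> < s" for h x y
  proof -
    let ?z = "((\<lambda>i. complex_of_real (vec_nth h i), complex_of_real x), complex_of_real y)"
    have "\<bar>(h, x, y) \<bullet> b\<bar> \<le> s" if "b \<in> ?B" for b
    proof -
      have "norm (complexified_inner ?z b) \<le> s"
        using h x y that by (intro norm_complexified_inner_Basis) (auto intro: less_imp_le)
      then show ?thesis by (simp only: complexified_inner_of_real norm_of_real)
    qed
    then have "norm (h, x, y) < r" by (rule norm_lt)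
    from has_sum_of_real[OF hs[OF this], where 'a=complex]
    have "((\<lambda>\<alpha>. t \<alpha> ?z) has_sum of_real (f (h, x, y))) ?A"
      by (simp add: t_def complexified_inner_of_real)
    then show ?thesis unfolding F_def by (rule infsumI)
  qed
  show ?thesis
    by (rule exI[of _ s], rule conjI[OF s], rule exI[of _ F], rule exI, intro conjI ballI allI impI)
      (rule F1 F2 F3; assumption?)+
qed

abbreviation "plots2 r \<equiv> prod_plots (poly_plots r) r"
abbreviation "plots3 r \<equiv> prod_plots (plots2 r) r"

lemmas plot_family_intros = plot_family_prod plot_family_poly

lemma norm_linepath_less:
  fixes x y :: complex
  assumes "norm x < r" "norm y < r" "t \<in> {0..1}"
  shows "norm (linepath x y t) < r"
  using convexD[OF convex_ball[of 0 r], of x y "1 - t" t] assms by (simp add: linepath_def)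

lemma integral_in_Reals:
  fixes g :: "real \<Rightarrow> complex"
  assumes "\<And>t. t \<in> {0..1} \<Longrightarrow> g t \<in> \<real>"
  shows "integral {0..1} g \<in> \<real>"
proof -
  have "Im (integral {0..1} g) = 0"
  proof (cases "g integrable_on {0..1}")
    case True
    then have "Im (integral {0..1} g) = integral {0..1} (\<lambda>t. Im (g t))"
      using integral_linear[OF True bounded_linear_Im] by (simp add: o_def)
    also have "\<dots> = integral {0..1} (\<lambda>_::real. 0)"
      by (rule integral_cong) (use assms in \<open>auto simp: complex_is_Real_iff\<close>)
    finally show ?thesis by simp
  qed (simp add: not_integrable_integral)
  then show ?thesis by (simp add: complex_is_Real_iff)
qed

definition real_point :: "(('i \<Rightarrow> complex) \<times> complex) \<times> complex \<Rightarrow> bool" where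
  "real_point z \<longleftrightarrow> (\<forall>i. fst (fst z) i \<in> \<real>) \<and> snd (fst z) \<in> \<real> \<and> snd z \<in> \<real>"

section \<open>Complexified orbits near a contact\<close>

text \<open>\<open>f ((a, x), y)\<close> stands for the complexified quotient Y / X at the parameter
  \<open>a\<close>. This locale solves dy/ds = f; the order of contact enters only in
  \<open>complex_contact\<close>.\<close>

locale complex_slope =
  fixes f :: "(('i \<Rightarrow> complex) \<times> complex) \<times> complex \<Rightarrow> complex" and r N :: real
  assumes r: "r > 0" and N: "N > 0"
    and hol: "curve_holomorphic (plots3 r) f"
    and bound: "\<And>z. z \<in> plot_dom (plots3 r) \<Longrightarrow> norm (f z) \<le> N"
    and real: "\<And>z. z \<in> plot_dom (plots3 r) \<Longrightarrow> real_point z \<Longrightarrow> f z \<in> \<real>"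
begin

definition L where "L = 2 * N / r"
text \<open>Segments between points of modulus below \<open>r1\<close> are shorter than
  \<open>2 * r1\<close>. The choice bounds the Picard integrals by r / 4, inside the disc of radius
  r / 2 of the iteration, and makes the Picard map contract by the factor 1/2.\<close>

definition r1 where "r1 = r / (8 * (N + 1))"

lemma r1: "r1 > 0" "r1 \<le> r / 8" "2 * r1 * N \<le> r / 4" "2 * r1 * L \<le> 1 / 2" "L > 0"
proof -
  show "r1 > 0" "L > 0" using r N by (auto simp: r1_def L_def)
  show "r1 \<le> r / 8" using r N by (simp add: r1_def field_simps)
  show "2 * r1 * N \<le> r / 4" using r N by (simp add: r1_def field_simps)
  show "2 * r1 * L \<le> 1 / 2" using r N by (simp add: r1_def L_def field_simps)
qed

lemma lipschitz:
  assumes z: "z \<in> plot_dom (plots2 r)" and y: "norm y \<le> r / 2" "norm y' \<le> r / 2"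
  shows "norm (f (z, y) - f (z, y')) \<le> L * norm (y - y')"
proof -
  have "plots2 r (ball 0 r) (\<lambda>_. z)"
    using plot_constant[OF plot_family_prod, OF plot_family_poly, OF z] .
  then have "plots3 r (ball 0 r) (\<lambda>y. (z, y))" by (auto intro: holomorphic_intros)
  then have h: "(\<lambda>y. f (z, y)) holomorphic_on ball 0 r"
    by (rule curve_holomorphicD[OF hol, OF open_ball])
  have "norm (f (z, y) - f (z, y')) \<le> N / (r - r / 2) * norm (y - y')"
    by (rule holomorphic_bounded_lipschitz[OF h]) (use z y r bound in auto)
  then show ?thesis by (simp add: L_def mult.commute)
qed

text \<open>With \<open>z = ((a, x), s)\<close> this is the integral of f(a, \<xi>, u(a, x, \<xi>))
  over the segment from \<open>x\<close> to \<open>s\<close>. Written over [0, 1] it has an interval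
  of integration that does not depend on \<open>z\<close>.\<close>

definition picard :: "((('i \<Rightarrow> complex) \<times> complex) \<times> complex \<Rightarrow> complex) \<Rightarrow> (('i \<Rightarrow> complex) \<times> complex) \<times> complex \<Rightarrow> complex"
  where "picard u z = integral {0..1} (\<lambda>t.
    f ((fst (fst z), linepath (snd (fst z)) (snd z) t), u (fst z, linepath (snd (fst z)) (snd z) t))
      * (snd z - snd (fst z)))"

text \<open>Reality at real points is built into the set on which the iteration runs, so the fixed
  point inherits it.\<close>

definition range_set :: "(('i \<Rightarrow> complex) \<times> complex) \<times> complex \<Rightarrow> complex set" where
  "range_set z = (if real_point z then \<real> \<inter> cball 0 (r / 2) else cball 0 (r / 2))"

lemma range_set_norm: "y \<in> range_set z \<Longrightarrow> norm y \<le> r / 2"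
  by (auto simp: range_set_def split: if_splits)

lemma linepath_plot:
  assumes c: "plots3 r1 T c" and t: "t \<in> {0..1}"
  shows "plots3 r1 T (\<lambda>w. (fst (c w), linepath (snd (fst (c w))) (snd (c w)) t))"
proof -
  from c have 1: "plots2 r1 T (\<lambda>w. fst (c w))" "(\<lambda>w. snd (c w)) holomorphic_on T"
    "\<forall>w\<in>T. norm (snd (c w)) < r1" "(\<lambda>w. snd (fst (c w))) holomorphic_on T"
    "\<forall>w\<in>T. norm (snd (fst (c w))) < r1"
    by (simp_all add: prod_plots_def)
  have "(\<lambda>w. linepath (snd (fst (c w))) (snd (c w)) t) holomorphic_on T"
    unfolding linepath_def scaleR_conv_of_real
    by (intro holomorphic_on_add holomorphic_on_mult holomorphic_on_const 1)
  with 1 t norm_linepath_less show ?thesis by simp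
qed

lemma plots2_mono: "plots2 r1 T c \<Longrightarrow> plots2 r T c"
proof (erule prod_plots_mono)
  show "poly_plots r1 T (\<lambda>w. fst (c w)) \<Longrightarrow> poly_plots r T (\<lambda>w. fst (c w))"
    by (erule poly_plots_mono) (use r1 r in simp)
qed (use r1 r in simp)

lemma picard_plot:
  assumes u: "curve_holomorphic (plots3 r1) u" "\<And>z. z \<in> plot_dom (plots3 r1) \<Longrightarrow> u z \<in> range_set z"
    and c: "plots3 r1 T c" and T: "open T"
  shows "plots3 r T (\<lambda>w. ((fst (fst (c w)), snd (c w)), u (c w)))"
proof -
  have u1: "(\<lambda>w. u (c w)) holomorphic_on T" by (rule curve_holomorphicD[OF u(1), OF T, OF c])
  have u2: "norm (u (c w)) < r" if "w \<in> T" for w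
  proof -
    have "c w \<in> plot_dom (plots3 r1)"
      by (rule plot_familyD(1)[OF plot_family_prod, OF plot_family_prod, OF plot_family_poly, OF c that])
    from range_set_norm[OF u(2)[OF this]] r show ?thesis by simp
  qed
  have "plots2 r1 T (\<lambda>w. (fst (fst (c w)), snd (c w)))"
    using c by (simp add: prod_plots_def)
  from plots2_mono[OF this] u1 u2 show ?thesis by (simp add: prod_plots_def)
qed

lemma picard_integrand_holomorphic:
  assumes u: "curve_holomorphic (plots3 r1) u" "\<And>z. z \<in> plot_dom (plots3 r1) \<Longrightarrow> u z \<in> range_set z"
    and z: "z \<in> plot_dom (plots2 r1)"
  shows "(\<lambda>s. f ((fst z, s), u (z, s))) holomorphic_on ball 0 r1"
proof -
  have "plots2 r1 (ball 0 r1) (\<lambda>_. z)"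
    using plot_constant[OF plot_family_prod, OF plot_family_poly, OF z] .
  then have "plots3 r1 (ball 0 r1) (\<lambda>s. (z, s))" by (auto intro: holomorphic_intros)
  from picard_plot[OF u this open_ball] show ?thesis
    using curve_holomorphicD[OF hol, OF open_ball, of 0 r1 "\<lambda>w. ((fst z, w), u (z, w))"] by simp
qed

lemma picard_point:
  assumes u: "\<And>z. z \<in> plot_dom (plots3 r1) \<Longrightarrow> u z \<in> range_set z" and z: "z \<in> plot_dom (plots2 r1)"
    and s: "norm s < r1"
  shows "((fst z, s), u (z, s)) \<in> plot_dom (plots3 r)" "norm (f ((fst z, s), u (z, s))) \<le> N"
proof -
  have "u (z, s) \<in> range_set (z, s)" using u z s by simp
  then have "norm (u (z, s)) < r" using range_set_norm r by fastforce
  then show "((fst z, s), u (z, s)) \<in> plot_dom (plots3 r)" using z s r1 r by (auto intro: less_le_trans)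
  then show "norm (f ((fst z, s), u (z, s))) \<le> N" by (rule bound)
qed

lemma picard_maps:
  assumes u: "curve_holomorphic (plots3 r1) u" "\<And>z. z \<in> plot_dom (plots3 r1) \<Longrightarrow> u z \<in> range_set z"
  shows "curve_holomorphic (plots3 r1) (picard u)" "z \<in> plot_dom (plots3 r1) \<Longrightarrow> picard u z \<in> range_set z"
proof -
  let ?F = "\<lambda>z t. f ((fst (fst z), linepath (snd (fst z)) (snd z) t), u (fst z, linepath (snd (fst z)) (snd z) t))
      * (snd z - snd (fst z))"
  have lp: "norm (linepath (snd (fst z)) (snd z) t) < r1" if "z \<in> plot_dom (plots3 r1)" "t \<in> {0..1}" for z :: "(('i \<Rightarrow> complex) \<times> complex) \<times> complex" and t
    using that by (intro norm_linepath_less) auto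
  have cont: "continuous_on {0..1} (?F z)" if z: "z \<in> plot_dom (plots3 r1)" for z
  proof -
    have "continuous_on (ball 0 r1) (\<lambda>s. f ((fst (fst z), s), u (fst z, s)))"
      by (rule holomorphic_on_imp_continuous_on[OF picard_integrand_holomorphic[OF u]]) (use z in auto)
    moreover have "continuous_on {0..1} (linepath (snd (fst z)) (snd z))" by (rule continuous_on_linepath)
    moreover have "linepath (snd (fst z)) (snd z) ` {0..1} \<subseteq> ball 0 r1" using lp[OF z] by auto
    ultimately have "continuous_on {0..1} (\<lambda>t. f ((fst (fst z), linepath (snd (fst z)) (snd z) t), u (fst z, linepath (snd (fst z)) (snd z) t)))"
      by (rule continuous_on_compose2)
    then show ?thesis by (intro continuous_intros)
  qed
  have d: "norm (snd z - snd (fst z)) \<le> 2 * r1" if "z \<in> plot_dom (plots3 r1)" for z :: "(('i \<Rightarrow> complex) \<times> complex) \<times> complex"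
    using that norm_triangle_ineq4[of "snd z" "snd (fst z)"] by auto
  have bd: "norm (?F z t) \<le> r / 4" if z: "z \<in> plot_dom (plots3 r1)" and t: "t \<in> {0..1}" for z t
  proof -
    have "norm (?F z t) \<le> N * (2 * r1)"
      unfolding norm_mult using picard_point(2)[OF u(2) _ lp[OF z t], of "fst z"] z d[OF z] N
      by (intro mult_mono) auto
    then show ?thesis using r1(3) by (simp add: mult_ac)
  qed
  show "curve_holomorphic (plots3 r1) (picard u)"
    unfolding picard_def
  proof (rule curve_holomorphic_integral[where M="r / 4"])
    show "plot_family (plots3 r1)" by (intro plot_family_intros)
    fix t :: real assume t: "t \<in> {0..1}"
    show "curve_holomorphic (plots3 r1) (\<lambda>z. ?F z t)"
      unfolding curve_holomorphic_def
    proof (intro allI impI)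
      fix T and c :: "complex \<Rightarrow> (('i \<Rightarrow> complex) \<times> complex) \<times> complex"
      assume T: "open T" and c: "plots3 r1 T c"
      have h1: "(\<lambda>w. f ((fst (fst (c w)), linepath (snd (fst (c w))) (snd (c w)) t),
          u (fst (c w), linepath (snd (fst (c w))) (snd (c w)) t))) holomorphic_on T"
        using curve_holomorphicD[OF hol, OF T, OF picard_plot[OF u linepath_plot[OF c t] T]] by simp
      from c have "(\<lambda>w. snd (c w)) holomorphic_on T" "(\<lambda>w. snd (fst (c w))) holomorphic_on T"
        by (simp_all add: prod_plots_def)
      then show "(\<lambda>w. ?F (c w) t) holomorphic_on T"
        by (intro holomorphic_on_mult holomorphic_on_diff h1)
    qed
  qed (use cont bd in auto)
  show "picard u z \<in> range_set z" if z: "z \<in> plot_dom (plots3 r1)"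
  proof -
    have "norm (picard u z) \<le> r / 4 * (1 - 0)"
      unfolding picard_def by (rule integral_bound) (use cont bd z in auto)
    then have 1: "norm (picard u z) \<le> r / 2" using r by simp
    have 2: "picard u z \<in> \<real>" if re: "real_point z"
      unfolding picard_def
    proof (rule integral_in_Reals)
      fix t :: real assume t: "t \<in> {0..1}"
      let ?s = "linepath (snd (fst z)) (snd z) t"
      have s: "?s \<in> \<real>" using re by (simp add: real_point_def linepath_def scaleR_conv_of_real)
      have "u (fst z, ?s) \<in> range_set (fst z, ?s)" using z lp[OF z t] by (intro u) auto
      moreover have "real_point (fst z, ?s)" using re s by (simp add: real_point_def)
      ultimately have "u (fst z, ?s) \<in> \<real>" by (simp add: range_set_def)
      then have "real_point ((fst (fst z), ?s), u (fst z, ?s))" using re s by (simp add: real_point_def)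
      then have "f ((fst (fst z), ?s), u (fst z, ?s)) \<in> \<real>"
        using z by (intro real picard_point(1)[OF u(2) _ lp[OF z t]]) auto
      then show "?F z t \<in> \<real>" using re by (simp add: real_point_def)
    qed
    from 1 2 show ?thesis by (simp add: range_set_def)
  qed
qed

lemma picard_contracts:
  assumes u: "curve_holomorphic (plots3 r1) u" and v: "curve_holomorphic (plots3 r1) v"
    and uv: "\<And>z. z \<in> plot_dom (plots3 r1) \<Longrightarrow> u z \<in> range_set z \<and> v z \<in> range_set z \<and> norm (u z - v z) \<le> e"
    and z: "z \<in> plot_dom (plots3 r1)"
  shows "norm (picard u z - picard v z) \<le> e / 2"
proof -
  let ?s = "linepath (snd (fst z)) (snd z)"
  let ?F = "\<lambda>u t. f ((fst (fst z), ?s t), u (fst z, ?s t)) * (snd z - snd (fst z))"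
  have lp: "norm (?s t) < r1" if "t \<in> {0..1}" for t
    using that z by (intro norm_linepath_less) auto
  have cont: "continuous_on {0..1} (?F u)"
    if u: "curve_holomorphic (plots3 r1) u" "\<And>z. z \<in> plot_dom (plots3 r1) \<Longrightarrow> u z \<in> range_set z" for u
  proof -
    have "continuous_on (ball 0 r1) (\<lambda>s. f ((fst (fst z), s), u (fst z, s)))"
      by (rule holomorphic_on_imp_continuous_on[OF picard_integrand_holomorphic[OF u]]) (use z in auto)
    moreover have "continuous_on {0..1} ?s" by (rule continuous_on_linepath)
    moreover have "?s ` {0..1} \<subseteq> ball 0 r1" using lp by auto
    ultimately have "continuous_on {0..1} (\<lambda>t. f ((fst (fst z), ?s t), u (fst z, ?s t)))"
      by (rule continuous_on_compose2)
    then show ?thesis by (intro continuous_intros)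
  qed
  have cu: "continuous_on {0..1} (?F u)" by (rule cont[OF u]) (use uv in auto)
  have cv: "continuous_on {0..1} (?F v)" by (rule cont[OF v]) (use uv in auto)
  have d: "norm (snd z - snd (fst z)) \<le> 2 * r1"
    using z norm_triangle_ineq4[of "snd z" "snd (fst z)"] by auto
  have "norm (?F u t - ?F v t) \<le> e / 2" if t: "t \<in> {0..1}" for t
  proof -
    have zs: "(fst z, ?s t) \<in> plot_dom (plots3 r1)" using z lp[OF t] by simp
    have z2: "(fst (fst z), ?s t) \<in> plot_dom (plots2 r)" using zs z r1 r by (auto intro: less_le_trans)
    have "norm (f ((fst (fst z), ?s t), u (fst z, ?s t)) - f ((fst (fst z), ?s t), v (fst z, ?s t)))
        \<le> L * norm (u (fst z, ?s t) - v (fst z, ?s t))"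
      by (rule lipschitz[OF z2]) (use uv[OF zs] range_set_norm in blast)+
    also have "\<dots> \<le> L * e" using uv[OF zs] r1(5) by (intro mult_left_mono) auto
    finally have 1: "norm (f ((fst (fst z), ?s t), u (fst z, ?s t)) - f ((fst (fst z), ?s t), v (fst z, ?s t))) \<le> L * e" .
    have "0 \<le> e" using uv[OF zs] norm_ge_zero order_trans by blast
    have "norm (?F u t - ?F v t) = norm (f ((fst (fst z), ?s t), u (fst z, ?s t)) - f ((fst (fst z), ?s t), v (fst z, ?s t)))
        * norm (snd z - snd (fst z))"
      by (simp only: norm_mult[symmetric] left_diff_distrib)
    also have "\<dots> \<le> (L * e) * (2 * r1)" using 1 d by (intro mult_mono) (auto intro: order_trans[OF norm_ge_zero])
    also have "\<dots> = (2 * r1 * L) * e" by simp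
    also have "\<dots> \<le> 1 / 2 * e" using r1(4) \<open>0 \<le> e\<close> by (intro mult_right_mono) auto
    finally show ?thesis by simp
  qed
  then have "norm (integral {0..1} (\<lambda>t. ?F u t - ?F v t)) \<le> e / 2 * (1 - 0)"
    by (intro integral_bound continuous_on_diff cu cv) auto
  moreover have "integral {0..1} (\<lambda>t. ?F u t - ?F v t) = picard u z - picard v z"
    unfolding picard_def
    by (intro integral_diff integrable_continuous_interval cu cv)
  ultimately show ?thesis by simp
qed

lemma solution_exists:
  "\<exists>\<eta>. curve_holomorphic (plots3 r1) \<eta> \<and> (\<forall>z\<in>plot_dom (plots3 r1). \<eta> z \<in> range_set z \<and> picard \<eta> z = \<eta> z)"
proof -
  have cl: "closed (range_set z) \<and> range_set z \<subseteq> cball 0 (r / 2)" for z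
    by (auto simp: range_set_def intro: closed_Int closed_complex_Reals)
  have P: "plot_family (plots3 r1)" by (intro plot_family_intros)
  show ?thesis
  proof (rule curve_holomorphic_fixed_point[where P="plots3 r1" and K=range_set and B="r / 2" and \<T>=picard and ?u0.0="\<lambda>_. 0"])
    show "curve_holomorphic (plots3 r1) (\<lambda>_. 0)" by (simp add: curve_holomorphic_def)
    show "0 \<in> range_set z" for z using r by (simp add: range_set_def)
    show "curve_holomorphic (plots3 r1) (picard u) \<and> (\<forall>z\<in>plot_dom (plots3 r1). picard u z \<in> range_set z)"
      if "curve_holomorphic (plots3 r1) u" "\<And>z. z \<in> plot_dom (plots3 r1) \<Longrightarrow> u z \<in> range_set z" for u
      using picard_maps[OF that] by blast
    show "\<forall>z\<in>plot_dom (plots3 r1). norm (picard u z - picard v z) \<le> e / 2"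
      if "curve_holomorphic (plots3 r1) u" "curve_holomorphic (plots3 r1) v"
        "\<And>z. z \<in> plot_dom (plots3 r1) \<Longrightarrow> u z \<in> range_set z \<and> v z \<in> range_set z \<and> norm (u z - v z) \<le> e" for u v e
      using picard_contracts[OF that] by blast
    show "r / 2 > 0" using r by simp
    show "\<exists>\<eta>. curve_holomorphic (plots3 r1) \<eta> \<and> (\<forall>z\<in>plot_dom (plots3 r1). \<eta> z \<in> range_set z \<and> picard \<eta> z = \<eta> z)"
      if "curve_holomorphic (plots3 r1) u" "\<And>z. z \<in> plot_dom (plots3 r1) \<Longrightarrow> u z \<in> range_set z"
        "\<And>z. z \<in> plot_dom (plots3 r1) \<Longrightarrow> picard u z = u z" for u
      using that by blast
  qed (use P cl in auto)
qed

definition \<eta> where "\<eta> = (SOME \<eta>. curve_holomorphic (plots3 r1) \<eta> \<and>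
   (\<forall>z\<in>plot_dom (plots3 r1). \<eta> z \<in> range_set z \<and> picard \<eta> z = \<eta> z))"

lemma eta: "curve_holomorphic (plots3 r1) \<eta>"
  "\<And>z. z \<in> plot_dom (plots3 r1) \<Longrightarrow> \<eta> z \<in> range_set z"
  "\<And>z. z \<in> plot_dom (plots3 r1) \<Longrightarrow> picard \<eta> z = \<eta> z"
  using someI_ex[OF solution_exists, folded \<eta>_def] by auto

lemma norm_eta: "z \<in> plot_dom (plots3 r1) \<Longrightarrow> norm (\<eta> z) \<le> r / 2"
  using eta(2) range_set_norm by blast

lemma eta_real: "z \<in> plot_dom (plots3 r1) \<Longrightarrow> real_point z \<Longrightarrow> \<eta> z \<in> \<real>"
  using eta(2)[of z] by (simp add: range_set_def)

text \<open>The integrand is holomorphic on a disc and has a primitive \<open>G\<close> there, so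
  the fixed point equation becomes \<open>\<eta> (z, s) = G s - G (snd z)\<close>, which can be
  differentiated.\<close>

lemma eta_ode:
  assumes z: "z \<in> plot_dom (plots2 r1)" and s: "norm s < r1"
  shows "((\<lambda>s. \<eta> (z, s)) has_field_derivative f ((fst z, s), \<eta> (z, s))) (at s)"
    and "\<eta> (z, snd z) = 0"
proof -
  let ?g = "\<lambda>s. f ((fst z, s), \<eta> (z, s))"
  have g: "?g holomorphic_on ball 0 r1" by (rule picard_integrand_holomorphic[OF eta(1,2) z])
  obtain G where G: "\<And>s. s \<in> ball 0 r1 \<Longrightarrow> (G has_field_derivative ?g s) (at s within ball 0 r1)"
    using holomorphic_convex_primitive'[OF convex_ball open_ball g] by blast
  have eq: "\<eta> (z, s) = G s - G (snd z)" if s: "norm s < r1" for s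
  proof -
    have "path_image (linepath (snd z) s) \<subseteq> ball 0 r1"
      using z s norm_linepath_less by (auto simp: path_image_def)
    from contour_integral_primitive[OF G valid_path_linepath this]
    have "(?g has_contour_integral (G s - G (snd z))) (linepath (snd z) s)" by simp
    then have "((\<lambda>t. ?g (linepath (snd z) s t) * (s - snd z)) has_integral (G s - G (snd z))) {0..1}"
      by (simp add: has_contour_integral_linepath)
    then have "picard \<eta> (z, s) = G s - G (snd z)" by (simp only: picard_def fst_conv snd_conv integral_unique)
    then show ?thesis using eta(3)[of "(z, s)"] z s by simp
  qed
  show "\<eta> (z, snd z) = 0" using eq[of "snd z"] z by simp
  have "((\<lambda>s. G s - G (snd z)) has_field_derivative ?g s) (at s)"
    using G[of s] s at_within_open[of s "ball 0 r1"] by (auto intro!: derivative_eq_intros)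
  then show "((\<lambda>s. \<eta> (z, s)) has_field_derivative ?g s) (at s)"
    by (rule has_field_derivative_transform_within_open[of _ _ _ "ball 0 r1"]) (use s eq in auto)
qed

lemma eta_holomorphic: "z \<in> plot_dom (plots2 r1) \<Longrightarrow> (\<lambda>s. \<eta> (z, s)) holomorphic_on ball 0 r1"
  unfolding holomorphic_on_open[OF open_ball] using eta_ode(1) by (metis mem_ball_0)

end

section \<open>Cauchy integrals and division by powers\<close>

lemma Cauchy_integral_01:
  assumes R: "R holomorphic_on ball 0 r'" and r: "0 < r" "r < r'" and x: "norm x < r"
  shows "integral {0..1} (\<lambda>t. R (circlepath 0 r t) * circlepath 0 r t / (circlepath 0 r t - x)) = R x"
proof -
  have "R holomorphic_on cball 0 r" using R by (rule holomorphic_on_subset) (use r in auto)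
  then have "((\<lambda>u. R u / (u - x)) has_contour_integral 2 * of_real pi * \<i> * R x) (circlepath 0 r)"
    using x by (intro Cauchy_integral_circlepath_simple) auto
  then have i: "((\<lambda>t. R (circlepath 0 r t) / (circlepath 0 r t - x) * vector_derivative (circlepath 0 r) (at t))
      has_integral 2 * of_real pi * \<i> * R x) {0..1}"
    unfolding has_contour_integral .
  \<comment> \<open>On the circle d\<zeta> = 2 \<pi> i \<zeta> dt: the constant 2 \<pi> i cancels in
    Cauchy's formula, and the factor \<zeta> stays in the integrand.\<close>
  have d: "vector_derivative (circlepath 0 r) (at t) = (2 * of_real pi * \<i>) * circlepath 0 r t" for t
    unfolding vector_derivative_circlepath by (simp add: circlepath)
  have "((\<lambda>t. (2 * of_real pi * \<i>) * (R (circlepath 0 r t) * circlepath 0 r t / (circlepath 0 r t - x)))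
      has_integral (2 * of_real pi * \<i>) * R x) {0..1}"
    using i unfolding d by (rule has_integral_eq[rotated]) simp
  then have "(2 * of_real pi * \<i>) * integral {0..1} (\<lambda>t. R (circlepath 0 r t) * circlepath 0 r t / (circlepath 0 r t - x))
      = (2 * of_real pi * \<i>) * R x"
    unfolding integral_mult_right[symmetric] by (rule integral_unique)
  then show ?thesis by simp
qed

lemma norm_circlepath_0 [simp]: "r \<ge> 0 \<Longrightarrow> norm (circlepath 0 r t) = r"
  by (simp add: circlepath norm_mult)

lemma removable_power_factor:
  fixes g :: "complex \<Rightarrow> complex"
  assumes g: "g holomorphic_on ball 0 r" and r: "0 < r'" "r' \<le> r" and n: "n > 0"
    and C: "\<And>z. norm z < r' \<Longrightarrow> norm (g z) \<le> C * norm z ^ n"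
  shows "\<exists>R. R holomorphic_on ball 0 r \<and> (\<forall>z\<in>ball 0 r. g z = z ^ n * R z)"
proof -
  have h: "(\<lambda>z. g z / z ^ n) holomorphic_on ball 0 r - {0}"
    by (intro holomorphic_on_divide holomorphic_on_power holomorphic_on_ident holomorphic_on_subset[OF g]) auto
  have "\<exists>B. \<forall>\<^sub>F z in at 0. norm (g z / z ^ n) \<le> B"
  proof
    have "\<forall>\<^sub>F z in at (0::complex). norm z < r' \<and> z \<noteq> 0"
      using r by (auto simp: eventually_at)
    then show "\<forall>\<^sub>F z in at 0. norm (g z / z ^ n) \<le> C"
      by eventually_elim (use C in \<open>auto simp: norm_divide norm_power divide_simps\<close>)
  qed
  then obtain R where R: "R holomorphic_on ball 0 r" "\<forall>z\<in>ball 0 r - {0}. R z = g z / z ^ n"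
    using holomorphic_on_extend_bounded[OF h] r by auto
  have "g z = z ^ n * R z" if "z \<in> ball 0 r" for z
  proof (cases "z = 0")
    case True
    then show ?thesis using C[of 0] r zero_power[OF n, where 'a=real] zero_power[OF n, where 'a=complex] by simp
  next
    case False
    then show ?thesis using R(2) that by simp
  qed
  with R(1) show ?thesis by blast
qed

definition real_arg :: "('i \<Rightarrow> complex) \<Rightarrow> bool" where
  "real_arg a \<longleftrightarrow> (\<forall>i. a i \<in> \<real>)"

text \<open>\<open>flat\<close> speaks of real parameters, where the contact conditions of the
  family are available. \<open>\<alpha>\<close> is the leading coefficient at the parameter 0; at
  other real parameters this coefficient is \<open>R 0\<close>.\<close>

locale complex_contact = complex_slope f r N for f :: "(('i \<Rightarrow> complex) \<times> complex) \<times> complex \<Rightarrow> complex" and r N +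
  fixes k :: nat and \<alpha> :: real
  assumes k: "k > 0" and \<alpha>: "\<alpha> \<noteq> 0"
    and flat: "\<And>a. real_arg a \<Longrightarrow> (\<And>i. norm (a i) < r) \<Longrightarrow>
      \<exists>R. R holomorphic_on ball 0 r \<and> (\<forall>s\<in>ball 0 r. f ((a, s), 0) = s ^ (2 * k - 1) * R s) \<and>
        (a = (\<lambda>_. 0) \<longrightarrow> R 0 = of_real \<alpha>)"
begin

text \<open>Bounds the cofactor in \<open>flat\<close> for |s| at most r / 2, uniformly in the real
  parameter.\<close>

definition C0 where "C0 = N / (r / 2) ^ (2 * k - 1)"
definition C1 where "C1 = 8 * C0 * 3 ^ (2 * k - 1)"

lemma C0_pos: "C0 > 0" "C1 > 0" using r N by (auto simp: C0_def C1_def)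

lemma power_2k: "(x::'b::monoid_mult) * x ^ (2 * k - 1) = x ^ (2 * k)"
  using k power_Suc[of x "2 * k - 1"] by simp

lemma flat_factor:
  assumes a: "real_arg a" "\<And>i. norm (a i) < r"
  obtains R where "R holomorphic_on ball 0 r" "\<And>s. s \<in> ball 0 r \<Longrightarrow> f ((a, s), 0) = s ^ (2 * k - 1) * R s"
    "a = (\<lambda>_. 0) \<Longrightarrow> R 0 = of_real \<alpha>" "\<And>s. norm s \<le> r / 2 \<Longrightarrow> norm (R s) \<le> C0"
proof -
  obtain R where R: "R holomorphic_on ball 0 r" "\<And>s. s \<in> ball 0 r \<Longrightarrow> f ((a, s), 0) = s ^ (2 * k - 1) * R s"
    "a = (\<lambda>_. 0) \<Longrightarrow> R 0 = of_real \<alpha>"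
    using flat[OF a] by blast
  have "norm (R s) \<le> C0" if "norm s \<le> r / 2" for s
    unfolding C0_def
  proof (rule bound_cofactor_power[OF R(1)])
    show "norm (x ^ (2 * k - 1) * R x) \<le> N" if "norm x = r / 2" for x
      using R(2)[of x] bound[of "((a, x), 0)"] a(2) that r by simp
  qed (use r that in auto)
  with R show thesis by (rule that)
qed

lemma f_flat_bound:
  assumes a: "real_arg a" "\<And>i. norm (a i) < r" and s: "norm s \<le> r / 2"
  shows "norm (f ((a, s), 0)) \<le> C0 * norm s ^ (2 * k - 1)"
proof -
  obtain R where R: "R holomorphic_on ball 0 r" "\<And>s. s \<in> ball 0 r \<Longrightarrow> f ((a, s), 0) = s ^ (2 * k - 1) * R s"
    "a = (\<lambda>_. 0) \<Longrightarrow> R 0 = of_real \<alpha>" "\<And>s. norm s \<le> r / 2 \<Longrightarrow> norm (R s) \<le> C0"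
    using flat_factor[OF a] by blast
  have "f ((a, s), 0) = s ^ (2 * k - 1) * R s" using s r by (intro R(2)) auto
  moreover have "norm (R s) * norm s ^ (2 * k - 1) \<le> C0 * norm s ^ (2 * k - 1)"
    using R(4)[OF s] by (intro mult_right_mono) auto
  ultimately show ?thesis by (simp add: norm_mult norm_power mult.commute)
qed

text \<open>A bootstrap: the maximum \<open>S\<close> of the modulus on the disc of radius 3 |x|
  satisfies S \<le> 4 |x| (C0 (3 |x|)^(2k-1) + L S), and the last term is absorbed because 4 |x| L
  \<le> 1/4. The radius makes room for all points \<open>x * \<sigma>\<close> with |\<sigma>| <
  3.\<close>

lemma eta_small:
  assumes a: "real_arg a" "\<And>i. norm (a i) < r1" and x: "norm x \<le> r1 / 4" and s: "norm s \<le> 3 * norm x"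
  shows "norm (\<eta> ((a, x), s)) \<le> C1 * norm x ^ (2 * k)"
proof -
  let ?K = "cball (0::complex) (3 * norm x)" and ?e = "\<lambda>s. \<eta> ((a, x), s)"
  have sub: "?K \<subseteq> ball 0 r1" using x r1 by auto
  have z: "(a, x) \<in> plot_dom (plots2 r1)" using a x r1 by auto
  have "continuous_on ?K ?e"
    using holomorphic_on_imp_continuous_on[OF eta_holomorphic[OF z]] sub continuous_on_subset by blast
  then have "continuous_on ?K (\<lambda>s. norm (?e s))" by (rule continuous_on_norm)
  then have "\<exists>s1\<in>?K. \<forall>s\<in>?K. norm (?e s) \<le> norm (?e s1)"
    by (rule continuous_attains_sup[OF compact_cball, rotated]) simp
  then obtain s1 where s1: "s1 \<in> ?K" "\<And>s. s \<in> ?K \<Longrightarrow> norm (?e s) \<le> norm (?e s1)"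
    by blast
  define S where "S = norm (?e s1)"
  define B where "B = C0 * (3 * norm x) ^ (2 * k - 1) + L * S"
  have ar: "norm (a i) < r" for i using a(2)[of i] r1 r by (auto intro: less_le_trans)
  have "norm (?e s1 - ?e x) \<le> B * norm (s1 - x)"
  proof (rule field_differentiable_bound[OF convex_cball])
    fix u assume u: "u \<in> ?K"
    then have ur: "norm u < r1" using sub by auto
    show "(?e has_field_derivative f ((a, u), ?e u)) (at u within ?K)"
      using eta_ode(1)[OF z ur] by (simp add: has_field_derivative_at_within)
    have "norm (f ((a, u), ?e u)) \<le> norm (f ((a, u), 0)) + norm (f ((a, u), ?e u) - f ((a, u), 0))"
      by norm
    also have "\<dots> \<le> C0 * norm u ^ (2 * k - 1) + L * norm (?e u - 0)"
    proof (intro add_mono f_flat_bound lipschitz)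
      show "norm u \<le> r / 2" using ur r1 r by simp
      show "(a, u) \<in> plot_dom (plots2 r)" using ar ur r1 r by auto
      show "norm (?e u) \<le> r / 2" using z ur by (intro norm_eta) auto
    qed (use a ar r in auto)
    also have "\<dots> \<le> C0 * (3 * norm x) ^ (2 * k - 1) + L * S"
      using u s1(2)[OF u] C0_pos r1 unfolding S_def
      by (intro add_mono mult_left_mono power_mono) auto
    finally show "norm (f ((a, u), ?e u)) \<le> B" by (simp add: B_def)
  qed (use s1 in auto)
  moreover have "?e x = 0" using eta_ode(2)[OF z, of 0] r1 by simp
  moreover have "norm (s1 - x) \<le> 4 * norm x"
    using s1(1) norm_triangle_ineq4[of s1 x] by simp
  moreover have "B \<ge> 0" using C0_pos r1 by (auto simp: B_def S_def)
  ultimately have "S \<le> B * (4 * norm x)"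
    unfolding S_def by (metis (no_types, lifting) diff_zero mult_left_mono order_trans)
  also have "\<dots> = 4 * C0 * 3 ^ (2 * k - 1) * (norm x * norm x ^ (2 * k - 1)) + (4 * norm x * L) * S"
    by (simp add: B_def algebra_simps power_mult_distrib)
  also have "(4 * norm x * L) * S \<le> 1 / 4 * S"
  proof (rule mult_right_mono)
    have "4 * norm x * L \<le> r1 * L" using x r1 by (intro mult_right_mono) auto
    then show "4 * norm x * L \<le> 1 / 4" using r1(4) by simp
  qed (simp add: S_def)
  finally have S4: "S \<le> 4 * C0 * 3 ^ (2 * k - 1) * (norm x * norm x ^ (2 * k - 1)) + 1 / 4 * S" by simp
  define T where "T = C0 * 3 ^ (2 * k - 1) * (norm x * norm x ^ (2 * k - 1))"
  have "T \<ge> 0" using C0_pos by (simp add: T_def)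
  moreover have "S \<le> 4 * T + 1 / 4 * S" using S4 by (simp add: T_def mult.assoc)
  ultimately have "S \<le> 8 * T" by simp
  also have "8 * T = C1 * norm x ^ (2 * k)" unfolding T_def C1_def power_2k by simp
  finally have "S \<le> C1 * norm x ^ (2 * k)" .
  moreover have "norm (?e s) \<le> S" unfolding S_def using s by (intro s1) auto
  ultimately show ?thesis by simp
qed

definition \<rho> where "\<rho> = r1 / 4"
definition r2 where "r2 = r1 / 8"
definition M_Theta where "M_Theta = r / \<rho> ^ (2 * k)"

lemma radii: "\<rho> > 0" "r2 > 0" "r2 < \<rho>" "r2 = \<rho> / 2" "\<rho> < r1 / 3" "r2 < r1" "M_Theta > 0"
  using r1 r by (auto simp: \<rho>_def r2_def M_Theta_def)

text \<open>
  The Cauchy integral of \<open>x \<mapsto> \<eta>((a, x), x\<sigma>) / x^(2k)\<close> over a circle: it is defined, and holomorphic in \<open>a\<close>, at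
  complex parameters too, where removability of the singularity at \<open>x = 0\<close> has not been assumed.
\<close>

definition \<Theta> where "\<Theta> z = integral {0..1} (\<lambda>t. \<eta> ((fst (fst z), circlepath 0 \<rho> t), circlepath 0 \<rho> t * snd z)
    / circlepath 0 \<rho> t ^ (2 * k) * circlepath 0 \<rho> t / (circlepath 0 \<rho> t - snd (fst z)))"

abbreviation "plots_Theta \<equiv> prod_plots (plots2 r2) 3 :: ((('i \<Rightarrow> complex) \<times> complex) \<times> complex) plots"

lemma circle_times: "norm \<sigma> < 3 \<Longrightarrow> norm \<zeta> < r1 / 3 \<Longrightarrow> norm (\<zeta> * \<sigma>) < r1" for \<zeta> \<sigma> :: complex
proof -
  assume s: "norm \<sigma> < 3" "norm \<zeta> < r1 / 3"
  have "norm \<zeta> * norm \<sigma> \<le> norm \<zeta> * 3" using s by (intro mult_left_mono) auto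
  also have "\<dots> < r1" using s by simp
  finally show ?thesis by (simp add: norm_mult)
qed

lemma scaled_eta_holomorphic:
  assumes a: "\<And>i. norm (a i) < r1" and \<sigma>: "norm \<sigma> < 3"
  shows "(\<lambda>\<zeta>. \<eta> ((a, \<zeta>), \<zeta> * \<sigma>)) holomorphic_on ball 0 (r1 / 3)"
proof -
  have "plots3 r1 (ball 0 (r1 / 3)) (\<lambda>\<zeta>. ((a, \<zeta>), \<zeta> * \<sigma>))"
    using a \<sigma> circle_times r1 by (auto simp: poly_plots_def intro!: holomorphic_intros)
  then show ?thesis by (rule curve_holomorphicD[OF eta(1), OF open_ball])
qed

lemma Theta_holomorphic: "curve_holomorphic plots_Theta \<Theta>"
  and Theta_bound: "z \<in> plot_dom plots_Theta \<Longrightarrow> norm (\<Theta> z) \<le> M_Theta"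
proof -
  let ?\<zeta> = "circlepath 0 \<rho>"
  let ?F = "\<lambda>z t. \<eta> ((fst (fst z), ?\<zeta> t), ?\<zeta> t * snd z) / ?\<zeta> t ^ (2 * k) * ?\<zeta> t / (?\<zeta> t - snd (fst z))"
  have \<zeta>: "norm (?\<zeta> t) = \<rho>" "?\<zeta> t \<noteq> 0" for t
    using radii norm_circlepath_0[of \<rho> t] by (auto simp del: norm_circlepath_0)
  have far: "norm (?\<zeta> t - x) \<ge> \<rho> / 2" if "norm x < r2" for x t
    using that \<zeta>(1)[of t] radii norm_triangle_ineq2[of "?\<zeta> t" x] by simp
  have far0: "?\<zeta> t - x \<noteq> 0" if "norm x < r2" for x t
    using far[OF that, of t] radii by auto
  have cont: "continuous_on {0..1} (?F z)" if z: "z \<in> plot_dom plots_Theta" for z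
  proof -
    have "continuous_on (ball 0 (r1 / 3)) (\<lambda>\<zeta>. \<eta> ((fst (fst z), \<zeta>), \<zeta> * snd z))"
      using z by (intro holomorphic_on_imp_continuous_on scaled_eta_holomorphic) (auto intro: less_trans[OF _ radii(6)])
    moreover have c: "continuous_on {0..1} ?\<zeta>"
      using path_circlepath[of 0 \<rho>] by (simp add: path_def)
    moreover have "?\<zeta> ` {0..1} \<subseteq> ball 0 (r1 / 3)" using \<zeta> radii by auto
    ultimately have "continuous_on {0..1} (\<lambda>t. \<eta> ((fst (fst z), ?\<zeta> t), ?\<zeta> t * snd z))"
      by (rule continuous_on_compose2)
    then show ?thesis using c \<zeta> far0[of "snd (fst z)"] z by (intro continuous_intros) auto
  qed
  have bd: "norm (?F z t) \<le> M_Theta" if z: "z \<in> plot_dom plots_Theta" for z t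
  proof -
    have "norm (\<eta> ((fst (fst z), ?\<zeta> t), ?\<zeta> t * snd z)) \<le> r / 2"
    proof (rule norm_eta)
      have "norm (fst (fst z) i) < r1" for i using z by (auto intro: less_trans[OF _ radii(6)])
      then show "((fst (fst z), ?\<zeta> t), ?\<zeta> t * snd z) \<in> plot_dom (plots3 r1)"
        using z \<zeta>(1)[of t] radii circle_times[of "snd z" "?\<zeta> t"] by auto
    qed
    then have "norm (?F z t) \<le> (r / 2) / \<rho> ^ (2 * k) * \<rho> / (\<rho> / 2)"
      unfolding norm_mult norm_divide norm_power \<zeta>(1)
      using far[of "snd (fst z)" t] z radii r by (intro frac_le mult_right_mono divide_right_mono) auto
    then show ?thesis using radii by (simp add: M_Theta_def)
  qed
  show "curve_holomorphic plots_Theta \<Theta>"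
    unfolding \<Theta>_def
  proof (rule curve_holomorphic_integral[where M=M_Theta])
    show "plot_family plots_Theta" by (intro plot_family_intros)
    fix t :: real assume t: "t \<in> {0..1}"
    show "curve_holomorphic plots_Theta (\<lambda>z. ?F z t)"
      unfolding curve_holomorphic_def
    proof (intro allI impI)
      fix T and c :: "complex \<Rightarrow> (('i \<Rightarrow> complex) \<times> complex) \<times> complex"
      assume T: "open T" and c: "plots_Theta T c"
      have h: "(\<lambda>w. snd (fst (c w))) holomorphic_on T" "(\<lambda>w. snd (c w)) holomorphic_on T"
        "\<And>w. w \<in> T \<Longrightarrow> norm (snd (fst (c w))) < r2" "\<And>w. w \<in> T \<Longrightarrow> norm (snd (c w)) < 3"
        "poly_plots r2 T (\<lambda>w. fst (fst (c w)))"
        using c by (auto simp: prod_plots_def)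
      have "poly_plots r1 T (\<lambda>w. fst (fst (c w)))" using h(5) radii by (auto intro: poly_plots_mono)
      then have "plots3 r1 T (\<lambda>w. ((fst (fst (c w)), ?\<zeta> t), ?\<zeta> t * snd (c w)))"
        using h \<zeta>(1)[of t] radii circle_times[of _ "?\<zeta> t"]
        by (auto intro!: holomorphic_on_mult holomorphic_on_const)
      from curve_holomorphicD[OF eta(1), OF T, OF this]
      have e: "(\<lambda>w. \<eta> ((fst (fst (c w)), ?\<zeta> t), ?\<zeta> t * snd (c w))) holomorphic_on T" .
      show "(\<lambda>w. ?F (c w) t) holomorphic_on T"
        by (intro holomorphic_on_divide holomorphic_on_mult holomorphic_on_diff holomorphic_on_const e h(1))
          (use \<zeta> far0 h(3) in auto)
    qed
  qed (use cont bd in auto)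
  show "norm (\<Theta> z) \<le> M_Theta" if z: "z \<in> plot_dom plots_Theta"
  proof -
    have "norm (\<Theta> z) \<le> M_Theta * (1 - 0)"
      unfolding \<Theta>_def by (rule integral_bound) (use cont bd z in auto)
    then show ?thesis by simp
  qed
qed

text \<open>At real parameters \<open>eta_small\<close> makes the singularity at x = 0 removable,
  and Cauchy's formula identifies \<open>\<Theta>\<close> with the resulting cofactor.\<close>

lemma Theta_factor:
  assumes a: "real_arg a" "\<And>i. norm (a i) < r2" and \<sigma>: "norm \<sigma> < 3"
  shows "\<exists>R. R holomorphic_on ball 0 (r1 / 3) \<and> (\<forall>x\<in>ball 0 (r1 / 3). \<eta> ((a, x), x * \<sigma>) = x ^ (2 * k) * R x)
    \<and> (\<forall>x. norm x < r2 \<longrightarrow> \<Theta> ((a, x), \<sigma>) = R x)"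
proof -
  have a1: "norm (a i) < r1" for i using a(2)[of i] radii by simp
  have "\<exists>R. R holomorphic_on ball 0 (r1 / 3) \<and> (\<forall>x\<in>ball 0 (r1 / 3). \<eta> ((a, x), x * \<sigma>) = x ^ (2 * k) * R x)"
  proof (rule removable_power_factor[where r'="r1 / 4" and C=C1])
    show "norm (\<eta> ((a, z), z * \<sigma>)) \<le> C1 * norm z ^ (2 * k)" if z: "norm z < r1 / 4" for z
    proof (rule eta_small[OF a(1) a1])
      have "norm z * norm \<sigma> \<le> norm z * 3" using \<sigma> by (intro mult_left_mono) auto
      then show "norm (z * \<sigma>) \<le> 3 * norm z" by (simp add: norm_mult)
    qed (use z in auto)
  qed (use scaled_eta_holomorphic[OF a1 \<sigma>] r1 k in auto)
  then obtain R where R: "R holomorphic_on ball 0 (r1 / 3)"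
    "\<And>x. x \<in> ball 0 (r1 / 3) \<Longrightarrow> \<eta> ((a, x), x * \<sigma>) = x ^ (2 * k) * R x" by blast
  have "\<Theta> ((a, x), \<sigma>) = R x" if x: "norm x < r2" for x
  proof -
    have \<zeta>: "norm (circlepath 0 \<rho> t) = \<rho>" "circlepath 0 \<rho> t \<noteq> 0" for t
      using radii norm_circlepath_0[of \<rho> t] by (auto simp del: norm_circlepath_0)
    have "\<eta> ((a, circlepath 0 \<rho> t), circlepath 0 \<rho> t * \<sigma>) / circlepath 0 \<rho> t ^ (2 * k) = R (circlepath 0 \<rho> t)" for t
      using R(2)[of "circlepath 0 \<rho> t"] \<zeta>[of t] radii by simp
    then have "\<Theta> ((a, x), \<sigma>) = integral {0..1} (\<lambda>t. R (circlepath 0 \<rho> t) * circlepath 0 \<rho> t / (circlepath 0 \<rho> t - x))"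
      by (simp add: \<Theta>_def)
    also have "\<dots> = R x" by (rule Cauchy_integral_01[OF R(1)]) (use radii x in auto)
    finally show ?thesis .
  qed
  with R show ?thesis by blast
qed

lemma Theta_eta:
  assumes a: "real_arg a" "\<And>i. norm (a i) < r2" and \<sigma>: "norm \<sigma> < 3" and x: "norm x < r2"
  shows "\<eta> ((a, x), x * \<sigma>) = x ^ (2 * k) * \<Theta> ((a, x), \<sigma>)"
proof -
  obtain R where "\<forall>x\<in>ball 0 (r1 / 3). \<eta> ((a, x), x * \<sigma>) = x ^ (2 * k) * R x"
    "\<forall>x. norm x < r2 \<longrightarrow> \<Theta> ((a, x), \<sigma>) = R x"
    using Theta_factor[OF a \<sigma>] by blast
  then show ?thesis using x radii by auto
qed

lemma Theta_real:
  assumes a: "real_arg a" "\<And>i. norm (a i) < r2" and \<sigma>: "norm \<sigma> < 3" "\<sigma> \<in> \<real>" and x: "norm x < r2" "x \<in> \<real>"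
  shows "\<Theta> ((a, x), \<sigma>) \<in> \<real>"
proof -
  obtain R where R: "R holomorphic_on ball 0 (r1 / 3)"
    "\<forall>x\<in>ball 0 (r1 / 3). \<eta> ((a, x), x * \<sigma>) = x ^ (2 * k) * R x"
    "\<forall>x. norm x < r2 \<longrightarrow> \<Theta> ((a, x), \<sigma>) = R x"
    using Theta_factor[OF a \<sigma>(1)] by blast
  have nz: "R x \<in> \<real>" if x: "norm x < r2" "x \<in> \<real>" "x \<noteq> 0" for x
  proof -
    have xb: "x \<in> ball 0 (r1 / 3)" using x radii by auto
    have "norm (a i) < r1" for i using a(2)[of i] radii by simp
    then have "\<eta> ((a, x), x * \<sigma>) \<in> \<real>"
      using a x \<sigma> radii xb circle_times by (intro eta_real) (auto simp: real_point_def real_arg_def)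
    moreover have "R x = \<eta> ((a, x), x * \<sigma>) / x ^ (2 * k)" using R(2) xb x by simp
    ultimately show ?thesis using x by simp
  qed
  \<comment> \<open>At x = 0 the quotient gives no information; reality passes to the limit along a
    real sequence.\<close>
  have "R 0 \<in> \<real>"
  proof -
    define y where "y n = r2 / (real n + 2)" for n :: nat
    have y: "y n > 0" "y n < r2" for n using radii(2) by (auto simp: y_def divide_simps)
    have Rn: "R (of_real (y n)) \<in> \<real>" for n using y[of n] by (intro nz) auto
    have "y \<longlonglongrightarrow> 0" unfolding y_def
      using LIMSEQ_ignore_initial_segment[OF lim_const_over_n[of r2], of 2] by (simp add: add.commute)
    then have X: "(\<lambda>n. complex_of_real (y n)) \<longlonglongrightarrow> 0"
      using tendsto_of_real[of y 0 sequentially] by simp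
    have "continuous (at 0) R"
      using holomorphic_on_imp_continuous_on[OF R(1)] radii continuous_on_eq_continuous_at[OF open_ball]
      by (metis centre_in_ball less_trans)
    then have "(\<lambda>n. R (of_real (y n))) \<longlonglongrightarrow> R 0"
      using X continuous_at_sequentially[of 0 R] by (auto simp: o_def)
    then show ?thesis
      using closed_sequentially[OF closed_complex_Reals, of "\<lambda>n. R (of_real (y n))"] Rn by blast
  qed
  then show ?thesis using R(3) x nz by (cases "x = 0") auto
qed

text \<open>At the parameter 0 the slope is \<alpha> s^(2k-1) up to higher order, so \<eta> differs
  from \<alpha> (s^(2k) - x^(2k)) / 2k by O(|x|^(2k+1)). Dividing by x^(2k) and letting x tend to 0
  gives the value.\<close>

lemma Theta_0:
  assumes \<sigma>: "norm \<sigma> < 3"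
  shows "\<Theta> ((\<lambda>_. 0, 0), \<sigma>) = of_real \<alpha> / of_nat (2 * k) * (\<sigma> ^ (2 * k) - 1)"
proof -
  let ?a = "(\<lambda>_. 0) :: 'i \<Rightarrow> complex" and ?A = "complex_of_real \<alpha> / of_nat (2 * k)"
  have ra: "real_arg ?a" by (simp add: real_arg_def)
  obtain R where R: "R holomorphic_on ball 0 (r1 / 3)"
    "\<forall>x\<in>ball 0 (r1 / 3). \<eta> ((?a, x), x * \<sigma>) = x ^ (2 * k) * R x"
    "\<forall>x. norm x < r2 \<longrightarrow> \<Theta> ((?a, x), \<sigma>) = R x"
    using Theta_factor[OF ra _ \<sigma>] radii by auto
  obtain Q where Q: "Q holomorphic_on ball 0 r" "\<And>s. s \<in> ball 0 r \<Longrightarrow> f ((?a, s), 0) = s ^ (2 * k - 1) * Q s"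
    "Q 0 = of_real \<alpha>" "\<And>s. norm s \<le> r / 2 \<Longrightarrow> norm (Q s) \<le> C0"
    using flat_factor[OF ra] r by auto
  \<comment> \<open>The first summand comes from the dependence of \<open>f\<close> on
    \<open>y\<close>, with \<eta> = O(|x|^(2k)); the second from the variation of the cofactor
    \<open>Q\<close> between 0 and \<open>s\<close>.\<close>
  define C2 where "C2 = L * C1 + 3 ^ (2 * k) * (4 * C0 / r)"
  have C2: "C2 \<ge> 0" using C0_pos r1 r by (simp add: C2_def)
  have est: "norm (R x - ?A * (\<sigma> ^ (2 * k) - 1)) \<le> 4 * C2 * norm x" if x: "norm x < r2" "x \<noteq> 0" for x
  proof -
    let ?K = "cball (0::complex) (3 * norm x)"
    have z: "(?a, x) \<in> plot_dom (plots2 r1)" using x radii r1 by auto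
    let ?e = "\<lambda>s. \<eta> ((?a, x), s) - ?A * s ^ (2 * k)"
    have x\<sigma>: "norm (x * \<sigma>) \<le> 3 * norm x"
      using mult_left_mono[of "norm \<sigma>" 3 "norm x"] \<sigma> by (simp add: norm_mult)
    have "norm (?e (x * \<sigma>) - ?e x) \<le> (C2 * norm x ^ (2 * k)) * norm (x * \<sigma> - x)"
    proof (rule field_differentiable_bound[OF convex_cball, where f'="\<lambda>s. f ((?a, s), \<eta> ((?a, x), s)) - of_real \<alpha> * s ^ (2 * k - 1)"])
      fix s assume s: "s \<in> ?K"
      then have sr: "norm s < r1" "norm s \<le> r / 4" using x r1 by (auto simp: r2_def)
      have "(?e has_field_derivative f ((?a, s), \<eta> ((?a, x), s)) - ?A * (of_nat (2 * k) * s ^ (2 * k - 1))) (at s)"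
        by (intro DERIV_diff DERIV_cmult eta_ode(1)[OF z sr(1), simplified]) (auto intro!: derivative_eq_intros)
      moreover have "?A * (of_nat (2 * k) * s ^ (2 * k - 1)) = of_real \<alpha> * s ^ (2 * k - 1)" using k by simp
      ultimately show "(?e has_field_derivative f ((?a, s), \<eta> ((?a, x), s)) - of_real \<alpha> * s ^ (2 * k - 1)) (at s within ?K)"
        by (simp only: has_field_derivative_at_within)
      have e: "norm (\<eta> ((?a, x), s)) \<le> C1 * norm x ^ (2 * k)"
        using x s radii r1 by (intro eta_small[OF ra]) (auto simp: r2_def)
      have q: "norm (Q s - Q 0) \<le> C0 / (r / 2 - r / 4) * norm (s - 0)"
        using r sr by (intro holomorphic_bounded_lipschitz[of Q 0 "r/2"] holomorphic_on_subset[OF Q(1)] Q(4)) auto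
      have "norm (f ((?a, s), \<eta> ((?a, x), s)) - of_real \<alpha> * s ^ (2 * k - 1))
          \<le> norm (f ((?a, s), \<eta> ((?a, x), s)) - f ((?a, s), 0)) + norm (f ((?a, s), 0) - of_real \<alpha> * s ^ (2 * k - 1))"
        by norm
      also have "norm (f ((?a, s), \<eta> ((?a, x), s)) - f ((?a, s), 0)) \<le> L * norm (\<eta> ((?a, x), s) - 0)"
        using r sr z norm_eta[of "((?a, x), s)"] by (intro lipschitz) auto
      also have "\<dots> \<le> L * (C1 * norm x ^ (2 * k))" using e r1 by (intro mult_left_mono) auto
      also have "f ((?a, s), 0) - of_real \<alpha> * s ^ (2 * k - 1) = s ^ (2 * k - 1) * (Q s - Q 0)"
        using Q(2)[of s] Q(3) sr r by (simp add: algebra_simps)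
      also have "norm (s ^ (2 * k - 1) * (Q s - Q 0)) \<le> norm s ^ (2 * k - 1) * (4 * C0 / r * norm s)"
        unfolding norm_mult norm_power using q by (intro mult_left_mono) (simp_all add: field_simps)
      also have "\<dots> = (norm s) ^ (2 * k) * (4 * C0 / r)" unfolding power_2k[symmetric] by simp
      also have "\<dots> \<le> (3 * norm x) ^ (2 * k) * (4 * C0 / r)"
        using s C0_pos r by (intro mult_right_mono power_mono) auto
      finally show "norm (f ((?a, s), \<eta> ((?a, x), s)) - of_real \<alpha> * s ^ (2 * k - 1)) \<le> C2 * norm x ^ (2 * k)"
        by (simp add: C2_def algebra_simps power_mult_distrib)
    qed (use x\<sigma> in auto)
    also have "\<dots> \<le> (C2 * norm x ^ (2 * k)) * (4 * norm x)"
      using x\<sigma> norm_triangle_ineq4[of "x * \<sigma>" x] C2 by (intro mult_left_mono) auto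
    finally have 1: "norm (?e (x * \<sigma>) - ?e x) \<le> norm x ^ (2 * k) * (4 * C2 * norm x)" by (simp add: mult_ac)
    have "x \<in> ball 0 (r1 / 3)" using x radii by auto
    then have 2: "\<eta> ((?a, x), x * \<sigma>) = x ^ (2 * k) * R x" "\<eta> ((?a, x), x) = 0"
      using R(2) eta_ode(2)[OF z, of 0] r1 by auto
    have "x ^ (2 * k) * R x - A * (x ^ (2 * k) * \<sigma> ^ (2 * k)) - (0 - A * x ^ (2 * k))
        = x ^ (2 * k) * (R x - A * (\<sigma> ^ (2 * k) - 1))" for A
      by (simp add: algebra_simps)
    then have "?e (x * \<sigma>) - ?e x = x ^ (2 * k) * (R x - ?A * (\<sigma> ^ (2 * k) - 1))"
      unfolding 2 power_mult_distrib .
    with 1 have "norm x ^ (2 * k) * norm (R x - ?A * (\<sigma> ^ (2 * k) - 1)) \<le> norm x ^ (2 * k) * (4 * C2 * norm x)"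
      by (simp add: norm_mult norm_power)
    then show ?thesis using x by (simp add: mult_le_cancel_left)
  qed
  have "((\<lambda>x. R x - ?A * (\<sigma> ^ (2 * k) - 1)) \<longlongrightarrow> 0) (at 0)"
  proof (rule Lim_null_comparison)
    have "\<forall>\<^sub>F x in at (0::complex). norm x < r2 \<and> x \<noteq> 0"
      using radii(2) by (auto simp: eventually_at intro!: exI[of _ r2])
    then show "\<forall>\<^sub>F x in at 0. norm (R x - ?A * (\<sigma> ^ (2 * k) - 1)) \<le> 4 * C2 * norm x"
      by eventually_elim (use est in auto)
    show "((\<lambda>x::complex. 4 * C2 * norm x) \<longlongrightarrow> 0) (at 0)"
      by (rule tendsto_mult_right_zero, rule tendsto_norm_zero, rule tendsto_ident_at)
  qed
  then have l1: "(R \<longlongrightarrow> ?A * (\<sigma> ^ (2 * k) - 1)) (at 0)" using Lim_null by blast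
  have "continuous (at 0) R"
    using holomorphic_on_imp_continuous_on[OF R(1)] radii continuous_on_eq_continuous_at[OF open_ball]
    by (metis centre_in_ball less_trans)
  then have l2: "(R \<longlongrightarrow> R 0) (at 0)" by (simp add: isCont_def)
  have "R 0 = ?A * (\<sigma> ^ (2 * k) - 1)" by (rule tendsto_unique[OF _ l2 l1]) simp
  then show ?thesis using R(3) radii by simp
qed


lemma Theta_close:
  assumes \<sigma>: "norm \<sigma> < 3" and \<theta>: "0 < \<theta>" "\<theta> \<le> 1 / 2" and z: "z \<in> plot_dom (plots2 (\<theta> * r2))"
  shows "norm (\<Theta> (z, \<sigma>) - \<Theta> ((\<lambda>_. 0, 0), \<sigma>)) \<le> 2 * M_Theta * \<theta>"
proof -
  have F: "curve_holomorphic (plots2 r2) (\<lambda>z. \<Theta> (z, \<sigma>))"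
    unfolding curve_holomorphic_def
  proof (intro allI impI)
    fix T and c :: "complex \<Rightarrow> ('i \<Rightarrow> complex) \<times> complex" assume T: "open T" and c: "plots2 r2 T c"
    have "plots_Theta T (\<lambda>w. (c w, \<sigma>))" using c \<sigma> by simp
    from curve_holomorphicD[OF Theta_holomorphic, OF T, OF this]
    show "(\<lambda>w. \<Theta> (c w, \<sigma>)) holomorphic_on T" .
  qed
  have "norm ((\<lambda>z. \<Theta> (z, \<sigma>)) (fst z, snd z) - (\<lambda>z. \<Theta> (z, \<sigma>)) (\<lambda>_. 0, 0)) \<le> 2 * M_Theta * \<theta>"
  proof (rule curve_holomorphic_close_to_0[OF F _ \<theta>])
    show "norm (\<Theta> (z, \<sigma>)) \<le> M_Theta" if "z \<in> plot_dom (plots2 r2)" for z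
      using Theta_bound[of "(z, \<sigma>)"] that \<sigma> by simp
  qed (use radii(2) z in \<open>auto intro: less_imp_le\<close>)
  then show ?thesis by simp
qed

lemma scaled_plots2_mono:
  assumes "0 < \<theta>" "\<theta> \<le> 1 / 2" "plots2 (\<theta> * r2) T c"
  shows "plots2 r2 T c"
proof -
  have "\<theta> * r2 \<le> 1 * r2" using assms radii by (intro mult_right_mono) auto
  then show ?thesis
    using assms(3) by (auto elim!: prod_plots_mono poly_plots_mono)
qed

text \<open>At the base point \<Theta> / \<alpha> has derivative \<sigma>^(2k-1) = -1 at its zero
  \<sigma> = -1. So with \<sigma> = -1 + \<tau> the map \<tau> \<mapsto> \<tau> + \<Theta> /
  \<alpha> has derivative near 0; it contracts, and its fixed point is the zero. Closeness on a
  larger disc carries this over to nearby parameters.\<close>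

lemma Theta_root:
  "\<exists>\<theta> \<psi>. 0 < \<theta> \<and> \<theta> \<le> 1 / 2 \<and> curve_holomorphic (plots2 (\<theta> * r2)) \<psi> \<and>
     (\<forall>z\<in>plot_dom (plots2 (\<theta> * r2)). norm (\<psi> z) \<le> 1 / 2 \<and> \<Theta> (z, -1 + \<psi> z) = 0 \<and>
       (real_arg (fst z) \<longrightarrow> snd z \<in> \<real> \<longrightarrow> \<psi> z \<in> \<real>))"
proof -
  let ?A = "complex_of_real \<alpha>"
  \<comment> \<open>The derivative of \<open>G0\<close>; it vanishes at 0 because 2k - 1 is
    odd.\<close>
  let ?d = "\<lambda>\<tau>::complex. 1 + (-1 + \<tau>) ^ (2 * k - 1)"
  have "isCont ?d 0" by (intro continuous_intros)
  then obtain d where d: "d > 0" "\<And>\<tau>. norm \<tau> < d \<Longrightarrow> norm (?d \<tau> - ?d 0) < 1 / 4"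
    unfolding continuous_at_eps_delta dist_norm by (metis diff_zero zero_less_divide_1_iff zero_less_numeral)
  have odd: "odd (2 * k - 1)" using k by simp
  then have "?d 0 = 0" by simp
  with d have d': "norm (?d \<tau>) < 1 / 4" if "norm \<tau> < d" for \<tau> using that by fastforce
  define p where "p = min (d / 2) (1 / 2)"
  have p: "p > 0" "p < d" "p \<le> 1 / 2" using d by (auto simp: p_def)
  \<comment> \<open>With this radius \<open>G\<close> differs from \<open>G0\<close> by at most p /
    8 on the unit disc, so on the disc of radius 1/2 the Lipschitz constant changes by at most p /
    4.\<close>
  define \<theta> where "\<theta> = min (1 / 2) (\<bar>\<alpha>\<bar> * p / (16 * M_Theta))"
  have \<theta>: "0 < \<theta>" "\<theta> \<le> 1 / 2" using \<alpha> p radii by (auto simp: \<theta>_def)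
  have "\<theta> * (16 * M_Theta) \<le> \<bar>\<alpha>\<bar> * p"
    using radii(7) mult_right_mono[of \<theta> "\<bar>\<alpha>\<bar> * p / (16 * M_Theta)" "16 * M_Theta"] by (simp add: \<theta>_def)
  then have eps: "2 * M_Theta * \<theta> / \<bar>\<alpha>\<bar> \<le> p / 8" using \<alpha> by (simp add: field_simps)
  let ?P = "plots2 (\<theta> * r2) :: (('i \<Rightarrow> complex) \<times> complex) plots"
  define G where "G z \<tau> = \<tau> + \<Theta> (z, -1 + \<tau>) / ?A" for z \<tau>
  define G0 where "G0 \<tau> = \<tau> + ((-1 + \<tau>) ^ (2 * k) - 1) / of_nat (2 * k)" for \<tau> :: complex
  have s3: "norm (-1 + \<tau>) < 3" if "norm \<tau> < 1" for \<tau> :: complex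
    using that norm_triangle_ineq[of "-1" \<tau>] by simp
  have G00: "G (\<lambda>_. 0, 0) \<tau> = G0 \<tau>" if "norm \<tau> < 1" for \<tau>
    using Theta_0[OF s3[OF that]] \<alpha> by (simp add: G_def G0_def)
  have zdom: "z \<in> plot_dom (plots2 r2)" if "z \<in> plot_dom ?P" for z
    using scaled_plots2_mono[OF \<theta>, of UNIV "\<lambda>_. z"] that unfolding plot_dom_def by blast
  have E: "norm (G z \<tau> - G0 \<tau>) \<le> p / 8" if z: "z \<in> plot_dom ?P" and \<tau>: "norm \<tau> < 1" for z \<tau>
  proof -
    have "G z \<tau> - G0 \<tau> = (\<Theta> (z, -1 + \<tau>) - \<Theta> ((\<lambda>_. 0, 0), -1 + \<tau>)) / ?A"
      unfolding G00[OF \<tau>, symmetric] by (simp add: G_def diff_divide_distrib)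
    then have "norm (G z \<tau> - G0 \<tau>) \<le> 2 * M_Theta * \<theta> / \<bar>\<alpha>\<bar>"
      using Theta_close[OF s3[OF \<tau>] \<theta> z] by (simp add: norm_divide divide_right_mono)
    with eps show ?thesis by simp
  qed
  have G0_lip: "norm (G0 \<tau> - G0 \<tau>') \<le> 1 / 4 * norm (\<tau> - \<tau>')" if "norm \<tau> \<le> p" "norm \<tau>' \<le> p" for \<tau> \<tau>'
  proof (rule field_differentiable_bound[of "cball 0 p" G0 ?d])
    fix u :: complex assume u: "u \<in> cball 0 p"
    have k0: "(of_nat (2 * k) :: complex) \<noteq> 0" using k by simp
    have "(G0 has_field_derivative 1 + (of_nat (2 * k) * (-1 + u) ^ (2 * k - 1)) / of_nat (2 * k)) (at u)"
      unfolding G0_def using k0 by (auto intro!: derivative_eq_intros)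
    then show "(G0 has_field_derivative ?d u) (at u within cball 0 p)"
      using k0 by (simp add: has_field_derivative_at_within)
    show "norm (?d u) \<le> 1 / 4" using d'[of u] u p by simp
  qed (use that in auto)
  have line: "(\<lambda>\<tau>. \<Theta> (z, -1 + \<tau>)) holomorphic_on ball 0 1" if z: "z \<in> plot_dom ?P" for z
  proof -
    have "plots2 r2 (ball 0 1) (\<lambda>_. z)"
      by (rule plot_constant[OF plot_family_prod, OF plot_family_poly, OF zdom[OF z]])
    then have "plots_Theta (ball 0 1) (\<lambda>\<tau>. (z, -1 + \<tau>))"
      using s3 by (auto intro!: holomorphic_intros)
    then show ?thesis by (rule curve_holomorphicD[OF Theta_holomorphic, OF open_ball])
  qed
  have G_lip: "norm (G z \<tau> - G z \<tau>') \<le> 1 / 2 * norm (\<tau> - \<tau>')"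
    if z: "z \<in> plot_dom ?P" and "norm \<tau> \<le> p" "norm \<tau>' \<le> p" for z \<tau> \<tau>'
  proof -
    have "(\<lambda>\<tau>. G z \<tau> - G0 \<tau>) holomorphic_on ball 0 1"
      unfolding G_def G0_def using k \<alpha>
      by (intro holomorphic_on_diff holomorphic_on_add holomorphic_on_divide holomorphic_on_ident line[OF z]
          holomorphic_on_const holomorphic_on_power) auto
    then have "norm ((G z \<tau> - G0 \<tau>) - (G z \<tau>' - G0 \<tau>')) \<le> (p / 8) / (1 - 1 / 2) * norm (\<tau> - \<tau>')"
      by (rule holomorphic_bounded_lipschitz[where a=0]) (use that p E[OF z] in auto)
    also have "\<dots> \<le> 1 / 4 * norm (\<tau> - \<tau>')" using p by (intro mult_right_mono) auto
    finally show ?thesis using G0_lip[OF that(2,3)] norm_triangle_ineq[of "(G z \<tau> - G0 \<tau>) - (G z \<tau>' - G0 \<tau>')" "G0 \<tau> - G0 \<tau>'"]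
      by simp
  qed
  have G_map: "norm (G z \<tau>) \<le> p" if z: "z \<in> plot_dom ?P" and \<tau>: "norm \<tau> \<le> p" for z \<tau>
  proof -
    have "norm (G z \<tau> - G z 0) \<le> 1 / 2 * norm (\<tau> - 0)" using p by (intro G_lip z \<tau>) auto
    moreover have "norm (G z 0) \<le> p / 8" using E[OF z, of 0] by (simp add: G0_def)
    ultimately show ?thesis using norm_triangle_ineq[of "G z \<tau> - G z 0" "G z 0"] \<tau> p by simp
  qed
  define K where "K z = (if real_arg (fst z) \<and> snd z \<in> \<real> then \<real> \<inter> cball 0 p else cball 0 p :: complex set)"
    for z :: "('i \<Rightarrow> complex) \<times> complex"
  have Kn: "norm y \<le> p" if "y \<in> K z" for y z using that by (auto simp: K_def split: if_splits)
  have P: "plot_family ?P" by (intro plot_family_intros)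
  have "\<exists>\<psi>. curve_holomorphic ?P \<psi> \<and> (\<forall>z\<in>plot_dom ?P. \<psi> z \<in> K z \<and> G z (\<psi> z) = \<psi> z)"
  proof (rule curve_holomorphic_fixed_point[where P="?P" and K=K and B=p and \<T>="\<lambda>u z. G z (u z)" and ?u0.0="\<lambda>_. 0"])
    show "curve_holomorphic ?P (\<lambda>_. 0)" by (simp add: curve_holomorphic_def)
    show "0 \<in> K z" for z using p by (simp add: K_def)
    show "closed (K z) \<and> K z \<subseteq> cball 0 p" for z
      by (auto simp: K_def intro: closed_Int closed_complex_Reals)
    show "curve_holomorphic ?P (\<lambda>z. G z (u z)) \<and> (\<forall>z\<in>plot_dom ?P. G z (u z) \<in> K z)"
      if u: "curve_holomorphic ?P u" "\<And>z. z \<in> plot_dom ?P \<Longrightarrow> u z \<in> K z" for u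
    proof
      have un: "norm (u z) < 1" if "z \<in> plot_dom ?P" for z using Kn[OF u(2)[OF that]] p by simp
      show "curve_holomorphic ?P (\<lambda>z. G z (u z))"
        unfolding curve_holomorphic_def
      proof (intro allI impI)
        fix T c assume T: "open T" and c: "?P T c"
        have uc: "(\<lambda>w. u (c w)) holomorphic_on T" by (rule curve_holomorphicD[OF u(1), OF T, OF c])
        have "c w \<in> plot_dom ?P" if "w \<in> T" for w by (rule plot_familyD(1)[OF P, OF c that])
        then have "plots_Theta T (\<lambda>w. (c w, -1 + u (c w)))"
          using scaled_plots2_mono[OF \<theta> c] uc un s3 by (auto intro!: holomorphic_intros)
        from curve_holomorphicD[OF Theta_holomorphic, OF T, OF this]
        show "(\<lambda>w. G (c w) (u (c w))) holomorphic_on T"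
          unfolding G_def using uc \<alpha>
          by (intro holomorphic_on_add holomorphic_on_divide holomorphic_on_const) auto
      qed
      show "\<forall>z\<in>plot_dom ?P. G z (u z) \<in> K z"
      proof
        fix z assume z: "z \<in> plot_dom ?P"
        have 1: "norm (G z (u z)) \<le> p" by (rule G_map[OF z Kn[OF u(2)[OF z]]])
        have 2: "G z (u z) \<in> \<real>" if re: "real_arg (fst z)" "snd z \<in> \<real>"
        proof -
          have uR: "u z \<in> \<real>" using u(2)[OF z] re by (simp add: K_def)
          have "\<Theta> ((fst z, snd z), -1 + u z) \<in> \<real>"
            using zdom[OF z] re uR s3[OF un[OF z]] by (intro Theta_real) auto
          then show ?thesis using uR by (simp add: G_def)
        qed
        from 1 2 show "G z (u z) \<in> K z" by (simp add: K_def)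
      qed
    qed
    show "\<forall>z\<in>plot_dom ?P. norm (G z (u z) - G z (v z)) \<le> e / 2"
      if "\<And>z. z \<in> plot_dom ?P \<Longrightarrow> u z \<in> K z \<and> v z \<in> K z \<and> norm (u z - v z) \<le> e" for u v e
    proof
      fix z assume z: "z \<in> plot_dom ?P"
      have "norm (G z (u z) - G z (v z)) \<le> 1 / 2 * norm (u z - v z)"
        using that[OF z] by (intro G_lip z) (blast intro: Kn)+
      with that[OF z] show "norm (G z (u z) - G z (v z)) \<le> e / 2" by simp
    qed
    show "\<exists>\<psi>. curve_holomorphic ?P \<psi> \<and> (\<forall>z\<in>plot_dom ?P. \<psi> z \<in> K z \<and> G z (\<psi> z) = \<psi> z)"
      if "curve_holomorphic ?P u" "\<And>z. z \<in> plot_dom ?P \<Longrightarrow> u z \<in> K z"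
        "\<And>z. z \<in> plot_dom ?P \<Longrightarrow> G z (u z) = u z" for u
      using that by blast
  qed (use P p in auto)
  then obtain \<psi> where \<psi>: "curve_holomorphic ?P \<psi>" "\<And>z. z \<in> plot_dom ?P \<Longrightarrow> \<psi> z \<in> K z"
    "\<And>z. z \<in> plot_dom ?P \<Longrightarrow> G z (\<psi> z) = \<psi> z" by blast
  have "norm (\<psi> z) \<le> 1 / 2 \<and> \<Theta> (z, -1 + \<psi> z) = 0 \<and> (real_arg (fst z) \<longrightarrow> snd z \<in> \<real> \<longrightarrow> \<psi> z \<in> \<real>)"
    if z: "z \<in> plot_dom ?P" for z
    using \<psi>(2)[OF z] \<psi>(3)[OF z] Kn[OF \<psi>(2)[OF z]] p \<alpha> by (auto simp: G_def K_def)
  with \<psi>(1) \<theta> show ?thesis by blast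
qed

text \<open>The Cauchy integral device once more, for the slope on the axis. The integral depends
  holomorphically on parameter and phase variable, hence is close to \<open>\<alpha>\<close>, and so
  the slope keeps its sign at nearby real parameters.\<close>

lemma slope_cofactor:
  "\<exists>\<theta>. 0 < \<theta> \<and> \<theta> \<le> 1 / 2 \<and> (\<forall>a s. real_arg a \<longrightarrow> (\<forall>i. norm (a i) < \<theta> * r2) \<longrightarrow> norm s < \<theta> * r2 \<longrightarrow>
     (\<exists>q. f ((a, s), 0) = s ^ (2 * k - 1) * q \<and> norm (q - of_real \<alpha>) \<le> \<bar>\<alpha>\<bar> / 2))"
proof -
  let ?\<zeta> = "circlepath 0 \<rho>"
  let ?F = "\<lambda>z t. f ((fst z, ?\<zeta> t), 0) / ?\<zeta> t ^ (2 * k - 1) * ?\<zeta> t / (?\<zeta> t - snd z)"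
  define q where "q z = integral {0..1} (?F z)" for z
  define M where "M = N / \<rho> ^ (2 * k - 1) * \<rho> / (\<rho> / 2)"
  have M: "M > 0" using N radii by (simp add: M_def)
  have \<zeta>: "norm (?\<zeta> t) = \<rho>" "?\<zeta> t \<noteq> 0" for t
    using radii norm_circlepath_0[of \<rho> t] by (auto simp del: norm_circlepath_0)
  have rr: "\<rho> < r" "r2 < r" using r1 r by (auto simp: \<rho>_def r2_def)
  have far: "norm (?\<zeta> t - x) \<ge> \<rho> / 2" if "norm x < r2" for x t
    using that \<zeta>(1)[of t] radii norm_triangle_ineq2[of "?\<zeta> t" x] by simp
  have far0: "?\<zeta> t - x \<noteq> 0" if "norm x < r2" for x t
    using far[OF that, of t] radii by auto
  have fz: "((fst z, s), 0) \<in> plot_dom (plots3 r)" if "z \<in> plot_dom (plots2 r2)" "norm s < r" for z :: "('i \<Rightarrow> complex) \<times> complex" and s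
    using that r by (auto intro: less_trans[OF _ rr(2)])
  have cont: "continuous_on {0..1} (?F z)" if z: "z \<in> plot_dom (plots2 r2)" for z
  proof -
    have "plots3 r (ball 0 r) (\<lambda>s. ((fst z, s), 0))"
      using fz[OF z] r by (auto simp: poly_plots_def intro: less_trans[OF _ rr(2)])
    then have "(\<lambda>s. f ((fst z, s), 0)) holomorphic_on ball 0 r" by (rule curve_holomorphicD[OF hol, OF open_ball])
    then have "continuous_on (ball 0 r) (\<lambda>s. f ((fst z, s), 0))" by (rule holomorphic_on_imp_continuous_on)
    moreover have c: "continuous_on {0..1} ?\<zeta>"
      using path_circlepath[of 0 \<rho>] by (simp add: path_def)
    moreover have "?\<zeta> ` {0..1} \<subseteq> ball 0 r" using \<zeta> rr by auto
    ultimately have "continuous_on {0..1} (\<lambda>t. f ((fst z, ?\<zeta> t), 0))"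
      by (rule continuous_on_compose2)
    then show ?thesis using c \<zeta> far0[of "snd z"] z by (intro continuous_intros) auto
  qed
  have bd: "norm (?F z t) \<le> M" if z: "z \<in> plot_dom (plots2 r2)" for z t
  proof -
    have "norm (f ((fst z, ?\<zeta> t), 0)) \<le> N" by (rule bound[OF fz[OF z]]) (use \<zeta> rr in simp)
    then show ?thesis
      unfolding M_def norm_mult norm_divide norm_power \<zeta>(1)
      using far[of "snd z" t] z radii N by (intro frac_le mult_right_mono divide_right_mono) auto
  qed
  have q: "curve_holomorphic (plots2 r2) q"
    unfolding q_def
  proof (rule curve_holomorphic_integral[where M=M])
    show "plot_family (plots2 r2)" by (intro plot_family_intros)
    fix t :: real assume t: "t \<in> {0..1}"
    show "curve_holomorphic (plots2 r2) (\<lambda>z. ?F z t)"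
      unfolding curve_holomorphic_def
    proof (intro allI impI)
      fix T and c :: "complex \<Rightarrow> ('i \<Rightarrow> complex) \<times> complex" assume T: "open T" and c: "plots2 r2 T c"
      have h: "(\<lambda>w. snd (c w)) holomorphic_on T" "\<And>w. w \<in> T \<Longrightarrow> norm (snd (c w)) < r2"
        "poly_plots r2 T (\<lambda>w. fst (c w))"
        using c by (auto simp: prod_plots_def)
      have "poly_plots r T (\<lambda>w. fst (c w))" using h(3) rr by (auto intro: poly_plots_mono)
      then have "plots3 r T (\<lambda>w. ((fst (c w), ?\<zeta> t), 0))" using \<zeta>(1)[of t] rr r by auto
      from curve_holomorphicD[OF hol, OF T, OF this]
      have e: "(\<lambda>w. f ((fst (c w), ?\<zeta> t), 0)) holomorphic_on T" .
      show "(\<lambda>w. ?F (c w) t) holomorphic_on T"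
        by (intro holomorphic_on_divide holomorphic_on_mult holomorphic_on_diff holomorphic_on_const e h(1))
          (use \<zeta> far0 h(2) in auto)
    qed
  qed (use cont bd in auto)
  have qM: "norm (q z) \<le> M" if z: "z \<in> plot_dom (plots2 r2)" for z
  proof -
    have "norm (q z) \<le> M * (1 - 0)" unfolding q_def by (rule integral_bound) (use cont bd z in auto)
    then show ?thesis by simp
  qed
  have qf: "f ((a, s), 0) = s ^ (2 * k - 1) * q (a, s)" "a = (\<lambda>_. 0) \<Longrightarrow> s = 0 \<Longrightarrow> q (a, s) = of_real \<alpha>"
    if a: "real_arg a" "\<And>i. norm (a i) < r2" and s: "norm s < r2" for a s
  proof -
    have ar: "norm (a i) < r" for i using a(2)[of i] rr by simp
    obtain R where R: "R holomorphic_on ball 0 r" "\<And>s. s \<in> ball 0 r \<Longrightarrow> f ((a, s), 0) = s ^ (2 * k - 1) * R s"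
      "a = (\<lambda>_. 0) \<Longrightarrow> R 0 = of_real \<alpha>" using flat_factor[OF a(1) ar] by metis
    have "?F (a, s) = (\<lambda>t. R (?\<zeta> t) * ?\<zeta> t / (?\<zeta> t - s))"
      using R(2) \<zeta> rr by (auto simp: fun_eq_iff)
    then have "q (a, s) = integral {0..1} (\<lambda>t. R (?\<zeta> t) * ?\<zeta> t / (?\<zeta> t - s))" by (simp add: q_def)
    also have "\<dots> = R s" by (rule Cauchy_integral_01[OF R(1)]) (use radii rr s in auto)
    finally have "q (a, s) = R s" .
    then show "f ((a, s), 0) = s ^ (2 * k - 1) * q (a, s)" "a = (\<lambda>_. 0) \<Longrightarrow> s = 0 \<Longrightarrow> q (a, s) = of_real \<alpha>"
      using R(2,3) s rr by auto
  qed
  define \<theta> where "\<theta> = min (1 / 2) (\<bar>\<alpha>\<bar> / (4 * M))"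
  have \<theta>: "0 < \<theta>" "\<theta> \<le> 1 / 2" using \<alpha> M by (auto simp: \<theta>_def)
  have "\<theta> * (4 * M) \<le> \<bar>\<alpha>\<bar>"
    using M mult_right_mono[of \<theta> "\<bar>\<alpha>\<bar> / (4 * M)" "4 * M"] by (simp add: \<theta>_def)
  then have \<theta>M: "2 * M * \<theta> \<le> \<bar>\<alpha>\<bar> / 2" by (simp add: mult_ac)
  have "\<exists>q. f ((a, s), 0) = s ^ (2 * k - 1) * q \<and> norm (q - of_real \<alpha>) \<le> \<bar>\<alpha>\<bar> / 2"
    if a: "real_arg a" "\<And>i. norm (a i) < \<theta> * r2" and s: "norm s < \<theta> * r2" for a s
  proof -
    have "\<theta> * r2 \<le> 1 * r2" using \<theta> radii by (intro mult_right_mono) auto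
    then have a2: "norm (a i) < r2" "norm s < r2" for i using a(2)[of i] s by auto
    have "norm (q (a, s) - q (\<lambda>_. 0, 0)) \<le> 2 * M * \<theta>"
    proof (rule curve_holomorphic_close_to_0[OF q _ \<theta>])
      show "norm (q z) \<le> M" if "z \<in> plot_dom (plots2 r2)" for z using qM[OF that] .
    qed (use a(2) s radii(2) in \<open>auto intro: less_imp_le\<close>)
    moreover have "q (\<lambda>_. 0, 0) = of_real \<alpha>"
      using qf(2)[of "\<lambda>_. 0" 0] radii by (simp add: real_arg_def)
    ultimately show ?thesis using qf(1)[OF a(1) a2(1) a2(2)] \<theta>M by force
  qed
  with \<theta> show ?thesis by blast
qed

text \<open>Collects what \<open>half_turn\<close> asks for: the root of \<open>\<Theta>\<close>
  gives the other zero of the graph, the value of \<open>\<Theta>\<close> at \<sigma> = 0, close to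
  - \<alpha> / 2k, gives the side on which the graph passes over 0, and the cofactor gives the sign
  of the slope.\<close>

theorem half_turn_data:
  "\<exists>\<rho>' \<psi>. 0 < \<rho>' \<and> \<rho>' \<le> r2 \<and> curve_holomorphic (plots2 \<rho>') \<psi> \<and>
     (\<forall>z\<in>plot_dom (plots2 \<rho>'). norm (\<psi> z) \<le> 1 / 2) \<and>
     (\<forall>a x. real_arg a \<longrightarrow> (\<forall>i. norm (a i) < \<rho>') \<longrightarrow> \<bar>x\<bar> < \<rho>' \<longrightarrow>
        \<psi> (a, of_real x) \<in> \<real> \<and> \<eta> ((a, of_real x), of_real x * (-1 + \<psi> (a, of_real x))) = 0 \<and>
        (x \<noteq> 0 \<longrightarrow> \<alpha> * Re (\<eta> ((a, of_real x), 0)) < 0 \<and> \<alpha> * (x * Re (f ((a, of_real x), 0))) > 0))"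
proof -
  obtain \<theta>1 \<psi> where 1: "0 < \<theta>1" "\<theta>1 \<le> 1 / 2" "curve_holomorphic (plots2 (\<theta>1 * r2)) \<psi>"
     "\<forall>z\<in>plot_dom (plots2 (\<theta>1 * r2)). norm (\<psi> z) \<le> 1 / 2 \<and> \<Theta> (z, -1 + \<psi> z) = 0 \<and>
       (real_arg (fst z) \<longrightarrow> snd z \<in> \<real> \<longrightarrow> \<psi> z \<in> \<real>)"
    using Theta_root by blast
  obtain \<theta>2 where 2: "0 < \<theta>2" "\<theta>2 \<le> 1 / 2" "\<And>a s. real_arg a \<Longrightarrow> (\<forall>i. norm (a i) < \<theta>2 * r2) \<Longrightarrow> norm s < \<theta>2 * r2 \<Longrightarrow>
     (\<exists>q. f ((a, s), 0) = s ^ (2 * k - 1) * q \<and> norm (q - of_real \<alpha>) \<le> \<bar>\<alpha>\<bar> / 2)"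
    using slope_cofactor by blast
  define \<theta>3 where "\<theta>3 = min (1 / 2) (\<bar>\<alpha>\<bar> / (8 * k * M_Theta))"
  have 3: "0 < \<theta>3" "\<theta>3 \<le> 1 / 2" using \<alpha> k radii by (auto simp: \<theta>3_def)
  have "\<theta>3 * (8 * k * M_Theta) \<le> \<bar>\<alpha>\<bar>"
    using radii(7) k mult_right_mono[of \<theta>3 "\<bar>\<alpha>\<bar> / (8 * k * M_Theta)" "8 * k * M_Theta"] by (simp add: \<theta>3_def)
  then have \<theta>3M: "2 * M_Theta * \<theta>3 \<le> \<bar>\<alpha>\<bar> / (4 * k)" using k by (simp add: field_simps)
  define \<theta> where "\<theta> = min \<theta>1 (min \<theta>2 \<theta>3)"
  have \<theta>: "0 < \<theta>" "\<theta> \<le> 1 / 2" "\<theta> \<le> \<theta>1" "\<theta> \<le> \<theta>2" "\<theta> \<le> \<theta>3" using 1 2 3 by (auto simp: \<theta>_def)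
  have le: "\<theta> * r2 \<le> \<theta>1 * r2" "\<theta> * r2 \<le> \<theta>2 * r2" "\<theta> * r2 \<le> \<theta>3 * r2" "\<theta> * r2 \<le> 1 * r2"
    using \<theta> radii by (auto intro!: mult_right_mono)
  let ?\<rho> = "\<theta> * r2"
  have mono: "plots2 (\<theta>1 * r2) T c" if "plots2 ?\<rho> T c" for T and c :: "complex \<Rightarrow> ('i \<Rightarrow> complex) \<times> complex"
    using that le by (auto elim!: prod_plots_mono poly_plots_mono)
  have dom: "z \<in> plot_dom (plots2 (\<theta>1 * r2))" if "z \<in> plot_dom (plots2 ?\<rho>)" for z :: "('i \<Rightarrow> complex) \<times> complex"
    using that mono unfolding plot_dom_def by blast
  have "\<psi> (a, of_real x) \<in> \<real> \<and> \<eta> ((a, of_real x), of_real x * (-1 + \<psi> (a, of_real x))) = 0 \<and>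
        (x \<noteq> 0 \<longrightarrow> \<alpha> * Re (\<eta> ((a, of_real x), 0)) < 0 \<and> \<alpha> * (x * Re (f ((a, of_real x), 0))) > 0)"
    if a: "real_arg a" "\<And>i. norm (a i) < ?\<rho>" and x: "\<bar>x\<bar> < ?\<rho>" for a x
  proof -
    let ?x = "complex_of_real x"
    have a2: "norm (a i) < r2" "norm ?x < r2" for i using a(2)[of i] x le by auto
    have z: "(a, ?x) \<in> plot_dom (plots2 ?\<rho>)" using a x by simp
    have p: "norm (\<psi> (a, ?x)) \<le> 1 / 2" "\<Theta> ((a, ?x), -1 + \<psi> (a, ?x)) = 0" "\<psi> (a, ?x) \<in> \<real>"
      using 1(4) dom[OF z] a(1) by auto
    have "norm (-1 + \<psi> (a, ?x)) < 3" using p(1) norm_triangle_ineq[of "-1" "\<psi> (a, ?x)"] by simp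
    from Theta_eta[OF a(1) a2(1) this a2(2)] p(2)
    have eta0: "\<eta> ((a, ?x), ?x * (-1 + \<psi> (a, ?x))) = 0" by simp
    have "\<alpha> * Re (\<eta> ((a, ?x), 0)) < 0 \<and> \<alpha> * (x * Re (f ((a, ?x), 0))) > 0" if x0: "x \<noteq> 0"
    proof
      let ?t = "\<Theta> ((a, ?x), 0)"
      have x2k: "x ^ (2 * k) > 0" using x0 by (simp add: zero_less_power_eq)
      have z3: "(a, ?x) \<in> plot_dom (plots2 (\<theta>3 * r2))" using a x le by (auto intro: less_le_trans)
      have "norm (?t - \<Theta> ((\<lambda>_. 0, 0), 0)) \<le> \<bar>\<alpha>\<bar> / (4 * k)"
        using Theta_close[OF _ 3 z3, of 0] \<theta>3M by simp
      moreover have "\<Theta> ((\<lambda>_. 0, 0), 0) = - of_real (\<alpha> / (2 * k))"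
        using Theta_0[of 0] k by (simp add: zero_power)
      ultimately have "norm (?t + of_real (\<alpha> / (2 * k))) \<le> \<bar>\<alpha>\<bar> / (4 * k)" by simp
      then have "\<bar>Re ?t + \<alpha> / (2 * k)\<bar> \<le> \<bar>\<alpha>\<bar> / (4 * k)"
        using abs_Re_le_cmod[of "?t + of_real (\<alpha> / (2 * k))"] by simp
      then have "\<bar>\<alpha>\<bar> * \<bar>Re ?t + \<alpha> / (2 * k)\<bar> \<le> \<bar>\<alpha>\<bar> * (\<bar>\<alpha>\<bar> / (4 * k))" by (intro mult_left_mono) auto
      then have "\<bar>\<alpha> * Re ?t + \<alpha>^2 / (2 * k)\<bar> \<le> \<alpha>^2 / (4 * k)"
        by (simp add: abs_mult[symmetric] power2_eq_square distrib_left)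
      moreover have "\<alpha>^2 / (4 * k) < \<alpha>^2 / (2 * k)" using \<alpha> k by (simp add: field_simps)
      ultimately have "\<alpha> * Re ?t < 0" by linarith
      moreover have "\<eta> ((a, ?x), 0) = of_real (x ^ (2 * k)) * ?t"
        using Theta_eta[OF a(1) a2(1) _ a2(2), of 0] by simp
      then have "Re (\<eta> ((a, ?x), 0)) = x ^ (2 * k) * Re ?t" by (simp del: of_real_power)
      ultimately show "\<alpha> * Re (\<eta> ((a, ?x), 0)) < 0"
        using mult_pos_neg[OF x2k, of "\<alpha> * Re ?t"] by (simp add: mult.left_commute)
      have "\<exists>q. f ((a, ?x), 0) = ?x ^ (2 * k - 1) * q \<and> norm (q - of_real \<alpha>) \<le> \<bar>\<alpha>\<bar> / 2"
        by (rule 2(3)[OF a(1)]) (use a x le in \<open>auto intro: less_le_trans\<close>)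
      then obtain q where q: "f ((a, ?x), 0) = ?x ^ (2 * k - 1) * q" "norm (q - of_real \<alpha>) \<le> \<bar>\<alpha>\<bar> / 2" by blast
      have "\<bar>Re q - \<alpha>\<bar> \<le> \<bar>\<alpha>\<bar> / 2" using q(2) abs_Re_le_cmod[of "q - of_real \<alpha>"] by simp
      then have "\<bar>\<alpha>\<bar> * \<bar>Re q - \<alpha>\<bar> \<le> \<bar>\<alpha>\<bar> * (\<bar>\<alpha>\<bar> / 2)" by (intro mult_left_mono) auto
      then have "\<bar>\<alpha> * Re q - \<alpha>^2\<bar> \<le> \<alpha>^2 / 2"
        by (simp add: abs_mult[symmetric] power2_eq_square right_diff_distrib)
      moreover have "\<alpha>^2 > 0" using \<alpha> by simp
      ultimately have aq: "\<alpha> * Re q > 0" by linarith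
      have "Re (f ((a, ?x), 0)) = x ^ (2 * k - 1) * Re q"
        unfolding q(1) of_real_power[symmetric] by (simp del: of_real_power)
      then have "x * Re (f ((a, ?x), 0)) = x ^ (2 * k) * Re q"
        using power_2k[of x] by (simp only: mult.assoc[symmetric])
      then show "\<alpha> * (x * Re (f ((a, ?x), 0))) > 0"
        using mult_pos_pos[OF x2k aq] by (simp add: mult.left_commute)
    qed
    with eta0 p(3) show ?thesis by blast
  qed
  moreover have "0 < ?\<rho>" "?\<rho> \<le> r2" using \<theta> radii le by auto
  moreover have "curve_holomorphic (plots2 ?\<rho>) \<psi>" by (rule curve_holomorphic_mono[OF 1(3) mono])
  moreover have "\<forall>z\<in>plot_dom (plots2 ?\<rho>). norm (\<psi> z) \<le> 1 / 2" using 1(4) dom by blast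
  ultimately show ?thesis by blast
qed

end

section \<open>From analytic families to half-turns\<close>

text \<open>A variant of \<open>curve_holomorphic_close_to_0\<close> around any centre in the
  polydisc of half the size. It keeps the complexified X away from 0 and gives the continuity of the
  field.\<close>

lemma plots3_close:
  fixes F :: "(('i \<Rightarrow> complex) \<times> complex) \<times> complex \<Rightarrow> complex"
  assumes F: "curve_holomorphic (plots3 r) F" and M: "\<And>z. z \<in> plot_dom (plots3 r) \<Longrightarrow> norm (F z) \<le> M"
    and \<theta>: "0 < \<theta>" "\<theta> \<le> 1 / 4" and r: "r > 0"
    and a: "\<And>i. norm (a i) \<le> r / 2" "\<And>i. norm (a' i - a i) \<le> \<theta> * r"
    and x: "norm x \<le> r / 2" "norm (x' - x) \<le> \<theta> * r"
    and y: "norm y \<le> r / 2" "norm (y' - y) \<le> \<theta> * r"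
  shows "norm (F ((a', x'), y') - F ((a, x), y)) \<le> 4 * M * \<theta>"
proof -
  let ?c = "\<lambda>w. ((\<lambda>i. a i + w * (a' i - a i), x + w * (x' - x)), y + w * (y' - y))"
  let ?R = "1 / (2 * \<theta>)"
  have bd: "norm (p + w * q) < r" if "norm w < ?R" "norm p \<le> r / 2" "norm q \<le> \<theta> * r" for w p q :: complex
  proof -
    have "norm w * norm q \<le> norm w * (\<theta> * r)" using that by (intro mult_left_mono) auto
    also have "\<dots> < ?R * (\<theta> * r)" using that \<theta> r by (intro mult_strict_right_mono) auto
    also have "\<dots> = r / 2" using \<theta> by simp
    finally show ?thesis using that norm_triangle_ineq[of p "w * q"] by (simp add: norm_mult)
  qed
  have P: "plots3 r (ball 0 ?R) ?c"
    using bd a x y by (auto simp: poly_plots_def intro!: holomorphic_intros)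
  have "norm (F (?c 1) - F (?c 0)) \<le> M / (?R - 1) * norm (1 - 0 :: complex)"
  proof (rule holomorphic_bounded_lipschitz[where a=0])
    show "(\<lambda>w. F (?c w)) holomorphic_on ball 0 ?R"
      by (rule curve_holomorphicD[OF F, OF open_ball P])
    show "norm (F (?c w)) \<le> M" if "w \<in> ball 0 ?R" for w
      using plot_familyD(1)[OF plot_family_prod[OF plot_family_prod], OF plot_family_poly, OF P, OF that]
      by (intro M) auto
    show "1 < ?R" using \<theta> by (simp add: field_simps)
  qed auto
  moreover have "M / (?R - 1) \<le> 2 * M * (2 * \<theta>)"
  proof -
    have "norm (F ((\<lambda>_. 0, 0), 0)) \<le> M" using r by (intro M) auto
    then have "0 \<le> M" using norm_ge_zero order_trans by blast
    then show ?thesis using \<theta> by (intro divide_inverse_minus_1_le) auto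
  qed
  ultimately show ?thesis by simp
qed

abbreviation complexify :: "real ^ 'n::finite \<Rightarrow> 'n \<Rightarrow> complex" where
  "complexify h \<equiv> \<lambda>i. of_real (vec_nth h i)"

lemma plots3_mono: "plots3 s T c \<Longrightarrow> s \<le> r \<Longrightarrow> plots3 r T c"
  by (auto elim!: prod_plots_mono poly_plots_mono)

lemma analytic_component_extension:
  fixes f :: "(real ^ 'n::finite) \<times> real \<times> real \<Rightarrow> 'b::real_normed_vector" and l :: "'b \<Rightarrow> real"
  assumes f: "real_analytic_at f p" and l: "bounded_linear l"
  shows "\<exists>s>0. \<exists>F M. curve_holomorphic (plots3 s) F \<and> (\<forall>z\<in>plot_dom (plots3 s). norm (F z) \<le> M) \<and>
    (\<forall>h x y. (\<forall>i. \<bar>vec_nth h i\<bar> < s) \<longrightarrow> \<bar>x\<bar> < s \<longrightarrow> \<bar>y\<bar> < s \<longrightarrow>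
      F ((complexify h, of_real x), of_real y) = of_real (l (f (p + (h, x, y)))))"
proof -
  obtain r c where r: "r > 0" and hs: "\<And>z. norm z < r \<Longrightarrow>
      ((\<lambda>\<alpha>. (\<Prod>b\<in>Basis. (z \<bullet> b) ^ \<alpha> b) *\<^sub>R c \<alpha>) has_sum f (p + z)) (Basis \<rightarrow>\<^sub>E UNIV)"
    using f unfolding real_analytic_at_def by blast
  have hs': "((\<lambda>\<alpha>. (\<Prod>b\<in>Basis. (z \<bullet> b) ^ \<alpha> b) * l (c \<alpha>)) has_sum l (f (p + z))) (Basis \<rightarrow>\<^sub>E UNIV)"
    if "norm z < r" for z
    using has_sum_bounded_linear[OF l hs[OF that]]
    by (simp add: linear_scale[OF bounded_linear.linear[OF l]] o_def)
  show ?thesis by (rule power_series_complex_extension[OF r]) (rule hs')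
qed

text \<open>The radius is reduced until the complexified X differs from its base value by at most
  one half of it, so that Y / X is holomorphic on the whole polydisc. The bound \<open>e\<close>
  serves to keep the parameters in \<open>U\<close>.\<close>

lemma analytic_family_extension:
  fixes Z :: "real ^ 'n::finite \<Rightarrow> vfield"
  assumes an: "real_analytic_at (\<lambda>(\<Lambda>, p). Z \<Lambda> p) (\<Lambda>0, (0, 0))" and X0: "fst (Z \<Lambda>0 (0, 0)) \<noteq> 0" and e: "e > 0"
  shows "\<exists>r FX FY M. 0 < r \<and> r \<le> e \<and> curve_holomorphic (plots3 r) FX \<and> curve_holomorphic (plots3 r) FY \<and>
    (\<forall>z\<in>plot_dom (plots3 r). norm (FX z) \<le> M \<and> norm (FY z) \<le> M \<and>
       norm (FX z - of_real (fst (Z \<Lambda>0 (0, 0)))) \<le> \<bar>fst (Z \<Lambda>0 (0, 0))\<bar> / 2) \<and>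
    (\<forall>h x y. (\<forall>i. \<bar>vec_nth h i\<bar> < r) \<longrightarrow> \<bar>x\<bar> < r \<longrightarrow> \<bar>y\<bar> < r \<longrightarrow>
      FX ((complexify h, of_real x), of_real y) = of_real (fst (Z (\<Lambda>0 + h) (x, y))) \<and>
      FY ((complexify h, of_real x), of_real y) = of_real (snd (Z (\<Lambda>0 + h) (x, y))))"
proof -
  let ?X0 = "fst (Z \<Lambda>0 (0, 0))"
  have eq: "(case (\<Lambda>0, 0, 0) + (h, x, y) of (\<Lambda>, p) \<Rightarrow> Z \<Lambda> p) = Z (\<Lambda>0 + h) (x, y)" for h x y by simp
  obtain s1 FX M1 where 1: "s1 > 0" "curve_holomorphic (plots3 s1) FX" "\<And>z. z \<in> plot_dom (plots3 s1) \<Longrightarrow> norm (FX z) \<le> M1"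
    "\<And>h x y. (\<And>i. \<bar>vec_nth h i\<bar> < s1) \<Longrightarrow> \<bar>x\<bar> < s1 \<Longrightarrow> \<bar>y\<bar> < s1 \<Longrightarrow>
      FX ((complexify h, of_real x), of_real y) = of_real (fst (Z (\<Lambda>0 + h) (x, y)))"
    using analytic_component_extension[OF an bounded_linear_fst, unfolded eq] by metis
  obtain s2 FY M2 where 2: "s2 > 0" "curve_holomorphic (plots3 s2) FY" "\<And>z. z \<in> plot_dom (plots3 s2) \<Longrightarrow> norm (FY z) \<le> M2"
    "\<And>h x y. (\<And>i. \<bar>vec_nth h i\<bar> < s2) \<Longrightarrow> \<bar>x\<bar> < s2 \<Longrightarrow> \<bar>y\<bar> < s2 \<Longrightarrow>
      FY ((complexify h, of_real x), of_real y) = of_real (snd (Z (\<Lambda>0 + h) (x, y)))"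
    using analytic_component_extension[OF an bounded_linear_snd, unfolded eq] by metis
  define M where "M = max \<bar>M1\<bar> \<bar>M2\<bar> + 1"
  have M: "M > 0" "M1 \<le> M" "M2 \<le> M" by (auto simp: M_def)
  define \<theta> where "\<theta> = min (1 / 4) (\<bar>?X0\<bar> / (8 * M))"
  have \<theta>: "0 < \<theta>" "\<theta> \<le> 1 / 4" "4 * M * \<theta> \<le> \<bar>?X0\<bar> / 2" using X0 M by (auto simp: \<theta>_def min_def field_simps)
  define r where "r = min e (min (\<theta> * s1) s2)"
  have r: "0 < r" "r \<le> e" "r \<le> \<theta> * s1" "r \<le> s2" "r \<le> s1"
  proof -
    have "\<theta> * s1 \<le> 1 * s1" using \<theta> 1 by (intro mult_right_mono) auto
    moreover have "0 < \<theta> * s1" using \<theta> 1 by simp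
    ultimately show "0 < r" "r \<le> e" "r \<le> \<theta> * s1" "r \<le> s2" "r \<le> s1" using e 2 by (auto simp: r_def min_def)
  qed
  have hol: "curve_holomorphic (plots3 r) FX" "curve_holomorphic (plots3 r) FY"
    by (rule curve_holomorphic_mono[OF 1(2)], erule plots3_mono, rule r)
      (rule curve_holomorphic_mono[OF 2(2)], erule plots3_mono, rule r)
  have X00: "FX ((\<lambda>_. 0, 0), 0) = of_real ?X0" using 1(4)[of 0 0 0] 1(1) by simp
  have bd: "norm (FX z) \<le> M \<and> norm (FY z) \<le> M \<and> norm (FX z - of_real ?X0) \<le> \<bar>?X0\<bar> / 2"
    if z: "z \<in> plot_dom (plots3 r)" for z
  proof -
    obtain a x y where zz: "z = ((a, x), y)" by (metis prod.collapse)
    have ax: "norm (a i) \<le> \<theta> * s1" "norm x \<le> \<theta> * s1" "norm y \<le> \<theta> * s1" for i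
      using z r by (auto simp: zz intro: less_imp_le order_trans[OF less_imp_le])
    have "z \<in> plot_dom (plots3 s1)" "z \<in> plot_dom (plots3 s2)" using z r by (auto simp: zz intro: less_le_trans)
    moreover have "norm (FX ((a, x), y) - FX ((\<lambda>_. 0, 0), 0)) \<le> 4 * M1 * \<theta>"
      by (rule plots3_close[OF 1(2,3) \<theta>(1,2) 1(1)]) (use ax 1(1) in auto)
    moreover have "4 * M1 * \<theta> \<le> 4 * M * \<theta>" using M \<theta> by auto
    ultimately show ?thesis using 1(3)[of z] 2(3)[of z] M \<theta>(3) X00 unfolding zz by fastforce
  qed
  have ex: "FX ((complexify h, of_real x), of_real y) = of_real (fst (Z (\<Lambda>0 + h) (x, y))) \<and>
      FY ((complexify h, of_real x), of_real y) = of_real (snd (Z (\<Lambda>0 + h) (x, y)))"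
    if "\<forall>i. \<bar>vec_nth h i\<bar> < r" "\<bar>x\<bar> < r" "\<bar>y\<bar> < r" for h x y
    using that r by (intro conjI 1(4) 2(4)) (auto intro: less_le_trans)
  show ?thesis
    by (rule exI[of _ r], rule exI[of _ FX], rule exI[of _ FY], rule exI[of _ M]) (use r hol bd ex in blast)
qed

lemma has_real_derivative_Re:
  fixes F :: "complex \<Rightarrow> complex"
  assumes "(F has_field_derivative D) (at (of_real x))"
  shows "((\<lambda>x. Re (F (of_real x))) has_real_derivative Re D) (at x)"
proof -
  have "((\<lambda>x. F (of_real x)) has_vector_derivative D) (at x)"
    by (rule has_vector_derivative_real_field[OF assms])
  then show ?thesis unfolding has_real_derivative_iff_has_vector_derivative
    by (rule bounded_linear.has_vector_derivative[OF bounded_linear_Re])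
qed

section \<open>One side of an analytic family\<close>

locale analytic_side =
  fixes Z :: "real ^ 'n::finite \<Rightarrow> vfield" and \<Lambda>0 :: "real ^ 'n" and k :: nat and \<sigma> :: real
    and FX FY :: "(('n \<Rightarrow> complex) \<times> complex) \<times> complex \<Rightarrow> complex" and r M :: real
  assumes r: "r > 0" and k: "k > 0" and \<sigma>: "\<sigma> = 1 \<or> \<sigma> = -1"
    and hX: "curve_holomorphic (plots3 r) FX" and hY: "curve_holomorphic (plots3 r) FY"
    and bX: "\<And>z. z \<in> plot_dom (plots3 r) \<Longrightarrow> norm (FX z) \<le> M"
    and bY: "\<And>z. z \<in> plot_dom (plots3 r) \<Longrightarrow> norm (FY z) \<le> M"
    and close: "\<And>z. z \<in> plot_dom (plots3 r) \<Longrightarrow>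
      norm (FX z - of_real (fst (Z \<Lambda>0 (0, 0)))) \<le> \<bar>fst (Z \<Lambda>0 (0, 0))\<bar> / 2"
    and X0: "fst (Z \<Lambda>0 (0, 0)) \<noteq> 0"
    and eX: "\<And>h x y. (\<And>i. \<bar>vec_nth h i\<bar> < r) \<Longrightarrow> \<bar>x\<bar> < r \<Longrightarrow> \<bar>y\<bar> < r \<Longrightarrow>
      FX ((complexify h, of_real x), of_real y) = of_real (fst (Z (\<Lambda>0 + h) (x, y)))"
    and eY: "\<And>h x y. (\<And>i. \<bar>vec_nth h i\<bar> < r) \<Longrightarrow> \<bar>x\<bar> < r \<Longrightarrow> \<bar>y\<bar> < r \<Longrightarrow>
      FY ((complexify h, of_real x), of_real y) = of_real (snd (Z (\<Lambda>0 + h) (x, y)))"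
    and contact: "\<And>h. (\<And>i. \<bar>vec_nth h i\<bar> < r) \<Longrightarrow> snd (Z (\<Lambda>0 + h) (0, 0)) = 0 \<and>
      (\<forall>i\<in>{1..2 * k - 2}. dx_at_0 i (\<lambda>p. snd (Z (\<Lambda>0 + h) p)) = 0)"
    and visibility: "\<sigma> * (fst (Z \<Lambda>0 (0, 0)) * dx_at_0 (2 * k - 1) (\<lambda>p. snd (Z \<Lambda>0 p))) < 0"
begin

definition X0 where "X0 = fst (Z \<Lambda>0 (0, 0))"
definition f where "f z = FY z / FX z"
text \<open>The coefficient of s^(2k-1) in the expansion of Y / X along the axis at the base
  parameter.\<close>

definition \<alpha> where "\<alpha> = dx_at_0 (2 * k - 1) (\<lambda>p. snd (Z \<Lambda>0 p)) / fact (2 * k - 1) / X0"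
definition N where "N = 2 * M / \<bar>X0\<bar> + 1"

lemma X0_nz: "X0 \<noteq> 0" using X0 by (simp add: X0_def)

lemma M_nonneg: "M \<ge> 0"
proof -
  have "norm (FX ((\<lambda>_. 0, 0), 0)) \<le> M" using r by (intro bX) auto
  then show ?thesis using norm_ge_zero order_trans by blast
qed

lemma FX_low: "z \<in> plot_dom (plots3 r) \<Longrightarrow> norm (FX z) \<ge> \<bar>X0\<bar> / 2" "z \<in> plot_dom (plots3 r) \<Longrightarrow> FX z \<noteq> 0"
proof -
  show *: "norm (FX z) \<ge> \<bar>X0\<bar> / 2" if "z \<in> plot_dom (plots3 r)" for z
    using close[OF that] norm_triangle_ineq3[of "of_real X0 :: complex" "FX z"]
    by (simp add: X0_def norm_minus_commute)
  show "FX z \<noteq> 0" if "z \<in> plot_dom (plots3 r)" using *[OF that] X0_nz by auto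
qed

lemma sigma_alpha: "\<sigma> * \<alpha> < 0" "\<alpha> \<noteq> 0"
proof -
  let ?d = "dx_at_0 (2 * k - 1) (\<lambda>p. snd (Z \<Lambda>0 p))"
  have "\<sigma> * \<alpha> = (\<sigma> * (X0 * ?d)) / (fact (2 * k - 1) * X0\<^sup>2)"
    using X0_nz by (simp add: \<alpha>_def power2_eq_square divide_simps)
  also have "\<dots> < 0" using visibility X0_nz unfolding X0_def[symmetric] by (intro divide_neg_pos mult_pos_pos) auto
  finally show "\<sigma> * \<alpha> < 0" .
  then show "\<alpha> \<noteq> 0" by auto
qed

lemma real_arg_complexify:
  assumes "real_arg a"
  shows "a = complexify (\<chi> i. Re (a i))"
  using assms by (auto simp: real_arg_def)

lemma real_point_values:
  assumes "z \<in> plot_dom (plots3 r)" "real_point z"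
  shows "FX z \<in> \<real>" "FY z \<in> \<real>"
proof -
  obtain a x y where z: "z = ((a, x), y)" by (metis prod.collapse)
  obtain x' y' where xy: "x = of_real x'" "y = of_real y'" using assms(2) by (auto simp: real_point_def z elim!: Reals_cases)
  have ra: "real_arg a" using assms(2) by (auto simp: real_point_def real_arg_def z)
  have b: "\<bar>vec_nth (\<chi> i. Re (a i)) i\<bar> < r" "\<bar>x'\<bar> < r" "\<bar>y'\<bar> < r" for i
    using assms(1) le_less_trans[OF abs_Re_le_cmod] by (auto simp: z xy)
  show "FX z \<in> \<real>" "FY z \<in> \<real>" unfolding z xy
    using eX[OF b] eY[OF b] real_arg_complexify[OF ra] by (metis Reals_of_real)+
qed

lemma dom_real: "(\<And>i. \<bar>vec_nth h i\<bar> < s) \<Longrightarrow> \<bar>x\<bar> < s \<Longrightarrow> \<bar>y\<bar> < s \<Longrightarrow>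
    ((complexify h, of_real x), of_real y) \<in> plot_dom (plots3 s)"
  by simp

text \<open>The contact conditions annihilate the Taylor coefficients of Y along the axis below
  order 2k - 1. They speak of real derivatives, so the complex coefficients are read off from the
  real restriction.\<close>

lemma contact_factor:
  assumes a: "real_arg a" "\<And>i. norm (a i) < r"
  shows "\<exists>R. R holomorphic_on ball 0 r \<and> (\<forall>s\<in>ball 0 r. f ((a, s), 0) = s ^ (2 * k - 1) * R s) \<and>
        (a = (\<lambda>_. 0) \<longrightarrow> R 0 = of_real \<alpha>)"
proof -
  define h where "h = (\<chi> i. Re (a i))"
  have ah: "a = complexify h" unfolding h_def by (rule real_arg_complexify[OF a(1)])
  have hr: "\<bar>vec_nth h i\<bar> < r" for i using a(2)[of i] by (simp add: ah)
  have P: "plots3 r (ball 0 r) (\<lambda>s. ((a, s), 0))" using a r by (auto simp: poly_plots_def intro!: holomorphic_intros)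
  have hol: "(\<lambda>s. FX ((a, s), 0)) holomorphic_on ball 0 r" "(\<lambda>s. FY ((a, s), 0)) holomorphic_on ball 0 r"
    by (rule curve_holomorphicD[OF hX, OF open_ball P], rule curve_holomorphicD[OF hY, OF open_ball P])
  have dom: "((a, s), 0) \<in> plot_dom (plots3 r)" if "s \<in> ball 0 r" for s using a r that by auto
  obtain R where R: "R holomorphic_on ball 0 r"
    "\<And>s. s \<in> ball 0 r \<Longrightarrow> FY ((a, s), 0) = (\<Sum>m<2 * k - 1. (deriv ^^ m) (\<lambda>s. FY ((a, s), 0)) 0 / fact m * s ^ m) + s ^ (2 * k - 1) * R s"
    "R 0 = (deriv ^^ (2 * k - 1)) (\<lambda>s. FY ((a, s), 0)) 0 / fact (2 * k - 1)"
    using holomorphic_factor_Taylor[OF hol(2), of "2 * k - 1"] r by blast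
  have re: "FY ((a, of_real x), 0) = of_real (snd (Z (\<Lambda>0 + h) (x, 0)))" if "\<bar>x\<bar> < r" for x
    using eY[OF hr that, of 0] r by (simp add: ah)
  have d: "(deriv ^^ m) (\<lambda>s. FY ((a, s), 0)) 0 = of_real (dx_at_0 m (\<lambda>p. snd (Z (\<Lambda>0 + h) p)))" for m
    using deriv_of_real_restriction[OF hol(2) re, of 0 m] r by (simp add: dx_at_0_def)
  have "(deriv ^^ m) (\<lambda>s. FY ((a, s), 0)) 0 = 0" if "m < 2 * k - 1" for m
  proof (cases "m = 0")
    case True
    then show ?thesis using re[of 0] contact[OF hr] r by simp
  next
    case False
    then show ?thesis using d[of m] contact[OF hr] that by simp
  qed
  then have Rs: "FY ((a, s), 0) = s ^ (2 * k - 1) * R s" if "s \<in> ball 0 r" for s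
    using R(2)[OF that] by simp
  have "(\<lambda>s. R s / FX ((a, s), 0)) holomorphic_on ball 0 r"
    by (intro holomorphic_on_divide R(1) hol(1) FX_low(2) dom)
  moreover have "f ((a, s), 0) = s ^ (2 * k - 1) * (R s / FX ((a, s), 0))" if "s \<in> ball 0 r" for s
    using Rs[OF that] by (simp add: f_def)
  moreover have "R 0 / FX ((a, 0), 0) = of_real \<alpha>" if "a = (\<lambda>_. 0)"
  proof -
    have h0: "h = 0" using that by (simp add: h_def vec_eq_iff)
    have "FX ((a, 0), 0) = of_real X0" using eX[OF hr, of 0 0] r by (simp add: ah h0 X0_def)
    then show ?thesis using R(3) d[of "2 * k - 1"] by (simp add: \<alpha>_def h0)
  qed
  ultimately show ?thesis by blast
qed

sublocale C: complex_contact f r N k \<alpha>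
proof
  show "0 < r" "0 < k" "\<alpha> \<noteq> 0" using r k sigma_alpha by auto
  show "0 < N" using M_nonneg by (simp add: N_def add_nonneg_pos)
  show "curve_holomorphic (plots3 r) f"
    unfolding curve_holomorphic_def f_def
  proof (intro allI impI)
    fix T and c :: "complex \<Rightarrow> (('n \<Rightarrow> complex) \<times> complex) \<times> complex"
    assume T: "open T" and c: "plots3 r T c"
    have "c w \<in> plot_dom (plots3 r)" if "w \<in> T" for w
      by (rule plot_familyD(1)[OF plot_family_prod[OF plot_family_prod], OF plot_family_poly, OF c, OF that])
    then show "(\<lambda>w. FY (c w) / FX (c w)) holomorphic_on T"
      by (intro holomorphic_on_divide curve_holomorphicD[OF hX, OF T c] curve_holomorphicD[OF hY, OF T c] FX_low(2))
  qed
  show "norm (f z) \<le> N" if z: "z \<in> plot_dom (plots3 r)" for z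
  proof -
    have "norm (f z) \<le> M / (\<bar>X0\<bar> / 2)" unfolding f_def norm_divide
      using FX_low(1)[OF z] bY[OF z] X0_nz M_nonneg by (intro frac_le) auto
    then show ?thesis by (simp add: N_def mult.commute)
  qed
  show "f z \<in> \<real>" if "z \<in> plot_dom (plots3 r)" "real_point z" for z
    unfolding f_def using real_point_values[OF that] by (rule Reals_divide[rotated])
  show "\<exists>R. R holomorphic_on ball 0 r \<and> (\<forall>s\<in>ball 0 r. f ((a, s), 0) = s ^ (2 * k - 1) * R s) \<and>
        (a = (\<lambda>_. 0) \<longrightarrow> R 0 = of_real \<alpha>)" if "real_arg a" "\<And>i. norm (a i) < r" for a
    by (rule contact_factor) (use that in auto)
qed

definition \<kappa> where "\<kappa> = sgn X0"

lemma kappa: "\<kappa> = 1 \<or> \<kappa> = -1" "\<kappa> * X0 = \<bar>X0\<bar>"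
  using X0_nz by (auto simp: \<kappa>_def sgn_if)

lemma field_facts:
  assumes h: "\<And>i. \<bar>vec_nth h i\<bar> < r" and x: "\<bar>x\<bar> < r" and y: "\<bar>y\<bar> < r"
  shows "\<bar>X0\<bar> / 2 \<le> \<kappa> * fst (Z (\<Lambda>0 + h) (x, y))" "norm (Z (\<Lambda>0 + h) (x, y)) \<le> 2 * M"
    "slope (Z (\<Lambda>0 + h)) x y = Re (f ((complexify h, of_real x), of_real y))"
proof -
  have dom: "((complexify h, of_real x), of_real y) \<in> plot_dom (plots3 r)" by (rule dom_real) (use assms in auto)
  have "\<bar>fst (Z (\<Lambda>0 + h) (x, y)) - X0\<bar> \<le> \<bar>X0\<bar> / 2"
    using close[OF dom] eX[OF h x y] unfolding X0_def by (metis norm_of_real of_real_diff)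
  then show "\<bar>X0\<bar> / 2 \<le> \<kappa> * fst (Z (\<Lambda>0 + h) (x, y))"
    using kappa by (auto simp: abs_if split: if_splits)
  have "norm (Z (\<Lambda>0 + h) (x, y)) \<le> \<bar>fst (Z (\<Lambda>0 + h) (x, y))\<bar> + \<bar>snd (Z (\<Lambda>0 + h) (x, y))\<bar>"
    by (metis norm_Pair_le prod.collapse real_norm_def)
  then show "norm (Z (\<Lambda>0 + h) (x, y)) \<le> 2 * M"
    using bX[OF dom] bY[OF dom] eX[OF h x y] eY[OF h x y] by simp
  show "slope (Z (\<Lambda>0 + h)) x y = Re (f ((complexify h, of_real x), of_real y))"
    using eX[OF h x y] eY[OF h x y] by (simp add: slope_def f_def flip: of_real_divide)
qed

lemma field_continuous:
  assumes h: "\<And>i. \<bar>vec_nth h i\<bar> < r / 2"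
  shows "continuous_on ({-r/2<..<r/2} \<times> {-r/2<..<r/2}) (Z (\<Lambda>0 + h))"
proof (rule continuous_at_imp_continuous_on, rule ballI)
  fix p assume p: "p \<in> {-r/2<..<r/2} \<times> {-r/2<..<r/2}"
  have hr: "\<bar>vec_nth h i\<bar> < r" for i using h[of i] r by simp
  let ?S = "{-r/2<..<r/2} \<times> {-r/2<..<r/2} :: (real \<times> real) set"
  show "isCont (Z (\<Lambda>0 + h)) p"
    unfolding continuous_at_eps_delta
  proof (intro allI impI)
    fix e :: real assume e: "e > 0"
    define \<theta> where "\<theta> = min (1 / 4) (e / (16 * (M + 1)))"
    have \<theta>: "0 < \<theta>" "\<theta> \<le> 1 / 4" "8 * M * \<theta> < e"
    proof -
      show "0 < \<theta>" using e M_nonneg by (auto simp: \<theta>_def)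
      show "\<theta> \<le> 1 / 4" unfolding \<theta>_def by (rule min.cobounded1)
      have "8 * M * \<theta> \<le> 8 * M * (e / (16 * (M + 1)))" using M_nonneg by (intro mult_left_mono) (auto simp: \<theta>_def)
      also have "\<dots> < e" using M_nonneg e by (simp add: field_simps) (use mult_nonneg_nonneg[of M e] in linarith)
      finally show "8 * M * \<theta> < e" .
    qed
    obtain d where d: "d > 0" "ball p d \<subseteq> ?S"
      using p open_contains_ball[of ?S] open_Times[OF open_greaterThanLessThan open_greaterThanLessThan] by blast
    have "dist (Z (\<Lambda>0 + h) q) (Z (\<Lambda>0 + h) p) < e" if q: "dist q p < min d (\<theta> * r)" for q
    proof -
      have qS: "q \<in> ?S" by (rule subsetD[OF d(2)]) (use q in \<open>simp add: dist_commute\<close>)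
      obtain x y where pe: "p = (x, y)" by fastforce
      obtain x' y' where qe: "q = (x', y')" by fastforce
      have b: "\<bar>x\<bar> < r / 2" "\<bar>y\<bar> < r / 2" "\<bar>x'\<bar> < r / 2" "\<bar>y'\<bar> < r / 2" using p qS pe qe by auto
      have dd: "\<bar>x' - x\<bar> \<le> \<theta> * r" "\<bar>y' - y\<bar> \<le> \<theta> * r"
        using q dist_fst_le[of q p] dist_snd_le[of q p] by (auto simp: pe qe dist_real_def)
      have cl: "norm (F ((complexify h, of_real x'), of_real y') - F ((complexify h, of_real x), of_real y)) \<le> 4 * M * \<theta>"
        if F: "curve_holomorphic (plots3 r) F" "\<And>z. z \<in> plot_dom (plots3 r) \<Longrightarrow> norm (F z) \<le> M"
        for F :: "(('n \<Rightarrow> complex) \<times> complex) \<times> complex \<Rightarrow> complex"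
        proof (rule plots3_close[where F=F and a="complexify h" and a'="complexify h", OF F \<theta>(1,2) r])
          show "norm (of_real x' - of_real x :: complex) \<le> \<theta> * r" "norm (of_real y' - of_real y :: complex) \<le> \<theta> * r"
            using dd by (metis norm_of_real of_real_diff)+
        qed (use b h r \<theta> in \<open>auto simp: less_imp_le\<close>)
      have bb: "\<bar>x\<bar> < r" "\<bar>y\<bar> < r" "\<bar>x'\<bar> < r" "\<bar>y'\<bar> < r" using b r by auto
      have "\<bar>fst (Z (\<Lambda>0 + h) q) - fst (Z (\<Lambda>0 + h) p)\<bar> \<le> 4 * M * \<theta>"
        using cl[OF hX bX] eX[OF hr bb(1,2)] eX[OF hr bb(3,4)] by (simp add: pe qe flip: of_real_diff)
      moreover have "\<bar>snd (Z (\<Lambda>0 + h) q) - snd (Z (\<Lambda>0 + h) p)\<bar> \<le> 4 * M * \<theta>"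
        using cl[OF hY bY] eY[OF hr bb(1,2)] eY[OF hr bb(3,4)] by (simp add: pe qe flip: of_real_diff)
      ultimately show ?thesis
        using norm_Pair_le[of "fst (Z (\<Lambda>0 + h) q) - fst (Z (\<Lambda>0 + h) p)" "snd (Z (\<Lambda>0 + h) q) - snd (Z (\<Lambda>0 + h) p)"] \<theta>(3)
        by (simp add: dist_norm minus_prod_def)
    qed
    then show "\<exists>d>0. \<forall>q. dist q p < d \<longrightarrow> dist (Z (\<Lambda>0 + h) q) (Z (\<Lambda>0 + h) p) < e"
      using d \<theta> r by (intro exI[of _ "min d (\<theta> * r)"]) auto
  qed
qed

text \<open>\<open>R\<close>, \<open>\<rho>\<close> and \<open>r0\<close> remain free because the
  upper and the lower half-turn have to share them. The condition \<open>2 * N * \<rho> < R\<close>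
  keeps the graphs, whose slope is at most \<open>N\<close>, inside the box.\<close>

theorem half_turn_family:
  "\<exists>s m B L N \<eta> \<psi>. 0 < s \<and> s \<le> r \<and> curve_holomorphic (plots2 s) \<psi> \<and> 0 < N \<and>
     (\<forall>z\<in>plot_dom (plots2 s). norm (\<psi> z) \<le> 1 / 2) \<and>
     (\<forall>h x. (\<forall>i. \<bar>vec_nth h i\<bar> < s) \<longrightarrow> \<bar>x\<bar> < s \<longrightarrow> \<psi> (complexify h, of_real x) \<in> \<real>) \<and>
     (\<forall>h \<rho> R r0. (\<forall>i. \<bar>vec_nth h i\<bar> < s) \<longrightarrow> 0 < R \<longrightarrow> R \<le> s \<longrightarrow> \<rho> \<le> s \<longrightarrow> 2 * N * \<rho> < R \<longrightarrow> 0 < r0 \<longrightarrow> 2 * r0 \<le> \<rho> \<longrightarrow>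
        half_turn \<sigma> \<kappa> \<rho> R m B L N r0 (Z (\<Lambda>0 + h)) (\<eta> h)
          (\<lambda>x. x * (-1 + Re (\<psi> (complexify h, of_real x)))))"
proof -
  obtain \<rho>' \<psi> where \<rho>': "0 < \<rho>'" "\<rho>' \<le> C.r2" and \<psi>: "curve_holomorphic (plots2 \<rho>') \<psi>"
     "\<And>z. z \<in> plot_dom (plots2 \<rho>') \<Longrightarrow> norm (\<psi> z) \<le> 1 / 2"
     and data: "\<And>a x. real_arg a \<Longrightarrow> (\<And>i. norm (a i) < \<rho>') \<Longrightarrow> \<bar>x\<bar> < \<rho>' \<Longrightarrow>
        \<psi> (a, of_real x) \<in> \<real> \<and> C.\<eta> ((a, of_real x), of_real x * (-1 + \<psi> (a, of_real x))) = 0 \<and>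
        (x \<noteq> 0 \<longrightarrow> \<alpha> * Re (C.\<eta> ((a, of_real x), 0)) < 0 \<and> \<alpha> * (x * Re (f ((a, of_real x), 0))) > 0)"
    using C.half_turn_data by blast
  have \<rho>1: "\<rho>' \<le> C.r1" "\<rho>' \<le> r / 8" "\<rho>' < r" using \<rho>'(2) C.radii C.r1 r by linarith+
  define \<eta> where "\<eta> h x s = Re (C.\<eta> ((complexify h, of_real x), of_real s))" for h :: "real ^ 'n" and x s :: real
  have ra: "real_arg (complexify h)" for h :: "real ^ 'n" by (simp add: real_arg_def)
  have ht: "half_turn \<sigma> \<kappa> \<rho> R (\<bar>X0\<bar> / 2) (2 * M) C.L N r0 (Z (\<Lambda>0 + h)) (\<eta> h)
          (\<lambda>x. x * (-1 + Re (\<psi> (complexify h, of_real x))))"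
    if h: "\<forall>i. \<bar>vec_nth h i\<bar> < \<rho>'" and R: "0 < R" "R \<le> \<rho>'" and \<rho>: "\<rho> \<le> \<rho>'" "2 * N * \<rho> < R" and r0: "0 < r0" "2 * r0 \<le> \<rho>"
    for h \<rho> R r0
  proof -
    have hr: "\<bar>vec_nth h i\<bar> < r" for i using h \<rho>1 less_trans by blast
    have h1: "norm (complexify h i) < \<rho>'" for i using h by simp
    have dom2: "(complexify h, of_real x) \<in> plot_dom (plots2 C.r1)" if "\<bar>x\<bar> < \<rho>" for x
      using that h \<rho> \<rho>1 by (auto intro: less_le_trans)
    have dom3: "((complexify h, of_real x), of_real s) \<in> plot_dom (plots3 C.r1)" if "\<bar>x\<bar> < \<rho>" "\<bar>s\<bar> < \<rho>" for x s
      using that h \<rho> \<rho>1 by (auto intro: less_le_trans)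
    have \<eta>R: "C.\<eta> ((complexify h, of_real x), of_real s) = of_real (\<eta> h x s)" if "\<bar>x\<bar> < \<rho>" "\<bar>s\<bar> < \<rho>" for x s
      using C.eta_real[OF dom3[OF that]] by (simp add: \<eta>_def real_point_def)
    have \<eta>b: "\<bar>\<eta> h x s\<bar> \<le> r / 2" if "\<bar>x\<bar> < \<rho>" "\<bar>s\<bar> < \<rho>" for x s
      using C.norm_eta[OF dom3[OF that]] abs_Re_le_cmod order_trans unfolding \<eta>_def by blast
    have sl: "slope (Z (\<Lambda>0 + h)) x y = Re (f ((complexify h, of_real x), of_real y))" if "\<bar>x\<bar> < \<rho>" "\<bar>y\<bar> \<le> r / 2" for x y
      using that \<rho> \<rho>1 r by (intro field_facts(3)[OF hr]) auto
    have ode: "(\<eta> h x has_real_derivative slope (Z (\<Lambda>0 + h)) s (\<eta> h x s)) (at s)" if xs: "\<bar>x\<bar> < \<rho>" "\<bar>s\<bar> < \<rho>" for x s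
    proof -
      have "norm (of_real s :: complex) < C.r1" using xs \<rho> \<rho>1 by simp
      from has_real_derivative_Re[OF C.eta_ode(1)[OF dom2[OF xs(1)] this]]
      have D: "((\<lambda>s. Re (C.\<eta> ((complexify h, of_real x), of_real s))) has_real_derivative
          Re (f ((complexify h, of_real s), C.\<eta> ((complexify h, of_real x), of_real s)))) (at s)" by simp
      have e: "Re (f ((complexify h, of_real s), C.\<eta> ((complexify h, of_real x), of_real s))) = slope (Z (\<Lambda>0 + h)) s (\<eta> h x s)"
        unfolding \<eta>R[OF xs] sl[OF xs(2) \<eta>b[OF xs]] by (rule refl)
      have e2: "(\<lambda>s. Re (C.\<eta> ((complexify h, of_real x), of_real s))) = \<eta> h x" by (rule ext) (simp add: \<eta>_def)
      show ?thesis using D unfolding e e2 .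
    qed
    have diag: "\<eta> h x x = 0" if "\<bar>x\<bar> < \<rho>" for x
    proof -
      have "norm (of_real x :: complex) < C.r1" using that \<rho> \<rho>1 by simp
      from C.eta_ode(2)[OF dom2[OF that] this] show ?thesis by (simp add: \<eta>_def)
    qed
    have lin: "\<bar>\<eta> h x s\<bar> \<le> N * \<bar>s - x\<bar>" if xs: "\<bar>x\<bar> < \<rho>" "\<bar>s\<bar> < \<rho>" for x s
    proof -
      have "norm (\<eta> h x s - \<eta> h x x) \<le> N * norm (s - x)"
      proof (rule field_differentiable_bound[of "{-\<rho><..<\<rho>}"])
        fix t assume "t \<in> {-\<rho><..<\<rho>}"
        then have t: "\<bar>t\<bar> < \<rho>" by auto
        show "(\<eta> h x has_real_derivative slope (Z (\<Lambda>0 + h)) t (\<eta> h x t)) (at t within {-\<rho><..<\<rho>})"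
          using ode[OF xs(1) t] by (rule has_field_derivative_at_within)
        have "norm (f ((complexify h, of_real t), of_real (\<eta> h x t))) \<le> N"
          using \<eta>b[OF xs(1) t] t hr r \<rho> \<rho>1 by (intro C.bound dom_real) auto
        then show "norm (slope (Z (\<Lambda>0 + h)) t (\<eta> h x t)) \<le> N"
          using sl[OF t \<eta>b[OF xs(1) t]] abs_Re_le_cmod order_trans by fastforce
      qed (use xs in auto)
      then show ?thesis using diag[OF xs(1)] by simp
    qed
    have Rr: "R \<le> r / 2" "\<rho> \<le> r / 2" using R \<rho> \<rho>1 r by auto
    have dat: "\<psi> (complexify h, of_real x) \<in> \<real>" "C.\<eta> ((complexify h, of_real x), of_real x * (-1 + \<psi> (complexify h, of_real x))) = 0"
      "x \<noteq> 0 \<Longrightarrow> \<alpha> * \<eta> h x 0 < 0" "x \<noteq> 0 \<Longrightarrow> \<alpha> * (x * slope (Z (\<Lambda>0 + h)) x 0) > 0" if "\<bar>x\<bar> < \<rho>" for x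
      using data[OF ra h1, of x] sl[OF that, of 0] r that \<rho> by (auto simp: \<eta>_def)
    have \<psi>x: "\<bar>Re (\<psi> (complexify h, of_real x))\<bar> \<le> 1 / 2" if "\<bar>x\<bar> < \<rho>" for x
    proof -
      have "norm (\<psi> (complexify h, of_real x)) \<le> 1 / 2" using that h \<rho> by (intro \<psi>(2)) auto
      then show ?thesis using abs_Re_le_cmod order_trans by blast
    qed
    have flip: "\<sigma> * u > 0 \<longleftrightarrow> \<alpha> * u < 0" "\<sigma> * u < 0 \<longleftrightarrow> \<alpha> * u > 0" for u
      using \<sigma> sigma_alpha by (auto simp: zero_less_mult_iff mult_less_0_iff)
    show ?thesis
    proof
      show "continuous_on ({-\<rho><..<\<rho>} \<times> {-R<..<R}) (Z (\<Lambda>0 + h))"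
      proof (rule continuous_on_subset[OF field_continuous])
        show "\<bar>vec_nth h i\<bar> < r / 2" for i using h \<rho>1 r less_trans[of "\<bar>vec_nth h i\<bar>" \<rho>' "r / 2"] by auto
      qed (use Rr in auto)
      show "\<bar>X0\<bar> / 2 \<le> \<kappa> * fst (Z (\<Lambda>0 + h) (x, y))" "norm (Z (\<Lambda>0 + h) (x, y)) \<le> 2 * M"
        if "\<bar>x\<bar> < \<rho>" "\<bar>y\<bar> < R" for x y
        using that Rr r by (intro field_facts hr; simp)+
      show "\<bar>slope (Z (\<Lambda>0 + h)) x y - slope (Z (\<Lambda>0 + h)) x y'\<bar> \<le> C.L * \<bar>y - y'\<bar>"
        if "\<bar>x\<bar> < \<rho>" "\<bar>y\<bar> < R" "\<bar>y'\<bar> < R" for x y y'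
      proof -
        have "norm (f ((complexify h, of_real x), of_real y) - f ((complexify h, of_real x), of_real y')) \<le> C.L * norm (of_real y - of_real y' :: complex)"
          using that Rr hr r by (intro C.lipschitz) auto
        moreover have "norm (of_real y - of_real y' :: complex) = \<bar>y - y'\<bar>" by (metis norm_of_real of_real_diff)
        ultimately show ?thesis using that Rr sl[OF that(1), of y] sl[OF that(1), of y']
            abs_Re_le_cmod[of "f ((complexify h, of_real x), of_real y) - f ((complexify h, of_real x), of_real y')"] by simp
      qed
      show "\<bar>\<eta> h x s\<bar> < R" if xs: "\<bar>x\<bar> < \<rho>" "\<bar>s\<bar> < \<rho>" for x s
      proof -
        have "\<bar>\<eta> h x s\<bar> \<le> N * \<bar>s - x\<bar>" by (rule lin[OF xs])
        also have "\<dots> \<le> N * (2 * \<rho>)" using xs C.N by (intro mult_left_mono) auto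
        finally show ?thesis using \<rho>(2) by simp
      qed
      show "\<sigma> * (s * slope (Z (\<Lambda>0 + h)) s 0) < 0" if "s \<noteq> 0" "\<bar>s\<bar> < 2 * r0" for s
        using dat(4)[of s] that r0 flip(2) by auto
      show "\<sigma> * \<eta> h x 0 > 0" if "x \<noteq> 0" "\<bar>x\<bar> < r0" for x
        using dat(3)[of x] that r0 flip(1) by auto
      show "x * (x * (-1 + Re (\<psi> (complexify h, of_real x)))) < 0 \<and> \<bar>x * (-1 + Re (\<psi> (complexify h, of_real x)))\<bar> \<le> 3 / 2 * \<bar>x\<bar> \<and>
          \<eta> h x (x * (-1 + Re (\<psi> (complexify h, of_real x)))) = 0" if x: "x \<noteq> 0" "\<bar>x\<bar> < r0" for x
      proof -
        have xr: "\<bar>x\<bar> < \<rho>" using x r0 by auto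
        define q where "q = -1 + Re (\<psi> (complexify h, of_real x))"
        have q: "q < 0" "\<bar>q\<bar> \<le> 3 / 2" using \<psi>x[OF xr] by (auto simp: q_def abs_if split: if_splits)
        have "x * (x * q) = x\<^sup>2 * q" by (simp add: power2_eq_square)
        also have "\<dots> < 0" using x q by (intro mult_pos_neg) auto
        finally have 1: "x * (x * q) < 0" .
        have 2: "\<bar>x * q\<bar> \<le> 3 / 2 * \<bar>x\<bar>" using mult_left_mono[OF q(2), of "\<bar>x\<bar>"] by (simp add: abs_mult)
        have "of_real x * (-1 + \<psi> (complexify h, of_real x)) = of_real (x * q)"
          using dat(1)[OF xr] by (simp add: q_def)
        then have "\<eta> h x (x * q) = 0" using dat(2)[OF xr] unfolding \<eta>_def by (metis zero_complex.simps(1))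
        with 1 2 show ?thesis unfolding q_def by blast
      qed
    qed (use \<sigma> kappa r0 R X0_nz C.r1 C.N diag ode lin in auto)
  qed
  have real: "\<psi> (complexify h, of_real x) \<in> \<real>" if "\<forall>i. \<bar>vec_nth h i\<bar> < \<rho>'" "\<bar>x\<bar> < \<rho>'" for h x
    using data[OF ra, of h x] that by simp
  show ?thesis
    by (intro exI[of _ \<rho>'] exI[of _ "\<bar>X0\<bar> / 2"] exI[of _ "2 * M"] exI[of _ "C.L"] exI[of _ N] exI[of _ \<eta>] exI[of _ \<psi>]
        conjI ballI allI impI)
      (rule \<rho>'(1) less_imp_le[OF \<rho>1(3)] \<psi>(1) C.N | (erule \<psi>(2)) | (rule real; assumption) | (rule ht; assumption))+
qed

end

section \<open>Displacement maps of pairs of involutions\<close>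

text \<open>The identity is known on a real interval around 0, and the identity theorem extends it.
  The radius r / 2 leaves room for the growth of the modulus under \<alpha> by a factor of at most
  3/2.\<close>

lemma complex_involution:
  fixes \<alpha> u :: "complex \<Rightarrow> complex"
  assumes u: "u holomorphic_on ball 0 r" "\<And>x. x \<in> ball 0 r \<Longrightarrow> norm (u x) \<le> 1 / 2"
    and \<alpha>: "\<And>x. \<alpha> x = x * (-1 + u x)"
    and e: "e > 0" "\<And>x :: real. \<bar>x\<bar> < e \<Longrightarrow> \<alpha> (\<alpha> (of_real x)) = of_real x"
    and x: "x \<in> ball 0 (r / 2)"
  shows "\<alpha> (\<alpha> x) = x"
proof -
  have r: "r > 0" using x by (metis ball_eq_empty empty_iff half_gt_zero_iff not_less)
  have le: "norm (\<alpha> y) \<le> 3 / 2 * norm y" if "y \<in> ball 0 r" for y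
  proof -
    have "norm (-1 + u y) \<le> 3 / 2" using u(2)[OF that] norm_triangle_ineq[of "-1" "u y"] by simp
    then have "norm y * norm (-1 + u y) \<le> norm y * (3 / 2)" by (intro mult_left_mono) auto
    then show ?thesis by (simp add: \<alpha> norm_mult)
  qed
  have maps: "\<alpha> ` ball 0 (r / 2) \<subseteq> ball 0 r"
  proof (rule image_subsetI)
    fix y :: complex assume y: "y \<in> ball 0 (r / 2)"
    then have "y \<in> ball 0 r" using r by auto
    from le[OF this] y r show "\<alpha> y \<in> ball 0 r" by simp
  qed
  have h: "\<alpha> holomorphic_on ball 0 r" unfolding \<alpha>[abs_def] by (intro holomorphic_intros u(1))
  have "(\<alpha> \<circ> \<alpha>) holomorphic_on ball 0 (r / 2)"
    by (rule holomorphic_on_compose_gen[OF holomorphic_on_subset[OF h] h maps]) (use r in auto)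
  then have hol: "(\<lambda>x. \<alpha> (\<alpha> x) - x) holomorphic_on ball 0 (r / 2)"
    unfolding o_def by (intro holomorphic_intros)
  have "\<alpha> (\<alpha> x) - x = 0"
  proof (rule analytic_continuation[OF hol open_ball connected_ball, where U="of_real ` {y. \<bar>y\<bar> < min e (r / 2)}" and \<xi>=0])
    show "(0::complex) islimpt of_real ` {y. \<bar>y\<bar> < min e (r / 2)}"
      unfolding islimpt_approachable
    proof (intro allI impI)
      fix d :: real assume d: "d > 0"
      define y where "y = min d (min e (r / 2)) / 2"
      have "0 < y" "y < d" "y < min e (r / 2)" using d e r by (auto simp: y_def)
      then show "\<exists>x'\<in>of_real ` {y. \<bar>y\<bar> < min e (r / 2)}. x' \<noteq> 0 \<and> dist x' (0::complex) < d"
        by (intro bexI[of _ "of_real y"]) auto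
    qed
  qed (use e r x in auto)
  then show ?thesis by simp
qed

text \<open>
  In \<open>\<Delta>(\<alpha>(x)) + B(x) \<Delta>(x) = 0\<close> split off the Taylor polynomial of degree \<open>N - 1\<close> of \<open>\<Delta>\<close>.  What remains is \<open>x^N E(x)\<close>
  with \<open>E(0) = -2 V\<^sub>N\<close> for odd \<open>N\<close>, and the maximum principle bounds \<open>E(0)\<close> linearly by the lower coefficients.
\<close>

theorem odd_coefficient_bound:
  fixes \<alpha> \<beta> u v :: "complex \<Rightarrow> complex"
  assumes r: "0 < r" "r \<le> 1"
    and u: "u holomorphic_on ball 0 r" "\<And>x. x \<in> ball 0 r \<Longrightarrow> norm (u x) \<le> 1 / 2"
    and v: "v holomorphic_on ball 0 r" "\<And>x. x \<in> ball 0 r \<Longrightarrow> norm (v x) \<le> 1 / 2"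
    and \<alpha>: "\<And>x. \<alpha> x = x * (-1 + u x)" and \<beta>: "\<And>x. \<beta> x = x * (-1 + v x)"
    and inv: "\<And>x. x \<in> ball 0 (r / 2) \<Longrightarrow> \<alpha> (\<alpha> x) = x" "\<And>x. x \<in> ball 0 (r / 2) \<Longrightarrow> \<beta> (\<beta> x) = x"
    and N: "odd N"
  defines "V \<equiv> \<lambda>m. (deriv ^^ m) (\<lambda>x. \<alpha> x - \<beta> x) 0 / fact m"
  shows "norm (V N) \<le> 2 * (4 / r) ^ N * (\<Sum>m<N. norm (V m))"
proof -
  define S where "S = (\<Sum>m<N. norm (V m))"
  have h\<alpha>: "\<alpha> holomorphic_on ball 0 r" unfolding \<alpha>[abs_def] by (intro holomorphic_intros u(1))
  have h\<beta>: "\<beta> holomorphic_on ball 0 r" unfolding \<beta>[abs_def] by (intro holomorphic_intros v(1))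
  have le: "norm (x * (-1 + w x)) \<le> 3 / 2 * norm x" if "norm (w x) \<le> 1 / 2" for x and w :: "complex \<Rightarrow> complex"
  proof -
    have "norm (-1 + w x) \<le> 3 / 2" using that norm_triangle_ineq[of "-1" "w x"] by simp
    then have "norm x * norm (-1 + w x) \<le> norm x * (3 / 2)" by (intro mult_left_mono) auto
    then show ?thesis by (simp add: norm_mult)
  qed
  have le\<alpha>: "norm (\<alpha> x) \<le> 3 / 2 * norm x" if "x \<in> ball 0 r" for x unfolding \<alpha> by (rule le, rule u(2)[OF that])
  have le\<beta>: "norm (\<beta> x) \<le> 3 / 2 * norm x" if "x \<in> ball 0 r" for x unfolding \<beta> by (rule le, rule v(2)[OF that])
  \<comment> \<open>The derivative -1 + w(0) of an involution at its fixed point squares to 1, and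
    |w(0)| \<le> 1/2 excludes w(0) = 2.\<close>
  have one: "w 0 = 0" if w: "w holomorphic_on ball 0 r" "norm (w 0) \<le> 1 / 2"
    and i: "\<And>x. x \<in> ball 0 (r / 2) \<Longrightarrow> x * (-1 + w x) * (-1 + w (x * (-1 + w x))) = x" for w :: "complex \<Rightarrow> complex"
  proof -
    let ?g = "\<lambda>x. x * (-1 + w x)"
    have "(w has_field_derivative deriv w 0) (at 0)"
      by (rule holomorphic_derivI[OF w(1) open_ball]) (use r in auto)
    then have d: "(?g has_field_derivative (-1 + w 0)) (at 0)" by (auto intro!: derivative_eq_intros)
    have "((\<lambda>x. ?g (?g x)) has_field_derivative (-1 + w 0) * (-1 + w 0)) (at 0)"
      by (rule DERIV_chain2[of ?g]) (use d in auto)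
    moreover have "((\<lambda>x. ?g (?g x)) has_field_derivative 1) (at 0)"
      by (rule has_field_derivative_transform_within_open[OF DERIV_ident open_ball[of 0 "r / 2"]]) (use r i in auto)
    ultimately have "(-1 + w 0) * (-1 + w 0) = 1" by (rule DERIV_unique)
    then have "w 0 * (w 0 - 2) = 0" by (simp add: algebra_simps)
    then show ?thesis using w(2) by auto
  qed
  have u0: "u 0 = 0" by (rule one) (use u r inv(1) in \<open>auto simp: \<alpha>\<close>)
  have v0: "v 0 = 0" by (rule one) (use v r inv(2) in \<open>auto simp: \<beta>\<close>)
  have sub: "x \<in> ball 0 r" "x \<in> ball 0 (r / 2)" "\<alpha> x \<in> ball 0 (r / 2)" "\<beta> x \<in> ball 0 (r / 2)" "\<alpha> x \<in> ball 0 r"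
    if "x \<in> ball 0 (r / 3)" for x
  proof -
    show x: "x \<in> ball 0 r" "x \<in> ball 0 (r / 2)" using that r by auto
    show "\<alpha> x \<in> ball 0 (r / 2)" "\<beta> x \<in> ball 0 (r / 2)" "\<alpha> x \<in> ball 0 r"
      using le\<alpha>[OF x(1)] le\<beta>[OF x(1)] that r by auto
  qed
  \<comment> \<open>The mean of \<beta>' over the segment from \<beta>(x) to \<alpha>(x), so that
    \<beta>(\<alpha>(x)) - \<beta>(\<beta>(x)) = B(x) (\<alpha>(x) - \<beta>(x)). As both maps are
    involutions, the left side is -(\<alpha> - \<beta>) taken at \<alpha>(x).\<close>
  define B where "B x = integral {0..1} (\<lambda>t. deriv \<beta> (linepath (\<beta> x) (\<alpha> x) t))" for x
  have lp: "linepath (\<beta> x) (\<alpha> x) t \<in> ball 0 (r / 2)" if "x \<in> ball 0 (r / 3)" "t \<in> {0..1}" for x t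
    using norm_linepath_less[of "\<beta> x" "r / 2" "\<alpha> x" t] sub[OF that(1)] that(2) by simp
  have d\<beta>: "deriv \<beta> holomorphic_on ball 0 r" by (rule holomorphic_deriv[OF h\<beta> open_ball])
  have d\<beta>3: "norm (deriv \<beta> y) \<le> 3" if y: "y \<in> ball 0 (r / 2)" for y
  proof -
    have s: "ball y (r / 2) \<subseteq> ball 0 r"
    proof
      fix z assume "z \<in> ball y (r / 2)"
      then show "z \<in> ball 0 r" using y norm_triangle_ineq2[of z y] by (simp add: dist_norm norm_minus_commute)
    qed
    have "norm (deriv \<beta> y) \<le> (3 / 2 * r) / (r / 2)"
    proof (rule norm_deriv_le_bound[OF holomorphic_on_subset[OF h\<beta> s]])
      show "norm (\<beta> z) \<le> 3 / 2 * r" if "z \<in> ball y (r / 2)" for z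
        using le\<beta>[OF subsetD[OF s that]] subsetD[OF s that] by simp
    qed (use r in auto)
    then show ?thesis using r by simp
  qed
  have Bc: "continuous_on {0..1} (\<lambda>t. deriv \<beta> (linepath (\<beta> x) (\<alpha> x) t))" if "x \<in> ball 0 (r / 3)" for x
    by (rule continuous_on_compose2[OF holomorphic_on_imp_continuous_on[OF d\<beta>] continuous_on_linepath])
      (use lp[OF that] r in force)
  have hB: "B holomorphic_on ball 0 (r / 3)"
    unfolding B_def[abs_def]
  proof (rule holomorphic_on_integral_parameter[where M=3])
    fix t :: real assume t: "t \<in> {0..1}"
    have "(\<lambda>w. linepath (\<beta> w) (\<alpha> w) t) holomorphic_on ball 0 (r / 3)"
      unfolding linepath_def scaleR_conv_of_real
      by (intro holomorphic_intros holomorphic_on_subset[OF h\<alpha>] holomorphic_on_subset[OF h\<beta>]) (use r in auto)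
    then show "(\<lambda>w. deriv \<beta> (linepath (\<beta> w) (\<alpha> w) t)) holomorphic_on ball 0 (r / 3)"
      using holomorphic_on_compose_gen[OF _ d\<beta>, of "\<lambda>w. linepath (\<beta> w) (\<alpha> w) t" "ball 0 (r / 3)"] lp[OF _ t] r
      by (force simp: o_def)
  qed (use Bc d\<beta>3 lp in auto)
  have B3: "norm (B x) \<le> 3" if "x \<in> ball 0 (r / 3)" for x
    using integral_bound[OF _ Bc[OF that], of 3] d\<beta>3 lp[OF that] by (simp add: B_def)
  have B0: "B 0 = -1"
  proof -
    have "\<alpha> 0 = 0" "\<beta> 0 = 0" by (simp_all add: \<alpha> \<beta>)
    then have "B 0 = deriv \<beta> 0" by (simp add: B_def linepath_def)
    moreover have "(v has_field_derivative deriv v 0) (at 0)"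
      by (rule holomorphic_derivI[OF v(1) open_ball]) (use r in auto)
    then have "(\<beta> has_field_derivative -1) (at 0)"
      unfolding \<beta>[abs_def] using v0 by (auto intro!: derivative_eq_intros)
    ultimately show ?thesis by (simp add: DERIV_imp_deriv)
  qed
  have Beq: "\<beta> (\<alpha> x) - \<beta> (\<beta> x) = B x * (\<alpha> x - \<beta> x)" if x: "x \<in> ball 0 (r / 3)" for x
  proof -
    have "(deriv \<beta> has_contour_integral \<beta> (pathfinish (linepath (\<beta> x) (\<alpha> x))) - \<beta> (pathstart (linepath (\<beta> x) (\<alpha> x))))
        (linepath (\<beta> x) (\<alpha> x))"
    proof (rule contour_integral_primitive[where S="ball 0 r"])
      show "(\<beta> has_field_derivative deriv \<beta> y) (at y within ball 0 r)" if "y \<in> ball 0 r" for y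
        by (rule has_field_derivative_at_within[OF holomorphic_derivI[OF h\<beta> open_ball that]])
      show "path_image (linepath (\<beta> x) (\<alpha> x)) \<subseteq> ball 0 r"
        unfolding path_image_def using lp[OF x] r by force
    qed auto
    then have "((\<lambda>t. deriv \<beta> (linepath (\<beta> x) (\<alpha> x) t) * (\<alpha> x - \<beta> x)) has_integral \<beta> (\<alpha> x) - \<beta> (\<beta> x)) {0..1}"
      by (simp add: has_contour_integral_linepath)
    moreover have "((\<lambda>t. deriv \<beta> (linepath (\<beta> x) (\<alpha> x) t) * (\<alpha> x - \<beta> x)) has_integral B x * (\<alpha> x - \<beta> x)) {0..1}"
      unfolding B_def by (intro has_integral_mult_left integrable_integral integrable_continuous_real Bc[OF x])
    ultimately show ?thesis by (rule has_integral_unique)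
  qed
  have hD: "(\<lambda>x. \<alpha> x - \<beta> x) holomorphic_on ball 0 r" by (intro holomorphic_intros h\<alpha> h\<beta>)
  obtain R where R: "R holomorphic_on ball 0 r"
    "\<And>x. x \<in> ball 0 r \<Longrightarrow> \<alpha> x - \<beta> x = (\<Sum>m<N. V m * x ^ m) + x ^ N * R x" "R 0 = V N"
    using holomorphic_factor_Taylor[OF hD, of N] r unfolding V_def by blast
  define E where "E x = (-1 + u x) ^ N * R (\<alpha> x) + B x * R x" for x
  have hE: "E holomorphic_on ball 0 (r / 3)"
  proof -
    have "(R \<circ> \<alpha>) holomorphic_on ball 0 (r / 3)"
      by (rule holomorphic_on_compose_gen[OF holomorphic_on_subset[OF h\<alpha>] R(1)]) (use sub r in auto)
    then show ?thesis unfolding E_def[abs_def] o_def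
      by (intro holomorphic_intros hB holomorphic_on_subset[OF u(1)] holomorphic_on_subset[OF R(1)]) (use r in auto)
  qed
  have PS: "norm (\<Sum>m<N. V m * y ^ m) \<le> S" if "norm y \<le> 1" for y
    unfolding S_def using that
    by (intro order_trans[OF norm_sum] sum_mono) (auto simp: norm_mult norm_power intro!: mult_left_le power_le_one)
  have xE: "norm (x ^ N * E x) \<le> 4 * S" if x: "x \<in> ball 0 (r / 3)" for x
  proof -
    note s = sub[OF x]
    define p q where "p = (\<Sum>m<N. V m * x ^ m)" and "q = (\<Sum>m<N. V m * \<alpha> x ^ m)"
    have "\<alpha> (\<alpha> x) - \<beta> (\<alpha> x) = - B x * (\<alpha> x - \<beta> x)"
      using Beq[OF x] inv[OF s(2)] by (simp add: algebra_simps)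
    then have e1: "\<alpha> x ^ N * R (\<alpha> x) = - B x * (\<alpha> x - \<beta> x) - q"
      using R(2)[OF s(5)] by (simp add: q_def eq_diff_eq add.commute)
    have e2: "x ^ N * R x = \<alpha> x - \<beta> x - p" using R(2)[OF s(1)] by (simp add: p_def)
    have "x ^ N * E x = \<alpha> x ^ N * R (\<alpha> x) + B x * (x ^ N * R x)"
      unfolding E_def by (simp add: \<alpha>[of x] power_mult_distrib distrib_left mult_ac)
    also have "\<dots> = - (q + B x * p)" unfolding e1 e2 by (simp add: right_diff_distrib)
    also have "norm \<dots> \<le> norm q + norm (B x) * norm p"
      unfolding norm_minus_cancel norm_mult[symmetric] by (rule norm_triangle_ineq)
    also have "\<dots> \<le> S + 3 * S"
      unfolding p_def q_def using s r B3[OF x] PS[of x] PS[of "\<alpha> x"] by (intro add_mono mult_mono) auto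
    finally show ?thesis by simp
  qed
  have "norm (E 0) \<le> 4 * S / (r / 4) ^ N"
    by (rule bound_cofactor_power[OF hE]) (use r xE in auto)
  \<comment> \<open>Both summands equal \<open>- V N\<close>: the first through (-1)^N with
    \<open>N\<close> odd, the second through \<open>B 0 = -1\<close>.\<close>
  moreover have "E 0 = - 2 * V N"
    using N by (simp add: E_def \<alpha> u0 B0 R(3))
  ultimately have "2 * norm (V N) \<le> 4 * S / (r / 4) ^ N" by (simp add: norm_mult)
  also have "\<dots> = 2 * (2 * (4 / r) ^ N * S)" by (simp add: power_divide)
  finally show ?thesis unfolding S_def by linarith
qed

text \<open>An odd term is controlled by the terms of smaller index, the largest of which is of
  order \<mu>^(P+1-m). So the odd terms gain one factor \<mu> over the scale \<mu>^(P-m) of the even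
  ones.\<close>

lemma odd_terms_small:
  fixes v :: "nat \<Rightarrow> real"
  assumes K: "0 \<le> K" and C: "0 \<le> C" and \<mu>: "0 < \<mu>" "\<mu> \<le> 1" and v: "\<And>m. 0 \<le> v m"
    and ev: "\<And>m. m \<le> P \<Longrightarrow> even m \<Longrightarrow> v m \<le> C * \<mu> ^ (P - m)"
    and od: "\<And>m. m \<le> P \<Longrightarrow> odd m \<Longrightarrow> v m \<le> K * (\<Sum>j<m. v j)"
    and m: "m \<le> P" "odd m"
  shows "v m \<le> K * (C * (\<Sum>j<P. (1 + K) ^ j)) * \<mu> ^ (P + 1 - m)"
proof -
  \<comment> \<open>\<open>T m\<close> will dominate the sum of the terms before \<open>m\<close>,
    up to the power of \<mu>. Its recursion adds K T(m) + C, which covers an odd and an even term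
    alike.\<close>
  define T where "T m = C * (\<Sum>j<m. (1 + K) ^ j)" for m
  have T0: "0 \<le> T m" for m unfolding T_def using C K by (intro mult_nonneg_nonneg sum_nonneg) auto
  have Trec: "T (Suc m) = T m + K * T m + C" for m
  proof -
    have "(\<Sum>j<Suc m. (1 + K) ^ j) = 1 + (1 + K) * (\<Sum>j<m. (1 + K) ^ j)"
      unfolding sum.lessThan_Suc_shift by (simp add: sum_distrib_left)
    then show ?thesis by (simp add: T_def algebra_simps)
  qed
  have "(\<Sum>j<m. v j) \<le> T m * \<mu> ^ (P + 1 - m)" if "m \<le> P + 1" for m
    using that
  proof (induction m)
    case 0
    then show ?case by (simp add: T_def)
  next
    case (Suc m)
    then have mP: "m \<le> P" by simp
    have pw: "\<mu> ^ (P + 1 - m) \<le> \<mu> ^ (P - m)" using \<mu> by (intro power_decreasing) auto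
    have IH: "(\<Sum>j<m. v j) \<le> T m * \<mu> ^ (P + 1 - m)" using Suc by simp
    also have "\<dots> \<le> T m * \<mu> ^ (P - m)" by (rule mult_left_mono[OF pw T0])
    finally have a: "(\<Sum>j<m. v j) \<le> T m * \<mu> ^ (P - m)" .
    have b: "v m \<le> (K * T m + C) * \<mu> ^ (P - m)"
    proof (cases "even m")
      case True
      have "v m \<le> C * \<mu> ^ (P - m)" by (rule ev[OF mP True])
      also have "\<dots> \<le> (K * T m + C) * \<mu> ^ (P - m)" using K T0 \<mu> by (intro mult_right_mono) auto
      finally show ?thesis .
    next
      case False
      have "v m \<le> K * (\<Sum>j<m. v j)" by (rule od[OF mP False])
      also have "\<dots> \<le> K * (T m * \<mu> ^ (P - m))" by (rule mult_left_mono[OF a K])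
      also have "\<dots> = (K * T m) * \<mu> ^ (P - m)" by simp
      also have "\<dots> \<le> (K * T m + C) * \<mu> ^ (P - m)" using C \<mu> by (intro mult_right_mono) auto
      finally show ?thesis .
    qed
    show ?case using a b by (simp add: Trec algebra_simps)
  qed
  then have "(\<Sum>j<m. v j) \<le> T m * \<mu> ^ (P + 1 - m)" using m by simp
  also have "\<dots> \<le> T P * \<mu> ^ (P + 1 - m)"
    unfolding T_def using m \<mu> C K by (intro mult_right_mono mult_left_mono sum_mono2) auto
  finally have "K * (\<Sum>j<m. v j) \<le> K * (T P * \<mu> ^ (P + 1 - m))" by (rule mult_left_mono[OF _ K])
  then show ?thesis using od[OF m] by (simp add: T_def mult.assoc)
qed

text \<open>\<open>\<epsilon>\<close> depends on \<open>q\<close> alone, through its slope at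
  \<open>a\<close> and its values of opposite sign on both sides of \<open>a\<close>; so it serves
  for all perturbations.\<close>

lemma persistent_zero:
  fixes q q' :: "real \<Rightarrow> real"
  assumes dq: "\<And>x. \<bar>x - a\<bar> < e \<Longrightarrow> (q has_real_derivative q' x) (at x)" and cq: "isCont q' a"
    and q: "q a = 0" "q' a \<noteq> 0" and e: "e > 0"
  shows "\<exists>\<epsilon>>0. \<forall>g g'. (\<forall>x. \<bar>x - a\<bar> < e \<longrightarrow> (g has_real_derivative g' x) (at x) \<and> \<bar>g x - q x\<bar> < \<epsilon> \<and> \<bar>g' x - q' x\<bar> < \<epsilon>) \<longrightarrow>
    (\<exists>x. \<bar>x - a\<bar> < e \<and> g x = 0 \<and> g' x \<noteq> 0)"
proof -
  define s l where "s = sgn (q' a)" and "l = \<bar>q' a\<bar>"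
  have l: "l > 0" "s * q' a = l" "\<bar>s\<bar> = 1" using q by (auto simp: s_def l_def sgn_if)
  obtain d where d: "d > 0" "\<And>x. \<bar>x - a\<bar> < d \<Longrightarrow> \<bar>q' x - q' a\<bar> < l / 2"
    using cq l(1) unfolding continuous_at_eps_delta dist_real_def by (meson half_gt_zero)
  define t where "t = min d e / 2"
  have t: "t > 0" "t < d" "t < e" using d e by (auto simp: t_def)
  have q'l: "s * q' x > l / 2" if "\<bar>x - a\<bar> < d" for x
  proof -
    have "\<bar>s * q' x - s * q' a\<bar> < l / 2"
      using d(2)[OF that] l(3) by (metis abs_mult mult_1 right_diff_distrib)
    then show ?thesis using l(2) by linarith
  qed
  have dsq: "((\<lambda>x. s * q x) has_real_derivative s * q' x) (at x)" if "\<bar>x - a\<bar> < e" for x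
    using dq[OF that] by (auto intro!: derivative_eq_intros)
  have hi: "s * q (a + t) > l / 2 * t"
  proof -
    obtain z where z: "a < z" "z < a + t" "s * q (a + t) - s * q a = (a + t - a) * (s * q' z)"
      using MVT2[of a "a + t" "\<lambda>x. s * q x" "\<lambda>x. s * q' x"] dsq t by auto
    have "l / 2 * t < s * q' z * t" using q'l[of z] z t by (intro mult_strict_right_mono) auto
    moreover have "s * q (a + t) = s * q' z * t" using z(3) q(1) by algebra
    ultimately show ?thesis by (simp only:)
  qed
  have lo: "s * q (a - t) < - (l / 2 * t)"
  proof -
    obtain z where z: "a - t < z" "z < a" "s * q a - s * q (a - t) = (a - (a - t)) * (s * q' z)"
      using MVT2[of "a - t" a "\<lambda>x. s * q x" "\<lambda>x. s * q' x"] dsq t by auto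
    have "l / 2 * t < s * q' z * t" using q'l[of z] z t by (intro mult_strict_right_mono) auto
    moreover have "s * q (a - t) = - (s * q' z * t)" using z(3) q(1) by algebra
    ultimately show ?thesis by (simp only: neg_less_iff_less)
  qed
  define \<epsilon> where "\<epsilon> = min (l / 2) (l / 2 * t)"
  have \<epsilon>: "\<epsilon> > 0" "\<epsilon> \<le> l / 2" "\<epsilon> \<le> l / 2 * t" using l t by (auto simp: \<epsilon>_def)
  show ?thesis
  proof (rule exI[of _ \<epsilon>], intro conjI allI impI \<epsilon>(1))
    fix g g' :: "real \<Rightarrow> real"
    assume g: "\<forall>x. \<bar>x - a\<bar> < e \<longrightarrow> (g has_real_derivative g' x) (at x) \<and> \<bar>g x - q x\<bar> < \<epsilon> \<and> \<bar>g' x - q' x\<bar> < \<epsilon>"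
    have near: "\<bar>s * g x - s * q x\<bar> < \<epsilon>" "\<bar>s * g' x - s * q' x\<bar> < \<epsilon>" if "\<bar>x - a\<bar> < e" for x
      using g that l(3) by (metis abs_mult mult_1 right_diff_distrib)+
    have "s * g (a - t) \<le> 0" "0 \<le> s * g (a + t)"
      using near(1)[of "a - t"] near(1)[of "a + t"] lo hi \<epsilon> t by linarith+
    moreover have "isCont g x" if "\<bar>x - a\<bar> < e" for x by (rule DERIV_isCont) (use g that in blast)
    then have "\<forall>x. a - t \<le> x \<and> x \<le> a + t \<longrightarrow> isCont (\<lambda>x. s * g x) x"
      using t by (auto intro!: continuous_intros)
    ultimately obtain x where x: "a - t \<le> x" "x \<le> a + t" "s * g x = 0"
      using IVT[of "\<lambda>x. s * g x" "a - t" 0 "a + t"] t by auto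
    have xa: "\<bar>x - a\<bar> < e" "\<bar>x - a\<bar> < d" using x t by auto
    have "s * g' x > 0" using near(2)[OF xa(1)] q'l[OF xa(2)] \<epsilon> by linarith
    then show "\<exists>x. \<bar>x - a\<bar> < e \<and> g x = 0 \<and> g' x \<noteq> 0" using x xa l(3) by (intro exI[of _ x]) auto
  qed
qed

section \<open>The model polynomial and the persistence of its zeros\<close>

definition model :: "nat \<Rightarrow> complex \<Rightarrow> complex" where
  "model n s = s\<^sup>2 * (\<Prod>i\<in>{1..n}. s\<^sup>2 - (of_nat i)\<^sup>2)"

lemma model_holomorphic: "model n holomorphic_on S"
  unfolding model_def[abs_def] by (intro holomorphic_intros)

lemma model_real: "model n (of_real x) = of_real (x\<^sup>2 * (\<Prod>i\<in>{1..n}. x\<^sup>2 - (of_nat i)\<^sup>2))"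
  by (simp add: model_def)

lemma model_simple_zero:
  assumes i: "i \<in> {1..n}"
  shows "model n (of_nat i) = 0" "deriv (model n) (of_nat i) \<noteq> 0"
proof -
  define H where "H s = s\<^sup>2 * (s + of_nat i) * (\<Prod>j\<in>{1..n} - {i}. s\<^sup>2 - (of_nat j)\<^sup>2)" for s :: complex
  have eq: "model n s = (s - of_nat i) * H s" for s
  proof -
    have "(\<Prod>j\<in>{1..n}. s\<^sup>2 - (of_nat j)\<^sup>2) = (s\<^sup>2 - (of_nat i)\<^sup>2) * (\<Prod>j\<in>{1..n} - {i}. s\<^sup>2 - (of_nat j)\<^sup>2)"
      by (rule prod.remove) (use i in auto)
    then show ?thesis unfolding model_def H_def square_diff_square_factored power2_eq_square by (simp only: mult_ac)
  qed
  then show "model n (of_nat i) = 0" by simp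
  have "H holomorphic_on UNIV" unfolding H_def[abs_def] by (intro holomorphic_intros)
  then have "(H has_field_derivative deriv H (of_nat i)) (at (of_nat i))"
    by (rule holomorphic_derivI[OF _ open_UNIV]) simp
  then have "((\<lambda>s. (s - of_nat i) * H s) has_field_derivative H (of_nat i)) (at (of_nat i))"
    by (auto intro!: derivative_eq_intros)
  then have "deriv (model n) (of_nat i) = H (of_nat i)" unfolding eq[abs_def] by (rule DERIV_imp_deriv)
  moreover have "H (of_nat i) \<noteq> 0"
  proof -
    have "(of_nat i :: complex)\<^sup>2 - (of_nat j)\<^sup>2 \<noteq> 0" if "j \<noteq> i" for j
    proof -
      have "(of_nat (i ^ 2) :: complex) \<noteq> of_nat (j ^ 2)" using that by (subst of_nat_eq_iff) simp
      then show ?thesis by simp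
    qed
    moreover have "(of_nat i + of_nat i :: complex) \<noteq> 0" using i by (simp flip: of_nat_add)
    ultimately show ?thesis using i by (auto simp: H_def)
  qed
  ultimately show "deriv (model n) (of_nat i) \<noteq> 0" by simp
qed

text \<open>\<open>q 2\<close> is, up to sign, the square of n!. That it does not vanish finally
  lets the size of V_2 control the scale \<mu>.\<close>

lemma model_coefficients:
  "\<exists>q :: nat \<Rightarrow> real. q (2 * n + 2) = 1 \<and> q 2 \<noteq> 0 \<and> (\<forall>m. odd m \<longrightarrow> q m = 0) \<and> q 0 = 0 \<and>
     (\<forall>s. model n s = (\<Sum>m\<le>2 * n + 2. of_real (q m) * s ^ m))"
proof -
  have "\<exists>p :: nat \<Rightarrow> real. p n = 1 \<and> p 0 \<noteq> 0 \<and> (\<forall>j>n. p j = 0) \<and>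
    (\<forall>t::complex. (\<Prod>i\<in>{1..n}. t - (of_nat i)\<^sup>2) = (\<Sum>j\<le>n. of_real (p j) * t ^ j))"
  proof (induction n)
    case 0
    then show ?case by (intro exI[of _ "\<lambda>j. if j = 0 then 1 else 0"]) auto
  next
    case (Suc n)
    then obtain p :: "nat \<Rightarrow> real" where p: "p n = 1" "p 0 \<noteq> 0" "\<And>j. j > n \<Longrightarrow> p j = 0"
      "\<And>t::complex. (\<Prod>i\<in>{1..n}. t - (of_nat i)\<^sup>2) = (\<Sum>j\<le>n. of_real (p j) * t ^ j)" by blast
    define b :: real where "b = (of_nat (Suc n))\<^sup>2"
    have b: "b \<noteq> 0" "of_real b = ((of_nat (Suc n))\<^sup>2 :: complex)" by (simp_all add: b_def)
    define p' where "p' j = (if j = 0 then 0 else p (j - 1)) - b * p j" for j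
    have "(\<Prod>i\<in>{1..Suc n}. t - (of_nat i)\<^sup>2) = (\<Sum>j\<le>Suc n. of_real (p' j) * t ^ j)" for t :: complex
    proof -
      have "(\<Prod>i\<in>{1..Suc n}. t - (of_nat i)\<^sup>2) = (t - of_real b) * (\<Sum>j\<le>n. of_real (p j) * t ^ j)"
        unfolding b(2) by (simp add: p(4)[symmetric])
      also have "\<dots> = (\<Sum>j\<le>n. of_real (p j) * t ^ Suc j) - (\<Sum>j\<le>n. of_real (b * p j) * t ^ j)"
        unfolding left_diff_distrib sum_distrib_left by (simp add: sum_subtractf mult_ac)
      also have "(\<Sum>j\<le>n. of_real (p j) * t ^ Suc j) = (\<Sum>j\<le>Suc n. of_real (if j = 0 then 0 else p (j - 1)) * t ^ j)"
        unfolding sum.atMost_Suc_shift by simp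
      also have "(\<Sum>j\<le>n. of_real (b * p j) * t ^ j) = (\<Sum>j\<le>Suc n. of_real (b * p j) * t ^ j)"
        using p(3) by simp
      finally show ?thesis unfolding sum_subtractf[symmetric] p'_def of_real_diff left_diff_distrib .
    qed
    moreover have "p' (Suc n) = 1" "p' 0 \<noteq> 0" "\<forall>j>Suc n. p' j = 0" using p b by (auto simp: p'_def)
    ultimately show ?case by blast
  qed
  then obtain p :: "nat \<Rightarrow> real" where p: "p n = 1" "p 0 \<noteq> 0"
    "\<And>t::complex. (\<Prod>i\<in>{1..n}. t - (of_nat i)\<^sup>2) = (\<Sum>j\<le>n. of_real (p j) * t ^ j)" by blast
  define q where "q m = (if even m \<and> 2 \<le> m then p (m div 2 - 1) else 0)" for m
  have "model n s = (\<Sum>m\<le>2 * n + 2. of_real (q m) * s ^ m)" for s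
  proof -
    have pw: "s ^ (2 * j + 2) = s\<^sup>2 * (s\<^sup>2) ^ j" for j by (metis power_add power_mult mult.commute)
    have "model n s = (\<Sum>j\<le>n. of_real (p j) * s ^ (2 * j + 2))"
      unfolding model_def p(3) sum_distrib_left pw
      by (rule sum.cong[OF refl]) (rule mult.left_commute)
    also have "\<dots> = (\<Sum>m\<in>(\<lambda>j. 2 * j + 2) ` {..n}. of_real (q m) * s ^ m)"
      by (subst sum.reindex) (auto simp: inj_on_def q_def)
    also have "\<dots> = (\<Sum>m\<le>2 * n + 2. of_real (q m) * s ^ m)"
    proof (rule sum.mono_neutral_left)
      show "\<forall>m\<in>{..2 * n + 2} - (\<lambda>j. 2 * j + 2) ` {..n}. of_real (q m) * s ^ m = 0"
      proof
        fix m assume m: "m \<in> {..2 * n + 2} - (\<lambda>j. 2 * j + 2) ` {..n}"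
        have "\<not> (even m \<and> 2 \<le> m)"
        proof
          assume "even m \<and> 2 \<le> m"
          then have "m = 2 * (m div 2 - 1) + 2" "m div 2 - 1 \<le> n" using m by auto
          then show False using m by blast
        qed
        then show "of_real (q m) * s ^ m = 0" by (auto simp: q_def)
      qed
    qed auto
    finally show ?thesis .
  qed
  then show ?thesis using p by (intro exI[of _ q]) (auto simp: q_def)
qed

text \<open>Uniform closeness on the disc of radius n + 2 gives closeness of the derivatives for |x|
  < n + 1 by Cauchy's estimate, as \<open>persistent_zero\<close> requires. The distance 1/2
  separates the zeros belonging to different \<open>i\<close>.\<close>

lemma model_zeros_persist:
  "\<exists>\<epsilon>>0. \<forall>G. G holomorphic_on ball 0 (real n + 2) \<longrightarrow>
     (\<forall>s\<in>ball 0 (real n + 2). norm (G s - model n s) \<le> \<epsilon>) \<longrightarrow>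
     (\<forall>x. \<bar>x\<bar> < real n + 2 \<longrightarrow> G (of_real x) \<in> \<real>) \<longrightarrow>
     (\<forall>i\<in>{1..n}. \<exists>x. \<bar>x - real i\<bar> < 1 / 2 \<and> G (of_real x) = 0 \<and> deriv G (of_real x) \<noteq> 0)"
proof -
  let ?Q = "model n"
  have "\<exists>\<epsilon>>0. \<forall>g g'. (\<forall>x. \<bar>x - real i\<bar> < 1 / 2 \<longrightarrow> (g has_real_derivative g' x) (at x) \<and>
        \<bar>g x - Re (?Q (of_real x))\<bar> < \<epsilon> \<and> \<bar>g' x - Re (deriv ?Q (of_real x))\<bar> < \<epsilon>) \<longrightarrow>
      (\<exists>x. \<bar>x - real i\<bar> < 1 / 2 \<and> g x = 0 \<and> g' x \<noteq> 0)" if i: "i \<in> {1..n}" for i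
  proof (rule persistent_zero)
    show "((\<lambda>x. Re (?Q (of_real x))) has_real_derivative Re (deriv ?Q (of_real x))) (at x)" for x
      by (rule has_real_derivative_Re[OF holomorphic_derivI[OF model_holomorphic open_UNIV UNIV_I]])
    have "continuous_on UNIV (deriv ?Q)"
      by (intro holomorphic_on_imp_continuous_on holomorphic_deriv model_holomorphic open_UNIV)
    then have "isCont (deriv ?Q) (of_real (real i))" by (simp add: continuous_on_eq_continuous_at)
    have "isCont (\<lambda>x. deriv ?Q (of_real x)) (real i)"
      by (rule isCont_o2[where f=of_real and g="deriv ?Q"]) (use \<open>isCont (deriv ?Q) (of_real (real i))\<close> in auto)
    then show "isCont (\<lambda>x. Re (deriv ?Q (of_real x))) (real i)" by (rule continuous_Re)
    show "Re (?Q (of_real (real i))) = 0" using model_simple_zero(1)[OF i] by simp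
    have "(deriv ^^ 1) ?Q (of_real (real i)) = of_real ((deriv ^^ 1) (\<lambda>x. x\<^sup>2 * (\<Prod>i\<in>{1..n}. x\<^sup>2 - (of_nat i)\<^sup>2)) (real i))"
      by (rule deriv_of_real_restriction[where r="real i + 1"]) (auto intro: model_holomorphic simp: model_real)
    then have "deriv ?Q (of_nat i) \<in> \<real>" by simp
    then show "Re (deriv ?Q (of_real (real i))) \<noteq> 0" using model_simple_zero(2)[OF i] by (auto elim!: Reals_cases)
  qed simp
  then obtain \<epsilon> where \<epsilon>: "\<And>i. i \<in> {1..n} \<Longrightarrow> \<epsilon> i > 0"
    "\<And>i g g'. i \<in> {1..n} \<Longrightarrow> (\<forall>x. \<bar>x - real i\<bar> < 1 / 2 \<longrightarrow> (g has_real_derivative g' x) (at x) \<and>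
        \<bar>g x - Re (?Q (of_real x))\<bar> < \<epsilon> i \<and> \<bar>g' x - Re (deriv ?Q (of_real x))\<bar> < \<epsilon> i) \<Longrightarrow>
      (\<exists>x. \<bar>x - real i\<bar> < 1 / 2 \<and> g x = 0 \<and> g' x \<noteq> 0)"
    by metis
  \<comment> \<open>Halving the minimum turns the non-strict bound on \<open>G\<close> into the
    strict one of \<open>\<epsilon> i\<close>; the element 1 keeps the set nonempty for
    \<open>n = 0\<close>.\<close>
  define \<delta> where "\<delta> = Min (insert 1 (\<epsilon> ` {1..n})) / 2"
  have m: "Min (insert 1 (\<epsilon> ` {1..n})) > 0" using \<epsilon>(1) by (subst Min_gr_iff) auto
  have \<delta>: "\<delta> > 0" using m by (simp add: \<delta>_def)
  have \<delta>i: "\<delta> < \<epsilon> i" if "i \<in> {1..n}" for i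
  proof -
    have "Min (insert 1 (\<epsilon> ` {1..n})) \<le> \<epsilon> i" using that by (intro Min_le) auto
    then show ?thesis using m unfolding \<delta>_def by linarith
  qed
  show ?thesis
  proof (rule exI[of _ \<delta>], intro conjI allI impI ballI \<delta>)
    fix G :: "complex \<Rightarrow> complex" and i
    assume G: "G holomorphic_on ball 0 (real n + 2)" "\<forall>s\<in>ball 0 (real n + 2). norm (G s - ?Q s) \<le> \<delta>"
      "\<forall>x. \<bar>x\<bar> < real n + 2 \<longrightarrow> G (of_real x) \<in> \<real>" and i: "i \<in> {1..n}"
    have "\<forall>x. \<bar>x - real i\<bar> < 1 / 2 \<longrightarrow> ((\<lambda>x. Re (G (of_real x))) has_real_derivative Re (deriv G (of_real x))) (at x) \<and>
        \<bar>Re (G (of_real x)) - Re (?Q (of_real x))\<bar> < \<epsilon> i \<and> \<bar>Re (deriv G (of_real x)) - Re (deriv ?Q (of_real x))\<bar> < \<epsilon> i"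
    proof (intro allI impI conjI)
      fix x assume x: "\<bar>x - real i\<bar> < 1 / 2"
      have "real i \<le> real n" using i by simp
      then have xn: "\<bar>x\<bar> < real n + 1" using x by linarith
      then have xb: "(of_real x :: complex) \<in> ball 0 (real n + 2)" by simp
      show "((\<lambda>x. Re (G (of_real x))) has_real_derivative Re (deriv G (of_real x))) (at x)"
        by (rule has_real_derivative_Re[OF holomorphic_derivI[OF G(1) open_ball xb]])
      show "\<bar>Re (G (of_real x)) - Re (?Q (of_real x))\<bar> < \<epsilon> i"
        using G(2) xb \<delta>i[OF i] abs_Re_le_cmod[of "G (of_real x) - ?Q (of_real x)"] by fastforce
      have sub: "ball (of_real x) 1 \<subseteq> ball (0::complex) (real n + 2)"
      proof
        fix z :: complex assume "z \<in> ball (of_real x) 1"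
        then show "z \<in> ball 0 (real n + 2)" using xn norm_triangle_ineq2[of z "of_real x"] by (simp add: dist_norm norm_minus_commute)
      qed
      have "norm (deriv (\<lambda>s. G s - ?Q s) (of_real x)) \<le> \<delta> / 1"
        by (rule norm_deriv_le_bound) (use G sub in \<open>auto intro!: holomorphic_intros model_holomorphic intro: holomorphic_on_subset\<close>)
      moreover have "deriv (\<lambda>s. G s - ?Q s) (of_real x) = deriv G (of_real x) - deriv ?Q (of_real x)"
        by (rule deriv_diff) (use holomorphic_on_imp_differentiable_at[OF _ open_ball xb] G(1) model_holomorphic in auto)
      ultimately show "\<bar>Re (deriv G (of_real x)) - Re (deriv ?Q (of_real x))\<bar> < \<epsilon> i"
        using \<delta>i[OF i] abs_Re_le_cmod[of "deriv G (of_real x) - deriv ?Q (of_real x)"] by simp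
    qed
    from \<epsilon>(2)[OF i this] obtain x where x: "\<bar>x - real i\<bar> < 1 / 2" "Re (G (of_real x)) = 0" "Re (deriv G (of_real x)) \<noteq> 0" by blast
    have "real i \<le> real n" using i by simp
    then have "\<bar>x\<bar> < real n + 2" using x(1) by linarith
    then have "G (of_real x) = 0" using G(3) x(2) by (auto elim!: Reals_cases)
    then show "\<exists>x. \<bar>x - real i\<bar> < 1 / 2 \<and> G (of_real x) = 0 \<and> deriv G (of_real x) \<noteq> 0" using x by (intro exI[of _ x]) auto
  qed
qed

text \<open>In the variable s = x / \<mu> and after division by \<mu>^P, the m-th Taylor term
  carries the factor \<mu>^(m-P). Up to m = P this turns the coefficients into \<open>c m\<close>
  within \<tau>, and the remainder beyond order P retains a factor \<mu>.\<close>

lemma scaled_Taylor_close: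
  fixes \<Delta> :: "complex \<Rightarrow> complex" and P :: nat and c :: "nat \<Rightarrow> real" and s :: complex
  assumes \<Delta>: "\<Delta> holomorphic_on ball 0 r" "\<And>x. x \<in> ball 0 r \<Longrightarrow> norm (\<Delta> x) \<le> M" and r: "0 < r" "r \<le> 1"
    and \<mu>: "0 < \<mu>" "\<mu> \<le> 1" "\<mu> * \<nu> \<le> r / 2" and \<tau>: "0 \<le> \<tau>" "\<tau> \<le> 1" and \<nu>: "\<nu> \<ge> 1"
    and cf: "\<And>m. m \<le> P \<Longrightarrow> norm ((deriv ^^ m) \<Delta> 0 / fact m - of_real (c m * \<mu> ^ (P - m))) \<le> \<tau> * \<mu> ^ (P - m)"
    and s: "norm s \<le> \<nu>"
  shows "norm (\<Delta> (of_real \<mu> * s) / of_real \<mu> ^ P - (\<Sum>m\<le>P. of_real (c m) * s ^ m)) \<le>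
    (\<tau> + \<mu>) * ((\<Sum>m\<le>P. \<nu> ^ m) + \<nu> ^ Suc P * ((M + (\<Sum>m\<le>P. norm (c m) + 1)) / (r / 2) ^ Suc P))"
proof -
  define V where "V m = (deriv ^^ m) \<Delta> 0 / fact m" for m
  obtain R where R: "R holomorphic_on ball 0 r" "\<And>x. x \<in> ball 0 r \<Longrightarrow> \<Delta> x = (\<Sum>m<Suc P. V m * x ^ m) + x ^ Suc P * R x"
    using holomorphic_factor_Taylor[OF \<Delta>(1), of "Suc P"] unfolding V_def by blast
  define K where "K = M + (\<Sum>m\<le>P. norm (c m) + 1)"
  have V: "norm (V m) \<le> norm (c m) + 1" if "m \<le> P" for m
  proof -
    have p: "\<mu> ^ (P - m) \<le> 1" "0 \<le> \<mu> ^ (P - m)" using \<mu> by (auto intro: power_le_one)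
    have "norm (V m) \<le> norm (c m * \<mu> ^ (P - m)) + \<tau> * \<mu> ^ (P - m)"
      using cf[OF that] norm_triangle_sub[of "V m" "of_real (c m * \<mu> ^ (P - m))"] unfolding V_def norm_of_real real_norm_def by linarith
    also have "\<dots> \<le> norm (c m) * 1 + 1 * 1"
      unfolding norm_mult using p \<tau> by (intro add_mono mult_mono) (auto simp: norm_power)
    finally show ?thesis by simp
  qed
  have KR: "norm (R x) \<le> K / (r / 2) ^ Suc P" if "norm x \<le> r / 2" for x
  proof (rule bound_cofactor_power[OF R(1) _ _ _ that])
    fix x :: complex assume x: "norm x = r / 2"
    then have xr: "x \<in> ball 0 r" using r by simp
    have "norm (x ^ Suc P * R x) = norm (\<Delta> x - (\<Sum>m<Suc P. V m * x ^ m))" using R(2)[OF xr] by simp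
    also have "\<dots> \<le> norm (\<Delta> x) + norm (\<Sum>m<Suc P. V m * x ^ m)" by (rule norm_triangle_ineq4)
    also have "\<dots> \<le> M + (\<Sum>m<Suc P. norm (c m) + 1)"
    proof (intro add_mono \<Delta>(2)[OF xr] order_trans[OF norm_sum] sum_mono)
      fix m assume "m \<in> {..<Suc P}"
      then have "norm (V m) \<le> norm (c m) + 1" using V by simp
      moreover have "norm (V m * x ^ m) \<le> norm (V m)" using x r by (auto simp: norm_mult norm_power intro!: mult_left_le power_le_one)
      ultimately show "norm (V m * x ^ m) \<le> norm (c m) + 1" by linarith
    qed
    finally show "norm (x ^ Suc P * R x) \<le> K" by (simp add: K_def lessThan_Suc_atMost)
  qed (use r in auto)
  have "norm (of_real \<mu> * s) = \<mu> * norm s" using \<mu> by (simp add: norm_mult)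
  also have "\<dots> \<le> \<mu> * \<nu>" using s \<mu> by (intro mult_left_mono) auto
  finally have \<mu>s: "norm (of_real \<mu> * s) \<le> r / 2" using \<mu>(3) by linarith
  then have \<mu>sr: "of_real \<mu> * s \<in> ball 0 r" using r by simp
  have "\<Delta> (of_real \<mu> * s) / of_real \<mu> ^ P - (\<Sum>m\<le>P. of_real (c m) * s ^ m) =
      (\<Sum>m\<le>P. (V m - of_real (c m * \<mu> ^ (P - m))) / of_real \<mu> ^ (P - m) * s ^ m) + of_real \<mu> * (s ^ Suc P * R (of_real \<mu> * s))"
  proof -
    have "V m * (of_real \<mu> * s) ^ m / of_real \<mu> ^ P = V m / of_real \<mu> ^ (P - m) * s ^ m" if "m \<le> P" for m
    proof -
      have "(of_real \<mu> :: complex) ^ P = of_real \<mu> ^ (P - m) * of_real \<mu> ^ m" using that by (simp flip: power_add)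
      then show ?thesis using \<mu> by (simp add: power_mult_distrib)
    qed
    then have "(\<Sum>m<Suc P. V m * (of_real \<mu> * s) ^ m) / of_real \<mu> ^ P = (\<Sum>m\<le>P. V m / of_real \<mu> ^ (P - m) * s ^ m)"
      by (simp add: sum_divide_distrib lessThan_Suc_atMost)
    moreover have "(of_real \<mu> * s) ^ Suc P * R (of_real \<mu> * s) / of_real \<mu> ^ P = of_real \<mu> * (s ^ Suc P * R (of_real \<mu> * s))"
      using \<mu> by (simp add: power_mult_distrib)
    moreover have "(V m - of_real (c m * \<mu> ^ (P - m))) / of_real \<mu> ^ (P - m) * s ^ m = V m / of_real \<mu> ^ (P - m) * s ^ m - of_real (c m) * s ^ m" for m
      using \<mu> by (simp add: diff_divide_distrib left_diff_distrib)
    ultimately show ?thesis unfolding R(2)[OF \<mu>sr] add_divide_distrib by (simp only: sum_subtractf add_diff_eq diff_add_eq)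
  qed
  also have "norm \<dots> \<le> (\<Sum>m\<le>P. \<tau> * \<nu> ^ m) + \<mu> * (\<nu> ^ Suc P * (K / (r / 2) ^ Suc P))"
  proof (intro order_trans[OF norm_triangle_ineq] add_mono order_trans[OF norm_sum] sum_mono)
    fix m assume "m \<in> {..P}"
    then have "norm (V m - of_real (c m * \<mu> ^ (P - m))) / \<mu> ^ (P - m) \<le> \<tau>"
      using cf[of m] \<mu> by (simp add: V_def pos_divide_le_eq)
    then have "norm (V m - of_real (c m * \<mu> ^ (P - m))) / \<mu> ^ (P - m) * norm s ^ m \<le> \<tau> * \<nu> ^ m"
      using s \<tau> \<mu> by (intro mult_mono power_mono divide_nonneg_nonneg) auto
    then show "norm ((V m - of_real (c m * \<mu> ^ (P - m))) / of_real \<mu> ^ (P - m) * s ^ m) \<le> \<tau> * \<nu> ^ m"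
      using \<mu> by (simp add: norm_mult norm_divide norm_power)
  next
    have "norm s ^ Suc P * norm (R (of_real \<mu> * s)) \<le> \<nu> ^ Suc P * (K / (r / 2) ^ Suc P)"
      using s \<nu> KR[OF \<mu>s] by (intro mult_mono power_mono) auto
    then show "norm (of_real \<mu> * (s ^ Suc P * R (of_real \<mu> * s))) \<le> \<mu> * (\<nu> ^ Suc P * (K / (r / 2) ^ Suc P))"
      unfolding norm_mult norm_power norm_of_real abs_of_pos[OF \<mu>(1)] by (rule mult_left_mono) (use \<mu> in auto)
  qed
  also have "\<dots> \<le> (\<tau> + \<mu>) * ((\<Sum>m\<le>P. \<nu> ^ m) + \<nu> ^ Suc P * (K / (r / 2) ^ Suc P))"
  proof -
    have "norm (\<Delta> 0) \<le> M" using r by (intro \<Delta>) auto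
    then have "0 \<le> M" using norm_ge_zero order_trans by blast
    then have "0 \<le> K" unfolding K_def by (intro add_nonneg_nonneg sum_nonneg) auto
    then have "0 \<le> \<mu> * (\<Sum>m\<le>P. \<nu> ^ m)" "0 \<le> \<tau> * (\<nu> ^ Suc P * (K / (r / 2) ^ Suc P))"
      using \<mu> \<tau> \<nu> r by (auto intro!: mult_nonneg_nonneg sum_nonneg)
    then show ?thesis by (simp only: sum_distrib_left[symmetric] distrib_left distrib_right)
  qed
  finally show ?thesis by (simp add: K_def)
qed

section \<open>Taylor coefficients of the half-return maps as functions of the parameter\<close>

lemma Taylor_coefficient_integral:
  assumes f: "f holomorphic_on ball 0 r'" and r: "0 < r" "r < r'"
  shows "(deriv ^^ m) f 0 / fact m = integral {0..1} (\<lambda>t. f (circlepath 0 r t) / circlepath 0 r t ^ m)"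
proof -
  let ?\<zeta> = "circlepath 0 r" and ?c = "2 * of_real pi * \<i>"
  have fc: "f holomorphic_on cball 0 r" using f by (rule holomorphic_on_subset) (use r in auto)
  have "((\<lambda>u. f u / (u - 0) ^ Suc m) has_contour_integral (?c / fact m * (deriv ^^ m) f 0)) ?\<zeta>"
    using Cauchy_has_contour_integral_higher_derivative_circlepath[OF holomorphic_on_imp_continuous_on[OF fc]
        holomorphic_on_subset[OF fc ball_subset_cball], of 0 m] r by simp
  then have i: "((\<lambda>t. f (?\<zeta> t) / (?\<zeta> t - 0) ^ Suc m * vector_derivative ?\<zeta> (at t)) has_integral ?c / fact m * (deriv ^^ m) f 0) {0..1}"
    unfolding has_contour_integral .
  have d: "vector_derivative ?\<zeta> (at t) = ?c * ?\<zeta> t" for t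
    unfolding vector_derivative_circlepath by (simp add: circlepath)
  have nz: "?\<zeta> t \<noteq> 0" for t using r by (metis norm_circlepath_0 norm_zero less_imp_le less_irrefl)
  have "((\<lambda>t. ?c * (f (?\<zeta> t) / ?\<zeta> t ^ m)) has_integral ?c * ((deriv ^^ m) f 0 / fact m)) {0..1}"
    using i unfolding d by (rule has_integral_eq[rotated, THEN has_integral_eq_rhs]) (use nz in auto)
  then have e: "?c * integral {0..1} (\<lambda>t. f (?\<zeta> t) / ?\<zeta> t ^ m) = ?c * ((deriv ^^ m) f 0 / fact m)"
    unfolding integral_mult_right[symmetric] by (rule integral_unique)
  have "?c \<noteq> 0" by simp
  from iffD1[OF mult_left_cancel[OF this] e] show ?thesis by (rule sym)
qed

definition half_map :: "(('i \<Rightarrow> complex) \<times> complex \<Rightarrow> complex) \<Rightarrow> ('i \<Rightarrow> complex) \<Rightarrow> complex \<Rightarrow> complex" where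
  "half_map \<psi> a x = x * (-1 + \<psi> (a, x))"

locale half_map_family =
  fixes \<psi> :: "('n::finite \<Rightarrow> complex) \<times> complex \<Rightarrow> complex" and s :: real
  assumes s: "0 < s" "s \<le> 1" and hol: "curve_holomorphic (plots2 s) \<psi>"
    and bound: "\<And>z. z \<in> plot_dom (plots2 s) \<Longrightarrow> norm (\<psi> z) \<le> 1 / 2"
    and real: "\<And>h x. (\<And>i. \<bar>vec_nth h i\<bar> < s) \<Longrightarrow> \<bar>x\<bar> < s \<Longrightarrow> \<psi> (complexify h, of_real x) \<in> \<real>"
begin

lemma section_holomorphic:
  assumes "\<And>i. norm (a i) < s"
  shows "(\<lambda>x. \<psi> (a, x)) holomorphic_on ball 0 s" "half_map \<psi> a holomorphic_on ball 0 s"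
proof -
  have P: "plots2 s (ball 0 s) (\<lambda>x. (a, x))" using assms by (auto simp: poly_plots_def intro!: holomorphic_intros)
  show h: "(\<lambda>x. \<psi> (a, x)) holomorphic_on ball 0 s" by (rule curve_holomorphicD[OF hol, OF open_ball P])
  show "half_map \<psi> a holomorphic_on ball 0 s" unfolding half_map_def[abs_def] by (intro holomorphic_intros h)
qed

lemma half_map_bound:
  assumes "\<And>i. norm (a i) < s" "norm x < s"
  shows "norm (half_map \<psi> a x) \<le> 3 / 2 * norm x" "norm (half_map \<psi> a x) \<le> 2"
proof -
  have "norm (-1 + \<psi> (a, x)) \<le> 3 / 2"
    using bound[of "(a, x)"] assms norm_triangle_ineq[of "-1" "\<psi> (a, x)"] by simp
  then have "norm x * norm (-1 + \<psi> (a, x)) \<le> norm x * (3 / 2)" by (intro mult_left_mono) auto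
  then show "norm (half_map \<psi> a x) \<le> 3 / 2 * norm x" by (simp add: half_map_def norm_mult)
  then show "norm (half_map \<psi> a x) \<le> 2" using assms(2) s by simp
qed

lemma half_map_real:
  assumes "\<And>i. \<bar>vec_nth h i\<bar> < s" "\<bar>x\<bar> < s"
  shows "half_map \<psi> (complexify h) (of_real x) = of_real (x * (-1 + Re (\<psi> (complexify h, of_real x))))"
  using real[OF assms] by (simp add: half_map_def)

definition coefficient :: "nat \<Rightarrow> ('n \<Rightarrow> complex) \<Rightarrow> complex" where
  "coefficient m a = (deriv ^^ m) (half_map \<psi> a) 0 / fact m"

text \<open>The integral over a fixed circle expresses the coefficient by values of
  \<open>\<psi>\<close>, and so makes it bounded and holomorphic along curves in the
  parameter.\<close>

lemma coefficient_regular: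
  "continuous_on (ball 0 s) (\<lambda>h. coefficient m (complexify h))"
  "(\<lambda>h. coefficient m (complexify h)) differentiable (at 0)"
proof -
  let ?\<zeta> = "circlepath 0 (s / 2)"
  have nz: "?\<zeta> t \<noteq> 0" for t using s by (metis norm_circlepath_0 norm_zero less_imp_le less_irrefl half_gt_zero)
  define G where "G a = integral {0..1} (\<lambda>t. half_map \<psi> a (?\<zeta> t) / ?\<zeta> t ^ m)" for a
  have G: "coefficient m a = G a" if "\<And>i. norm (a i) < s" for a
    unfolding coefficient_def G_def by (rule Taylor_coefficient_integral[OF section_holomorphic(2)[OF that]]) (use s in auto)
  have b: "norm (half_map \<psi> a (?\<zeta> t) / ?\<zeta> t ^ m) \<le> 2 / (s / 2) ^ m" if "\<And>i. norm (a i) < s" for a t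
    unfolding norm_divide norm_power using half_map_bound(2)[OF that, of "?\<zeta> t"] s by (intro divide_mono) auto
  have c: "continuous_on {0..1} (\<lambda>t. half_map \<psi> a (?\<zeta> t) / ?\<zeta> t ^ m)" if "\<And>i. norm (a i) < s" for a
  proof -
    have "continuous_on {0..1} ?\<zeta>" using path_circlepath[of 0 "s / 2"] by (simp add: path_def)
    moreover have "continuous_on {0..1} (\<lambda>t. half_map \<psi> a (?\<zeta> t))"
      by (rule continuous_on_compose2[OF holomorphic_on_imp_continuous_on[OF section_holomorphic(2)[OF that]] calculation])
        (use s in auto)
    ultimately show ?thesis using nz by (intro continuous_intros) auto
  qed
  have hG: "curve_holomorphic (poly_plots s) G"
    unfolding G_def[abs_def]
  proof (rule curve_holomorphic_integral[OF plot_family_poly, where M="2 / (s / 2) ^ m"])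
    fix t :: real assume "t \<in> {0..1}"
    show "curve_holomorphic (poly_plots s) (\<lambda>a. half_map \<psi> a (?\<zeta> t) / ?\<zeta> t ^ m)"
      unfolding curve_holomorphic_def
    proof (intro allI impI)
      fix T and c :: "complex \<Rightarrow> 'n \<Rightarrow> complex" assume T: "open T" and cT: "poly_plots s T c"
      have "plots2 s T (\<lambda>w. (c w, ?\<zeta> t))" using cT s by (auto intro: holomorphic_intros)
      from curve_holomorphicD[OF hol, OF T this]
      show "(\<lambda>w. half_map \<psi> (c w) (?\<zeta> t) / ?\<zeta> t ^ m) holomorphic_on T"
        unfolding half_map_def using nz by (intro holomorphic_intros) auto
    qed
  qed (use b c in auto)
  have bG: "norm (G a) \<le> 2 / (s / 2) ^ m" if "\<And>i. norm (a i) < s" for a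
    unfolding G_def using integral_bound[OF _ c[OF that] b[OF that]] by simp
  have eq: "coefficient m (complexify h) = G (complexify h)" if "h \<in> ball 0 s" for h
    by (rule G) (use that component_le_norm_cart[of h] in \<open>auto intro: le_less_trans\<close>)
  have R: "continuous_on (ball 0 s) (\<lambda>h. G (complexify h))" "(\<lambda>h. G (complexify h)) differentiable (at 0)"
    by (rule curve_holomorphic_differentiable_at_0[OF hG s(1)], rule bG, blast)+
  show "continuous_on (ball 0 s) (\<lambda>h. coefficient m (complexify h))"
    using R(1) by (rule continuous_on_eq) (rule eq[symmetric])
  show "(\<lambda>h. coefficient m (complexify h)) differentiable (at 0)"
    using R(2) unfolding differentiable_def
    by (metis (no_types, lifting) has_derivative_transform_within_open[OF _ open_ball, of _ _ 0 UNIV 0 s] eq centre_in_ball s(1))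
qed

lemma coefficient_real:
  assumes h: "\<And>i. \<bar>vec_nth h i\<bar> < s" and r0: "0 < r0" "r0 \<le> s"
    and f: "\<And>x. \<bar>x\<bar> < r0 \<Longrightarrow> f x = x * (-1 + Re (\<psi> (complexify h, of_real x)))"
  shows "coefficient m (complexify h) = of_real (taylor_coeff f m)"
proof -
  have "half_map \<psi> (complexify h) holomorphic_on ball 0 s" by (rule section_holomorphic(2)) (use h in auto)
  then have hh: "half_map \<psi> (complexify h) holomorphic_on ball 0 r0" by (rule holomorphic_on_subset) (use r0 in auto)
  have "(deriv ^^ m) (half_map \<psi> (complexify h)) (of_real 0) = of_real ((deriv ^^ m) f 0)"
    by (rule deriv_of_real_restriction[OF hh]) (use half_map_real[OF h] f r0 in auto)
  then show ?thesis by (simp add: coefficient_def taylor_coeff_def)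
qed

text \<open>For the sign: -1 + \<psi> has real part at most -1/2, and by Cauchy's estimate the other
  term, x times the derivative of \<psi>, is less than 1/2 for |x| < s / 2.\<close>

lemma half_map_derivative:
  assumes h: "\<And>i. \<bar>vec_nth h i\<bar> < s" and x: "\<bar>x\<bar> < s / 2"
  shows "((\<lambda>x. x * (-1 + Re (\<psi> (complexify h, of_real x)))) has_real_derivative
      Re (deriv (half_map \<psi> (complexify h)) (of_real x))) (at x)"
    "Re (deriv (half_map \<psi> (complexify h)) (of_real x)) < 0"
proof -
  let ?u = "\<lambda>x. \<psi> (complexify h, x)"
  have xb: "of_real x \<in> ball (0::complex) s" using x s by simp
  have hn: "norm (complexify h i) < s" for i using h by simp
  have "((\<lambda>x. Re (half_map \<psi> (complexify h) (of_real x))) has_real_derivative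
      Re (deriv (half_map \<psi> (complexify h)) (of_real x))) (at x)"
    by (rule has_real_derivative_Re[OF holomorphic_derivI[OF section_holomorphic(2)[OF hn] open_ball xb]])
  then show "((\<lambda>x. x * (-1 + Re (\<psi> (complexify h, of_real x)))) has_real_derivative
      Re (deriv (half_map \<psi> (complexify h)) (of_real x))) (at x)"
  proof (rule has_field_derivative_transform_within_open[of _ _ _ "{-s<..<s}"])
    show "Re (half_map \<psi> (complexify h) (of_real y)) = y * (-1 + Re (\<psi> (complexify h, of_real y)))"
      if "y \<in> {-s<..<s}" for y
      using half_map_real[OF h, of y] that by auto
  qed (use x s in auto)
  have du: "(?u has_field_derivative deriv ?u (of_real x)) (at (of_real x))"
    by (rule holomorphic_derivI[OF section_holomorphic(1)[OF hn] open_ball xb])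
  have "(half_map \<psi> (complexify h) has_field_derivative (-1 + ?u (of_real x)) + of_real x * deriv ?u (of_real x)) (at (of_real x))"
    unfolding half_map_def[abs_def] using du by (auto intro!: derivative_eq_intros)
  then have d: "deriv (half_map \<psi> (complexify h)) (of_real x) = (-1 + ?u (of_real x)) + of_real x * deriv ?u (of_real x)"
    by (rule DERIV_imp_deriv)
  have sub: "ball (of_real x) (s / 2) \<subseteq> ball (0::complex) s"
  proof
    fix z :: complex assume "z \<in> ball (of_real x) (s / 2)"
    then show "z \<in> ball 0 s" using x norm_triangle_ineq2[of z "of_real x"] by (simp add: dist_norm norm_minus_commute)
  qed
  have "norm (deriv ?u (of_real x)) \<le> (1 / 2) / (s / 2)"
  proof (rule norm_deriv_le_bound[OF holomorphic_on_subset[OF section_holomorphic(1)[OF hn] sub]])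
    show "norm (\<psi> (complexify h, z)) \<le> 1 / 2" if "z \<in> ball (of_real x) (s / 2)" for z
      using bound[of "(complexify h, z)"] h subsetD[OF sub that] by simp
  qed (use s in auto)
  then have "\<bar>x\<bar> * norm (deriv ?u (of_real x)) \<le> \<bar>x\<bar> * (1 / s)" using s by (intro mult_left_mono) auto
  also have "\<dots> < s / 2 * (1 / s)" using x s by (intro mult_strict_right_mono) auto
  also have "\<dots> = 1 / 2" using s by simp
  finally have "Re (of_real x * deriv ?u (of_real x)) < 1 / 2"
    using complex_Re_le_cmod[of "of_real x * deriv ?u (of_real x)"] by (simp add: norm_mult)
  moreover have "Re (?u (of_real x)) \<le> 1 / 2"
    using bound[of "(complexify h, of_real x)"] h x s complex_Re_le_cmod[of "?u (of_real x)"] by simp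
  ultimately show "Re (deriv (half_map \<psi> (complexify h)) (of_real x)) < 0" unfolding d by simp
qed

end

section \<open>Bifurcation of limit cycles\<close>

text \<open>Both sides share the radius \<open>s\<close>, and none of the constants depends on the
  parameter offset \<open>h\<close>; this makes the size of the neighbourhoods below uniform in
  \<open>h\<close>.\<close>

locale half_turn_families =
  up: half_map_family \<psi> s + lo: half_map_family \<psi>' s
  for \<psi> \<psi>' :: "('n::finite \<Rightarrow> complex) \<times> complex \<Rightarrow> complex" and s +
  fixes Zp Zm :: "real ^ 'n \<Rightarrow> vfield" and \<Lambda>0 :: "real ^ 'n" and \<kappa> m B L N m' B' L' N' :: real
    and \<eta> \<eta>' :: "real ^ 'n \<Rightarrow> real \<Rightarrow> real \<Rightarrow> real"
  assumes N: "0 < N" "0 < N'"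
    and up_turn: "\<And>h \<rho> R r0. (\<And>i. \<bar>vec_nth h i\<bar> < s) \<Longrightarrow> 0 < R \<Longrightarrow> R \<le> s \<Longrightarrow> \<rho> \<le> s \<Longrightarrow> 2 * N * \<rho> < R \<Longrightarrow> 0 < r0 \<Longrightarrow> 2 * r0 \<le> \<rho> \<Longrightarrow>
        half_turn 1 \<kappa> \<rho> R m B L N r0 (Zp (\<Lambda>0 + h)) (\<eta> h) (\<lambda>x. x * (-1 + Re (\<psi> (complexify h, of_real x))))"
    and lo_turn: "\<And>h \<rho> R r0. (\<And>i. \<bar>vec_nth h i\<bar> < s) \<Longrightarrow> 0 < R \<Longrightarrow> R \<le> s \<Longrightarrow> \<rho> \<le> s \<Longrightarrow> 2 * N' * \<rho> < R \<Longrightarrow> 0 < r0 \<Longrightarrow> 2 * r0 \<le> \<rho> \<Longrightarrow>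
        half_turn (-1) (- \<kappa>) \<rho> R m' B' L' N' r0 (Zm (\<Lambda>0 + h)) (\<eta>' h) (\<lambda>x. x * (-1 + Re (\<psi>' (complexify h, of_real x))))"
begin

text \<open>Chosen so that both height conditions, \<open>2 * N * \<rho> < s\<close> and
  \<open>2 * N' * \<rho> < s\<close>, hold for boxes of the common height R = s.\<close>

definition \<rho> where "\<rho> = s / (4 * (N + N' + 1))"
definition r0 where "r0 = \<rho> / 2"

lemma radii: "0 < \<rho>" "\<rho> \<le> s / 4" "2 * N * \<rho> < s" "2 * N' * \<rho> < s" "0 < r0" "2 * r0 \<le> \<rho>" "r0 \<le> s / 8"
proof -
  have p: "0 < 4 * (N + N' + 1)" using N by simp
  show 1: "0 < \<rho>" unfolding \<rho>_def using p up.s by simp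
  have q: "4 * (N + N' + 1) * \<rho> = s" using p by (simp add: \<rho>_def)
  have "N * \<rho> > 0" "N' * \<rho> > 0" using 1 N by auto
  moreover have "4 * (N * \<rho>) + 4 * (N' * \<rho>) + 4 * \<rho> = s" using q by (simp add: algebra_simps)
  ultimately show "\<rho> \<le> s / 4" "2 * N * \<rho> < s" "2 * N' * \<rho> < s" using 1 by auto
  then show "0 < r0" "2 * r0 \<le> \<rho>" "r0 \<le> s / 8" using 1 by (auto simp: r0_def)
qed

definition \<phi> where "\<phi> h x = x * (-1 + Re (\<psi> (complexify h, of_real x)))" for h x
definition \<phi>' where "\<phi>' h x = x * (-1 + Re (\<psi>' (complexify h, of_real x)))" for h x
definition D\<phi> where "D\<phi> h x = Re (deriv (half_map \<psi> (complexify h)) (of_real x))" for h x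
definition D\<phi>' where "D\<phi>' h x = Re (deriv (half_map \<psi>' (complexify h)) (of_real x))" for h x

lemma turns:
  assumes h: "\<And>i. \<bar>vec_nth h i\<bar> < s"
  shows "two_half_turns \<kappa> \<rho> s m B L N r0 m' B' L' N' (Zp (\<Lambda>0 + h)) (Zm (\<Lambda>0 + h)) (\<eta> h) (\<eta>' h)
    (\<phi> h) (\<phi>' h) (D\<phi> h) (D\<phi>' h)"
proof -
  interpret a: half_turn 1 \<kappa> \<rho> s m B L N r0 "Zp (\<Lambda>0 + h)" "\<eta> h" "\<phi> h"
    unfolding \<phi>_def[abs_def] by (rule up_turn[OF h]) (use radii up.s in auto)
  interpret b: half_turn "-1" "- \<kappa>" \<rho> s m' B' L' N' r0 "Zm (\<Lambda>0 + h)" "\<eta>' h" "\<phi>' h"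
    unfolding \<phi>'_def[abs_def] by (rule lo_turn[OF h]) (use radii up.s in auto)
  show ?thesis
  proof
    show "(\<phi> h has_real_derivative D\<phi> h x) (at x) \<and> D\<phi> h x < 0" if "\<bar>x\<bar> < r0" for x
      unfolding \<phi>_def[abs_def] D\<phi>_def using that radii up.s by (intro conjI up.half_map_derivative[OF h]) auto
    show "(\<phi>' h has_real_derivative D\<phi>' h x) (at x) \<and> D\<phi>' h x < 0" if "\<bar>x\<bar> < r0" for x
      unfolding \<phi>'_def[abs_def] D\<phi>'_def using that radii up.s by (intro conjI lo.half_map_derivative[OF h]) auto
  qed
qed

definition V where "V j h = lyapunov_coeff (Zp (\<Lambda>0 + h)) (Zm (\<Lambda>0 + h)) j"
definition \<Delta> where "\<Delta> h x = of_real \<kappa> * (half_map \<psi> (complexify h) x - half_map \<psi>' (complexify h) x)" for h x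

text \<open>On a short real interval the half-maps are the half-return maps of the fields. The
  involution property and the Taylor coefficients pass from there to the complex side.\<close>

lemma
  assumes h: "\<And>i. \<bar>vec_nth h i\<bar> < s"
  shows involutions: "x \<in> ball 0 (s / 2) \<Longrightarrow> half_map \<psi> (complexify h) (half_map \<psi> (complexify h) x) = x"
      "x \<in> ball 0 (s / 2) \<Longrightarrow> half_map \<psi>' (complexify h) (half_map \<psi>' (complexify h) x) = x"
    and lyapunov_as_coefficient: "of_real (V j h) = of_real \<kappa> * (up.coefficient j (complexify h) - lo.coefficient j (complexify h))"
    and kappa: "\<kappa> = 1 \<or> \<kappa> = -1"
proof -
  interpret T: two_half_turns \<kappa> \<rho> s m B L N r0 m' B' L' N' "Zp (\<Lambda>0 + h)" "Zm (\<Lambda>0 + h)" "\<eta> h" "\<eta>' h" "\<phi> h" "\<phi>' h" "D\<phi> h" "D\<phi>' h"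
    by (rule turns[OF h])
  show k: "\<kappa> = 1 \<or> \<kappa> = -1" by (rule T.up.\<kappa>)
  have hn: "norm (complexify h i) < s" for i using h by simp
  have small: "\<bar>\<phi> h x\<bar> < r0" "\<bar>\<phi>' h x\<bar> < r0" if "\<bar>x\<bar> < r0 / 2" for x
    using T.up.phi[of x] T.lo.phi[of x] that radii T.up.phi_0 T.lo.phi_0 by (cases "x = 0"; force)+
  have inv: "\<phi> h (\<phi> h x) = x" "\<phi>' h (\<phi>' h x) = x" if "\<bar>x\<bar> < r0 / 2" for x
    using T.up.phi_involution[of x] T.lo.phi_involution[of x] small[OF that] that radii T.up.phi_0 T.lo.phi_0
    by (cases "x = 0"; force)+
  have rs: "\<bar>x\<bar> < s" if "\<bar>x\<bar> < r0" for x using that radii up.s by linarith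
  have re: "half_map \<psi> (complexify h) (of_real x) = of_real (\<phi> h x)" "half_map \<psi>' (complexify h) (of_real x) = of_real (\<phi>' h x)"
    if "\<bar>x\<bar> < r0" for x
    using up.half_map_real[OF h rs[OF that]] lo.half_map_real[OF h rs[OF that]] by (simp_all add: \<phi>_def \<phi>'_def)
  have rd: "\<bar>x\<bar> < r0" if "\<bar>x\<bar> < r0 / 2" for x using that radii by linarith
  show "half_map \<psi> (complexify h) (half_map \<psi> (complexify h) x) = x" if "x \<in> ball 0 (s / 2)"
  proof (rule complex_involution[where u="\<lambda>x. \<psi> (complexify h, x)" and e="r0 / 2", OF up.section_holomorphic(1)[OF hn]])
    show "half_map \<psi> (complexify h) (half_map \<psi> (complexify h) (of_real x)) = of_real x" if "\<bar>x\<bar> < r0 / 2" for x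
      using re(1)[OF rd[OF that]] re(1)[OF small(1)[OF that]] inv(1)[OF that] by simp
  qed (use that up.bound h radii in \<open>auto simp: half_map_def\<close>)
  show "half_map \<psi>' (complexify h) (half_map \<psi>' (complexify h) x) = x" if "x \<in> ball 0 (s / 2)"
  proof (rule complex_involution[where u="\<lambda>x. \<psi>' (complexify h, x)" and e="r0 / 2", OF lo.section_holomorphic(1)[OF hn]])
    show "half_map \<psi>' (complexify h) (half_map \<psi>' (complexify h) (of_real x)) = of_real x" if "\<bar>x\<bar> < r0 / 2" for x
      using re(2)[OF rd[OF that]] re(2)[OF small(2)[OF that]] inv(2)[OF that] by simp
  qed (use that lo.bound h radii in \<open>auto simp: half_map_def\<close>)
  have "up.coefficient j (complexify h) = of_real (taylor_coeff (half_return 1 (Zp (\<Lambda>0 + h))) j)"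
    by (rule up.coefficient_real[OF h radii(5)]) (use radii up.s T.up.half_return_eq_phi in \<open>auto simp: \<phi>_def\<close>)
  moreover have "lo.coefficient j (complexify h) = of_real (taylor_coeff (half_return (-1) (Zm (\<Lambda>0 + h))) j)"
    by (rule lo.coefficient_real[OF h radii(5)]) (use radii up.s T.lo.half_return_eq_phi in \<open>auto simp: \<phi>'_def\<close>)
  moreover have "sgn (fst (Zp (\<Lambda>0 + h) (0, 0))) = \<kappa>"
    using T.up.Xlow[of 0 0] T.up.pos radii k by (auto simp: sgn_if)
  ultimately show "of_real (V j h) = of_real \<kappa> * (up.coefficient j (complexify h) - lo.coefficient j (complexify h))"
    by (simp add: V_def lyapunov_coeff_def)
qed

lemma V_regular: "continuous_on (ball 0 s) (V j)" "V j differentiable (at 0)"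
proof -
  have eq: "V j h = Re (of_real \<kappa> * (up.coefficient j (complexify h) - lo.coefficient j (complexify h)))" if "h \<in> ball 0 s" for h
  proof -
    have "\<bar>vec_nth h i\<bar> < s" for i using that component_le_norm_cart[of h i] by simp
    from lyapunov_as_coefficient[OF this] show ?thesis by (metis Re_complex_of_real)
  qed
  have "continuous_on (ball 0 s) (\<lambda>h. Re (of_real \<kappa> * (up.coefficient j (complexify h) - lo.coefficient j (complexify h))))"
    by (intro continuous_intros up.coefficient_regular lo.coefficient_regular)
  then show "continuous_on (ball 0 s) (V j)" by (rule continuous_on_eq) (simp add: eq)
  obtain d d' where "((\<lambda>h. up.coefficient j (complexify h)) has_derivative d) (at 0)" "((\<lambda>h. lo.coefficient j (complexify h)) has_derivative d') (at 0)"
    using up.coefficient_regular(2) lo.coefficient_regular(2) unfolding differentiable_def by blast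
  then have "((\<lambda>h. Re (of_real \<kappa> * (up.coefficient j (complexify h) - lo.coefficient j (complexify h)))) has_derivative
      (\<lambda>x. Re (of_real \<kappa> * (d x - d' x)))) (at 0)"
    by (intro bounded_linear.has_derivative[OF bounded_linear_Re] has_derivative_mult_right has_derivative_diff)
  then have "(V j has_derivative (\<lambda>x. Re (of_real \<kappa> * (d x - d' x)))) (at 0)"
    by (rule has_derivative_transform_within_open[OF _ open_ball[of 0 s]]) (use up.s eq in auto)
  then show "V j differentiable (at 0)" unfolding differentiable_def by blast
qed

lemma Delta_Taylor:
  assumes h: "\<And>i. \<bar>vec_nth h i\<bar> < s"
  shows "\<Delta> h holomorphic_on ball 0 s" "x \<in> ball 0 s \<Longrightarrow> norm (\<Delta> h x) \<le> 4"
    "(deriv ^^ j) (\<Delta> h) 0 / fact j = of_real (V j h)"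
    "\<bar>x'\<bar> < s \<Longrightarrow> \<Delta> h (of_real x') = of_real (\<kappa> * (\<phi> h x' - \<phi>' h x'))"
    "odd j \<Longrightarrow> \<bar>V j h\<bar> \<le> 2 * (4 / s) ^ j * (\<Sum>l<j. \<bar>V l h\<bar>)"
proof -
  have hn: "norm (complexify h i) < s" for i using h by simp
  note hp = up.section_holomorphic(2)[OF hn] and hm = lo.section_holomorphic(2)[OF hn]
  show "\<Delta> h holomorphic_on ball 0 s" unfolding \<Delta>_def[abs_def] by (intro holomorphic_intros hp hm)
  have k1: "norm (of_real \<kappa> :: complex) = 1" using kappa[OF h] by auto
  show "norm (\<Delta> h x) \<le> 4" if "x \<in> ball 0 s"
    using norm_triangle_ineq4[of "half_map \<psi> (complexify h) x" "half_map \<psi>' (complexify h) x"]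
      up.half_map_bound(2)[where a="complexify h", OF hn, of x] lo.half_map_bound(2)[where a="complexify h", OF hn, of x] that k1
    by (simp add: \<Delta>_def norm_mult)
  have hd: "(\<lambda>x. half_map \<psi> (complexify h) x - half_map \<psi>' (complexify h) x) holomorphic_on ball 0 s"
    by (intro holomorphic_intros hp hm)
  have dd: "(deriv ^^ l) (\<lambda>x. half_map \<psi> (complexify h) x - half_map \<psi>' (complexify h) x) 0 / fact l
      = up.coefficient l (complexify h) - lo.coefficient l (complexify h)" for l
    using higher_deriv_diff[OF hp hm open_ball, of 0 l] up.s
    by (simp add: up.coefficient_def lo.coefficient_def diff_divide_distrib)
  have "(deriv ^^ j) (\<Delta> h) 0 = of_real \<kappa> * (deriv ^^ j) (\<lambda>x. half_map \<psi> (complexify h) x - half_map \<psi>' (complexify h) x) 0"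
    unfolding \<Delta>_def[abs_def] by (rule higher_deriv_cmult[OF hd _ open_ball]) (use up.s in auto)
  then show "(deriv ^^ j) (\<Delta> h) 0 / fact j = of_real (V j h)"
    unfolding lyapunov_as_coefficient[OF h] dd[symmetric] by simp
  show "\<Delta> h (of_real x') = of_real (\<kappa> * (\<phi> h x' - \<phi>' h x'))" if "\<bar>x'\<bar> < s"
    using up.half_map_real[OF h that] lo.half_map_real[OF h that] by (simp add: \<Delta>_def \<phi>_def \<phi>'_def)
  have nV: "norm (up.coefficient l (complexify h) - lo.coefficient l (complexify h)) = \<bar>V l h\<bar>" for l
    using arg_cong[OF lyapunov_as_coefficient[OF h, of l], of norm] k1 by (simp add: norm_mult)
  show "\<bar>V j h\<bar> \<le> 2 * (4 / s) ^ j * (\<Sum>l<j. \<bar>V l h\<bar>)" if "odd j"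
    using odd_coefficient_bound[of s "\<lambda>x. \<psi> (complexify h, x)" "\<lambda>x. \<psi>' (complexify h, x)"
        "half_map \<psi> (complexify h)" "half_map \<psi>' (complexify h)" j, unfolded dd nV,
        OF up.s up.section_holomorphic(1)[OF hn] _ lo.section_holomorphic(1)[OF hn] _ _ _ involutions[OF h] that]
      up.bound lo.bound h by (simp add: half_map_def)
qed

end

context half_turn_families
begin

text \<open>A simple zero of \<open>\<Delta> h\<close> means equal values but different derivatives
  of the two half-return maps, as \<open>hyperbolic_cycle\<close> asks. The last claim serves to
  tell the cycles of different zeros apart.\<close>

lemma cycle_of_simple_zero:
  assumes h: "\<And>i. \<bar>vec_nth h i\<bar> < s" and x: "0 < x" "x < r0 / 4"
    and zero: "\<Delta> h (of_real x) = 0" "deriv (\<Delta> h) (of_real x) \<noteq> 0"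
  shows "hyperbolic_limit_cycle (Zp (\<Lambda>0 + h)) (Zm (\<Lambda>0 + h)) (half_turn.arc (\<eta> h) (\<phi> h) x \<union> half_turn.arc (\<eta>' h) (\<phi>' h) x)"
    "\<forall>p\<in>half_turn.arc (\<eta> h) (\<phi> h) x \<union> half_turn.arc (\<eta>' h) (\<phi>' h) x. norm p \<le> (3 / 2 + 5 / 2 * (N + N')) * x"
    "(x, 0) \<in> half_turn.arc (\<eta> h) (\<phi> h) x \<union> half_turn.arc (\<eta>' h) (\<phi>' h) x"
    "\<And>y. (y, 0) \<in> half_turn.arc (\<eta> h) (\<phi> h) x \<union> half_turn.arc (\<eta>' h) (\<phi>' h) x \<Longrightarrow> 0 < y \<Longrightarrow> y = x"
proof -
  interpret T: two_half_turns \<kappa> \<rho> s m B L N r0 m' B' L' N' "Zp (\<Lambda>0 + h)" "Zm (\<Lambda>0 + h)" "\<eta> h" "\<eta>' h" "\<phi> h" "\<phi>' h" "D\<phi> h" "D\<phi>' h"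
    by (rule turns[OF h])
  have xs: "\<bar>x\<bar> < s" "x \<noteq> 0" "\<bar>x\<bar> < r0" using x radii up.s by linarith+
  have k: "\<kappa> \<noteq> 0" using kappa[OF h] by auto
  have eq: "\<phi> h x = \<phi>' h x" using zero(1) Delta_Taylor(4)[OF h xs(1)] k by simp
  have "(deriv ^^ 1) (\<Delta> h) (of_real x) = of_real ((deriv ^^ 1) (\<lambda>x. \<kappa> * (\<phi> h x - \<phi>' h x)) x)"
    by (rule deriv_of_real_restriction[OF Delta_Taylor(1)[OF h] Delta_Taylor(4)[OF h]]) (use xs in auto)
  moreover have "((\<lambda>x. \<kappa> * (\<phi> h x - \<phi>' h x)) has_real_derivative \<kappa> * (D\<phi> h x - D\<phi>' h x)) (at x)"
    using T.D\<phi>[OF xs(3)] T.D\<phi>'[OF xs(3)] by (intro DERIV_cmult DERIV_diff) auto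
  ultimately have ne: "D\<phi> h x \<noteq> D\<phi>' h x" using zero(2) by (auto simp: DERIV_imp_deriv)
  show "hyperbolic_limit_cycle (Zp (\<Lambda>0 + h)) (Zm (\<Lambda>0 + h)) (T.up.arc x \<union> T.lo.arc x)"
    by (rule T.hyperbolic_cycle[OF x eq ne])
  show "\<forall>p\<in>T.up.arc x \<union> T.lo.arc x. norm p \<le> (3 / 2 + 5 / 2 * (N + N')) * x"
  proof
    fix p assume "p \<in> T.up.arc x \<union> T.lo.arc x"
    then have "norm p \<le> (3 / 2 + 5 / 2 * N) * \<bar>x\<bar> \<or> norm p \<le> (3 / 2 + 5 / 2 * N') * \<bar>x\<bar>"
      using T.up.arc_small[OF xs(2,3)] T.lo.arc_small[OF xs(2,3)] by blast
    moreover have "(3 / 2 + 5 / 2 * N) * \<bar>x\<bar> \<le> (3 / 2 + 5 / 2 * (N + N')) * x"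
      "(3 / 2 + 5 / 2 * N') * \<bar>x\<bar> \<le> (3 / 2 + 5 / 2 * (N + N')) * x"
      using x N by (auto intro!: mult_mono)
    ultimately show "norm p \<le> (3 / 2 + 5 / 2 * (N + N')) * x" by linarith
  qed
  show "(x, 0) \<in> T.up.arc x \<union> T.lo.arc x" using T.arc_endpoints(3)[OF xs(2,3)] by blast
  have neg: "\<phi> h x < 0" using T.up.phi[OF xs(2,3)] x by (auto simp: mult_less_0_iff)
  show "y = x" if "(y, 0) \<in> T.up.arc x \<union> T.lo.arc x" "0 < y" for y
    using that T.arc_endpoints(1,2)[OF xs(2,3), of "(y, 0)"] neg eq by auto
qed

text \<open>\<open>K\<close>, \<open>\<mu>0\<close> and \<open>\<tau>\<close> are fixed before
  \<open>h\<close> and \<mu>, so one tolerance serves all scales. The rescaled displacement differs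
  from \<open>model n\<close> by at most (\<tau> + \<mu>) A / |c|, and the zeros of the model
  persist.\<close>

theorem cycles_near_model:
  fixes n :: nat and c :: real and q :: "nat \<Rightarrow> real"
  assumes c: "c \<noteq> 0" and q: "\<And>m. odd m \<Longrightarrow> q m = 0" "q 0 = 0"
    "\<And>z. model n z = (\<Sum>m\<le>2 * n + 2. of_real (q m) * z ^ m)"
  shows "\<exists>K \<mu>0 \<tau>. 0 < K \<and> 0 < \<mu>0 \<and> \<mu>0 \<le> 1 \<and> 0 < \<tau> \<and> (\<forall>h \<mu>. (\<forall>i. \<bar>vec_nth h i\<bar> < s) \<longrightarrow> 0 < \<mu> \<longrightarrow> \<mu> < \<mu>0 \<longrightarrow>
    (\<forall>j\<in>{1..n + 1}. \<bar>V (2 * j) h - c * q (2 * j) * \<mu> ^ (2 * n + 2 - 2 * j)\<bar> \<le> \<tau> * \<mu> ^ (2 * n + 2 - 2 * j)) \<longrightarrow>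
    (\<exists>S. card S = n \<and> (\<forall>\<Gamma>\<in>S. hyperbolic_limit_cycle (Zp (\<Lambda>0 + h)) (Zm (\<Lambda>0 + h)) \<Gamma> \<and> (\<forall>p\<in>\<Gamma>. norm p \<le> K * \<mu>))))"
proof -
  define P where "P = 2 * n + 2"
  define \<nu> where "\<nu> = real n + 2"
  have \<nu>: "\<nu> \<ge> 1" "\<nu> > 0" by (auto simp: \<nu>_def)
  obtain \<epsilon> where \<epsilon>: "\<epsilon> > 0" "\<And>G i. G holomorphic_on ball 0 \<nu> \<Longrightarrow>
     (\<forall>z\<in>ball 0 \<nu>. norm (G z - model n z) \<le> \<epsilon>) \<Longrightarrow> (\<forall>x. \<bar>x\<bar> < \<nu> \<longrightarrow> G (of_real x) \<in> \<real>) \<Longrightarrow> i \<in> {1..n} \<Longrightarrow>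
     \<exists>x. \<bar>x - real i\<bar> < 1 / 2 \<and> G (of_real x) = 0 \<and> deriv G (of_real x) \<noteq> 0"
    using model_zeros_persist[of n] unfolding \<nu>_def by blast
  define A where "A = (\<Sum>m\<le>P. \<nu> ^ m) + \<nu> ^ Suc P * ((4 + (\<Sum>m\<le>P. norm (c * q m) + 1)) / (s / 2) ^ Suc P)"
  have A: "A > 0"
  proof -
    have "0 < (\<Sum>m\<le>P. \<nu> ^ m)" using \<nu> by (intro sum_pos) auto
    moreover have "0 \<le> (\<Sum>m\<le>P. norm (c * q m) + 1)" by (intro sum_nonneg) auto
    ultimately show ?thesis unfolding A_def using \<nu> up.s by (intro add_pos_nonneg mult_nonneg_nonneg divide_nonneg_nonneg) auto
  qed
  \<comment> \<open>Half of the admissible error \<epsilon> |c| is reserved for the coefficients and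
    half for the remainder, which is covered by \<mu> \<le> \<tau>.\<close>
  define \<tau> where "\<tau> = min 1 (\<epsilon> * \<bar>c\<bar> / (2 * A))"
  have \<tau>: "0 < \<tau>" "\<tau> \<le> 1" "2 * \<tau> * A \<le> \<epsilon> * \<bar>c\<bar>"
  proof -
    show "0 < \<tau>" using \<epsilon> c A by (simp add: \<tau>_def)
    show "\<tau> \<le> 1" unfolding \<tau>_def by (rule min.cobounded1)
    have "\<tau> \<le> \<epsilon> * \<bar>c\<bar> / (2 * A)" unfolding \<tau>_def by (rule min.cobounded2)
    then have "\<tau> * (2 * A) \<le> \<epsilon> * \<bar>c\<bar>" using A by (simp add: pos_le_divide_eq)
    then show "2 * \<tau> * A \<le> \<epsilon> * \<bar>c\<bar>" by (simp add: mult_ac)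
  qed
  define KK where "KK = 2 * (4 / s) ^ P"
  define C where "C = (\<Sum>m\<le>P. \<bar>c * q m\<bar>) + 1"
  define D where "D = KK * (C * (\<Sum>j<P. (1 + KK) ^ j))"
  have KK: "KK \<ge> 0" using up.s by (simp add: KK_def)
  have C: "C \<ge> 0" "\<And>m. m \<le> P \<Longrightarrow> \<bar>c * q m\<bar> + 1 \<le> C"
    unfolding C_def by (auto intro!: add_nonneg_nonneg sum_nonneg member_le_sum)
  have D: "D \<ge> 0" unfolding D_def using KK C by (intro mult_nonneg_nonneg sum_nonneg) auto
  \<comment> \<open>The bounds after 1 provide, in this order: \<mu> \<le> \<tau> for the Taylor
    remainder, D \<mu> \<le> \<tau> for the odd coefficients, \<mu> \<nu> \<le> s / 2 for the domain
    of the Taylor estimate, and \<mu> \<nu> < r0 / 4 for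
    \<open>cycle_of_simple_zero\<close>.\<close>
  define \<mu>0 where "\<mu>0 = min 1 (min \<tau> (min (\<tau> / (D + 1)) (min (s / (2 * \<nu>)) (r0 / (4 * \<nu>)))))"
  have \<mu>0: "0 < \<mu>0" "\<mu>0 \<le> 1" "\<mu>0 \<le> \<tau>" "\<mu>0 \<le> \<tau> / (D + 1)" "\<mu>0 \<le> s / (2 * \<nu>)" "\<mu>0 \<le> r0 / (4 * \<nu>)"
  proof -
    have "0 < \<tau> / (D + 1)" "0 < s / (2 * \<nu>)" "0 < r0 / (4 * \<nu>)"
      using \<tau>(1) D up.s(1) \<nu>(2) radii(5) by (auto intro!: divide_pos_pos)
    then show "0 < \<mu>0" using \<tau>(1) by (simp only: \<mu>0_def min_less_iff_conj zero_less_one simp_thms)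
    show "\<mu>0 \<le> 1" "\<mu>0 \<le> \<tau>" "\<mu>0 \<le> \<tau> / (D + 1)" "\<mu>0 \<le> s / (2 * \<nu>)" "\<mu>0 \<le> r0 / (4 * \<nu>)"
      by (simp_all only: \<mu>0_def min_le_iff_disj order_refl simp_thms)
  qed
  define K where "K = (3 / 2 + 5 / 2 * (N + N')) * \<nu>"
  have K: "K > 0" unfolding K_def using N \<nu> by (intro mult_pos_pos add_pos_pos) auto
  have cycles: "\<exists>S. card S = n \<and> (\<forall>\<Gamma>\<in>S. hyperbolic_limit_cycle (Zp (\<Lambda>0 + h)) (Zm (\<Lambda>0 + h)) \<Gamma> \<and> (\<forall>p\<in>\<Gamma>. norm p \<le> K * \<mu>))"
    if h: "\<forall>i. \<bar>vec_nth h i\<bar> < s" and \<mu>: "0 < \<mu>" "\<mu> < \<mu>0"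
      and ev: "\<forall>j\<in>{1..n + 1}. \<bar>V (2 * j) h - c * q (2 * j) * \<mu> ^ (P - 2 * j)\<bar> \<le> \<tau> * \<mu> ^ (P - 2 * j)" for h \<mu>
  proof -
    have h': "\<bar>vec_nth h i\<bar> < s" for i using h by blast
    note DT = Delta_Taylor[OF h']
    have \<mu>1: "\<mu> \<le> 1" "\<mu> \<le> \<tau>" "D * \<mu> \<le> \<tau>" "\<mu> * \<nu> \<le> s / 2" "\<mu> * \<nu> < r0 / 4"
    proof -
      show "\<mu> \<le> 1" "\<mu> \<le> \<tau>" using \<mu> \<mu>0 by auto
      have "\<mu> < \<tau> / (D + 1)" "\<mu> < s / (2 * \<nu>)" "\<mu> < r0 / (4 * \<nu>)" using \<mu> \<mu>0 by linarith+
      then have "\<mu> * (D + 1) < \<tau>" "\<mu> * (2 * \<nu>) < s" "\<mu> * (4 * \<nu>) < r0"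
        using D \<nu> by (simp_all add: pos_less_divide_eq add_nonneg_pos)
      then show "D * \<mu> \<le> \<tau>" "\<mu> * \<nu> \<le> s / 2" "\<mu> * \<nu> < r0 / 4" using \<mu> by (auto simp: algebra_simps)
    qed
    have V0: "V 0 h = 0" using DT(3)[of 0] by (simp add: \<Delta>_def half_map_def)
    have even_case: "\<bar>V m h - c * q m * \<mu> ^ (P - m)\<bar> \<le> \<tau> * \<mu> ^ (P - m)" if m: "m \<le> P" "even m" for m
    proof (cases "m = 0")
      case True
      then show ?thesis using V0 q(2) \<tau> \<mu> by simp
    next
      case False
      then obtain j where "m = 2 * j" "j \<in> {1..n + 1}" using m by (auto simp: P_def elim!: evenE)
      then show ?thesis using ev by blast
    qed
    \<comment> \<open>The odd coefficients are not prescribed. They are of order D \<mu>^(P+1-m),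
      and the extra factor \<mu> brings them within the tolerance around the value 0 that the even
      model has there.\<close>
    have odd_case: "\<bar>V m h\<bar> \<le> \<tau> * \<mu> ^ (P - m)" if m: "m \<le> P" "odd m" for m
    proof -
      have "\<bar>V m h\<bar> \<le> KK * (C * (\<Sum>j<P. (1 + KK) ^ j)) * \<mu> ^ (P + 1 - m)"
      proof (rule odd_terms_small[where v="\<lambda>m. \<bar>V m h\<bar>", OF KK C(1) \<mu>(1) \<mu>1(1) _ _ _ m])
        fix l assume l: "l \<le> P" "even l"
        have "\<bar>V l h\<bar> \<le> \<bar>c * q l * \<mu> ^ (P - l)\<bar> + \<tau> * \<mu> ^ (P - l)" using even_case[OF l] by linarith
        also have "\<dots> \<le> \<bar>c * q l\<bar> * \<mu> ^ (P - l) + 1 * \<mu> ^ (P - l)"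
          using \<mu> \<tau> by (intro add_mono mult_right_mono) (auto simp: abs_mult)
        also have "\<dots> = (\<bar>c * q l\<bar> + 1) * \<mu> ^ (P - l)" by (simp add: distrib_right)
        also have "\<dots> \<le> C * \<mu> ^ (P - l)" using C(2)[OF l(1)] \<mu> by (intro mult_right_mono) auto
        finally show "\<bar>V l h\<bar> \<le> C * \<mu> ^ (P - l)" .
      next
        fix l assume l: "l \<le> P" "odd l"
        have "(4 / s) ^ l \<le> (4 / s) ^ P" using up.s l by (intro power_increasing) (auto simp: le_divide_eq)
        then have "2 * (4 / s) ^ l * (\<Sum>j<l. \<bar>V j h\<bar>) \<le> KK * (\<Sum>j<l. \<bar>V j h\<bar>)"
          unfolding KK_def by (intro mult_right_mono sum_nonneg) auto
        with DT(5)[OF l(2)] show "\<bar>V l h\<bar> \<le> KK * (\<Sum>j<l. \<bar>V j h\<bar>)" by linarith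
      qed auto
      also have "\<dots> = D * \<mu> * \<mu> ^ (P - m)" using m by (simp add: D_def Suc_diff_le)
      also have "\<dots> \<le> \<tau> * \<mu> ^ (P - m)" using \<mu>1(3) \<mu> by (intro mult_right_mono) auto
      finally show ?thesis .
    qed
    have cf: "norm ((deriv ^^ m) (\<Delta> h) 0 / fact m - of_real ((c * q m) * \<mu> ^ (P - m))) \<le> \<tau> * \<mu> ^ (P - m)" if "m \<le> P" for m
    proof -
      have "\<bar>V m h - c * q m * \<mu> ^ (P - m)\<bar> \<le> \<tau> * \<mu> ^ (P - m)"
        using even_case[OF that] odd_case[OF that] q(1)[of m] by (cases "even m") auto
      then show ?thesis unfolding DT(3) by (metis norm_of_real of_real_diff)
    qed
    define G where "G z = \<Delta> h (of_real \<mu> * z) / of_real \<mu> ^ P / of_real c" for z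
    have close: "norm (G z - model n z) \<le> \<epsilon>" if z: "z \<in> ball 0 \<nu>" for z
    proof -
      have "norm (\<Delta> h (of_real \<mu> * z) / of_real \<mu> ^ P - (\<Sum>m\<le>P. of_real (c * q m) * z ^ m)) \<le> (\<tau> + \<mu>) * A"
        unfolding A_def by (rule scaled_Taylor_close[OF DT(1,2) up.s \<mu>(1) \<mu>1(1,4) _ \<tau>(2) \<nu>(1) cf]) (use z \<tau> in auto)
      also have "\<dots> \<le> 2 * \<tau> * A" using \<mu>1(2) A by (intro mult_right_mono) auto
      also note \<tau>(3)
      finally have b: "norm (\<Delta> h (of_real \<mu> * z) / of_real \<mu> ^ P - (\<Sum>m\<le>P. of_real (c * q m) * z ^ m)) \<le> \<epsilon> * \<bar>c\<bar>" .
      have "G z - model n z = (\<Delta> h (of_real \<mu> * z) / of_real \<mu> ^ P - (\<Sum>m\<le>P. of_real (c * q m) * z ^ m)) / of_real c"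
        unfolding G_def q(3) P_def[symmetric] using c by (simp add: diff_divide_distrib sum_divide_distrib)
      then show ?thesis using b c by (simp add: norm_divide pos_divide_le_eq)
    qed
    have \<mu>z: "of_real \<mu> * z \<in> ball 0 s" if "z \<in> ball 0 \<nu>" for z :: complex
    proof -
      have "\<mu> * norm z < \<mu> * \<nu>" using that \<mu> by simp
      then have "\<mu> * norm z < s" using \<mu>1(4) up.s by linarith
      then show ?thesis using \<mu> by (simp add: norm_mult)
    qed
    have "(\<Delta> h \<circ> (\<lambda>z. of_real \<mu> * z)) holomorphic_on ball 0 \<nu>"
      by (rule holomorphic_on_compose_gen[OF _ DT(1)]) (use \<mu>z in \<open>auto intro!: holomorphic_intros\<close>)
    then have hG: "G holomorphic_on ball 0 \<nu>"
      unfolding G_def[abs_def] o_def using \<mu> c by (intro holomorphic_intros) auto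
    have rG: "G (of_real x) \<in> \<real>" if "\<bar>x\<bar> < \<nu>" for x
    proof -
      have "\<bar>\<mu> * x\<bar> < s" using \<mu>z[of "of_real x"] that by (simp add: norm_mult abs_mult)
      from DT(4)[OF this] show ?thesis by (simp add: G_def)
    qed
    obtain X where X: "\<And>i. i \<in> {1..n} \<Longrightarrow> \<bar>X i - real i\<bar> < 1 / 2 \<and> G (of_real (X i)) = 0 \<and> deriv G (of_real (X i)) \<noteq> 0"
      using \<epsilon>(2)[OF hG] close rG by metis
    define x where "x i = \<mu> * X i" for i
    have Xb: "1 / 2 < X i" "X i < \<nu>" if "i \<in> {1..n}" for i
    proof -
      have "1 \<le> real i" "real i \<le> real n" using that by auto
      then show "1 / 2 < X i" "X i < \<nu>" using X[OF that] unfolding \<nu>_def by linarith+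
    qed
    have x: "0 < x i" "x i < r0 / 4" "x i \<le> \<mu> * \<nu>" if "i \<in> {1..n}" for i
    proof -
      show "0 < x i" using Xb[OF that] \<mu> by (simp add: x_def)
      have "x i < \<mu> * \<nu>" unfolding x_def using Xb[OF that] \<mu> by (intro mult_strict_left_mono) auto
      then show "x i < r0 / 4" "x i \<le> \<mu> * \<nu>" using \<mu>1(5) by auto
    qed
    have zero: "\<Delta> h (of_real (x i)) = 0" "deriv (\<Delta> h) (of_real (x i)) \<noteq> 0" if i: "i \<in> {1..n}" for i
    proof -
      show "\<Delta> h (of_real (x i)) = 0" using X[OF i] \<mu> c by (simp add: G_def x_def)
      have "of_real (X i) \<in> ball (0::complex) \<nu>" using Xb[OF i] by simp
      from \<mu>z[OF this] have "(\<Delta> h has_field_derivative deriv (\<Delta> h) (of_real \<mu> * of_real (X i))) (at (of_real \<mu> * of_real (X i)))"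
        by (rule holomorphic_derivI[OF DT(1) open_ball])
      then have "(G has_field_derivative deriv (\<Delta> h) (of_real \<mu> * of_real (X i)) * of_real \<mu> / of_real \<mu> ^ P / of_real c) (at (of_real (X i)))"
        unfolding G_def[abs_def]
        by (intro DERIV_cdivide DERIV_chain2[of "\<Delta> h"]) (auto intro!: derivative_eq_intros)
      then have "deriv G (of_real (X i)) = deriv (\<Delta> h) (of_real \<mu> * of_real (X i)) * of_real \<mu> / of_real \<mu> ^ P / of_real c"
        by (rule DERIV_imp_deriv)
      then show "deriv (\<Delta> h) (of_real (x i)) \<noteq> 0" using X[OF i] by (auto simp: x_def)
    qed
    define \<Gamma> where "\<Gamma> i = half_turn.arc (\<eta> h) (\<phi> h) (x i) \<union> half_turn.arc (\<eta>' h) (\<phi>' h) (x i)" for i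
    note cyc = cycle_of_simple_zero[OF h' x(1,2) zero]
    \<comment> \<open>Equal cycles have the same positive crossing, whereas zeros within 1/2 of
      different integers are different.\<close>
    have inj: "inj_on \<Gamma> {1..n}"
    proof (rule inj_onI)
      fix i j assume ij: "i \<in> {1..n}" "j \<in> {1..n}" "\<Gamma> i = \<Gamma> j"
      then have "x i = x j" using cyc(3)[OF ij(1,1,1,1)] cyc(4)[OF ij(2,2,2,2)] x(1)[OF ij(1)] unfolding \<Gamma>_def by metis
      then have "X i = X j" using \<mu> by (simp add: x_def)
      then have "\<bar>real i - real j\<bar> < 1" using X[OF ij(1)] X[OF ij(2)] by linarith
      then show "i = j" by linarith
    qed
    have "hyperbolic_limit_cycle (Zp (\<Lambda>0 + h)) (Zm (\<Lambda>0 + h)) (\<Gamma> i) \<and> (\<forall>p\<in>\<Gamma> i. norm p \<le> K * \<mu>)" if i: "i \<in> {1..n}" for i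
    proof -
      have "(3 / 2 + 5 / 2 * (N + N')) * x i \<le> (3 / 2 + 5 / 2 * (N + N')) * (\<mu> * \<nu>)"
        using x(3)[OF i] N by (intro mult_left_mono) auto
      also have "\<dots> = K * \<mu>" by (simp add: K_def)
      finally have "(3 / 2 + 5 / 2 * (N + N')) * x i \<le> K * \<mu>" .
      then show ?thesis using cyc(1,2)[OF i i i i] unfolding \<Gamma>_def by (meson order_trans)
    qed
    then show ?thesis using card_image[OF inj] by (intro exI[of _ "\<Gamma> ` {1..n}"]) auto
  qed
  show ?thesis
    by (rule exI[of _ K], rule exI[of _ \<mu>0], rule exI[of _ \<tau>], intro conjI allI impI K \<mu>0(1,2) \<tau>(1))
      (rule cycles[unfolded P_def]; assumption)
qed

end

section \<open>Common radii for the two sides of the family\<close>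

lemma half_map_family_mono:
  assumes "half_map_family \<psi> r" "0 < s" "s \<le> r"
  shows "half_map_family \<psi> s"
proof -
  interpret half_map_family \<psi> r by (rule assms(1))
  have P: "plots2 r T c" if "plots2 s T c" for T :: "complex set" and c :: "complex \<Rightarrow> ('a \<Rightarrow> complex) \<times> complex"
    using that assms(3) by (auto elim!: prod_plots_mono poly_plots_mono)
  show ?thesis
  proof
    show "curve_holomorphic (plots2 s) \<psi>" by (rule curve_holomorphic_mono[OF hol P])
    show "norm (\<psi> z) \<le> 1 / 2" if "z \<in> plot_dom (plots2 s)" for z
      using that assms(3) by (intro bound) (auto intro: less_le_trans)
    show "\<psi> (complexify h, of_real x) \<in> \<real>" if "\<And>i. \<bar>vec_nth h i\<bar> < s" "\<bar>x\<bar> < s" for h x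
      using that assms(3) by (intro real) (auto intro: less_le_trans)
  qed (use assms hol s in auto)
qed

lemma analytic_half_turn_family:
  fixes Z :: "real ^ 'n::finite \<Rightarrow> vfield"
  assumes an: "real_analytic_at (\<lambda>(\<Lambda>, p). Z \<Lambda> p) (\<Lambda>0, (0, 0))" and U: "open U" "\<Lambda>0 \<in> U"
    and k: "k > 0" and \<sigma>: "\<sigma> = 1 \<or> \<sigma> = -1" and X0: "fst (Z \<Lambda>0 (0, 0)) \<noteq> 0"
    and contact: "\<And>\<Lambda>. \<Lambda> \<in> U \<Longrightarrow> snd (Z \<Lambda> (0, 0)) = 0 \<and> (\<forall>i\<in>{1..2 * k - 2}. dx_at_0 i (\<lambda>p. snd (Z \<Lambda> p)) = 0)"
    and visibility: "\<sigma> * (fst (Z \<Lambda>0 (0, 0)) * dx_at_0 (2 * k - 1) (\<lambda>p. snd (Z \<Lambda>0 p))) < 0"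
  shows "\<exists>s m B L N \<eta> \<psi>. half_map_family \<psi> s \<and> 0 < N \<and>
     (\<forall>h \<rho> R r0. (\<forall>i. \<bar>vec_nth h i\<bar> < s) \<longrightarrow> 0 < R \<longrightarrow> R \<le> s \<longrightarrow> \<rho> \<le> s \<longrightarrow> 2 * N * \<rho> < R \<longrightarrow> 0 < r0 \<longrightarrow> 2 * r0 \<le> \<rho> \<longrightarrow>
        half_turn \<sigma> (sgn (fst (Z \<Lambda>0 (0, 0)))) \<rho> R m B L N r0 (Z (\<Lambda>0 + h)) (\<eta> h)
          (\<lambda>x. x * (-1 + Re (\<psi> (complexify h, of_real x)))))"
proof -
  obtain e where e: "e > 0" "ball \<Lambda>0 e \<subseteq> U" using U open_contains_ball by blast
  \<comment> \<open>An offset whose coordinates are below e / n has norm below \<open>e\<close>, so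
    the contact conditions assumed on \<open>U\<close> apply to it; the bound 1 gives the radius at
    most 1 of \<open>half_map_family\<close>.\<close>
  define d where "d = min 1 (e / real CARD('n))"
  have d: "d > 0" "d \<le> 1" "d \<le> e / real CARD('n)" using e by (auto simp: d_def)
  obtain r FX FY M where E0: "0 < r \<and> r \<le> d \<and> curve_holomorphic (plots3 r) FX \<and> curve_holomorphic (plots3 r) FY \<and>
    (\<forall>z\<in>plot_dom (plots3 r). norm (FX z) \<le> M \<and> norm (FY z) \<le> M \<and>
       norm (FX z - of_real (fst (Z \<Lambda>0 (0, 0)))) \<le> \<bar>fst (Z \<Lambda>0 (0, 0))\<bar> / 2) \<and>
    (\<forall>h x y. (\<forall>i. \<bar>vec_nth h i\<bar> < r) \<longrightarrow> \<bar>x\<bar> < r \<longrightarrow> \<bar>y\<bar> < r \<longrightarrow>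
      FX ((complexify h, of_real x), of_real y) = of_real (fst (Z (\<Lambda>0 + h) (x, y))) \<and>
      FY ((complexify h, of_real x), of_real y) = of_real (snd (Z (\<Lambda>0 + h) (x, y))))"
    using analytic_family_extension[OF an X0 d(1)] by (elim exE) (rule that)
  then have E: "0 < r" "r \<le> d" by blast+
  have inU: "\<Lambda>0 + h \<in> U" if h: "\<And>i. \<bar>vec_nth h i\<bar> < r" for h
  proof -
    have "norm h \<le> (\<Sum>i\<in>UNIV. \<bar>vec_nth h i\<bar>)" by (rule norm_le_l1_cart)
    also have "\<dots> < (\<Sum>i\<in>(UNIV::'n set). r)" using h by (intro sum_strict_mono) auto
    also have "\<dots> = real CARD('n) * r" by simp
    also have "\<dots> \<le> real CARD('n) * (e / real CARD('n))" using E(2) d(3) by (intro mult_left_mono) auto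
    also have "\<dots> = e" by simp
    finally show ?thesis using e(2) by (auto simp: subset_iff dist_norm)
  qed
  interpret S: analytic_side Z \<Lambda>0 k \<sigma> FX FY r M
  proof
    show "snd (Z (\<Lambda>0 + h) (0, 0)) = 0 \<and> (\<forall>i\<in>{1..2 * k - 2}. dx_at_0 i (\<lambda>p. snd (Z (\<Lambda>0 + h) p)) = 0)"
      if "\<And>i. \<bar>vec_nth h i\<bar> < r" for h
      by (rule contact[OF inU[OF that]])
  qed (use E0 k \<sigma> X0 visibility in \<open>elim conjE; force\<close>)+
  have \<kappa>: "S.\<kappa> = sgn (fst (Z \<Lambda>0 (0, 0)))" by (simp add: S.\<kappa>_def S.X0_def)
  obtain s m B L N \<eta> \<psi> where F: "0 < s \<and> s \<le> r \<and> curve_holomorphic (plots2 s) \<psi> \<and> 0 < N \<and>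
     (\<forall>z\<in>plot_dom (plots2 s). norm (\<psi> z) \<le> 1 / 2) \<and>
     (\<forall>h x. (\<forall>i. \<bar>vec_nth h i\<bar> < s) \<longrightarrow> \<bar>x\<bar> < s \<longrightarrow> \<psi> (complexify h, of_real x) \<in> \<real>) \<and>
     (\<forall>h \<rho> R r0. (\<forall>i. \<bar>vec_nth h i\<bar> < s) \<longrightarrow> 0 < R \<longrightarrow> R \<le> s \<longrightarrow> \<rho> \<le> s \<longrightarrow> 2 * N * \<rho> < R \<longrightarrow> 0 < r0 \<longrightarrow> 2 * r0 \<le> \<rho> \<longrightarrow>
        half_turn \<sigma> (sgn (fst (Z \<Lambda>0 (0, 0)))) \<rho> R m B L N r0 (Z (\<Lambda>0 + h)) (\<eta> h)
          (\<lambda>x. x * (-1 + Re (\<psi> (complexify h, of_real x)))))"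
    using S.half_turn_family[unfolded \<kappa>] by (elim exE) (rule that)
  have hm: "half_map_family \<psi> s"
    by (unfold_locales) (use F E(2) d in \<open>elim conjE; force\<close>)+
  show ?thesis
    by (rule exI[of _ s], rule exI[of _ m], rule exI[of _ B], rule exI[of _ L], rule exI[of _ N], rule exI[of _ \<eta>],
        rule exI[of _ \<psi>], intro conjI hm) (insert F, elim conjE, assumption)+
qed

lemma monodromic_half_turn_families:
  fixes Zp Zm :: "real ^ 'n::finite \<Rightarrow> vfield"
  assumes k: "kp > 0" "km > 0" and U: "open U" "\<Lambda>0 \<in> U"
    and an: "real_analytic_at (\<lambda>(\<Lambda>, p). Zp \<Lambda> p) (\<Lambda>0, (0, 0))" "real_analytic_at (\<lambda>(\<Lambda>, p). Zm \<Lambda> p) (\<Lambda>0, (0, 0))"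
    and mt: "\<And>\<Lambda>. \<Lambda> \<in> U \<Longrightarrow> monodromic_tangential (Zp \<Lambda>) (Zm \<Lambda>) kp km"
  shows "\<exists>\<psi> \<psi>' s \<kappa> m B L N m' B' L' N' \<eta> \<eta>'. half_turn_families \<psi> \<psi>' s Zp Zm \<Lambda>0 \<kappa> m B L N m' B' L' N' \<eta> \<eta>'"
proof -
  let ?\<kappa> = "sgn (fst (Zp \<Lambda>0 (0, 0)))"
  note mt0 = mt[OF U(2), unfolded monodromic_tangential_def Let_def]
  have up: "\<exists>s m B L N \<eta> \<psi>. half_map_family \<psi> s \<and> 0 < N \<and>
     (\<forall>h \<rho> R r0. (\<forall>i. \<bar>vec_nth h i\<bar> < s) \<longrightarrow> 0 < R \<longrightarrow> R \<le> s \<longrightarrow> \<rho> \<le> s \<longrightarrow> 2 * N * \<rho> < R \<longrightarrow> 0 < r0 \<longrightarrow> 2 * r0 \<le> \<rho> \<longrightarrow>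
        half_turn 1 ?\<kappa> \<rho> R m B L N r0 (Zp (\<Lambda>0 + h)) (\<eta> h) (\<lambda>x. x * (-1 + Re (\<psi> (complexify h, of_real x)))))"
  proof (rule analytic_half_turn_family[where Z=Zp and k=kp and U=U and \<sigma>=1, OF an(1) U k(1)])
    show "snd (Zp \<Lambda> (0, 0)) = 0 \<and> (\<forall>i\<in>{1..2 * kp - 2}. dx_at_0 i (\<lambda>p. snd (Zp \<Lambda> p)) = 0)" if "\<Lambda> \<in> U" for \<Lambda>
      using mt[OF that, unfolded monodromic_tangential_def Let_def] by blast
  qed (use mt0 in simp_all)
  have lo: "\<exists>s m B L N \<eta> \<psi>. half_map_family \<psi> s \<and> 0 < N \<and>
     (\<forall>h \<rho> R r0. (\<forall>i. \<bar>vec_nth h i\<bar> < s) \<longrightarrow> 0 < R \<longrightarrow> R \<le> s \<longrightarrow> \<rho> \<le> s \<longrightarrow> 2 * N * \<rho> < R \<longrightarrow> 0 < r0 \<longrightarrow> 2 * r0 \<le> \<rho> \<longrightarrow>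
        half_turn (-1) (sgn (fst (Zm \<Lambda>0 (0, 0)))) \<rho> R m B L N r0 (Zm (\<Lambda>0 + h)) (\<eta> h) (\<lambda>x. x * (-1 + Re (\<psi> (complexify h, of_real x)))))"
  proof (rule analytic_half_turn_family[where Z=Zm and k=km and U=U and \<sigma>="-1", OF an(2) U k(2)])
    show "snd (Zm \<Lambda> (0, 0)) = 0 \<and> (\<forall>i\<in>{1..2 * km - 2}. dx_at_0 i (\<lambda>p. snd (Zm \<Lambda> p)) = 0)" if "\<Lambda> \<in> U" for \<Lambda>
      using mt[OF that, unfolded monodromic_tangential_def Let_def] by blast
  qed (use mt0 in simp_all)
  have \<kappa>: "sgn (fst (Zm \<Lambda>0 (0, 0))) = - ?\<kappa>"
    using mt0 by (auto simp: sgn_if mult_less_0_iff)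
  obtain s1 m B L N \<eta> \<psi> where 1: "half_map_family \<psi> s1" "0 < N"
     "\<And>h \<rho> R r0. (\<forall>i. \<bar>vec_nth h i\<bar> < s1) \<Longrightarrow> 0 < R \<Longrightarrow> R \<le> s1 \<Longrightarrow> \<rho> \<le> s1 \<Longrightarrow> 2 * N * \<rho> < R \<Longrightarrow> 0 < r0 \<Longrightarrow> 2 * r0 \<le> \<rho> \<Longrightarrow>
        half_turn 1 ?\<kappa> \<rho> R m B L N r0 (Zp (\<Lambda>0 + h)) (\<eta> h) (\<lambda>x. x * (-1 + Re (\<psi> (complexify h, of_real x))))"
    using up by blast
  obtain s2 m' B' L' N' \<eta>' \<psi>' where 2: "half_map_family \<psi>' s2" "0 < N'"
     "\<And>h \<rho> R r0. (\<forall>i. \<bar>vec_nth h i\<bar> < s2) \<Longrightarrow> 0 < R \<Longrightarrow> R \<le> s2 \<Longrightarrow> \<rho> \<le> s2 \<Longrightarrow> 2 * N' * \<rho> < R \<Longrightarrow> 0 < r0 \<Longrightarrow> 2 * r0 \<le> \<rho> \<Longrightarrow>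
        half_turn (-1) (- ?\<kappa>) \<rho> R m' B' L' N' r0 (Zm (\<Lambda>0 + h)) (\<eta>' h) (\<lambda>x. x * (-1 + Re (\<psi>' (complexify h, of_real x))))"
    using lo unfolding \<kappa> by blast
  interpret a: half_map_family \<psi> s1 by (rule 1(1))
  interpret b: half_map_family \<psi>' s2 by (rule 2(1))
  define s where "s = min s1 s2"
  have s: "0 < s" "s \<le> s1" "s \<le> s2" using a.s b.s by (auto simp: s_def)
  interpret a': half_map_family \<psi> s by (rule half_map_family_mono[OF 1(1) s(1,2)])
  interpret b': half_map_family \<psi>' s by (rule half_map_family_mono[OF 2(1) s(1,3)])
  have "half_turn_families \<psi> \<psi>' s Zp Zm \<Lambda>0 ?\<kappa> m B L N m' B' L' N' \<eta> \<eta>'"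
  proof (intro half_turn_families.intro half_turn_families_axioms.intro)
    fix h :: "real ^ 'n" and \<rho> R r0
    assume h: "\<And>i. \<bar>vec_nth h i\<bar> < s" and A: "0 < R" "R \<le> s" "\<rho> \<le> s" and r0: "0 < r0" "2 * r0 \<le> \<rho>"
    show "half_turn 1 ?\<kappa> \<rho> R m B L N r0 (Zp (\<Lambda>0 + h)) (\<eta> h) (\<lambda>x. x * (-1 + Re (\<psi> (complexify h, of_real x))))"
      if "2 * N * \<rho> < R"
      using that h A r0 s by (intro 1(3)) (auto intro: less_le_trans)
    show "half_turn (-1) (- ?\<kappa>) \<rho> R m' B' L' N' r0 (Zm (\<Lambda>0 + h)) (\<eta>' h) (\<lambda>x. x * (-1 + Re (\<psi>' (complexify h, of_real x))))"
      if "2 * N' * \<rho> < R"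
      using that h A r0 s by (intro 2(3)) (auto intro: less_le_trans)
  qed (rule 1(2) 2(2) a'.half_map_family_axioms b'.half_map_family_axioms)+
  then show ?thesis by (intro exI)
qed

theorem theoremE:
  fixes Zp Zm :: "real ^ 'n \<Rightarrow> vfield"
    and U :: "(real ^ 'n) set" and D :: "(real \<times> real) set"
    and kp km :: nat
    and \<Lambda>0 :: "real ^ 'n"
    and e :: "'n \<Rightarrow> nat"
  defines "V \<equiv> \<lambda>m \<Lambda>. lyapunov_coeff (Zp \<Lambda>) (Zm \<Lambda>) m"
  defines "VV \<equiv> \<lambda>\<Lambda>. (\<chi> i. V (2 * e i) \<Lambda>) :: real ^ 'n"
  assumes "kp > 0" and "km > 0"
    and "open U" and "open D" and "(0, 0) \<in> D"
    and "real_analytic_on (\<lambda>(\<Lambda>, p). Zp \<Lambda> p) (U \<times> D)"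
    and "real_analytic_on (\<lambda>(\<Lambda>, p). Zm \<Lambda> p) (U \<times> D)"
    and "\<And>\<Lambda>. \<Lambda> \<in> U \<Longrightarrow> monodromic_tangential (Zp \<Lambda>) (Zm \<Lambda>) kp km"
    and "bij_betw e UNIV {1..CARD('n)}"
    and "\<Lambda>0 \<in> U"
    and "VV \<Lambda>0 = 0"
    and "det (jacobian VV (at \<Lambda>0)) \<noteq> 0"
    and "V (2 * CARD('n) + 2) \<Lambda>0 \<noteq> 0"
  shows "\<exists>W. open W \<and> W \<subseteq> U \<and> \<Lambda>0 \<in> closure W \<and>
           (\<exists>C :: real ^ 'n \<Rightarrow> (real \<times> real) set set.
              (\<forall>\<Lambda>\<in>W. card (C \<Lambda>) = CARD('n) \<and>
                 (\<forall>\<Gamma>\<in>C \<Lambda>. \<Gamma> \<subseteq> D \<and> hyperbolic_limit_cycle (Zp \<Lambda>) (Zm \<Lambda>) \<Gamma>)) \<and>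
              (\<forall>\<epsilon>>0. \<forall>\<^sub>F \<Lambda> in at \<Lambda>0 within W. \<forall>\<Gamma>\<in>C \<Lambda>. \<Gamma> \<subseteq> ball (0, 0) \<epsilon>))"
proof -
  define n where "n = CARD('n)"
  define P where "P = 2 * n + 2"
  have n1: "n \<ge> 1" unfolding n_def by (simp add: Suc_leI)
  have an: "real_analytic_at (\<lambda>(\<Lambda>, p). Zp \<Lambda> p) (\<Lambda>0, (0, 0))" "real_analytic_at (\<lambda>(\<Lambda>, p). Zm \<Lambda> p) (\<Lambda>0, (0, 0))"
    using assms(7-9,12) unfolding real_analytic_on_def by auto
  obtain \<psi> \<psi>' s \<kappa> m B L N m' B' L' N' \<eta> \<eta>' where "half_turn_families \<psi> \<psi>' s Zp Zm \<Lambda>0 \<kappa> m B L N m' B' L' N' \<eta> \<eta>'"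
    using monodromic_half_turn_families[OF assms(3,4,5,12) an assms(10)] by blast
  then interpret F: half_turn_families \<psi> \<psi>' s Zp Zm \<Lambda>0 \<kappa> m B L N m' B' L' N' \<eta> \<eta>' .
  have VF: "V j (\<Lambda>0 + h) = F.V j h" for j h by (simp add: V_def F.V_def)
  have VF': "V j = (\<lambda>\<Lambda>. F.V j (\<Lambda> - \<Lambda>0))" for j using VF[of j "_ - \<Lambda>0"] by (simp add: fun_eq_iff)
  have hs: "\<bar>vec_nth (\<Lambda> - \<Lambda>0) i\<bar> < s" if "\<Lambda> \<in> ball \<Lambda>0 s" for \<Lambda> i
    using that component_le_norm_cart[of "\<Lambda> - \<Lambda>0" i] by (simp add: dist_norm norm_minus_commute)
  have Vcont: "continuous_on (ball \<Lambda>0 s) (V j)" for j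
    unfolding VF'[of j] by (rule continuous_on_compose2[OF F.V_regular(1)])
      (auto intro!: continuous_intros simp: dist_norm norm_minus_commute)
  have VVcont: "continuous_on (ball \<Lambda>0 s) VV"
    unfolding VV_def by (intro continuous_on_vec_lambda Vcont)
  have "V j differentiable (at \<Lambda>0)" for j
    unfolding VF'[of j] using differentiable_chain_at[of "\<lambda>\<Lambda>. \<Lambda> - \<Lambda>0" \<Lambda>0 "F.V j"] F.V_regular(2)[of j]
    by (simp add: o_def)
  then have VVdiff: "VV differentiable (at \<Lambda>0)"
    unfolding VV_def by (subst differentiable_componentwise_within) (auto simp: Basis_vec_def inner_axis)
  let ?J = "jacobian VV (at \<Lambda>0)"
  have VVder: "(VV has_derivative (\<lambda>h. ?J *v h)) (at \<Lambda>0)" using VVdiff jacobian_works by blast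
  obtain J' where "?J ** J' = mat 1" using assms(14) invertible_det_nz[of ?J] unfolding invertible_def by blast
  then have Jinv: "(\<lambda>h. ?J *v h) \<circ> (\<lambda>h. J' *v h) = id"
    by (simp add: fun_eq_iff matrix_vector_mul_assoc)
  define c where "c = V P \<Lambda>0"
  have c: "c \<noteq> 0" using assms(15) by (simp add: c_def P_def n_def)
  obtain q :: "nat \<Rightarrow> real" where q: "q P = 1" "q 2 \<noteq> 0" "\<And>m. odd m \<Longrightarrow> q m = 0" "q 0 = 0"
     "\<And>z. model n z = (\<Sum>m\<le>2 * n + 2. of_real (q m) * z ^ m)"
    using model_coefficients[of n] unfolding P_def by blast
  obtain K \<mu>0 \<tau> where K: "0 < K" "0 < \<mu>0" "\<mu>0 \<le> 1" "0 < \<tau>" and cycles: "\<And>h \<mu>. (\<forall>i. \<bar>vec_nth h i\<bar> < s) \<Longrightarrow> 0 < \<mu> \<Longrightarrow> \<mu> < \<mu>0 \<Longrightarrow>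
    (\<forall>j\<in>{1..n + 1}. \<bar>F.V (2 * j) h - c * q (2 * j) * \<mu> ^ (P - 2 * j)\<bar> \<le> \<tau> * \<mu> ^ (P - 2 * j)) \<Longrightarrow>
    \<exists>S. card S = n \<and> (\<forall>\<Gamma>\<in>S. hyperbolic_limit_cycle (Zp (\<Lambda>0 + h)) (Zm (\<Lambda>0 + h)) \<Gamma> \<and> (\<forall>p\<in>\<Gamma>. norm p \<le> K * \<mu>))"
    using F.cycles_near_model[OF c q(3,4,5)] unfolding P_def by blast
  obtain d where d: "d > 0" "ball (0, 0) d \<subseteq> D" using assms(6,7) open_contains_ball by blast
  define \<mu>1 where "\<mu>1 = min \<mu>0 (d / (2 * K))"
  have \<mu>1: "0 < \<mu>1" "\<mu>1 \<le> \<mu>0" "\<mu>1 \<le> 1" "K * \<mu>1 < d"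
  proof -
    show "0 < \<mu>1" "\<mu>1 \<le> \<mu>0" "\<mu>1 \<le> 1" using K d by (auto simp: \<mu>1_def)
    have "\<mu>1 \<le> d / (2 * K)" by (simp add: \<mu>1_def)
    then have "\<mu>1 * (2 * K) \<le> d" using K by (simp add: pos_le_divide_eq)
    moreover have "0 < K * \<mu>1" using K \<open>0 < \<mu>1\<close> by simp
    ultimately show "K * \<mu>1 < d" by (simp add: mult_ac)
  qed
  \<comment> \<open>The second bound makes V_2 comparable to \<mu>^(2n) on \<open>Q \<mu>\<close>;
    convergence to the origin rests on this.\<close>
  define \<tau>1 where "\<tau>1 = min \<tau> (\<bar>c * q 2\<bar> / 2)"
  have \<tau>1: "0 < \<tau>1" "\<tau>1 \<le> \<tau>" "\<tau>1 \<le> \<bar>c * q 2\<bar> / 2" using K c q by (auto simp: \<tau>1_def)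
  have "isCont (V P) \<Lambda>0" using Vcont[of P] F.up.s by (simp add: continuous_on_eq_continuous_at)
  then obtain b where b: "b > 0" "\<And>\<Lambda>. dist \<Lambda> \<Lambda>0 < b \<Longrightarrow> dist (V P \<Lambda>) (V P \<Lambda>0) < \<tau>"
    using K(4) unfolding continuous_at_eps_delta by blast
  \<comment> \<open>On \<open>Bo\<close> the coefficient V_(2n+2) stays within \<tau> of
    \<open>c\<close>. This is its condition in \<open>cycles\<close>, where the power of \<mu> has
    exponent 0, so that it is not a component to be adjusted.\<close>
  define Bo where "Bo = ball \<Lambda>0 (min b s) \<inter> U"
  have Bo: "open Bo" "\<Lambda>0 \<in> Bo" "Bo \<subseteq> U" "Bo \<subseteq> ball \<Lambda>0 s" "\<And>\<Lambda>. \<Lambda> \<in> Bo \<Longrightarrow> \<bar>V P \<Lambda> - c\<bar> < \<tau>"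
    using b F.up.s assms(5,12) by (auto simp: Bo_def c_def dist_commute dist_real_def)
  have VVBo: "continuous_on Bo VV" using VVcont Bo(4) by (rule continuous_on_subset)
  have ei: "1 \<le> e i" "e i \<le> n" for i
    using bij_betwE[OF assms(11)] by (auto simp: n_def)
  define w where "w \<mu> = (\<chi> i. c * q (2 * e i) * \<mu> ^ (P - 2 * e i)) " for \<mu> :: real
  define Q where "Q \<mu> = {\<Lambda> \<in> Bo. \<forall>i. \<bar>VV \<Lambda> $ i - w \<mu> $ i\<bar> < \<tau>1 * \<mu> ^ (P - 2 * e i)}" for \<mu>
  \<comment> \<open>Each \<open>Q \<mu>\<close> stays away from \<open>\<Lambda>0\<close>, because
    V_2 is bounded away from 0 on it; only the union over arbitrarily small scales accumulates at
    \<open>\<Lambda>0\<close>.\<close>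
  define W where "W = (\<Union>\<mu>\<in>{0<..<\<mu>1}. Q \<mu>)"
  have openQ: "open (Q \<mu>)" for \<mu>
  proof -
    have "Q \<mu> = Bo \<inter> VV -` (\<Inter>i. {v. \<bar>v $ i - w \<mu> $ i\<bar> < \<tau>1 * \<mu> ^ (P - 2 * e i)})"
      by (auto simp: Q_def)
    moreover have "open (\<Inter>i. {v :: real ^ 'n. \<bar>v $ i - w \<mu> $ i\<bar> < \<tau>1 * \<mu> ^ (P - 2 * e i)})"
      by (intro open_INT ballI open_Collect_less continuous_intros) auto
    ultimately show ?thesis using continuous_open_preimage[OF VVBo Bo(1)] by simp
  qed
  have openW: "open W" unfolding W_def by (intro open_UN ballI openQ)
  have WU: "W \<subseteq> U" using Bo(3) by (auto simp: W_def Q_def)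
  have closureW: "\<Lambda>0 \<in> closure W"
    unfolding closure_approachable
  proof (intro allI impI)
    fix \<delta> :: real assume \<delta>: "\<delta> > 0"
    \<comment> \<open>The derivative of \<open>VV\<close> at \<open>\<Lambda>0\<close> has a right
      inverse, so images of neighbourhoods of \<open>\<Lambda>0\<close> are neighbourhoods of
      \<open>VV \<Lambda>0 = 0\<close>. Hence the targets \<open>w \<mu>\<close> are attained by
      parameters as close to \<open>\<Lambda>0\<close> as desired.\<close>
    have "VV \<Lambda>0 \<in> interior (VV ` (ball \<Lambda>0 \<delta> \<inter> Bo))"
    proof (rule sussmann_open_mapping[OF Bo(1) VVBo Bo(2) VVder _ Jinv])
      show "\<Lambda>0 \<in> interior (ball \<Lambda>0 \<delta> \<inter> Bo)" using \<delta> Bo by (simp add: interior_open open_Int)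
    qed (auto intro: matrix_vector_mul_bounded_linear)
    then obtain t where t: "t > 0" "ball 0 t \<subseteq> VV ` (ball \<Lambda>0 \<delta> \<inter> Bo)"
      using assms(13) by (auto simp: mem_interior)
    define A where "A = (\<Sum>i\<in>UNIV. \<bar>c * q (2 * e i)\<bar>)"
    have A: "A \<ge> 0" unfolding A_def by (intro sum_nonneg) auto
    define \<mu> where "\<mu> = min (\<mu>1 / 2) (t / (2 * (A + 1)))"
    have \<mu>: "0 < \<mu>" "\<mu> < \<mu>1" "\<mu> \<le> 1" "\<mu> \<le> t / (2 * (A + 1))" using \<mu>1 t A by (auto simp: \<mu>_def)
    have "norm (w \<mu>) \<le> (\<Sum>i\<in>UNIV. \<bar>w \<mu> $ i\<bar>)" by (rule norm_le_l1_cart)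
    also have "\<dots> \<le> (\<Sum>i\<in>UNIV. \<bar>c * q (2 * e i)\<bar> * \<mu>)"
    proof (rule sum_mono)
      fix i
      \<comment> \<open>As \<open>e i \<le> n\<close>, the exponent is at least 2; so all components
        of \<open>w \<mu>\<close> tend to 0 with \<mu>.\<close>
      have "\<mu> ^ (P - 2 * e i) \<le> \<mu> ^ 1" using \<mu> ei[of i] by (intro power_decreasing) (auto simp: P_def)
      then have "\<bar>c * q (2 * e i)\<bar> * \<mu> ^ (P - 2 * e i) \<le> \<bar>c * q (2 * e i)\<bar> * \<mu>" by (intro mult_left_mono) auto
      then show "\<bar>w \<mu> $ i\<bar> \<le> \<bar>c * q (2 * e i)\<bar> * \<mu>" using \<mu> by (simp add: w_def abs_mult)
    qed
    also have "\<dots> = A * \<mu>" by (simp add: A_def sum_distrib_right)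
    also have "\<dots> < t"
    proof -
      have "\<mu> * (2 * (A + 1)) \<le> t" using \<mu>(4) A by (simp add: pos_le_divide_eq)
      moreover have "0 \<le> A * \<mu>" using A \<mu> by simp
      ultimately show ?thesis using \<mu>(1) by (simp add: algebra_simps)
    qed
    finally have "w \<mu> \<in> ball 0 t" by simp
    then obtain \<Lambda> where \<Lambda>: "\<Lambda> \<in> ball \<Lambda>0 \<delta>" "\<Lambda> \<in> Bo" "VV \<Lambda> = w \<mu>" using t(2) by auto
    then have "\<Lambda> \<in> Q \<mu>" using \<tau>1 \<mu> by (simp add: Q_def)
    then have "\<Lambda> \<in> W" using \<mu> by (auto simp: W_def)
    then show "\<exists>\<Lambda>\<in>W. dist \<Lambda> \<Lambda>0 < \<delta>" using \<Lambda>(1) by (auto simp: dist_commute)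
  qed
  have ex: "\<exists>S \<mu>. 0 < \<mu> \<and> \<mu> < \<mu>1 \<and> \<Lambda> \<in> Q \<mu> \<and> card S = n \<and>
      (\<forall>\<Gamma>\<in>S. hyperbolic_limit_cycle (Zp \<Lambda>) (Zm \<Lambda>) \<Gamma> \<and> (\<forall>p\<in>\<Gamma>. norm p \<le> K * \<mu>))" if "\<Lambda> \<in> W" for \<Lambda>
  proof -
    obtain \<mu> where \<mu>: "0 < \<mu>" "\<mu> < \<mu>1" "\<Lambda> \<in> Q \<mu>" using \<open>\<Lambda> \<in> W\<close> by (auto simp: W_def)
    have \<Lambda>: "\<Lambda> \<in> Bo" using \<mu>(3) by (simp add: Q_def)
    have "\<bar>F.V (2 * j) (\<Lambda> - \<Lambda>0) - c * q (2 * j) * \<mu> ^ (P - 2 * j)\<bar> \<le> \<tau> * \<mu> ^ (P - 2 * j)" if j: "j \<in> {1..n + 1}" for j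
    proof (cases "j = n + 1")
      case True
      then have "2 * j = P" by (simp add: P_def)
      then show ?thesis using Bo(5)[OF \<Lambda>] q(1) by (simp add: VF' less_imp_le)
    next
      case False
      then have "j \<in> {1..CARD('n)}" using j by (auto simp: n_def)
      then obtain i where i: "j = e i" using assms(11) by (metis bij_betw_imp_surj_on imageE)
      have "\<bar>VV \<Lambda> $ i - w \<mu> $ i\<bar> < \<tau>1 * \<mu> ^ (P - 2 * e i)" using \<mu>(3) by (simp add: Q_def)
      also have "\<dots> \<le> \<tau> * \<mu> ^ (P - 2 * e i)" using \<tau>1 \<mu> by (intro mult_right_mono) auto
      finally show ?thesis by (simp add: i VV_def VF' w_def)
    qed
    then have "\<exists>S. card S = n \<and> (\<forall>\<Gamma>\<in>S. hyperbolic_limit_cycle (Zp (\<Lambda>0 + (\<Lambda> - \<Lambda>0))) (Zm (\<Lambda>0 + (\<Lambda> - \<Lambda>0))) \<Gamma> \<and> (\<forall>p\<in>\<Gamma>. norm p \<le> K * \<mu>))"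
      using hs[of \<Lambda>] \<Lambda> Bo(4) \<mu> \<mu>1 by (intro cycles) auto
    then show ?thesis using \<mu> by auto
  qed
  \<comment> \<open>The scale \<open>M \<Lambda>\<close> is chosen together with the cycles, since
    it measures their distance from the origin.\<close>
  obtain C M where CM: "\<And>\<Lambda>. \<Lambda> \<in> W \<Longrightarrow> 0 < M \<Lambda> \<and> M \<Lambda> < \<mu>1 \<and> \<Lambda> \<in> Q (M \<Lambda>) \<and> card (C \<Lambda>) = n \<and>
      (\<forall>\<Gamma>\<in>C \<Lambda>. hyperbolic_limit_cycle (Zp \<Lambda>) (Zm \<Lambda>) \<Gamma> \<and> (\<forall>p\<in>\<Gamma>. norm p \<le> K * M \<Lambda>))"
    using ex by metis
  have subD: "\<Gamma> \<subseteq> D" if "\<Lambda> \<in> W" "\<Gamma> \<in> C \<Lambda>" for \<Lambda> \<Gamma>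
  proof
    fix p assume "p \<in> \<Gamma>"
    then have "norm p \<le> K * M \<Lambda>" using CM that by blast
    also have "\<dots> < K * \<mu>1" using CM[OF that(1)] K by simp
    also have "\<dots> < d" by (rule \<mu>1)
    finally have "p \<in> ball (0, 0) d" by (simp add: zero_prod_def[symmetric])
    then show "p \<in> D" using d(2) by blast
  qed
  \<comment> \<open>On \<open>Q \<mu>\<close> the modulus of V_2 exceeds |c q(2)| \<mu>^(2n) / 2. As
    V_2 is continuous and vanishes at \<open>\<Lambda>0\<close>, the scale
    \<open>M \<Lambda>\<close> tends to 0, and every cycle stays within K times this scale of the
    origin.\<close>
  have "\<forall>\<^sub>F \<Lambda> in at \<Lambda>0 within W. \<forall>\<Gamma>\<in>C \<Lambda>. \<Gamma> \<subseteq> ball (0, 0) \<epsilon>" if \<epsilon>: "\<epsilon> > 0" for \<epsilon>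
  proof -
    define t where "t = \<epsilon> / (2 * K)"
    have t: "t > 0" using \<epsilon> K by (simp add: t_def)
    obtain i1 where i1: "e i1 = 1" using assms(11) n1 by (metis atLeastAtMost_iff bij_betw_imp_surj_on imageE n_def order_refl)
    define g where "g = \<bar>c * q 2\<bar> / 2 * t ^ (2 * n)"
    have g: "g > 0" using c q t by (simp add: g_def)
    have "isCont (V 2) \<Lambda>0" using Vcont[of 2] F.up.s by (simp add: continuous_on_eq_continuous_at)
    then have ev1: "\<forall>\<^sub>F \<Lambda> in at \<Lambda>0 within W. dist (V 2 \<Lambda>) (V 2 \<Lambda>0) < g"
      using g by (intro tendstoD[OF tendsto_within_subset[of "V 2" _ _ UNIV]]) (auto simp: isCont_def)
    have V20: "V 2 \<Lambda>0 = 0" using assms(13) i1 by (metis VV_def mult.right_neutral vec_lambda_beta zero_index)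
    have ev2: "\<forall>\<^sub>F \<Lambda> in at \<Lambda>0 within W. \<Lambda> \<in> W" by (simp add: eventually_at_filter)
    from ev1 ev2 have "\<forall>\<^sub>F \<Lambda> in at \<Lambda>0 within W. \<bar>V 2 \<Lambda>\<bar> < g \<and> \<Lambda> \<in> W"
      by eventually_elim (simp add: V20 dist_real_def)
    then show ?thesis
    proof eventually_elim
      fix \<Lambda> assume \<Lambda>: "\<bar>V 2 \<Lambda>\<bar> < g \<and> \<Lambda> \<in> W"
      let ?\<mu> = "M \<Lambda>"
      have \<mu>: "0 < ?\<mu>" "\<Lambda> \<in> Q ?\<mu>" using CM \<Lambda> by auto
      have "\<bar>VV \<Lambda> $ i1 - w ?\<mu> $ i1\<bar> < \<tau>1 * ?\<mu> ^ (P - 2 * e i1)" using \<mu>(2) by (simp add: Q_def)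
      then have "\<bar>V 2 \<Lambda> - c * q 2 * ?\<mu> ^ (2 * n)\<bar> < \<tau>1 * ?\<mu> ^ (2 * n)"
        by (simp add: VV_def w_def i1 P_def)
      also have "\<dots> \<le> \<bar>c * q 2\<bar> / 2 * ?\<mu> ^ (2 * n)" using \<tau>1 \<mu> by (intro mult_right_mono) auto
      finally have "\<bar>V 2 \<Lambda> - c * q 2 * ?\<mu> ^ (2 * n)\<bar> < \<bar>c * q 2\<bar> * ?\<mu> ^ (2 * n) / 2" by simp
      moreover have "\<bar>c * q 2 * ?\<mu> ^ (2 * n)\<bar> = \<bar>c * q 2\<bar> * ?\<mu> ^ (2 * n)" using \<mu> by (simp add: abs_mult)
      ultimately have "\<bar>c * q 2\<bar> * ?\<mu> ^ (2 * n) / 2 < \<bar>V 2 \<Lambda>\<bar>" by linarith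
      then have lt: "\<bar>c * q 2\<bar> / 2 * ?\<mu> ^ (2 * n) < g" using \<Lambda> by simp
      have "?\<mu> < t"
      proof (rule ccontr)
        assume "\<not> ?\<mu> < t"
        then have "t ^ (2 * n) \<le> ?\<mu> ^ (2 * n)" using t by (intro power_mono) auto
        then have "g \<le> \<bar>c * q 2\<bar> / 2 * ?\<mu> ^ (2 * n)" unfolding g_def by (intro mult_left_mono) auto
        with lt show False by simp
      qed
      then have small: "K * ?\<mu> < \<epsilon>" using K \<epsilon> by (simp add: t_def field_simps)
      show "\<forall>\<Gamma>\<in>C \<Lambda>. \<Gamma> \<subseteq> ball (0, 0) \<epsilon>"
      proof (intro ballI subsetI)
        fix \<Gamma> p assume "\<Gamma> \<in> C \<Lambda>" "p \<in> \<Gamma>"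
        then have "norm p \<le> K * ?\<mu>" using CM \<Lambda> by blast
        with small show "p \<in> ball (0, 0) \<epsilon>" by (simp add: zero_prod_def[symmetric])
      qed
    qed
  qed
  then have lim: "\<forall>\<epsilon>>0. \<forall>\<^sub>F \<Lambda> in at \<Lambda>0 within W. \<forall>\<Gamma>\<in>C \<Lambda>. \<Gamma> \<subseteq> ball (0, 0) \<epsilon>" by simp
  have "\<forall>\<Lambda>\<in>W. card (C \<Lambda>) = CARD('n) \<and>
      (\<forall>\<Gamma>\<in>C \<Lambda>. \<Gamma> \<subseteq> D \<and> hyperbolic_limit_cycle (Zp \<Lambda>) (Zm \<Lambda>) \<Gamma>)"
    using CM subD unfolding n_def by blast
  with openW WU closureW lim show ?thesis by (intro exI[of _ W] exI[of _ C] conjI)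
qed

end
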